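(* Let $m\ge0$ and let $a^\pm:\mathbb{R}^d\to[0,\infty)$ satisfy condition (G): $a^\pm\ge0$ are symmetric, bounded, integrable, and there exist $\vartheta>0$ and $b\ge0$ such that $$\sum_{x\in\eta}\sum_{y\in\eta\setminus x}\big(a^-(x-y)-\vartheta a^+(x-y)\big)\ge-b|\eta|,\qquad\eta\in\Gamma_0.$$ Let $\alpha_0\in\mathbb{R}$ and let $\mu_0$ be a Borel probability measure on $\Gamma$ having correlation function $k_0\in\mathcal{K}_{\alpha_0}$. Let $(\mu_t)_{t\ge0}$ be the family of Borel probability measures on $\Gamma$ with correlation functions $(k_t)_{t\ge0}$ solving the hierarchical equation $\frac{\partial k_t}{\partial t}=L^\Delta k_t$, $k_t|_{t=0}=k_0$, as described in the context. Then: (a) $(\mu_t)_{t\ge0}$ is a (weak) solution to the Fokker–Planck equation for $L$ with initial condition $\mu_0$. (b) Let $(\nu_t)_{t\ge0}$ be another (weak) solution to the Fokker–Planck equation for $L$ with initial condition $\mu_0$ such that each $\nu_t$ has a correlation function $k_{\nu_t}$, and suppose that for any $T>0$ there exists $\beta_T\ge\alpha_0$ with $\sup_{t\in[0,T]}\|k_{\nu_t}\|_{\mathcal{K}_{\beta_T}}<\infty$. Then $\mu_t=\nu_t$ for all $t\ge0$.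
   Context: Configuration spaces. $\Gamma=\{\gamma\subset\mathbb{R}^d:|\gamma\cap\Lambda|<\infty\text{ for all compact }\Lambda\subset\mathbb{R}^d\}$, where $|A|$ is the number of elements of $A$, equipped with the smallest topology making $\gamma\mapsto\sum_{x\in\gamma}f(x)$ continuous for all continuous compactly supported $f:\mathbb{R}^d\to\mathbb{R}$ (a Polish space). $\Gamma_0=\bigsqcup_{n\ge0}\{\eta\subset\mathbb{R}^d:|\eta|=n\}$, with the $\sigma$-algebra generated by the sets $\{\eta:|\eta\cap\Lambda|=n\}$, $n\ge0$, $\Lambda$ compact. We write $\gamma\setminus x$, $\gamma\cup x$ for $\gamma\setminus\{x\}$, $\gamma\cup\{x\}$. The Lebesgue–Poisson measure $\lambda$ on $\Gamma_0$ is given by $\int_{\Gamma_0}G\,d\lambda=G(\emptyset)+\sum_{n\ge1}\frac1{n!}\int_{(\mathbb{R}^d)^n}G(\{x_1,\dots,x_n\})dx_1\cdots dx_n$. Functions. $B_{bs}(\Gamma_0)$: bounded measurable $G:\Gamma_0\to\mathbb{R}$ for which there are $N\in\mathbb{N}$ and a compact $\Lambda\subset\mathbb{R}^d$ with $G(\eta)=0$ whenever $|\eta|>N$ or $\eta\cap\Lambda^c\ne\emptyset$. $(KG)(\gamma):=\sum_{\eta\Subset\gamma}G(\eta)$, the sum over all finite subsets $\eta$ of $\gamma$. $\mathcal{FP}(\Gamma):=\{KG:G\in B_{bs}(\Gamma_0)\}$. Correlation functions. For a Borel probability measure $\mu$ on $\Gamma$, its correlation function (if it exists) is the function $k_\mu:\Gamma_0\to\mathbb{R}_+$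 uniquely determined ($\lambda$-a.e.) by $\int_\Gamma KG\,d\mu=\int_{\Gamma_0}Gk_\mu\,d\lambda$ for $G\in B_{bs}(\Gamma_0)$. $K$ then extends uniquely to a bounded linear operator $K:L^1(\Gamma_0,k_\mu\lambda)\to L^1(\Gamma,\mu)$. $\mathcal{K}_\alpha$ ($\alpha\in\mathbb{R}$) is the Banach space of measurable functions $k$ on $\Gamma_0$ with $\|k\|_{\mathcal{K}_\alpha}=\operatorname{ess\,sup}_{\eta\in\Gamma_0}|k(\eta)|e^{-\alpha|\eta|}<\infty$; $\mathcal{K}_{\alpha'}\subset\mathcal{K}_\alpha$ for $\alpha'<\alpha$. Generator. Formally $$(LF)(\gamma)=\sum_{x\in\gamma}\Big(m+\sum_{y\in\gamma\setminus x}a^-(x-y)\Big)(F(\gamma\setminus x)-F(\gamma))+\sum_{x\in\gamma}\int_{\mathbb{R}^d}a^+(x-y)(F(\gamma\cup y)-F(\gamma))dy.$$ It is only required to be well-defined $\mu$-a.e. for the measures $\mu$ under consideration: for $F=KG$, $G\in B_{bs}(\Gamma_0)$, and $\mu$ having a correlation function, $LF$ is understood as $K\widehat{L}G$, where $\widehat{L}=K^{-1}LK$ is given by $$(\widehat{L}G)(\eta)=-\Big(m|\eta|+\sum_{x\in\eta}\sum_{y\in\eta\setminus x}a^-(x-y)\Big)G(\eta)+\sum_{x\in\eta}\int_{\mathbb{R}^d}a^+(x-y)G(\eta\cup y)dy-\sum_{x\in\eta}\sum_{y\in\eta\setminus x}a^-(x-y)G(\eta\setminus x)+\sum_{x\in\eta}\int_{\mathbb{R}^d}a^+(x-y)G(\eta\setminus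 x\cup y)dy.$$ (Weak) solution to the Fokker–Planck equation with initial condition $\mu_0$: a family $(\mu_t)_{t\ge0}$ of Borel probability measures on $\Gamma$, with the given value $\mu_0$ at $t=0$, such that for any $F\in\mathcal{FP}(\Gamma)$: $F,LF\in L^1(\Gamma,\mu_t)$ for all $t\ge0$; $t\mapsto\int_\Gamma LF\,d\mu_t$ is locally integrable; and $\int_\Gamma F\,d\mu_t=\int_\Gamma F\,d\mu_0+\int_0^t\int_\Gamma LF\,d\mu_s\,ds$ for all $t\ge0$. The operator $L^\Delta$ is $$(L^\Delta k)(\eta)=-\Big(m|\eta|+\sum_{x\in\eta}\sum_{y\in\eta\setminus x}a^-(x-y)\Big)k(\eta)+\sum_{x\in\eta}\sum_{y\in\eta\setminus x}a^+(x-y)k(\eta\setminus x)-\sum_{x\in\eta}\int_{\mathbb{R}^d}a^-(x-y)k(\eta\cup y)dy+\sum_{x\in\eta}\int_{\mathbb{R}^d}a^+(x-y)k(\eta\setminus x\cup y)dy;$$ it satisfies $\int(\widehat{L}G)k\,d\lambda=\int G(L^\Delta k)d\lambda$ for $G,k\in B_{bs}(\Gamma_0)$. The family $(\mu_t)_{t\ge0}$. Known result (Kondratiev–Kozitsky), taken as given: under condition (G), for $\mu_0$ with correlation function $k_0\in\mathcal{K}_{\alpha_0}$ there is a unique family $(k_t)_{t\ge0}\subset\bigcup_{\alpha\in\mathbb{R}}\mathcal{K}_\alpha$ such that: for each $T>0$ there is $\alpha_T\ge\alpha_0$ with $k_t\in\mathcal{K}_{\alpha_T}$ for $t\in[0,T]$,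 and $(k_t)_{t\in[0,T]}$ is the unique classical solution in $\mathcal{K}_{\alpha_T}$ to $\frac{\partial k_t}{\partial t}=L^\Delta k_t$, $k_t|_{t=0}=k_0$ (in particular $t\mapsto k_t\in\mathcal{K}_{\alpha_T}$ is continuously differentiable on $[0,T]$ and the equation holds in $\mathcal{K}_{\alpha_T}$); and there is a unique family $(\mu_t)_{t\ge0}$ of Borel probability measures on $\Gamma$ such that $k_t$ is the correlation function of $\mu_t$ for every $t\ge0$. This is the family $(\mu_t)_{t\ge0}$ of the claim. *)

theory Defs
  imports "HOL-Probability.Probability"
begin

text \<open>\<open>\<real>\<^sup>d\<close>, \<open>d \<ge> 1\<close>, is rendered by an arbitrary type of class \<^class>\<open>euclidean_space\<close>.\<close>

section \<open>Configuration spaces\<close>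

definition configs :: "'a::euclidean_space set set" where
  "configs = {\<gamma>. \<forall>\<Lambda>. compact \<Lambda> \<longrightarrow> finite (\<gamma> \<inter> \<Lambda>)}"

text \<open>The initial topology of the maps \<open>\<gamma> \<mapsto> \<Sum>x\<in>\<gamma>. f x\<close>.  The sum over \<open>\<gamma>\<close> has
  only finitely many non-zero terms, so the unconditional sum is the ordinary finite one.\<close>

definition config_topology :: "'a::euclidean_space set topology" where
  "config_topology = topology_generated_by
     {{\<gamma> \<in> configs. (\<Sum>\<^sub>\<infinity>x\<in>\<gamma>. f x) \<in> U} | (f :: 'a \<Rightarrow> real) U.
        continuous_on UNIV f \<and> compact (closure {x. f x \<noteq> 0}) \<and> open U}"

definition config_borel :: "'a::euclidean_space set measure" where
  "config_borel = sigma configs {U. openin config_topology U}"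

definition config_prob :: "'a::euclidean_space set measure \<Rightarrow> bool" where
  "config_prob \<mu> \<longleftrightarrow> prob_space \<mu> \<and> sets \<mu> = sets config_borel"

definition fin_configs :: "'a::euclidean_space set set" where
  "fin_configs = {\<eta>. finite \<eta>}"

definition fin_config_space :: "'a::euclidean_space set measure" where
  "fin_config_space = sigma fin_configs
     {{\<eta> \<in> fin_configs. card (\<eta> \<inter> \<Lambda>) = n} | \<Lambda> n. compact \<Lambda>}"

text \<open>The summand for \<open>n = 0\<close> is \<open>indicator A {}\<close>, since the empty product space is a single
  point of mass 1.  Tuples with repeated entries form a null set for \<open>n \<ge> 1\<close>.\<close>

definition lebesgue_poisson :: "'a::euclidean_space set measure" where
  "lebesgue_poisson = measure_of fin_configs (sets fin_config_space)
     (\<lambda>A. \<Sum>n. ennreal (1 / fact n) *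
        (\<integral>\<^sup>+ x. indicator A (x ` {..<n}) \<partial>(\<Pi>\<^sub>M i\<in>{..<n}. (lborel :: 'a measure))))"

lemma space_fin_config_space [simp]: "space fin_config_space = fin_configs"
  unfolding fin_config_space_def by (rule space_measure_of) auto

lemma space_lebesgue_poisson [simp]: "space (lebesgue_poisson :: 'a::euclidean_space set measure) = fin_configs"
  unfolding lebesgue_poisson_def
  using sets.space_closed[of "fin_config_space :: 'a set measure"] by simp

lemma sets_lebesgue_poisson [simp, measurable_cong]:
  "sets (lebesgue_poisson :: 'a::euclidean_space set measure) = sets fin_config_space"
  unfolding lebesgue_poisson_def
  using sets.space_closed[of "fin_config_space :: 'a set measure"]
    sets.sigma_sets_eq[of "fin_config_space :: 'a set measure"]
  by simp

lemma measurable_tuple_to_set: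
  fixes n :: nat
  shows "(\<lambda>x. x ` {..<n}) \<in> (\<Pi>\<^sub>M i\<in>{..<n}. (lborel :: 'a::euclidean_space measure)) \<rightarrow>\<^sub>M fin_config_space"
  unfolding fin_config_space_def
proof (rule measurable_measure_of)
  let ?P = "\<Pi>\<^sub>M i\<in>{..<n}. (lborel :: 'a measure)"
  show "(\<lambda>x. x ` {..<n}) \<in> space ?P \<rightarrow> fin_configs"
    by (auto simp: fin_configs_def)
  fix A :: "'a set set"
  assume "A \<in> {{\<eta> \<in> fin_configs. card (\<eta> \<inter> \<Lambda>) = j} | \<Lambda> j. compact \<Lambda>}"
  then obtain \<Lambda> j where A: "A = {\<eta> \<in> fin_configs. card (\<eta> \<inter> \<Lambda>) = j}" and "compact \<Lambda>" by auto
  then have [measurable]: "\<Lambda> \<in> sets borel"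
    by (simp add: borel_closed compact_imp_closed)
  have eq: "card (x ` {..<n} \<inter> \<Lambda>) = j \<longleftrightarrow>
      (\<exists>J\<in>{J \<in> Pow {..<n}. card J = j}. (\<forall>i\<in>J. x i \<in> \<Lambda>) \<and> (\<forall>i\<in>J. \<forall>l\<in>J - {i}. x i \<noteq> x l) \<and>
         (\<forall>i\<in>{..<n}. x i \<in> \<Lambda> \<longrightarrow> (\<exists>l\<in>J. x i = x l)))" (is "?L \<longleftrightarrow> ?R") for x :: "nat \<Rightarrow> 'a"
  proof
    assume ?L
    have "x ` {..<n} \<inter> \<Lambda> \<subseteq> x ` {i\<in>{..<n}. x i \<in> \<Lambda>}" by auto
    then obtain J where J: "J \<subseteq> {i\<in>{..<n}. x i \<in> \<Lambda>}" "inj_on x J" "x ` {..<n} \<inter> \<Lambda> = x ` J"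
      by (auto simp only: subset_image_inj)
    with \<open>?L\<close> have "card J = j" by (simp add: card_image)
    moreover have "\<forall>i\<in>{..<n}. x i \<in> \<Lambda> \<longrightarrow> (\<exists>l\<in>J. x i = x l)"
      using J(3) by blast
    ultimately show ?R using J(1,2)
      by (intro bexI[of _ J]) (auto simp: inj_on_def)
  next
    assume ?R
    then obtain J where J: "J \<subseteq> {..<n}" "card J = j" "\<forall>i\<in>J. x i \<in> \<Lambda>"
      "\<forall>i\<in>J. \<forall>l\<in>J - {i}. x i \<noteq> x l" "\<forall>i\<in>{..<n}. x i \<in> \<Lambda> \<longrightarrow> (\<exists>l\<in>J. x i = x l)" by auto
    then have "x ` {..<n} \<inter> \<Lambda> = x ` J" "inj_on x J" by (auto simp: inj_on_def)
    then show ?L using J(2) by (simp add: card_image)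
  qed
  have fin: "finite J" if "J \<in> {J \<in> Pow {..<n}. card J = j}" for J
    using that by (auto intro: finite_subset)
  have comp: "(\<lambda>x. x i) \<in> ?P \<rightarrow>\<^sub>M borel" if "i \<in> {..<n}" for i
    using measurable_component_singleton[OF that, of "\<lambda>_. lborel :: 'a measure"] by simp
  have m1: "Measurable.pred ?P (\<lambda>x. x i \<in> \<Lambda>)" if "i \<in> {..<n}" for i
    using comp[OF that] by measurable
  have m2: "Measurable.pred ?P (\<lambda>x. x i = x l)" if "i \<in> {..<n}" "l \<in> {..<n}" for i l
    using measurable_equality_set[OF comp[OF that(1)] comp[OF that(2)]] by (simp add: pred_def)
  have body: "Measurable.pred ?P (\<lambda>x. (\<forall>i\<in>J. x i \<in> \<Lambda>) \<and>
      (\<forall>i\<in>J. \<forall>l\<in>J - {i}. x i \<noteq> x l) \<and>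
      (\<forall>i\<in>{..<n}. x i \<in> \<Lambda> \<longrightarrow> (\<exists>l\<in>J. x i = x l)))"
    if J: "J \<in> {J \<in> Pow {..<n}. card J = j}" for J
  proof -
    have sub: "i \<in> {..<n}" if "i \<in> J" for i using that J by auto
    show ?thesis
      by (intro pred_intros_logic(2-5) pred_intros_finite(3,4) finite_Diff fin[OF J] finite_lessThan
          m1 m2) (auto dest: sub)
  qed
  have "Measurable.pred ?P (\<lambda>x. card (x ` {..<n} \<inter> \<Lambda>) = j)"
    unfolding eq by (rule pred_intros_finite(4)[OF _ body]) auto
  then have "{x \<in> space ?P. card (x ` {..<n} \<inter> \<Lambda>) = j} \<in> sets ?P"
    by (rule predE)
  also have "{x \<in> space ?P. card (x ` {..<n} \<inter> \<Lambda>) = j} = (\<lambda>x. x ` {..<n}) -` A \<inter> space ?P"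
    by (auto simp: A fin_configs_def)
  finally show "(\<lambda>x. x ` {..<n}) -` A \<inter> space ?P \<in> sets ?P" .
qed auto

lemma emeasure_lebesgue_poisson:
  assumes "A \<in> sets fin_config_space"
  shows "emeasure (lebesgue_poisson :: 'a::euclidean_space set measure) A =
    (\<Sum>n. ennreal (1 / fact n) *
        (\<integral>\<^sup>+ x. indicator A (x ` {..<n}) \<partial>(\<Pi>\<^sub>M i\<in>{..<n}. (lborel :: 'a measure))))"
proof (rule emeasure_measure_of[OF lebesgue_poisson_def])
  let ?P = "\<lambda>n::nat. \<Pi>\<^sub>M i\<in>{..<n}. (lborel :: 'a measure)"
  let ?f = "\<lambda>A. \<Sum>n. ennreal (1 / fact n) * (\<integral>\<^sup>+ x. indicator A (x ` {..<n}) \<partial>?P n)"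
  show "sets fin_config_space \<subseteq> Pow fin_configs"
    using sets.space_closed by fastforce
  show "A \<in> sets lebesgue_poisson" using assms by simp
  show "positive (sets lebesgue_poisson) ?f" by (simp add: positive_def)
  have m: "(\<lambda>x. indicator B (x ` {..<n}) :: ennreal) \<in> borel_measurable (?P n)"
    if "B \<in> sets fin_config_space" for B n
    using measurable_compose[OF measurable_tuple_to_set borel_measurable_indicator[OF that]]
    by simp
  show "countably_additive (sets lebesgue_poisson) ?f"
  proof (rule countably_additiveI)
    fix B :: "nat \<Rightarrow> 'a set set"
    assume B: "range B \<subseteq> sets lebesgue_poisson" "disjoint_family B"
    then have Bs: "B i \<in> sets fin_config_space" for i
      by auto
    have sum: "(\<integral>\<^sup>+ x. indicator (\<Union>i. B i) (x ` {..<n}) \<partial>?P n) =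
        (\<Sum>i. \<integral>\<^sup>+ x. indicator (B i) (x ` {..<n}) \<partial>?P n)" for n
      unfolding suminf_indicator[OF B(2), symmetric] by (rule nn_integral_suminf[OF m[OF Bs]])
    have "(\<Sum>i. ?f (B i)) =
        (\<Sum>n i. ennreal (1 / fact n) * (\<integral>\<^sup>+ x. indicator (B i) (x ` {..<n}) \<partial>?P n))"
      using nn_integral_suminf[of "\<lambda>n i. ennreal (1 / fact n) *
          (\<integral>\<^sup>+ x. indicator (B i) (x ` {..<n}) \<partial>?P n)" "count_space UNIV"]
      unfolding nn_integral_count_space_nat by simp
    also have "\<dots> = ?f (\<Union>i. B i)"
      unfolding sum ennreal_suminf_cmult ..
    finally show "(\<Sum>i. ?f (B i)) = ?f (\<Union>i. B i)" .
  qed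
qed

section \<open>The K-transform and correlation functions\<close>

definition Bbs :: "('a::euclidean_space set \<Rightarrow> real) set" where
  "Bbs = {G. G \<in> borel_measurable fin_config_space \<and> bounded (G ` fin_configs) \<and>
     (\<exists>(N::nat) \<Lambda>. compact \<Lambda> \<and>
        (\<forall>\<eta>\<in>fin_configs. card \<eta> > N \<or> \<eta> \<inter> - \<Lambda> \<noteq> {} \<longrightarrow> G \<eta> = 0))}"

definition K_transform :: "('a::euclidean_space set \<Rightarrow> real) \<Rightarrow> 'a set \<Rightarrow> real" where
  "K_transform G \<gamma> = (\<Sum>\<^sub>\<infinity>\<eta>\<in>{\<eta>. finite \<eta> \<and> \<eta> \<subseteq> \<gamma>}. G \<eta>)"

definition FP :: "('a::euclidean_space set \<Rightarrow> real) set" where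
  "FP = K_transform ` Bbs"

definition correlation_function ::
    "'a::euclidean_space set measure \<Rightarrow> ('a set \<Rightarrow> real) \<Rightarrow> bool" where
  "correlation_function \<mu> k \<longleftrightarrow>
     k \<in> borel_measurable lebesgue_poisson \<and> (\<forall>\<eta>\<in>fin_configs. 0 \<le> k \<eta>) \<and>
     (\<forall>G\<in>Bbs. integrable \<mu> (K_transform G) \<and> integrable lebesgue_poisson (\<lambda>\<eta>. G \<eta> * k \<eta>) \<and>
        (\<integral>\<gamma>. K_transform G \<gamma> \<partial>\<mu>) = (\<integral>\<eta>. G \<eta> * k \<eta> \<partial>lebesgue_poisson))"

text \<open>\<open>K_extension \<mu> k G H\<close>: the function \<open>G\<close> belongs to \<open>L\<^sup>1(k \<lambda>)\<close>, and \<open>H\<close> is a version of the image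
  of \<open>G\<close> under the unique bounded linear extension \<open>L\<^sup>1(k \<lambda>) \<rightarrow> L\<^sup>1(\<mu>)\<close> of the K-transform, i.e.
  the \<open>L\<^sup>1(\<mu>)\<close>-limit of \<open>K G\<^sub>n\<close> for \<open>G\<^sub>n \<in> Bbs\<close> with \<open>G\<^sub>n \<rightarrow> G\<close> in \<open>L\<^sup>1(k \<lambda>)\<close>.\<close>

definition K_extension ::
    "'a::euclidean_space set measure \<Rightarrow> ('a set \<Rightarrow> real) \<Rightarrow> ('a set \<Rightarrow> real) \<Rightarrow> ('a set \<Rightarrow> real) \<Rightarrow> bool"
  where
  "K_extension \<mu> k G H \<longleftrightarrow>
     integrable (density lebesgue_poisson (\<lambda>\<eta>. ennreal (k \<eta>))) G \<and> integrable \<mu> H \<and>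
     (\<exists>Gn. (\<forall>n. Gn n \<in> Bbs) \<and>
        (\<lambda>n. \<integral>\<eta>. \<bar>Gn n \<eta> - G \<eta>\<bar> \<partial>density lebesgue_poisson (\<lambda>\<eta>. ennreal (k \<eta>))) \<longlonglongrightarrow> 0 \<and>
        (\<lambda>n. \<integral>\<gamma>. \<bar>K_transform (Gn n) \<gamma> - H \<gamma>\<bar> \<partial>\<mu>) \<longlonglongrightarrow> 0)"

text \<open>Elements of the Banach space \<open>K\<^sub>\<alpha>\<close> are represented by functions, and equality in it is
  equality almost everywhere with respect to \<open>lebesgue_poisson\<close>.\<close>

definition K_norm :: "real \<Rightarrow> ('a::euclidean_space set \<Rightarrow> real) \<Rightarrow> ereal" where
  "K_norm \<alpha> k = esssup lebesgue_poisson (\<lambda>\<eta>. ereal (\<bar>k \<eta>\<bar> * exp (- \<alpha> * real (card \<eta>))))"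

definition K_space :: "real \<Rightarrow> ('a::euclidean_space set \<Rightarrow> real) set" where
  "K_space \<alpha> = {k \<in> borel_measurable lebesgue_poisson. K_norm \<alpha> k < \<infinity>}"

section \<open>The generator and the Fokker--Planck equation\<close>

text \<open>Measurability is Borel measurability, as the kernels enter pointwise.\<close>

definition condition_G :: "('a::euclidean_space \<Rightarrow> real) \<Rightarrow> ('a \<Rightarrow> real) \<Rightarrow> bool" where
  "condition_G am ap \<longleftrightarrow>
     (\<forall>a\<in>{am, ap}. (\<forall>x. 0 \<le> a x) \<and> (\<forall>x. a (- x) = a x) \<and> bounded (range a) \<and> integrable lborel a) \<and>
     (\<exists>\<theta> b. \<theta> > 0 \<and> b \<ge> 0 \<and>
        (\<forall>\<eta>\<in>fin_configs. (\<Sum>x\<in>\<eta>. \<Sum>y\<in>\<eta> - {x}. am (x - y) - \<theta> * ap (x - y)) \<ge> - b * real (card \<eta>)))"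

definition L_hat :: "real \<Rightarrow> ('a::euclidean_space \<Rightarrow> real) \<Rightarrow> ('a \<Rightarrow> real) \<Rightarrow>
    ('a set \<Rightarrow> real) \<Rightarrow> 'a set \<Rightarrow> real" where
  "L_hat m am ap G \<eta> =
     - (m * real (card \<eta>) + (\<Sum>x\<in>\<eta>. \<Sum>y\<in>\<eta> - {x}. am (x - y))) * G \<eta>
     + (\<Sum>x\<in>\<eta>. \<integral>y. ap (x - y) * G (\<eta> \<union> {y}) \<partial>lborel)
     - (\<Sum>x\<in>\<eta>. \<Sum>y\<in>\<eta> - {x}. am (x - y) * G (\<eta> - {x}))
     + (\<Sum>x\<in>\<eta>. \<integral>y. ap (x - y) * G ((\<eta> - {x}) \<union> {y}) \<partial>lborel)"

definition L_Delta :: "real \<Rightarrow> ('a::euclidean_space \<Rightarrow> real) \<Rightarrow> ('a \<Rightarrow> real) \<Rightarrow>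
    ('a set \<Rightarrow> real) \<Rightarrow> 'a set \<Rightarrow> real" where
  "L_Delta m am ap k \<eta> =
     - (m * real (card \<eta>) + (\<Sum>x\<in>\<eta>. \<Sum>y\<in>\<eta> - {x}. am (x - y))) * k \<eta>
     + (\<Sum>x\<in>\<eta>. \<Sum>y\<in>\<eta> - {x}. ap (x - y) * k (\<eta> - {x}))
     - (\<Sum>x\<in>\<eta>. \<integral>y. am (x - y) * k (\<eta> \<union> {y}) \<partial>lborel)
     + (\<Sum>x\<in>\<eta>. \<integral>y. ap (x - y) * k ((\<eta> - {x}) \<union> {y}) \<partial>lborel)"

text \<open>\<open>generator_image m am ap \<mu> F H\<close>: the measure \<open>\<mu>\<close> has a correlation function, and
  \<open>L F = K (L_hat G)\<close> for \<open>F = K G\<close> is defined as an element of \<open>L\<^sup>1(\<mu>)\<close> and represented by \<open>H\<close>.\<close>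

definition generator_image :: "real \<Rightarrow> ('a::euclidean_space \<Rightarrow> real) \<Rightarrow> ('a \<Rightarrow> real) \<Rightarrow>
    'a set measure \<Rightarrow> ('a set \<Rightarrow> real) \<Rightarrow> ('a set \<Rightarrow> real) \<Rightarrow> bool" where
  "generator_image m am ap \<mu> F H \<longleftrightarrow>
     (\<exists>k G. correlation_function \<mu> k \<and> G \<in> Bbs \<and> F = K_transform G \<and>
        K_extension \<mu> k (L_hat m am ap G) H)"

text \<open>In the following definition \<open>LF t\<close> is a version of \<open>L F\<close> with respect to \<open>\<mu> t\<close>.\<close>

definition weak_solution :: "real \<Rightarrow> ('a::euclidean_space \<Rightarrow> real) \<Rightarrow> ('a \<Rightarrow> real) \<Rightarrow>
    'a set measure \<Rightarrow> (real \<Rightarrow> 'a set measure) \<Rightarrow> bool" where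
  "weak_solution m am ap \<mu>0 \<mu> \<longleftrightarrow>
     (\<forall>t\<ge>0. config_prob (\<mu> t)) \<and> \<mu> 0 = \<mu>0 \<and>
     (\<forall>F\<in>FP. \<exists>LF.
        (\<forall>t\<ge>0. generator_image m am ap (\<mu> t) F (LF t) \<and>
           integrable (\<mu> t) F \<and> integrable (\<mu> t) (LF t)) \<and>
        (\<forall>T>0. set_integrable lebesgue {0..T} (\<lambda>t. \<integral>\<gamma>. LF t \<gamma> \<partial>\<mu> t)) \<and>
        (\<forall>t\<ge>0. (\<integral>\<gamma>. F \<gamma> \<partial>\<mu> t) =
           (\<integral>\<gamma>. F \<gamma> \<partial>\<mu>0) + (LINT s:{0..t}|lebesgue. \<integral>\<gamma>. LF s \<gamma> \<partial>\<mu> s)))"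

section \<open>The hierarchical equation\<close>

text \<open>Continuous differentiability and the equation are understood in \<open>K\<^sub>\<alpha>\<close>, one-sidedly
  at the end points of \<open>[0, T]\<close>.\<close>

definition classical_solution :: "real \<Rightarrow> ('a::euclidean_space \<Rightarrow> real) \<Rightarrow> ('a \<Rightarrow> real) \<Rightarrow>
    real \<Rightarrow> real \<Rightarrow> ('a set \<Rightarrow> real) \<Rightarrow> (real \<Rightarrow> 'a set \<Rightarrow> real) \<Rightarrow> bool" where
  "classical_solution m am ap \<alpha> T k0 k \<longleftrightarrow>
     (AE \<eta> in lebesgue_poisson. k 0 \<eta> = k0 \<eta>) \<and>
     (\<forall>t\<in>{0..T}.
        k t \<in> K_space \<alpha> \<and> L_Delta m am ap (k t) \<in> K_space \<alpha> \<and>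
        ((\<lambda>s. K_norm \<alpha> (\<lambda>\<eta>. (k s \<eta> - k t \<eta>) / (s - t) - L_Delta m am ap (k t) \<eta>)) \<longlongrightarrow> 0)
          (at t within {0..T}) \<and>
        ((\<lambda>s. K_norm \<alpha> (\<lambda>\<eta>. L_Delta m am ap (k s) \<eta> - L_Delta m am ap (k t) \<eta>)) \<longlongrightarrow> 0)
          (at t within {0..T}))"

definition hierarchical_solution :: "real \<Rightarrow> ('a::euclidean_space \<Rightarrow> real) \<Rightarrow> ('a \<Rightarrow> real) \<Rightarrow>
    real \<Rightarrow> ('a set \<Rightarrow> real) \<Rightarrow> (real \<Rightarrow> 'a set \<Rightarrow> real) \<Rightarrow> bool" where
  "hierarchical_solution m am ap \<alpha>0 k0 k \<longleftrightarrow>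
     (\<forall>T>0. \<exists>\<alpha>\<ge>\<alpha>0. classical_solution m am ap \<alpha> T k0 k \<and>
        (\<forall>k'. classical_solution m am ap \<alpha> T k0 k' \<longrightarrow>
           (\<forall>t\<in>{0..T}. AE \<eta> in lebesgue_poisson. k' t \<eta> = k t \<eta>)))"

end

theory Submission
  imports Defs
begin

text \<open>
  Tested against \<open>F = K G\<close>, the Fokker--Planck equation is the equation
  \<open>\<langle>G, k\<^sub>t\<rangle>' = \<langle>L_hat G, k\<^sub>t\<rangle>\<close> for the correlation functions, where \<open>\<langle>G, k\<rangle>\<close> is the integral of \<open>G k\<close> over
  the Lebesgue--Poisson measure.  To give \<open>K (L_hat G)\<close> a meaning, \<open>L_hat G\<close> is approximated in
  \<open>L\<^sup>1\<close> by test functions: it is bounded, measurable and vanishes on configurations of many particles,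
  and only locality is lost (\<open>K_extension_exists\<close>, \<open>K_extension_integral\<close>, \<open>L_hat_bounded\<close>).  Mecke's
  formula makes \<open>L_hat\<close> and \<open>L_Delta\<close> adjoint to each other (\<open>L_hat_L_Delta_duality\<close>), so that a
  classical solution of the hierarchical equation satisfies the tested equation; integrating the
  derivative of \<open>\<langle>G, k\<^sub>t\<rangle>\<close> proves existence (\<open>hierarchical_weak_solution\<close>).

  For uniqueness, a second weak solution may take its correlation functions in a larger space
  \<open>K_space \<beta>\<close> than \<open>(k\<^sub>t)\<close> does, and the difference \<open>q\<close> of the two families is estimated directly.
  It solves the tested equation, starts at \<open>0\<close> and is bounded by \<open>C exp (\<beta> |\<eta>|)\<close>.  One
  contribution of the generator, the birth term, grows quadratically with the number of particles,
  too fast for an iteration over the spaces \<open>K_space \<alpha>\<close>.  By condition (G) it is at most the death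
  rate \<open>E\<close> divided by \<open>\<theta>\<close>, up to a linear term, and in Duhamel's formula for the
  semigroup \<open>exp (- t E)\<close> it turns into a contraction with factor \<open>exp (- \<alpha>) / \<theta>\<close>, which is at
  most \<open>1/2\<close> for large \<open>\<alpha>\<close> (\<open>off_weight_le\<close>, \<open>duhamel_estimate\<close>).  What remains grows linearly and is
  absorbed by increasing \<open>\<alpha>\<close> in many small steps (\<open>weak_evolution_short_time\<close>).  Thus \<open>q\<close>
  vanishes up to a time that depends on \<open>\<beta>\<close> only, and by repetition for all times
  (\<open>weak_evolution_zero\<close>).

  Finally, an exponentially bounded correlation function determines its measure
  (\<open>config_measure_unique\<close>): the probability that a bounded set contains no point is an alternating
  series of integrals of the correlation function, and these void events form an intersection-stable
  generator of the Borel sets.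
\<close>

section \<open>Measurability on the space of finite configurations\<close>

lemma finite_config_space: "\<eta> \<in> space fin_config_space \<Longrightarrow> finite \<eta>"
  by (simp add: fin_configs_def)

lemma fin_configs_iff [simp]: "\<eta> \<in> fin_configs \<longleftrightarrow> finite \<eta>"
  by (simp add: fin_configs_def)

lemma measurable_card_Int_compact:
  assumes "compact \<Lambda>"
  shows "(\<lambda>\<eta>. real (card (\<eta> \<inter> \<Lambda>))) \<in> borel_measurable (fin_config_space :: 'a::euclidean_space set measure)"
proof -
  have "(\<lambda>\<eta>. card (\<eta> \<inter> \<Lambda>)) \<in> fin_config_space \<rightarrow>\<^sub>M count_space UNIV"
    unfolding measurable_count_space_eq_countable[OF countable_subset[OF subset_UNIV countableI_type]]
  proof (intro conjI ballI)
    fix n :: nat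
    have "(\<lambda>\<eta>. card (\<eta> \<inter> \<Lambda>)) -` {n} \<inter> space fin_config_space = {\<eta> \<in> fin_configs. card (\<eta> \<inter> \<Lambda>) = n}"
      by auto
    also have "\<dots> \<in> sets fin_config_space"
      unfolding fin_config_space_def using assms by (intro in_measure_of) auto
    finally show "(\<lambda>\<eta>. card (\<eta> \<inter> \<Lambda>)) -` {n} \<inter> space (fin_config_space :: 'a set measure) \<in> sets fin_config_space" .
  qed auto
  then show ?thesis by simp
qed

lemma card_Int_cball_tendsto:
  fixes \<eta> :: "'a::euclidean_space set"
  assumes "finite \<eta>"
  shows "(\<lambda>n. real (card (\<eta> \<inter> (A \<inter> cball 0 (real n))))) \<longlonglongrightarrow> real (card (\<eta> \<inter> A))"
proof -
  obtain R where R: "\<eta> \<subseteq> cball 0 R"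
    using bounded_subset_ballD[OF finite_imp_bounded[OF assms], of 0] ball_subset_cball by blast
  have "eventually (\<lambda>n. real (card (\<eta> \<inter> (A \<inter> cball 0 (real n)))) = real (card (\<eta> \<inter> A))) sequentially"
    using eventually_ge_at_top[of "nat \<lceil>R\<rceil>"]
  proof eventually_elim
    case (elim n)
    then have "R \<le> real n" by linarith
    then have "\<eta> \<inter> (A \<inter> cball 0 (real n)) = \<eta> \<inter> A"
      using R by force
    then show ?case by simp
  qed
  then show ?thesis by (rule tendsto_eventually)
qed

lemma measurable_card_Int_closed:
  assumes "closed A"
  shows "(\<lambda>\<eta>. real (card (\<eta> \<inter> A))) \<in> borel_measurable (fin_config_space :: 'a::euclidean_space set measure)"
  using borel_measurable_LIMSEQ_real[OF card_Int_cball_tendsto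
      measurable_card_Int_compact[OF closed_Int_compact[OF assms compact_cball]]]
  by simp

lemma sum_indicat_real_card:
  "finite \<eta> \<Longrightarrow> (\<Sum>x\<in>\<eta>. indicat_real A x) = real (card (\<eta> \<inter> A))"
  by (simp add: indicator_def sum.If_cases)

lemma sums_indicator_disjoint:
  assumes "disjoint_family A"
  shows "(\<lambda>i. indicat_real (A i) x) sums indicator (\<Union>i. A i) x"
proof (cases "x \<in> (\<Union>i. A i)")
  case True
  then obtain j where j: "x \<in> A j" by auto
  then have "(\<lambda>i. indicat_real (A i) x) = (\<lambda>i. if i = j then 1 else 0)"
    using assms by (auto simp: disjoint_family_on_def fun_eq_iff indicator_def)
  then show ?thesis using True sums_single[of j "\<lambda>_. 1::real"] by simp
next
  case False
  then have "(\<lambda>i. indicat_real (A i) x) = (\<lambda>i. 0)" by (auto simp: fun_eq_iff)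
  then show ?thesis using False by simp
qed

text \<open>The generating events only count points in compact sets; the class of sets whose counting
  function is measurable is a Dynkin system containing the closed sets.\<close>

lemma measurable_card_Int:
  fixes A :: "'a::euclidean_space set"
  assumes "A \<in> sets borel"
  shows "(\<lambda>\<eta>. real (card (\<eta> \<inter> A))) \<in> borel_measurable fin_config_space"
proof -
  have A: "A \<in> sigma_sets UNIV (Collect closed)"
    using assms by (simp add: borel_eq_closed)
  have I: "Int_stable (Collect closed :: 'a set set)" "(Collect closed :: 'a set set) \<subseteq> Pow UNIV"
    by (auto simp: Int_stable_def)
  show ?thesis
    using I A
  proof (induct rule: sigma_sets_induct_disjoint)
    case (basic A)
    then show ?case by (simp add: measurable_card_Int_closed)
  next
    case (compl A)
    have "(\<lambda>\<eta>. real (card (\<eta> \<inter> UNIV)) - real (card (\<eta> \<inter> A))) \<in> borel_measurable fin_config_space"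
      using borel_measurable_diff[OF measurable_card_Int_closed[OF closed_UNIV] compl(2)] .
    also have "?this \<longleftrightarrow> ?case"
    proof (rule measurable_cong)
      fix \<eta> :: "'a set" assume "\<eta> \<in> space fin_config_space"
      then have "finite \<eta>" by (rule finite_config_space)
      then have "card \<eta> = card (\<eta> \<inter> A) + card (\<eta> - A)"
        by (metis Int_Diff_Un Int_Diff_disjoint card_Un_disjoint finite_Diff finite_Int)
      moreover have "\<eta> \<inter> (UNIV - A) = \<eta> - A" by auto
      ultimately show "real (card (\<eta> \<inter> UNIV)) - real (card (\<eta> \<inter> A)) = real (card (\<eta> \<inter> (UNIV - A)))" by simp
    qed
    finally show ?case .
  next
    case (union A)
    show ?case
    proof (rule borel_measurable_LIMSEQ_real)
      fix \<eta> :: "'a set" assume "\<eta> \<in> space fin_config_space"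
      then have fin: "finite \<eta>" by (rule finite_config_space)
      have "(\<lambda>i. \<Sum>x\<in>\<eta>. indicat_real (A i) x) sums (\<Sum>x\<in>\<eta>. indicat_real (\<Union>i. A i) x)"
        by (intro sums_sum sums_indicator_disjoint union)
      then show "(\<lambda>n. \<Sum>i<n. real (card (\<eta> \<inter> A i))) \<longlonglongrightarrow> real (card (\<eta> \<inter> (\<Union>i. A i)))"
        by (simp only: sum_indicat_real_card[OF fin] sums_def)
    next
      fix n show "(\<lambda>\<eta>. \<Sum>i<n. real (card (\<eta> \<inter> A i))) \<in> borel_measurable fin_config_space"
        using union by (intro borel_measurable_sum) auto
    qed
  qed auto
qed

lemma pred_count:
  assumes "(\<lambda>x. real (f x)) \<in> borel_measurable M"
  shows "f \<in> M \<rightarrow>\<^sub>M count_space (UNIV :: nat set)"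
proof -
  have "(\<lambda>x. nat \<lfloor>real (f x)\<rfloor>) \<in> M \<rightarrow>\<^sub>M count_space UNIV"
    using assms by measurable
  then show ?thesis by simp
qed

lemma measurable_card_config [measurable]: "card \<in> fin_config_space \<rightarrow>\<^sub>M count_space (UNIV :: nat set)"
  using pred_count[OF measurable_card_Int[of UNIV]] by simp

lemma measurable_card_Int' [measurable]:
  assumes "A \<in> sets borel"
  shows "(\<lambda>\<eta>. card (\<eta> \<inter> A)) \<in> fin_config_space \<rightarrow>\<^sub>M count_space UNIV"
  by (rule pred_count[OF measurable_card_Int[OF assms]])

lemma measurable_fin_config_spaceI:
  assumes "\<And>\<omega>. \<omega> \<in> space M \<Longrightarrow> finite (f \<omega>)"
    and "\<And>\<Lambda>. \<Lambda> \<in> sets borel \<Longrightarrow> (\<lambda>\<omega>. real (card (f \<omega> \<inter> \<Lambda>))) \<in> borel_measurable M"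
  shows "f \<in> M \<rightarrow>\<^sub>M (fin_config_space :: 'a::euclidean_space set measure)"
  unfolding fin_config_space_def
proof (rule measurable_measure_of)
  fix A :: "'a set set" assume "A \<in> {{\<eta> \<in> fin_configs. card (\<eta> \<inter> \<Lambda>) = n} | \<Lambda> n. compact \<Lambda>}"
  then obtain \<Lambda> n where A: "A = {\<eta> \<in> fin_configs. card (\<eta> \<inter> \<Lambda>) = n}" and "compact \<Lambda>" by auto
  then have [measurable]: "(\<lambda>\<omega>. real (card (f \<omega> \<inter> \<Lambda>))) \<in> borel_measurable M"
    by (intro assms) (simp add: borel_closed compact_imp_closed)
  have "f -` A \<inter> space M = {\<omega> \<in> space M. real (card (f \<omega> \<inter> \<Lambda>)) = real n}"
    using assms(1) by (auto simp: A)
  also have "\<dots> \<in> sets M" by measurable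
  finally show "f -` A \<inter> space M \<in> sets M" .
qed (use assms(1) in \<open>auto simp: fin_configs_def\<close>)

text \<open>Membership is detected by the countably many balls of radius \<open>1/(n+1)\<close> around the points of
  a countable dense set, because a finite configuration is closed.\<close>

lemma pred_member_config:
  "Measurable.pred (borel \<Otimes>\<^sub>M (fin_config_space :: 'a::euclidean_space set measure)) (\<lambda>(x, \<eta>). x \<in> \<eta>)"
proof -
  obtain D :: "'a set" where D: "countable D" "\<And>X. open X \<Longrightarrow> X \<noteq> {} \<Longrightarrow> \<exists>d \<in> D. d \<in> X"
    using countable_dense_setE by blast
  have eq: "x \<in> \<eta> \<longleftrightarrow> (\<forall>n::nat. \<exists>q\<in>D. dist q x < 1 / Suc n \<and> card (\<eta> \<inter> ball q (1 / Suc n)) > 0)"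
    if "finite \<eta>" for x :: 'a and \<eta>
  proof
    assume "x \<in> \<eta>"
    show "\<forall>n::nat. \<exists>q\<in>D. dist q x < 1 / Suc n \<and> card (\<eta> \<inter> ball q (1 / Suc n)) > 0"
    proof
      fix n :: nat
      obtain q where "q \<in> D" "q \<in> ball x (1 / Suc n)" using D(2)[of "ball x (1 / Suc n)"] by auto
      moreover have "x \<in> \<eta> \<inter> ball q (1 / Suc n)" using calculation \<open>x \<in> \<eta>\<close> by (simp add: dist_commute)
      then have "card (\<eta> \<inter> ball q (1 / Suc n)) > 0" using that by (auto simp: card_gt_0_iff)
      ultimately show "\<exists>q\<in>D. dist q x < 1 / Suc n \<and> card (\<eta> \<inter> ball q (1 / Suc n)) > 0"
        by (intro bexI[of _ q]) (auto simp: dist_commute)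
    qed
  next
    assume *: "\<forall>n::nat. \<exists>q\<in>D. dist q x < 1 / Suc n \<and> card (\<eta> \<inter> ball q (1 / Suc n)) > 0"
    have "x \<in> closure \<eta>" unfolding closure_approachable
    proof (intro allI impI)
      fix e :: real assume "e > 0"
      then obtain n where n: "2 / Suc n < e"
        using nat_approx_posE[of "e / 2"] by (auto simp: field_simps)
      obtain q where q: "dist q x < 1 / Suc n" "card (\<eta> \<inter> ball q (1 / Suc n)) > 0" using * by blast
      then obtain y where y: "y \<in> \<eta>" "dist q y < 1 / Suc n" by (auto simp: card_gt_0_iff)
      have "dist y x \<le> dist q y + dist q x" using dist_triangle3 by blast
      also have "\<dots> < 2 / Suc n" using q y by (simp add: field_simps)
      finally have "dist y x < e" using n by linarith
      with y show "\<exists>y\<in>\<eta>. dist y x < e" by auto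
    qed
    then show "x \<in> \<eta>" using that by (simp add: finite_imp_closed)
  qed
  have "Measurable.pred (borel \<Otimes>\<^sub>M (fin_config_space :: 'a set measure))
      (\<lambda>z. \<forall>n::nat. \<exists>q\<in>D. dist q (fst z) < 1 / Suc n \<and> card (snd z \<inter> ball q (1 / Suc n)) > 0)"
    using D(1) by measurable
  also have "?this \<longleftrightarrow> ?thesis"
    by (rule measurable_cong) (auto simp: eq space_pair_measure)
  finally show ?thesis .
qed

lemma pred_member_config' [measurable (raw)]:
  assumes "f \<in> M \<rightarrow>\<^sub>M borel" "g \<in> M \<rightarrow>\<^sub>M (fin_config_space :: 'a::euclidean_space set measure)"
  shows "Measurable.pred M (\<lambda>\<omega>. f \<omega> \<in> g \<omega>)"
  using measurable_compose[OF measurable_Pair[OF assms] pred_member_config] by simp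

lemma measurable_card_comp:
  assumes "g \<in> M \<rightarrow>\<^sub>M (fin_config_space :: 'a::euclidean_space set measure)" "A \<in> sets borel"
  shows "(\<lambda>\<omega>. real (card (g \<omega> \<inter> A))) \<in> borel_measurable M"
  using measurable_compose[OF assms(1) measurable_card_Int[OF assms(2)]] .

lemma finite_measurable_config:
  "g \<in> M \<rightarrow>\<^sub>M fin_config_space \<Longrightarrow> \<omega> \<in> space M \<Longrightarrow> finite (g \<omega>)"
  by (rule finite_config_space) (rule measurable_space)

lemma measurable_insert_config [measurable (raw)]:
  assumes [measurable]: "f \<in> M \<rightarrow>\<^sub>M borel" "g \<in> M \<rightarrow>\<^sub>M (fin_config_space :: 'a::euclidean_space set measure)"
  shows "(\<lambda>\<omega>. insert (f \<omega>) (g \<omega>)) \<in> M \<rightarrow>\<^sub>M fin_config_space"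
proof (rule measurable_fin_config_spaceI)
  fix \<Lambda> :: "'a set" assume [measurable]: "\<Lambda> \<in> sets borel"
  note [measurable] = measurable_card_comp
  have "(\<lambda>\<omega>. real (card (g \<omega> \<inter> \<Lambda>)) + (if f \<omega> \<in> \<Lambda> \<and> \<not> f \<omega> \<in> g \<omega> then 1 else 0)) \<in> borel_measurable M"
    by measurable
  also have "?this \<longleftrightarrow> (\<lambda>\<omega>. real (card (insert (f \<omega>) (g \<omega>) \<inter> \<Lambda>))) \<in> borel_measurable M"
    by (rule measurable_cong)
      (simp add: finite_measurable_config[OF assms(2)] Int_insert_left insert_absorb)
  finally show "(\<lambda>\<omega>. real (card (insert (f \<omega>) (g \<omega>) \<inter> \<Lambda>))) \<in> borel_measurable M" .
qed (simp add: finite_measurable_config[OF assms(2)])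

lemma measurable_delete_config [measurable (raw)]:
  assumes [measurable]: "f \<in> M \<rightarrow>\<^sub>M borel" "g \<in> M \<rightarrow>\<^sub>M (fin_config_space :: 'a::euclidean_space set measure)"
  shows "(\<lambda>\<omega>. g \<omega> - {f \<omega>}) \<in> M \<rightarrow>\<^sub>M fin_config_space"
proof (rule measurable_fin_config_spaceI)
  fix \<Lambda> :: "'a set" assume [measurable]: "\<Lambda> \<in> sets borel"
  note [measurable] = measurable_card_comp
  have "(\<lambda>\<omega>. real (card (g \<omega> \<inter> \<Lambda>)) - (if f \<omega> \<in> \<Lambda> \<and> f \<omega> \<in> g \<omega> then 1 else 0)) \<in> borel_measurable M"
    by measurable
  also have "?this \<longleftrightarrow> (\<lambda>\<omega>. real (card ((g \<omega> - {f \<omega>}) \<inter> \<Lambda>))) \<in> borel_measurable M"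
  proof (rule measurable_cong)
    fix \<omega> assume "\<omega> \<in> space M"
    then have fin: "finite (g \<omega> \<inter> \<Lambda>)" using finite_measurable_config[OF assms(2)] by auto
    have eq: "(g \<omega> - {f \<omega>}) \<inter> \<Lambda> = (g \<omega> \<inter> \<Lambda>) - {f \<omega>}" by auto
    show "real (card (g \<omega> \<inter> \<Lambda>)) - (if f \<omega> \<in> \<Lambda> \<and> f \<omega> \<in> g \<omega> then 1 else 0) = real (card ((g \<omega> - {f \<omega>}) \<inter> \<Lambda>))"
    proof (cases "f \<omega> \<in> g \<omega> \<inter> \<Lambda>")
      case True
      then have "card (g \<omega> \<inter> \<Lambda>) = Suc (card ((g \<omega> \<inter> \<Lambda>) - {f \<omega>}))"
        using fin by (intro card.remove)
      with True show ?thesis by (simp add: eq)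
    next
      case False
      then have "(g \<omega> \<inter> \<Lambda>) - {f \<omega>} = g \<omega> \<inter> \<Lambda>" by auto
      moreover have "\<not> (f \<omega> \<in> \<Lambda> \<and> f \<omega> \<in> g \<omega>)"
        using False by auto
      ultimately show ?thesis unfolding eq by simp
    qed
  qed
  finally show "(\<lambda>\<omega>. real (card ((g \<omega> - {f \<omega>}) \<inter> \<Lambda>))) \<in> borel_measurable M" .
qed (simp add: finite_measurable_config[OF assms(2)])

text \<open>Counting measure on the random configuration \<open>g \<omega>\<close> is a measurable kernel, but not a
  sub-probability kernel; a monotone class argument reduces the claim to rectangles.\<close>

lemma borel_measurable_sum_config_ennreal:
  fixes h :: "'a::euclidean_space \<times> 'b \<Rightarrow> ennreal"
  assumes h: "h \<in> borel_measurable (borel \<Otimes>\<^sub>M M)"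
    and g[measurable]: "g \<in> M \<rightarrow>\<^sub>M (fin_config_space :: 'a set measure)"
  shows "(\<lambda>\<omega>. \<Sum>x\<in>g \<omega>. h (x, \<omega>)) \<in> borel_measurable M"
  using h
proof induct
  case (cong u v)
  have "(\<lambda>\<omega>. \<Sum>x\<in>g \<omega>. u (x, \<omega>)) \<in> borel_measurable M \<longleftrightarrow> (\<lambda>\<omega>. \<Sum>x\<in>g \<omega>. v (x, \<omega>)) \<in> borel_measurable M"
    by (rule measurable_cong) (auto intro!: sum.cong cong(3) simp: space_pair_measure)
  then show ?case using cong by simp
next
  case (set A)
  let ?G = "{a \<times> b |a b. a \<in> sets (borel :: 'a measure) \<and> b \<in> sets M}"
  have "A \<in> sigma_sets (space borel \<times> space M) ?G"
    using set by (simp add: sets_pair_measure)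
  with Int_stable_pair_measure_generator pair_measure_closed
  show ?case
  proof (induct rule: sigma_sets_induct_disjoint)
    case (basic A)
    then obtain a b where A: "A = a \<times> b" and [measurable]: "a \<in> sets borel" "b \<in> sets M" by auto
    have "(\<lambda>\<omega>. ennreal (real (card (g \<omega> \<inter> a))) * indicator b \<omega>) \<in> borel_measurable M"
      using measurable_card_comp[OF g] by measurable
    also have "?this \<longleftrightarrow> ?case"
    proof (rule measurable_cong)
      fix \<omega> assume "\<omega> \<in> space M"
      then have "finite (g \<omega>)" by (rule finite_measurable_config[OF g])
      then show "ennreal (real (card (g \<omega> \<inter> a))) * indicator b \<omega> = (\<Sum>x\<in>g \<omega>. indicator A (x, \<omega>))"
        by (simp add: A indicator_times ennreal_indicator[symmetric] ennreal_mult sum_nonneg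
            del: ennreal_indicator flip: sum_distrib_right sum_indicat_real_card)
    qed
    finally show ?case .
  next
    case (compl A)
    have [measurable]: "(\<lambda>\<omega>. \<Sum>x\<in>g \<omega>. indicator A (x, \<omega>) :: ennreal) \<in> borel_measurable M"
      by (rule compl(2))
    have "(\<lambda>\<omega>. ennreal (real (card (g \<omega> \<inter> UNIV))) - (\<Sum>x\<in>g \<omega>. indicator A (x, \<omega>))) \<in> borel_measurable M"
      using measurable_card_comp[OF g] by measurable
    also have "?this \<longleftrightarrow> ?case"
    proof (rule measurable_cong)
      fix \<omega> assume w: "\<omega> \<in> space M"
      then have fin: "finite (g \<omega>)" by (rule finite_measurable_config[OF g])
      have "(\<Sum>x\<in>g \<omega>. indicator (space borel \<times> space M - A) (x, \<omega>)) + (\<Sum>x\<in>g \<omega>. indicator A (x, \<omega>))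
          = (\<Sum>x\<in>g \<omega>. 1 :: ennreal)"
        unfolding sum.distrib[symmetric] using w by (intro sum.cong) (auto simp: indicator_def)
      also have "\<dots> = ennreal (real (card (g \<omega> \<inter> UNIV)))"
        by (simp add: ennreal_of_nat_eq_real_of_nat)
      finally have *: "(\<Sum>x\<in>g \<omega>. indicator (space borel \<times> space M - A) (x, \<omega>)) + (\<Sum>x\<in>g \<omega>. indicator A (x, \<omega>))
          = ennreal (real (card (g \<omega> \<inter> UNIV)))" .
      have "(\<Sum>x\<in>g \<omega>. indicator A (x, \<omega>)) \<noteq> (top::ennreal)"
        using fin by (auto simp: indicator_def)
      then show "ennreal (real (card (g \<omega> \<inter> UNIV))) - (\<Sum>x\<in>g \<omega>. indicator A (x, \<omega>)) =
          (\<Sum>x\<in>g \<omega>. indicator (space borel \<times> space M - A) (x, \<omega>))"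
        unfolding *[symmetric] by (simp add: ennreal_add_diff_cancel_right)
    qed
    finally show ?case .
  next
    case (union A)
    have "(\<lambda>\<omega>. \<Sum>i. \<Sum>x\<in>g \<omega>. indicator (A i) (x, \<omega>) :: ennreal) \<in> borel_measurable M"
      using union(3) by (rule borel_measurable_suminf_order)
    also have "(\<lambda>\<omega>. \<Sum>i. \<Sum>x\<in>g \<omega>. indicator (A i) (x, \<omega>) :: ennreal) = (\<lambda>\<omega>. \<Sum>x\<in>g \<omega>. \<Sum>i. indicator (A i) (x, \<omega>))"
      by (intro ext suminf_sum) auto
    finally show ?case by (simp add: suminf_indicator[OF union(1)])
  qed simp
next
  case (mult u c)
  then show ?case by (simp flip: sum_distrib_left)
next
  case (add u v)
  then show ?case by (simp add: sum.distrib)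
next
  case (seq U)
  have "(\<lambda>\<omega>. \<Squnion>i. \<Sum>x\<in>g \<omega>. U i (x, \<omega>)) \<in> borel_measurable M"
    using seq by measurable
  also have "?this \<longleftrightarrow> ?case"
  proof (rule measurable_cong)
    fix \<omega> assume "\<omega> \<in> space M"
    then have fin: "finite (g \<omega>)" by (rule finite_measurable_config[OF g])
    have "(\<Squnion>i. \<Sum>x\<in>g \<omega>. U i (x, \<omega>)) = (\<Squnion>i. \<integral>\<^sup>+x. U i (x, \<omega>) \<partial>count_space (g \<omega>))"
      using fin by (simp add: nn_integral_count_space_finite)
    also have "\<dots> = (\<integral>\<^sup>+x. (\<Squnion>i. U i (x, \<omega>)) \<partial>count_space (g \<omega>))"
      using seq by (intro nn_integral_monotone_convergence_SUP[symmetric]) (auto simp: incseq_def le_fun_def)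
    finally show "(\<Squnion>i. \<Sum>x\<in>g \<omega>. U i (x, \<omega>)) = (\<Sum>x\<in>g \<omega>. (\<Squnion>i. U i) (x, \<omega>))"
      using fin by (simp add: nn_integral_count_space_finite image_comp)
  qed
  finally show ?case .
qed

lemma borel_measurable_sum_config [measurable (raw)]:
  fixes h :: "'a::euclidean_space \<Rightarrow> 'b \<Rightarrow> real"
  assumes [measurable]: "(\<lambda>z. h (fst z) (snd z)) \<in> borel_measurable (borel \<Otimes>\<^sub>M M)"
    and g: "g \<in> M \<rightarrow>\<^sub>M (fin_config_space :: 'a set measure)"
  shows "(\<lambda>\<omega>. \<Sum>x\<in>g \<omega>. h x \<omega>) \<in> borel_measurable M"
proof -
  have [measurable]: "(\<lambda>\<omega>. \<Sum>x\<in>g \<omega>. ennreal (h x \<omega>)) \<in> borel_measurable M"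
    "(\<lambda>\<omega>. \<Sum>x\<in>g \<omega>. ennreal (- h x \<omega>)) \<in> borel_measurable M"
    using borel_measurable_sum_config_ennreal[OF _ g, of "\<lambda>z. ennreal (h (fst z) (snd z))"]
      borel_measurable_sum_config_ennreal[OF _ g, of "\<lambda>z. ennreal (- h (fst z) (snd z))"] by auto
  have "(\<Sum>x\<in>g \<omega>. h x \<omega>) = enn2real (\<Sum>x\<in>g \<omega>. ennreal (h x \<omega>)) - enn2real (\<Sum>x\<in>g \<omega>. ennreal (- h x \<omega>))" for \<omega>
  proof -
    have e: "(\<Sum>x\<in>g \<omega>. ennreal (f x)) = ennreal (\<Sum>x\<in>g \<omega>. max 0 (f x))" for f :: "'a \<Rightarrow> real"
    proof -
      have "(\<Sum>x\<in>g \<omega>. ennreal (f x)) = (\<Sum>x\<in>g \<omega>. ennreal (max 0 (f x)))"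
        by (intro sum.cong refl) (simp add: max_def ennreal_neg)
      also have "\<dots> = ennreal (\<Sum>x\<in>g \<omega>. max 0 (f x))" by (rule sum_ennreal) simp
      finally show ?thesis .
    qed
    have "(\<Sum>x\<in>g \<omega>. h x \<omega>) = (\<Sum>x\<in>g \<omega>. max 0 (h x \<omega>)) - (\<Sum>x\<in>g \<omega>. max 0 (- h x \<omega>))"
      unfolding sum_subtractf[symmetric] by (intro sum.cong) auto
    then show ?thesis
      by (simp add: e sum_nonneg)
  qed
  then show ?thesis by (subst measurable_cong) measurable
qed

section \<open>Integration with respect to the Lebesgue--Poisson measure\<close>

lemma measurable_lebesgue_poisson [simp]:
  "measurable (lebesgue_poisson :: 'a::euclidean_space set measure) N = measurable fin_config_space N"
  by (rule measurable_cong_sets) simp_all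

text \<open>Integrating out one particle after the other replaces the integrals over tuples by a
  recursion on functions of configurations, which makes the symmetry in the particles automatic.\<close>

primrec layer_integral :: "nat \<Rightarrow> ('a::euclidean_space set \<Rightarrow> ennreal) \<Rightarrow> ennreal" where
  "layer_integral 0 G = G {}"
| "layer_integral (Suc n) G = layer_integral n (\<lambda>\<eta>. \<integral>\<^sup>+y. G (insert y \<eta>) \<partial>lborel)"

lemma borel_measurable_add_particle [measurable (raw)]:
  assumes [measurable]: "G \<in> borel_measurable fin_config_space"
  shows "(\<lambda>\<eta>. \<integral>\<^sup>+y. G (insert y \<eta>) \<partial>lborel :: ennreal) \<in> borel_measurable (fin_config_space :: 'a::euclidean_space set measure)"
  by measurable

lemma borel_measurable_config_flip:
  fixes h :: "'a::euclidean_space \<Rightarrow> 'a set \<Rightarrow> 'b::topological_space"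
  assumes "(\<lambda>z. h (fst z) (snd z)) \<in> borel_measurable (borel \<Otimes>\<^sub>M fin_config_space)"
  shows "(\<lambda>p. h (snd p) (fst p)) \<in> borel_measurable (fin_config_space \<Otimes>\<^sub>M lborel)"
  using measurable_compose[OF _ assms, of "\<lambda>p. (snd p, fst p)" "fin_config_space \<Otimes>\<^sub>M lborel"] by simp

lemma borel_measurable_config_nn_integral [measurable (raw)]:
  fixes h :: "'a::euclidean_space \<Rightarrow> 'a set \<Rightarrow> ennreal"
  assumes "(\<lambda>z. h (fst z) (snd z)) \<in> borel_measurable (borel \<Otimes>\<^sub>M fin_config_space)"
  shows "(\<lambda>\<eta>. \<integral>\<^sup>+x. h x \<eta> \<partial>lborel) \<in> borel_measurable fin_config_space"
  by (rule lborel.borel_measurable_nn_integral) (use borel_measurable_config_flip[OF assms] in \<open>simp add: case_prod_beta'\<close>)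

lemma borel_measurable_config_integral [measurable (raw)]:
  fixes h :: "'a::euclidean_space \<Rightarrow> 'a set \<Rightarrow> real"
  assumes "(\<lambda>z. h (fst z) (snd z)) \<in> borel_measurable (borel \<Otimes>\<^sub>M fin_config_space)"
  shows "(\<lambda>\<eta>. \<integral>x. h x \<eta> \<partial>lborel) \<in> borel_measurable fin_config_space"
  by (rule lborel.borel_measurable_lebesgue_integral) (use borel_measurable_config_flip[OF assms] in \<open>simp add: case_prod_beta'\<close>)

lemma layer_integral_cong:
  "(\<And>\<eta>. finite \<eta> \<Longrightarrow> G \<eta> = H \<eta>) \<Longrightarrow> layer_integral n G = layer_integral n H"
proof (induct n arbitrary: G H)
  case (Suc n)
  show ?case
    unfolding layer_integral.simps by (intro Suc(1) nn_integral_cong) (auto intro: Suc(2))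
qed auto

lemma layer_integral_mono:
  "(\<And>\<eta>. finite \<eta> \<Longrightarrow> G \<eta> \<le> H \<eta>) \<Longrightarrow> layer_integral n G \<le> layer_integral n H"
proof (induct n arbitrary: G H)
  case (Suc n)
  show ?case
    unfolding layer_integral.simps by (intro Suc(1) nn_integral_mono) (auto intro: Suc(2))
qed auto

lemma layer_integral_add:
  assumes "G \<in> borel_measurable fin_config_space" "H \<in> borel_measurable fin_config_space"
  shows "layer_integral n (\<lambda>\<eta>. G \<eta> + H \<eta>) = layer_integral n G + layer_integral n H"
  using assms
proof (induct n arbitrary: G H)
  case (Suc n)
  note [measurable] = Suc(2,3)
  have "layer_integral (Suc n) (\<lambda>\<eta>. G \<eta> + H \<eta>)
      = layer_integral n (\<lambda>\<eta>. (\<integral>\<^sup>+y. G (insert y \<eta>) \<partial>lborel) + (\<integral>\<^sup>+y. H (insert y \<eta>) \<partial>lborel))"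
    unfolding layer_integral.simps
  proof (rule layer_integral_cong)
    fix \<eta> :: "'a set" assume "finite \<eta>"
    then have [measurable]: "\<eta> \<in> space fin_config_space" by simp
    show "(\<integral>\<^sup>+y. G (insert y \<eta>) + H (insert y \<eta>) \<partial>lborel) = (\<integral>\<^sup>+y. G (insert y \<eta>) \<partial>lborel) + (\<integral>\<^sup>+y. H (insert y \<eta>) \<partial>lborel)"
      by (rule nn_integral_add) measurable
  qed
  also have "\<dots> = layer_integral (Suc n) G + layer_integral (Suc n) H"
    by (subst Suc(1)) simp_all
  finally show ?case .
qed auto

lemma layer_integral_cmult:
  assumes "G \<in> borel_measurable fin_config_space"
  shows "layer_integral n (\<lambda>\<eta>. c * G \<eta>) = c * layer_integral n G"
  using assms
proof (induct n arbitrary: G)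
  case (Suc n)
  note [measurable] = Suc(2)
  have "layer_integral (Suc n) (\<lambda>\<eta>. c * G \<eta>) = layer_integral n (\<lambda>\<eta>. c * (\<integral>\<^sup>+y. G (insert y \<eta>) \<partial>lborel))"
    unfolding layer_integral.simps
  proof (rule layer_integral_cong)
    fix \<eta> :: "'a set" assume "finite \<eta>"
    then have [measurable]: "\<eta> \<in> space fin_config_space" by simp
    show "(\<integral>\<^sup>+y. c * G (insert y \<eta>) \<partial>lborel) = c * (\<integral>\<^sup>+y. G (insert y \<eta>) \<partial>lborel)"
      by (rule nn_integral_cmult) measurable
  qed
  also have "\<dots> = c * layer_integral (Suc n) G"
    by (subst Suc(1)) simp_all
  finally show ?case .
qed auto

lemma measurable_image_tuple:
  assumes "finite J" "J \<subseteq> I"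
  shows "(\<lambda>x. x ` J) \<in> (\<Pi>\<^sub>M i\<in>I. (lborel :: 'a::euclidean_space measure)) \<rightarrow>\<^sub>M fin_config_space"
  using assms
proof induct
  case (insert j J)
  have "(\<lambda>x. x j) \<in> (\<Pi>\<^sub>M i\<in>I. (lborel :: 'a measure)) \<rightarrow>\<^sub>M lborel"
    using insert by (intro measurable_component_singleton) auto
  then show ?case using insert by (simp add: measurable_insert_config)
qed simp

interpretation lborel_product: product_sigma_finite "\<lambda>_::nat. lborel :: 'a::euclidean_space measure"
  by standard

lemma nn_integral_tuple:
  fixes J :: "nat set"
  assumes "finite J" "G \<in> borel_measurable fin_config_space"
  shows "(\<integral>\<^sup>+x. G (x ` J) \<partial>(\<Pi>\<^sub>M i\<in>J. (lborel :: 'a::euclidean_space measure))) = layer_integral (card J) G"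
  using assms
proof (induct J arbitrary: G)
  case empty
  then show ?case by (simp add: PiM_empty nn_integral_count_space_finite)
next
  case (insert j J)
  have img: "(x(j := y)) ` insert j J = insert y (x ` J)" for x :: "nat \<Rightarrow> 'a" and y
    using insert(2) by (auto simp: image_iff)
  have "(\<integral>\<^sup>+x. G (x ` insert j J) \<partial>(\<Pi>\<^sub>M i\<in>insert j J. (lborel :: 'a measure)))
      = (\<integral>\<^sup>+x. \<integral>\<^sup>+y. G ((x(j := y)) ` insert j J) \<partial>lborel \<partial>(\<Pi>\<^sub>M i\<in>J. (lborel :: 'a measure)))"
    by (rule lborel_product.product_nn_integral_insert)
       (use insert in \<open>auto intro!: measurable_compose[OF measurable_image_tuple] simp del: image_insert\<close>)
  also have "\<dots> = layer_integral (card (insert j J)) G"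
    unfolding img using insert(1,2) insert(3)[OF borel_measurable_add_particle[OF insert(4)]] by simp
  finally show ?case .
qed

lemma nn_integral_lebesgue_poisson:
  fixes G :: "'a::euclidean_space set \<Rightarrow> ennreal"
  assumes "G \<in> borel_measurable fin_config_space"
  shows "(\<integral>\<^sup>+\<eta>. G \<eta> \<partial>lebesgue_poisson) = (\<Sum>n. ennreal (1 / fact n) * layer_integral n G)"
proof -
  let ?P = "\<lambda>n::nat. \<Pi>\<^sub>M i\<in>{..<n}. (lborel :: 'a measure)"
  have m: "(\<lambda>x. u (x ` {..<n})) \<in> borel_measurable (?P n)"
    if "u \<in> borel_measurable fin_config_space" for u :: "'a set \<Rightarrow> ennreal" and n
    by (rule measurable_compose[OF measurable_image_tuple that]) auto
  have "(\<integral>\<^sup>+\<eta>. G \<eta> \<partial>lebesgue_poisson) = (\<Sum>n. ennreal (1 / fact n) * (\<integral>\<^sup>+x. G (x ` {..<n}) \<partial>?P n))"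
    using assms
  proof induct
    case (cong u v)
    have "(\<integral>\<^sup>+\<eta>. u \<eta> \<partial>lebesgue_poisson) = (\<integral>\<^sup>+\<eta>. v \<eta> \<partial>lebesgue_poisson)"
      using cong(3) by (intro nn_integral_cong) auto
    moreover have "(\<integral>\<^sup>+x. u (x ` {..<n}) \<partial>?P n) = (\<integral>\<^sup>+x. v (x ` {..<n}) \<partial>?P n)" for n
      using cong(3) by (intro nn_integral_cong) auto
    ultimately show ?case using cong(4) by simp
  next
    case (set A)
    then show ?case by (simp add: emeasure_lebesgue_poisson)
  next
    case (mult u c)
    then show ?case
      by (simp add: nn_integral_cmult m mult.left_commute[of _ c] )
  next
    case (add u v)
    then show ?case
      by (simp add: nn_integral_add m distrib_left suminf_add[symmetric] )
  next
    case (seq U)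
    have inc: "incseq (\<lambda>i x. U i (x ` {..<n}))" for n :: nat
      using seq(4) by (auto simp: incseq_def le_fun_def)
    have "(\<integral>\<^sup>+\<eta>. (SUP i. U i) \<eta> \<partial>lebesgue_poisson) = (SUP i. \<integral>\<^sup>+\<eta>. U i \<eta> \<partial>lebesgue_poisson)"
      unfolding SUP_apply using seq
      by (intro nn_integral_monotone_convergence_SUP) auto
    also have "\<dots> = (SUP i. \<integral>\<^sup>+n. ennreal (1 / fact n) * (\<integral>\<^sup>+x. U i (x ` {..<n}) \<partial>?P n) \<partial>count_space UNIV)"
      using seq(3) by (simp add: nn_integral_count_space_nat)
    also have "\<dots> = (\<integral>\<^sup>+n. (SUP i. ennreal (1 / fact n) * (\<integral>\<^sup>+x. U i (x ` {..<n}) \<partial>?P n)) \<partial>count_space UNIV)"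
      using seq(4) by (intro nn_integral_monotone_convergence_SUP[symmetric])
        (auto simp: incseq_def le_fun_def intro!: mult_left_mono nn_integral_mono)
    also have "\<dots> = (\<integral>\<^sup>+n. ennreal (1 / fact n) * (\<integral>\<^sup>+x. (SUP i. U i) (x ` {..<n}) \<partial>?P n) \<partial>count_space UNIV)"
      unfolding SUP_apply
      by (intro nn_integral_cong) (simp add: nn_integral_monotone_convergence_SUP[OF inc m[OF seq(1)]] SUP_mult_left_ennreal)
    finally show ?case by (simp add: nn_integral_count_space_nat)
  qed
  then show ?thesis using nn_integral_tuple[of "{..<n}" G for n] assms by simp
qed

lemma borel_measurable_removal_sum [measurable (raw)]:
  fixes f :: "'a::euclidean_space \<Rightarrow> 'a set \<Rightarrow> ennreal"
  assumes "(\<lambda>z. f (fst z) (snd z)) \<in> borel_measurable (borel \<Otimes>\<^sub>M fin_config_space)"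
  shows "(\<lambda>\<eta>. \<Sum>x\<in>\<eta>. f x (\<eta> - {x})) \<in> borel_measurable fin_config_space"
proof -
  have "(\<lambda>z. f (fst z) (snd z - {fst z})) \<in> borel_measurable (borel \<Otimes>\<^sub>M fin_config_space)"
    using measurable_compose[OF _ assms, of "\<lambda>z. (fst z, snd z - {fst z})"] by simp
  from borel_measurable_sum_config_ennreal[OF this, of "\<lambda>x. x"] show ?thesis by simp
qed

text \<open>A particle \<open>x\<close> of \<open>insert y \<eta>\<close> is either the last one or already in \<open>\<eta>\<close>; the case \<open>y \<in> \<eta>\<close>
  is negligible.  Thus the sum over the particles loses one of them at each level of the recursion.\<close>

lemma layer_integral_mecke:
  fixes h :: "'a::euclidean_space \<Rightarrow> 'a set \<Rightarrow> ennreal"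
  assumes "(\<lambda>z. h (fst z) (snd z)) \<in> borel_measurable (borel \<Otimes>\<^sub>M fin_config_space)"
  shows "layer_integral (Suc n) (\<lambda>\<eta>. \<Sum>x\<in>\<eta>. h x (\<eta> - {x}))
       = of_nat (Suc n) * layer_integral n (\<lambda>\<eta>. \<integral>\<^sup>+x. h x \<eta> \<partial>lborel)"
  using assms
proof (induct n arbitrary: h)
  case 0
  then show ?case by simp
next
  case (Suc n h)
  note [measurable] = Suc(2)
  define h' where "h' x \<xi> = (\<integral>\<^sup>+y. h x (insert y \<xi>) \<partial>lborel)" for x \<xi>
  have [measurable]: "(\<lambda>z. h' (fst z) (snd z)) \<in> borel_measurable (borel \<Otimes>\<^sub>M fin_config_space)"
  proof -
    have "(\<lambda>p. h (fst (fst p)) (insert (snd p) (snd (fst p)))) \<in> borel_measurable ((borel \<Otimes>\<^sub>M fin_config_space) \<Otimes>\<^sub>M lborel)"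
      using measurable_compose[OF _ Suc(2), of "\<lambda>p. (fst (fst p), insert (snd p) (snd (fst p)))"
          "(borel \<Otimes>\<^sub>M fin_config_space) \<Otimes>\<^sub>M lborel"] by simp
    then show ?thesis unfolding h'_def
      by (intro lborel.borel_measurable_nn_integral) (simp add: case_prod_beta')
  qed
  have step: "(\<integral>\<^sup>+y. (\<Sum>x\<in>insert y \<eta>. h x (insert y \<eta> - {x})) \<partial>lborel)
      = (\<integral>\<^sup>+y. h y \<eta> \<partial>lborel) + (\<Sum>x\<in>\<eta>. h' x (\<eta> - {x}))" if fin: "finite \<eta>" for \<eta>
  proof -
    have [measurable]: "\<eta> \<in> space fin_config_space" "\<And>x. \<eta> - {x} \<in> space fin_config_space" using fin by auto
    have [measurable]: "(\<lambda>y. h y \<xi>) \<in> borel_measurable lborel" if "finite \<xi>" for \<xi>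
      using measurable_compose[OF _ Suc(2), of "\<lambda>y. (y, \<xi>)" lborel] that by simp
    have [measurable]: "(\<lambda>y. h x (insert y (\<eta> - {x}))) \<in> borel_measurable lborel" for x
      using measurable_compose[OF _ Suc(2), of "\<lambda>y. (x, insert y (\<eta> - {x}))" lborel] by simp
    have "AE y in lborel. y \<notin> \<eta>"
      using fin by (intro AE_I'[of \<eta>]) (auto simp: finite_imp_null_set_lborel)
    then have "(\<integral>\<^sup>+y. (\<Sum>x\<in>insert y \<eta>. h x (insert y \<eta> - {x})) \<partial>lborel)
        = (\<integral>\<^sup>+y. h y \<eta> + (\<Sum>x\<in>\<eta>. h x (insert y (\<eta> - {x}))) \<partial>lborel)"
    proof (intro nn_integral_cong_AE, eventually_elim)
      fix y assume y: "y \<notin> \<eta>"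
      have "insert y \<eta> - {x} = insert y (\<eta> - {x})" if "x \<in> \<eta>" for x using that y by auto
      with fin y show "(\<Sum>x\<in>insert y \<eta>. h x (insert y \<eta> - {x})) = h y \<eta> + (\<Sum>x\<in>\<eta>. h x (insert y (\<eta> - {x})))"
        by (simp add: Diff_insert_absorb)
    qed
    also have "\<dots> = (\<integral>\<^sup>+y. h y \<eta> \<partial>lborel) + (\<Sum>x\<in>\<eta>. h' x (\<eta> - {x}))"
      unfolding h'_def using fin by (subst nn_integral_add) (auto simp: nn_integral_sum)
    finally show ?thesis .
  qed
  have swap: "(\<integral>\<^sup>+x. h' x \<xi> \<partial>lborel) = (\<integral>\<^sup>+y. \<integral>\<^sup>+x. h x (insert y \<xi>) \<partial>lborel \<partial>lborel)" if "finite \<xi>" for \<xi>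
  proof -
    have [measurable]: "\<xi> \<in> space fin_config_space" using that by simp
    have "(\<lambda>p. h (snd p) (insert (fst p) \<xi>)) \<in> borel_measurable (lborel \<Otimes>\<^sub>M lborel)"
      using measurable_compose[OF _ Suc(2), of "\<lambda>p. (snd p, insert (fst p) \<xi>)" "lborel \<Otimes>\<^sub>M lborel"] by simp
    then show ?thesis unfolding h'_def
      using lborel_pair.Fubini'[of "\<lambda>y x. h x (insert y \<xi>)"]
      by (simp add: case_prod_beta')
  qed
  have "layer_integral (Suc (Suc n)) (\<lambda>\<eta>. \<Sum>x\<in>\<eta>. h x (\<eta> - {x}))
      = layer_integral (Suc n) (\<lambda>\<eta>. (\<integral>\<^sup>+y. h y \<eta> \<partial>lborel) + (\<Sum>x\<in>\<eta>. h' x (\<eta> - {x})))"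
    unfolding layer_integral.simps(2)[of "Suc n"] by (rule layer_integral_cong) (rule step)
  also have "\<dots> = layer_integral (Suc n) (\<lambda>\<eta>. \<integral>\<^sup>+y. h y \<eta> \<partial>lborel)
      + layer_integral (Suc n) (\<lambda>\<eta>. \<Sum>x\<in>\<eta>. h' x (\<eta> - {x}))"
    by (rule layer_integral_add) measurable
  also have "layer_integral (Suc n) (\<lambda>\<eta>. \<Sum>x\<in>\<eta>. h' x (\<eta> - {x}))
      = of_nat (Suc n) * layer_integral n (\<lambda>\<eta>. \<integral>\<^sup>+x. h' x \<eta> \<partial>lborel)"
    by (rule Suc(1)) measurable
  also have "layer_integral n (\<lambda>\<eta>. \<integral>\<^sup>+x. h' x \<eta> \<partial>lborel) = layer_integral (Suc n) (\<lambda>\<eta>. \<integral>\<^sup>+y. h y \<eta> \<partial>lborel)"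
    unfolding layer_integral.simps(2)[of n] by (rule layer_integral_cong) (rule swap)
  finally show ?case by (simp add: distrib_right)
qed

text \<open>Mecke's formula: the factor \<open>n + 1\<close> from \<open>layer_integral_mecke\<close> turns \<open>1 / (n + 1)!\<close> into \<open>1 / n!\<close>.\<close>

theorem mecke_nn_integral:
  fixes h :: "'a::euclidean_space \<Rightarrow> 'a set \<Rightarrow> ennreal"
  assumes h[measurable]: "(\<lambda>z. h (fst z) (snd z)) \<in> borel_measurable (borel \<Otimes>\<^sub>M fin_config_space)"
  shows "(\<integral>\<^sup>+\<eta>. (\<Sum>x\<in>\<eta>. h x (\<eta> - {x})) \<partial>lebesgue_poisson)
       = (\<integral>\<^sup>+\<eta>. \<integral>\<^sup>+x. h x \<eta> \<partial>lborel \<partial>lebesgue_poisson)"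
proof -
  let ?S = "\<lambda>\<eta>. \<Sum>x\<in>\<eta>. h x (\<eta> - {x})" and ?I = "\<lambda>\<eta>. \<integral>\<^sup>+x. h x \<eta> \<partial>lborel"
  have "(\<integral>\<^sup>+\<eta>. ?S \<eta> \<partial>lebesgue_poisson) = (\<Sum>n. ennreal (1 / fact n) * layer_integral n ?S)"
    by (rule nn_integral_lebesgue_poisson) measurable
  also have "\<dots> = (\<Sum>n. ennreal (1 / fact (n + 1)) * layer_integral (n + 1) ?S)"
    by (subst suminf_offset[where i = 1]) simp_all
  also have "\<dots> = (\<Sum>n. ennreal (1 / fact n) * layer_integral n ?I)"
  proof (rule suminf_cong)
    fix n
    have "ennreal (1 / fact (n + 1)) * of_nat (Suc n) = ennreal (1 / fact n)"
      unfolding ennreal_of_nat_eq_real_of_nat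
      by (subst ennreal_mult[symmetric]) (auto simp: divide_simps add_pos_nonneg simp del: of_nat_Suc)
    then show "ennreal (1 / fact (n + 1)) * layer_integral (n + 1) ?S = ennreal (1 / fact n) * layer_integral n ?I"
      using layer_integral_mecke[OF h, of n] by (simp add: mult.assoc[symmetric])
  qed
  also have "\<dots> = (\<integral>\<^sup>+\<eta>. ?I \<eta> \<partial>lebesgue_poisson)"
    by (rule nn_integral_lebesgue_poisson[OF borel_measurable_config_nn_integral[OF h], symmetric])
  finally show ?thesis .
qed

text \<open>The signed version, obtained from the positive and the negative part of \<open>h\<close>; the inner integral
  exists for almost every \<open>\<eta>\<close> only.\<close>

theorem mecke_integral:
  fixes h :: "'a::euclidean_space \<Rightarrow> 'a set \<Rightarrow> real"
  assumes h[measurable]: "(\<lambda>z. h (fst z) (snd z)) \<in> borel_measurable (borel \<Otimes>\<^sub>M fin_config_space)"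
    and fin: "(\<integral>\<^sup>+\<eta>. (\<Sum>x\<in>\<eta>. ennreal \<bar>h x (\<eta> - {x})\<bar>) \<partial>lebesgue_poisson) < \<infinity>"
  shows "integrable lebesgue_poisson (\<lambda>\<eta>. \<Sum>x\<in>\<eta>. h x (\<eta> - {x}))" (is ?A)
    and "integrable lebesgue_poisson (\<lambda>\<eta>. \<integral>x. h x \<eta> \<partial>lborel)" (is ?B)
    and "AE \<eta> in lebesgue_poisson. integrable lborel (\<lambda>x. h x \<eta>)" (is ?C)
    and "(\<integral>\<eta>. (\<Sum>x\<in>\<eta>. h x (\<eta> - {x})) \<partial>lebesgue_poisson) = (\<integral>\<eta>. (\<integral>x. h x \<eta> \<partial>lborel) \<partial>lebesgue_poisson)" (is ?D)
proof -
  let ?L = "lebesgue_poisson :: 'a set measure"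
  define P where "P f \<eta> = (\<integral>\<^sup>+x. ennreal (f x \<eta>) \<partial>lborel)" for f :: "'a \<Rightarrow> 'a set \<Rightarrow> real" and \<eta>
  define S where "S f \<eta> = (\<Sum>x\<in>\<eta>. max 0 (f x (\<eta> - {x})))" for f :: "'a \<Rightarrow> 'a set \<Rightarrow> real" and \<eta>
  have sec: "(\<lambda>x. h x \<eta>) \<in> borel_measurable lborel" if "\<eta> \<in> space ?L" for \<eta>
    using measurable_compose[OF _ h, of "\<lambda>y. (y, \<eta>)" lborel] that by simp
  have [measurable]: "(\<lambda>\<eta>. \<integral>x. h x \<eta> \<partial>lborel) \<in> borel_measurable ?L"
    using borel_measurable_config_integral[OF h] by simp
  have part: "(\<integral>\<^sup>+\<eta>. P f \<eta> \<partial>?L) < \<infinity>" "integrable ?L (\<lambda>\<eta>. enn2real (P f \<eta>))"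
      "integrable ?L (S f)" "integral\<^sup>L ?L (S f) = (\<integral>\<eta>. enn2real (P f \<eta>) \<partial>?L)"
      "AE \<eta> in ?L. P f \<eta> < \<infinity>"
    if f[measurable]: "(\<lambda>z. f (fst z) (snd z)) \<in> borel_measurable (borel \<Otimes>\<^sub>M fin_config_space)"
      and le: "\<And>x \<eta>. f x \<eta> \<le> \<bar>h x \<eta>\<bar>" for f :: "'a \<Rightarrow> 'a set \<Rightarrow> real"
  proof -
    have Pm[measurable]: "P f \<in> borel_measurable ?L"
      unfolding P_def using borel_measurable_config_nn_integral[of "\<lambda>x \<eta>. ennreal (f x \<eta>)"] by simp
    have e: "ennreal (S f \<eta>) = (\<Sum>x\<in>\<eta>. ennreal (f x (\<eta> - {x})))" for \<eta>
    proof -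
      have "ennreal (S f \<eta>) = (\<Sum>x\<in>\<eta>. ennreal (max 0 (f x (\<eta> - {x}))))"
        unfolding S_def by (rule sum_ennreal[symmetric]) simp
      also have "\<dots> = (\<Sum>x\<in>\<eta>. ennreal (f x (\<eta> - {x})))"
        by (intro sum.cong refl) (simp add: max_def ennreal_neg)
      finally show ?thesis .
    qed
    have Sm[measurable]: "S f \<in> borel_measurable ?L"
    proof -
      have "(\<lambda>\<eta>. enn2real (\<Sum>x\<in>\<eta>. ennreal (f x (\<eta> - {x})))) \<in> borel_measurable fin_config_space"
        by measurable
      then have "(\<lambda>\<eta>. enn2real (ennreal (S f \<eta>))) \<in> borel_measurable fin_config_space" unfolding e .
      moreover have "S f \<eta> \<ge> 0" for \<eta> by (auto simp: S_def intro!: sum_nonneg)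
      ultimately show ?thesis by simp
    qed
    have S0: "S f \<eta> \<ge> 0" for \<eta> by (auto simp: S_def intro!: sum_nonneg)
    have eq: "(\<integral>\<^sup>+\<eta>. ennreal (S f \<eta>) \<partial>?L) = (\<integral>\<^sup>+\<eta>. P f \<eta> \<partial>?L)"
      unfolding e P_def by (rule mecke_nn_integral) measurable
    have "(\<integral>\<^sup>+\<eta>. ennreal (S f \<eta>) \<partial>?L) \<le> (\<integral>\<^sup>+\<eta>. (\<Sum>x\<in>\<eta>. ennreal \<bar>h x (\<eta> - {x})\<bar>) \<partial>?L)"
      unfolding e by (intro nn_integral_mono sum_mono ennreal_leI le)
    from this fin have "(\<integral>\<^sup>+\<eta>. ennreal (S f \<eta>) \<partial>?L) < \<infinity>" by (rule order.strict_trans1)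
    then show fP: "(\<integral>\<^sup>+\<eta>. P f \<eta> \<partial>?L) < \<infinity>" unfolding eq .
    then show AE: "AE \<eta> in ?L. P f \<eta> < \<infinity>"
      using nn_integral_PInf_AE[OF Pm] by (auto simp: less_top)
    have eq2: "(\<integral>\<^sup>+\<eta>. ennreal (enn2real (P f \<eta>)) \<partial>?L) = (\<integral>\<^sup>+\<eta>. P f \<eta> \<partial>?L)"
      using AE by (intro nn_integral_cong_AE) (auto elim!: eventually_mono)
    show "integrable ?L (\<lambda>\<eta>. enn2real (P f \<eta>))"
      by (rule integrableI_nonneg) (use fP eq2 in auto)
    show "integrable ?L (S f)"
      by (rule integrableI_nonneg) (use fP eq S0 in auto)
    show "integral\<^sup>L ?L (S f) = (\<integral>\<eta>. enn2real (P f \<eta>) \<partial>?L)"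
      using S0 eq eq2 by (simp add: integral_eq_nn_integral)
  qed
  have m: "(\<lambda>z. - h (fst z) (snd z)) \<in> borel_measurable (borel \<Otimes>\<^sub>M fin_config_space)" by measurable
  note p1 = part[of h, OF h abs_ge_self] and p2 = part[of "\<lambda>x \<eta>. - h x \<eta>", OF m abs_ge_minus_self]
  have Seq: "(\<Sum>x\<in>\<eta>. h x (\<eta> - {x})) = S h \<eta> - S (\<lambda>x \<eta>. - h x \<eta>) \<eta>" for \<eta>
    unfolding S_def sum_subtractf[symmetric] by (intro sum.cong) auto
  show ?A unfolding Seq using p1 p2 by (intro Bochner_Integration.integrable_diff)
  have AE2: "AE \<eta> in ?L. integrable lborel (\<lambda>x. h x \<eta>) \<and>
      (\<integral>x. h x \<eta> \<partial>lborel) = enn2real (P h \<eta>) - enn2real (P (\<lambda>x \<eta>. - h x \<eta>) \<eta>)"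
    using p1(5) p2(5) AE_space
  proof eventually_elim
    case (elim \<eta>)
    have "integrable lborel (\<lambda>x. h x \<eta>)"
      unfolding real_integrable_def using elim sec by (auto simp: P_def)
    then show ?case by (simp add: real_lebesgue_integral_def P_def)
  qed
  then show ?C by eventually_elim simp
  have "integrable ?L (\<lambda>\<eta>. enn2real (P h \<eta>) - enn2real (P (\<lambda>x \<eta>. - h x \<eta>) \<eta>))"
    using p1 p2 by (intro Bochner_Integration.integrable_diff)
  then show ?B
    by (rule Bochner_Integration.integrable_cong_AE_imp) (use AE2 in auto)
  have "(\<integral>\<eta>. (\<integral>x. h x \<eta> \<partial>lborel) \<partial>?L) = (\<integral>\<eta>. enn2real (P h \<eta>) - enn2real (P (\<lambda>x \<eta>. - h x \<eta>) \<eta>) \<partial>?L)"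
    by (rule integral_cong_AE) (use AE2 borel_measurable_integrable p1 p2 in auto)
  also have "\<dots> = (\<integral>\<eta>. S h \<eta> - S (\<lambda>x \<eta>. - h x \<eta>) \<eta> \<partial>?L)"
    using p1 p2 by simp
  finally show ?D unfolding Seq by simp
qed

section \<open>Locally supported functions are integrable\<close>

lemma pred_config_subset [measurable]:
  assumes [measurable]: "\<Lambda> \<in> sets borel"
  shows "Measurable.pred (fin_config_space :: 'a::euclidean_space set measure) (\<lambda>\<eta>. \<eta> \<subseteq> \<Lambda>)"
proof -
  have "Measurable.pred (fin_config_space :: 'a set measure) (\<lambda>\<eta>. real (card (\<eta> \<inter> \<Lambda>)) = real (card (\<eta> \<inter> UNIV)))"
    using borel_measurable_eq[OF measurable_card_Int[OF assms] measurable_card_Int[of UNIV]]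
    by (simp add: pred_def)
  also have "?this \<longleftrightarrow> ?thesis"
  proof (rule measurable_cong)
    fix \<eta> :: "'a set" assume "\<eta> \<in> space fin_config_space"
    then have "finite \<eta>" by (rule finite_config_space)
    then show "(real (card (\<eta> \<inter> \<Lambda>)) = real (card (\<eta> \<inter> UNIV))) = (\<eta> \<subseteq> \<Lambda>)"
      using card_subset_eq[of \<eta> "\<eta> \<inter> \<Lambda>"] by (auto simp: Int_absorb2)
  qed
  finally show ?thesis .
qed

text \<open>Adding a particle in \<open>\<Lambda>\<close> costs a factor \<open>c\<close> times the volume of \<open>\<Lambda>\<close>, whence the integral of \<open>c ^ |\<eta>|\<close> over
  the configurations in \<open>\<Lambda>\<close> is at most the exponential of \<open>c\<close> times the volume.\<close>

lemma layer_integral_power_le: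
  fixes \<Lambda> :: "'a::euclidean_space set" and c :: real
  assumes [measurable]: "\<Lambda> \<in> sets borel" and c: "c \<ge> 1" and V: "emeasure lborel \<Lambda> \<le> ennreal v" and v: "v \<ge> 0"
  shows "layer_integral n (\<lambda>\<eta>. ennreal (c ^ card \<eta>) * indicator {\<eta>. \<eta> \<subseteq> \<Lambda>} \<eta>) \<le> ennreal ((c * v) ^ n)"
proof (induct n)
  case (Suc n)
  have "(\<integral>\<^sup>+y. ennreal (c ^ card (insert y \<eta>)) * indicator {\<eta>. \<eta> \<subseteq> \<Lambda>} (insert y \<eta>) \<partial>lborel)
      \<le> ennreal (c * v) * (ennreal (c ^ card \<eta>) * indicator {\<eta>. \<eta> \<subseteq> \<Lambda>} \<eta>)" if "finite \<eta>" for \<eta>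
  proof -
    have "c ^ card (insert y \<eta>) \<le> c * c ^ card \<eta>" for y
      unfolding power_Suc[symmetric] using c that by (intro power_increasing) (auto simp: card_insert_if)
    then have "(\<integral>\<^sup>+y. ennreal (c ^ card (insert y \<eta>)) * indicator {\<eta>. \<eta> \<subseteq> \<Lambda>} (insert y \<eta>) \<partial>lborel)
        \<le> (\<integral>\<^sup>+y. ennreal (c * c ^ card \<eta>) * indicator {\<eta>. \<eta> \<subseteq> \<Lambda>} \<eta> * indicator \<Lambda> y \<partial>lborel)"
      by (intro nn_integral_mono) (auto simp: indicator_def intro!: ennreal_leI)
    also have "\<dots> = ennreal (c * c ^ card \<eta>) * indicator {\<eta>. \<eta> \<subseteq> \<Lambda>} \<eta> * emeasure lborel \<Lambda>"
      by (simp add: nn_integral_cmult)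
    also have "\<dots> \<le> ennreal (c * c ^ card \<eta>) * indicator {\<eta>. \<eta> \<subseteq> \<Lambda>} \<eta> * ennreal v"
      by (intro mult_left_mono V) auto
    also have "\<dots> = ennreal (c * v) * (ennreal (c ^ card \<eta>) * indicator {\<eta>. \<eta> \<subseteq> \<Lambda>} \<eta>)"
      using c v by (simp add: ennreal_mult ac_simps)
    finally show ?thesis .
  qed
  then have "layer_integral (Suc n) (\<lambda>\<eta>. ennreal (c ^ card \<eta>) * indicator {\<eta>. \<eta> \<subseteq> \<Lambda>} \<eta>)
      \<le> layer_integral n (\<lambda>\<eta>. ennreal (c * v) * (ennreal (c ^ card \<eta>) * indicator {\<eta>. \<eta> \<subseteq> \<Lambda>} \<eta>))"
    unfolding layer_integral.simps by (rule layer_integral_mono)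
  also have "\<dots> = ennreal (c * v) * layer_integral n (\<lambda>\<eta>. ennreal (c ^ card \<eta>) * indicator {\<eta>. \<eta> \<subseteq> \<Lambda>} \<eta>)"
    by (rule layer_integral_cmult) measurable
  also have "\<dots> \<le> ennreal (c * v) * ennreal ((c * v) ^ n)"
    by (intro mult_left_mono Suc) auto
  also have "\<dots> = ennreal ((c * v) ^ Suc n)" using c v by (simp add: ennreal_mult)
  finally show ?case .
qed simp

lemma nn_integral_power_local_finite:
  fixes \<Lambda> :: "'a::euclidean_space set" and c :: real
  assumes [measurable]: "\<Lambda> \<in> sets borel" and "bounded \<Lambda>" and c: "c \<ge> 1"
  shows "(\<integral>\<^sup>+\<eta>. ennreal (c ^ card \<eta>) * indicator {\<eta>. \<eta> \<subseteq> \<Lambda>} \<eta> \<partial>lebesgue_poisson) < \<infinity>"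
proof -
  define v where "v = measure lborel \<Lambda>"
  have v: "v \<ge> 0" "emeasure lborel \<Lambda> \<le> ennreal v"
    using emeasure_bounded_finite[OF \<open>bounded \<Lambda>\<close>] by (auto simp: v_def emeasure_eq_ennreal_measure less_top)
  have "(\<integral>\<^sup>+\<eta>. ennreal (c ^ card \<eta>) * indicator {\<eta>. \<eta> \<subseteq> \<Lambda>} \<eta> \<partial>lebesgue_poisson)
      = (\<Sum>n. ennreal (1 / fact n) * layer_integral n (\<lambda>\<eta>. ennreal (c ^ card \<eta>) * indicator {\<eta>. \<eta> \<subseteq> \<Lambda>} \<eta>))"
    by (rule nn_integral_lebesgue_poisson) measurable
  also have "\<dots> \<le> (\<Sum>n. ennreal ((c * v) ^ n /\<^sub>R fact n))"
  proof (intro suminf_le allI)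
    fix n
    have "ennreal (1 / fact n) * layer_integral n (\<lambda>\<eta>. ennreal (c ^ card \<eta>) * indicator {\<eta>. \<eta> \<subseteq> \<Lambda>} \<eta>)
        \<le> ennreal (1 / fact n) * ennreal ((c * v) ^ n)"
      by (intro mult_left_mono layer_integral_power_le assms v) auto
    also have "\<dots> = ennreal ((c * v) ^ n /\<^sub>R fact n)"
      using c v by (simp add: ennreal_mult[symmetric] divide_inverse mult.commute)
    finally show "ennreal (1 / fact n) * layer_integral n (\<lambda>\<eta>. ennreal (c ^ card \<eta>) * indicator {\<eta>. \<eta> \<subseteq> \<Lambda>} \<eta>)
        \<le> ennreal ((c * v) ^ n /\<^sub>R fact n)" .
  qed auto
  also have "\<dots> = ennreal (exp (c * v))"
    using c v by (intro suminf_ennreal_eq exp_converges) auto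
  finally show ?thesis by (simp add: order.strict_trans1)
qed

lemma integrable_local_bounded:
  fixes f :: "'a::euclidean_space set \<Rightarrow> real"
  assumes [measurable]: "f \<in> borel_measurable fin_config_space"
    and \<Lambda>: "\<Lambda> \<in> sets borel" "bounded \<Lambda>"
    and le: "\<And>\<eta>. finite \<eta> \<Longrightarrow> \<bar>f \<eta>\<bar> \<le> C * c ^ card \<eta>"
    and supp: "\<And>\<eta>. finite \<eta> \<Longrightarrow> \<not> \<eta> \<subseteq> \<Lambda> \<Longrightarrow> f \<eta> = 0" and c: "c \<ge> 1"
  shows "integrable lebesgue_poisson f"
proof (rule integrableI_bounded)
  show "f \<in> borel_measurable lebesgue_poisson" by simp
  have [measurable]: "\<Lambda> \<in> sets borel" by fact
  have C: "C \<ge> 0" using le[of "{}"] by simp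
  have "(\<integral>\<^sup>+\<eta>. ennreal (norm (f \<eta>)) \<partial>lebesgue_poisson)
      \<le> (\<integral>\<^sup>+\<eta>. ennreal C * (ennreal (c ^ card \<eta>) * indicator {\<eta>. \<eta> \<subseteq> \<Lambda>} \<eta>) \<partial>lebesgue_poisson)"
    using le supp c C
    by (intro nn_integral_mono) (auto simp: indicator_def ennreal_mult[symmetric] intro!: ennreal_leI)
  also have "\<dots> = ennreal C * (\<integral>\<^sup>+\<eta>. ennreal (c ^ card \<eta>) * indicator {\<eta>. \<eta> \<subseteq> \<Lambda>} \<eta> \<partial>lebesgue_poisson)"
    by (rule nn_integral_cmult) (simp , measurable)
  also have "\<dots> < \<infinity>"
    using nn_integral_power_local_finite[OF \<Lambda> c] by (simp add: ennreal_mult_less_top)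
  finally show "(\<integral>\<^sup>+\<eta>. ennreal (norm (f \<eta>)) \<partial>lebesgue_poisson) < \<infinity>" .
qed

section \<open>The Borel sets of the configuration space are generated by void events\<close>

lemma bounded_subset_cball0:
  fixes B :: "'a::real_normed_vector set"
  assumes "bounded B" obtains R where "B \<subseteq> cball 0 R"
  using assms by (meson bounded_subset_ballD ball_subset_cball subset_trans)

lemma config_finite_Int:
  assumes "\<gamma> \<in> configs" "bounded B"
  shows "finite (\<gamma> \<inter> B)"
proof -
  obtain R where "B \<subseteq> cball 0 R" using bounded_subset_cball0[OF assms(2)] .
  then have "\<gamma> \<inter> B \<subseteq> \<gamma> \<inter> cball 0 R" by auto
  moreover have "finite (\<gamma> \<inter> cball 0 R)" using assms(1) by (simp add: configs_def)
  ultimately show ?thesis by (rule finite_subset)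
qed

text \<open>Void events are stable under intersection, and their probabilities are accessible to
  inclusion--exclusion.  They generate the Borel sets because a configuration has no multiple points.\<close>

definition void_event :: "'a::euclidean_space set \<Rightarrow> 'a set set" where
  "void_event B = {\<gamma> \<in> configs. \<gamma> \<inter> B = {}}"

definition void_events :: "'a::euclidean_space set set set" where
  "void_events = void_event ` {B. B \<in> sets borel \<and> bounded B}"

lemma void_events_closed: "void_events \<subseteq> Pow configs"
  by (auto simp: void_events_def void_event_def)

lemma Int_stable_void_events: "Int_stable void_events"
  unfolding Int_stable_def void_events_def
proof safe
  fix A B :: "'a set" assume "A \<in> sets borel" "bounded A" "B \<in> sets borel" "bounded B"
  moreover have "void_event A \<inter> void_event B = void_event (A \<union> B)"
    by (auto simp: void_event_def)
  ultimately show "void_event A \<inter> void_event B \<in> void_event ` {B. B \<in> sets borel \<and> bounded B}"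
    by auto
qed

lemma void_event_in_sigma:
  "B \<in> sets borel \<Longrightarrow> bounded B \<Longrightarrow> void_event B \<in> sigma_sets configs void_events"
  by (rule sigma_sets.Basic) (auto simp: void_events_def)

text \<open>Two distinct points are separated by two disjoint balls of a countable family.\<close>

lemma one_point_event_in_sigma:
  fixes B :: "'a::euclidean_space set"
  assumes B: "B \<in> sets borel" "bounded B"
  shows "{\<gamma> \<in> configs. card (\<gamma> \<inter> B) = 1} \<in> sigma_sets configs void_events"
proof -
  interpret sigma_algebra configs "sigma_sets configs void_events :: 'a set set set"
    by (rule sigma_algebra_sigma_sets[OF void_events_closed])
  obtain D :: "'a set" where D: "countable D" "\<And>X. open X \<Longrightarrow> X \<noteq> {} \<Longrightarrow> \<exists>d \<in> D. d \<in> X"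
    using countable_dense_setE by blast
  define I where "I = {(p, q, n). p \<in> D \<and> q \<in> D \<and> ball p (1 / real (Suc n)) \<inter> ball q (1 / real (Suc n)) = {}}"
  define H where "H p n = configs - void_event (B \<inter> ball p (1 / real (Suc n)))" for p and n :: nat
  have Hm: "H p n \<in> sigma_sets configs void_events" for p n
    unfolding H_def by (intro Diff top void_event_in_sigma) (use B in \<open>auto intro: bounded_subset\<close>)
  have cI: "countable I"
    by (rule countable_subset[of _ "D \<times> D \<times> UNIV"]) (use D(1) in \<open>auto simp: I_def\<close>)
  have two: "(\<exists>x\<in>\<gamma> \<inter> B. \<exists>y\<in>\<gamma> \<inter> B. x \<noteq> y) \<longleftrightarrow> (\<exists>(p, q, n)\<in>I. \<gamma> \<in> H p n \<inter> H q n)" if g: "\<gamma> \<in> configs" for \<gamma>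
  proof
    assume "\<exists>x\<in>\<gamma> \<inter> B. \<exists>y\<in>\<gamma> \<inter> B. x \<noteq> y"
    then obtain x y where xy: "x \<in> \<gamma> \<inter> B" "y \<in> \<gamma> \<inter> B" "x \<noteq> y" by auto
    obtain n :: nat where n: "1 / real (Suc n) < dist x y / 4"
      using nat_approx_posE[of "dist x y / 4"] xy(3) by auto
    define r where "r = 1 / real (Suc n)"
    have r: "r > 0" by (simp add: r_def)
    obtain p where p: "p \<in> D" "p \<in> ball x r" using D(2)[of "ball x r"] r by auto
    obtain q where q: "q \<in> D" "q \<in> ball y r" using D(2)[of "ball y r"] r by auto
    have "ball p r \<inter> ball q r = {}"
    proof (rule ccontr)
      assume "ball p r \<inter> ball q r \<noteq> {}"
      then obtain z where z: "dist p z < r" "dist q z < r" by auto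
      have "dist x y \<le> dist x p + dist p z + dist q z + dist y q"
        using dist_triangle[of x y p] dist_triangle[of p y z] dist_triangle[of z y q]
        by (simp add: dist_commute)
      then show False using z p q n by (simp add: r_def dist_commute)
    qed
    moreover have "\<gamma> \<in> H p n" "\<gamma> \<in> H q n"
      using p q xy g by (auto simp: H_def void_event_def r_def dist_commute)
    ultimately show "\<exists>(p, q, n)\<in>I. \<gamma> \<in> H p n \<inter> H q n"
      using p q by (intro bexI[of _ "(p, q, n)"]) (auto simp: I_def r_def)
  next
    assume "\<exists>(p, q, n)\<in>I. \<gamma> \<in> H p n \<inter> H q n"
    then obtain p q n where i: "ball p (1 / real (Suc n)) \<inter> ball q (1 / real (Suc n)) = {}"
      and h: "\<gamma> \<in> H p n" "\<gamma> \<in> H q n" by (auto simp: I_def)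
    from h obtain x y where "x \<in> \<gamma> \<inter> B" "x \<in> ball p (1 / real (Suc n))"
      "y \<in> \<gamma> \<inter> B" "y \<in> ball q (1 / real (Suc n))" unfolding H_def void_event_def by blast
    moreover from this i have "x \<noteq> y" by blast
    ultimately show "\<exists>x\<in>\<gamma> \<inter> B. \<exists>y\<in>\<gamma> \<inter> B. x \<noteq> y" by blast
  qed
  have "{\<gamma> \<in> configs. card (\<gamma> \<inter> B) = 1} =
      (configs - void_event B) - (\<Union>i\<in>I. case i of (p, q, n) \<Rightarrow> H p n \<inter> H q n)"
  proof (intro set_eqI iffI)
    fix \<gamma> assume "\<gamma> \<in> {\<gamma> \<in> configs. card (\<gamma> \<inter> B) = 1}"
    then have g: "\<gamma> \<in> configs" and "card (\<gamma> \<inter> B) = 1" by auto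
    then obtain x where "\<gamma> \<inter> B = {x}" by (auto simp: card_1_singleton_iff)
    then have "\<not> (\<exists>(p, q, n)\<in>I. \<gamma> \<in> H p n \<inter> H q n)" and "\<gamma> \<notin> void_event B"
      unfolding two[OF g, symmetric] void_event_def by simp_all
    then show "\<gamma> \<in> (configs - void_event B) - (\<Union>i\<in>I. case i of (p, q, n) \<Rightarrow> H p n \<inter> H q n)"
      using g by blast
  next
    fix \<gamma> assume *: "\<gamma> \<in> (configs - void_event B) - (\<Union>i\<in>I. case i of (p, q, n) \<Rightarrow> H p n \<inter> H q n)"
    then have g: "\<gamma> \<in> configs" by auto
    have "\<not> (\<exists>(p, q, n)\<in>I. \<gamma> \<in> H p n \<inter> H q n)" using * by auto
    then have "\<forall>x\<in>\<gamma> \<inter> B. \<forall>y\<in>\<gamma> \<inter> B. x = y" using two[OF g] by blast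
    moreover have "\<gamma> \<inter> B \<noteq> {}" using * g by (auto simp: void_event_def)
    ultimately obtain x where "\<gamma> \<inter> B = {x}" by blast
    then show "\<gamma> \<in> {\<gamma> \<in> configs. card (\<gamma> \<inter> B) = 1}" using g by simp
  qed
  also have "\<dots> \<in> sigma_sets configs void_events"
    using B cI Hm by (intro Diff top void_event_in_sigma countable_UN') auto
  finally show ?thesis .
qed

text \<open>\<open>ball_pattern R Q r\<close> prescribes where the points in a large ball lie up to \<open>r\<close>.  With \<open>Q\<close>
  from a countable dense set and \<open>r\<close> of the form \<open>1/(n+1)\<close>, countably many of these events suffice to exhaust every open
  set (\<open>open_config_in_sigma\<close>).\<close>

definition ball_pattern :: "nat \<Rightarrow> 'a::euclidean_space set \<Rightarrow> real \<Rightarrow> 'a set set" where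
  "ball_pattern R Q r = {\<gamma> \<in> configs. \<gamma> \<inter> (cball 0 (real R) - (\<Union>q\<in>Q. ball q r)) = {} \<and>
     (\<forall>q\<in>Q. card (\<gamma> \<inter> (cball 0 (real R) \<inter> ball q r)) = 1)}"

lemma ball_pattern_in_sigma:
  assumes "finite Q"
  shows "ball_pattern R Q r \<in> sigma_sets configs void_events"
proof -
  interpret sigma_algebra configs "sigma_sets configs void_events :: 'a set set set"
    by (rule sigma_algebra_sigma_sets[OF void_events_closed])
  have eq: "ball_pattern R Q r = void_event (cball 0 (real R) - (\<Union>q\<in>Q. ball q r)) \<inter>
      {\<gamma> \<in> configs. \<forall>q\<in>Q. card (\<gamma> \<inter> (cball 0 (real R) \<inter> ball q r)) = 1}"
    by (auto simp: ball_pattern_def void_event_def)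
  show ?thesis unfolding eq
    by (intro Int void_event_in_sigma sets_Collect_finite_All one_point_event_in_sigma assms
        sets.Diff sets.Int borel_closed borel_open open_UN ballI closed_cball open_ball)
      (auto intro: bounded_subset[OF bounded_cball])
qed

text \<open>A neighbourhood of a configuration contains every configuration that matches it point by
  point, up to a small error, within a large ball.\<close>

definition matched :: "real \<Rightarrow> real \<Rightarrow> 'a::euclidean_space set \<Rightarrow> 'a set \<Rightarrow> bool" where
  "matched R e \<gamma> \<gamma>' \<longleftrightarrow> (\<exists>\<phi>. bij_betw \<phi> (\<gamma> \<inter> cball 0 R) (\<gamma>' \<inter> cball 0 R) \<and> (\<forall>x\<in>\<gamma> \<inter> cball 0 R. dist (\<phi> x) x < e))"

lemma matched_mono: "matched R e \<gamma> \<gamma>' \<Longrightarrow> e \<le> e' \<Longrightarrow> matched R e' \<gamma> \<gamma>'"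
  unfolding matched_def by (meson order.strict_trans2)

lemma config_topology_subset: "openin config_topology U \<Longrightarrow> U \<subseteq> configs"
  unfolding config_topology_def openin_topology_generated_by_iff
  by (induct rule: generate_topology_on.induct) auto

lemma open_config_matched:
  fixes U :: "'a::euclidean_space set set"
  assumes "openin config_topology U" "\<gamma>0 \<in> U"
  shows "\<exists>R0. \<forall>R\<ge>R0. \<exists>e>0. \<forall>\<gamma>\<in>configs. matched R e \<gamma>0 \<gamma> \<longrightarrow> \<gamma> \<in> U"
  using assms unfolding config_topology_def openin_topology_generated_by_iff
proof (induct arbitrary: rule: generate_topology_on.induct)
  case Empty
  then show ?case by simp
next
  case (Int a b)
  let ?P = "\<lambda>U R. \<exists>e>0. \<forall>\<gamma>\<in>configs. matched R e \<gamma>0 \<gamma> \<longrightarrow> \<gamma> \<in> U"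
  obtain R1 where R1: "\<forall>R\<ge>R1. ?P a R" using Int(2,5) by blast
  obtain R2 where R2: "\<forall>R\<ge>R2. ?P b R" using Int(4,5) by blast
  show ?case
  proof (rule exI[of _ "max R1 R2"], intro allI impI)
    fix R assume "R \<ge> max R1 R2"
    then have "?P a R" "?P b R" using R1 R2 by simp_all
    then obtain e1 e2 where e: "e1 > 0" "e2 > 0"
      and a: "\<And>\<gamma>. \<gamma> \<in> configs \<Longrightarrow> matched R e1 \<gamma>0 \<gamma> \<Longrightarrow> \<gamma> \<in> a"
      and b: "\<And>\<gamma>. \<gamma> \<in> configs \<Longrightarrow> matched R e2 \<gamma>0 \<gamma> \<Longrightarrow> \<gamma> \<in> b" by auto
    show "?P (a \<inter> b) R"
    proof (intro exI[of _ "min e1 e2"] conjI ballI impI IntI)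
      fix \<gamma> assume g: "\<gamma> \<in> configs" "matched R (min e1 e2) \<gamma>0 \<gamma>"
      show "\<gamma> \<in> a" by (rule a[OF g(1) matched_mono[OF g(2)]]) simp
      show "\<gamma> \<in> b" by (rule b[OF g(1) matched_mono[OF g(2)]]) simp
    qed (use e in simp)
  qed
next
  case (UN K)
  then obtain k where k: "k \<in> K" "\<gamma>0 \<in> k" by auto
  from UN(2)[OF this] obtain R0 where
    R0: "\<forall>R\<ge>R0. \<exists>e>0. \<forall>\<gamma>\<in>configs. matched R e \<gamma>0 \<gamma> \<longrightarrow> \<gamma> \<in> k" by (elim exE)
  show ?case
  proof (rule exI[of _ R0], intro allI impI)
    fix R assume "R \<ge> R0"
    with R0 have "\<exists>e>0. \<forall>\<gamma>\<in>configs. matched R e \<gamma>0 \<gamma> \<longrightarrow> \<gamma> \<in> k" by simp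
    then show "\<exists>e>0. \<forall>\<gamma>\<in>configs. matched R e \<gamma>0 \<gamma> \<longrightarrow> \<gamma> \<in> \<Union> K" using k(1) by blast
  qed
next
  case (Basis s)
  then obtain f :: "'a \<Rightarrow> real" and V where s: "s = {\<gamma> \<in> configs. (\<Sum>\<^sub>\<infinity>x\<in>\<gamma>. f x) \<in> V}"
    and f: "continuous_on UNIV f" "compact (closure {x. f x \<noteq> 0})" "open V" by blast
  have "bounded {x. f x \<noteq> 0}" using f(2) bounded_subset[OF compact_imp_bounded closure_subset] by blast
  then obtain R0 where "{x. f x \<noteq> 0} \<subseteq> cball 0 R0" by (rule bounded_subset_cball0)
  then have R0: "\<And>x. f x \<noteq> 0 \<Longrightarrow> x \<in> cball 0 R0" by auto
  have loc: "(\<Sum>\<^sub>\<infinity>x\<in>\<gamma>. f x) = (\<Sum>x\<in>\<gamma> \<inter> cball 0 R. f x)" if "\<gamma> \<in> configs" "R \<ge> R0" for \<gamma> R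
  proof -
    have "(\<Sum>\<^sub>\<infinity>x\<in>\<gamma>. f x) = (\<Sum>\<^sub>\<infinity>x\<in>\<gamma> \<inter> cball 0 R. f x)"
      by (rule infsum_cong_neutral) (use R0 that(2) in force)+
    then show ?thesis using config_finite_Int[OF that(1), of "cball 0 R"] by simp
  qed
  show ?case
  proof (rule exI[of _ R0], intro allI impI)
    fix R assume R: "R \<ge> R0"
    let ?A = "\<gamma>0 \<inter> cball 0 R"
    have g0: "\<gamma>0 \<in> configs" using Basis s by auto
    have fin: "finite ?A" by (rule config_finite_Int[OF g0]) simp
    have "(\<Sum>x\<in>?A. f x) \<in> V" using Basis s loc[OF g0 R] by auto
    then obtain d where d: "d > 0" "\<And>v. dist v (\<Sum>x\<in>?A. f x) < d \<Longrightarrow> v \<in> V"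
      using f(3) by (auto simp: open_dist)
    define d' where "d' = d / (real (card ?A) + 1)"
    have d': "d' > 0" using d by (simp add: d'_def add_nonneg_pos)
    have "eventually (\<lambda>e. \<forall>x\<in>?A. \<forall>y. dist y x < e \<longrightarrow> dist (f y) (f x) < d') (at_right 0)"
    proof (intro eventually_ball_finite fin ballI)
      fix x assume "x \<in> ?A"
      obtain e where e: "e > 0" "\<And>y. dist y x < e \<Longrightarrow> dist (f y) (f x) < d'"
        using f(1) d' unfolding continuous_on_iff by blast
      show "eventually (\<lambda>e. \<forall>y. dist y x < e \<longrightarrow> dist (f y) (f x) < d') (at_right 0)"
        unfolding eventually_at_right_field using e by (intro exI[of _ e]) auto
    qed
    moreover have "eventually (\<lambda>e::real. e > 0) (at_right 0)" by (rule eventually_at_right_less)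
    ultimately have "eventually (\<lambda>e. e > 0 \<and> (\<forall>x\<in>?A. \<forall>y. dist y x < e \<longrightarrow> dist (f y) (f x) < d')) (at_right 0)"
      by eventually_elim auto
    then obtain e where e: "e > 0" "\<And>x y. x \<in> ?A \<Longrightarrow> dist y x < e \<Longrightarrow> dist (f y) (f x) < d'"
      using eventually_happens'[OF trivial_limit_at_right_real] by blast
    show "\<exists>e>0. \<forall>\<gamma>\<in>configs. matched R e \<gamma>0 \<gamma> \<longrightarrow> \<gamma> \<in> s"
    proof (intro exI[of _ e] conjI ballI impI e)
      fix \<gamma> assume g: "\<gamma> \<in> configs" and "matched R e \<gamma>0 \<gamma>"
      then obtain \<phi> where \<phi>: "bij_betw \<phi> ?A (\<gamma> \<inter> cball 0 R)" "\<And>x. x \<in> ?A \<Longrightarrow> dist (\<phi> x) x < e"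
        unfolding matched_def by blast
      have "(\<Sum>y\<in>\<gamma> \<inter> cball 0 R. f y) = (\<Sum>x\<in>?A. f (\<phi> x))"
        using sum.reindex_bij_betw[OF \<phi>(1), of f] by simp
      then have "dist (\<Sum>y\<in>\<gamma> \<inter> cball 0 R. f y) (\<Sum>x\<in>?A. f x) = \<bar>\<Sum>x\<in>?A. f (\<phi> x) - f x\<bar>"
        by (simp add: dist_real_def sum_subtractf)
      also have "\<dots> \<le> (\<Sum>x\<in>?A. \<bar>f (\<phi> x) - f x\<bar>)" by (rule sum_abs)
      also have "\<dots> \<le> real (card ?A) * d'"
        using e(2)[OF _ \<phi>(2)] by (intro sum_bounded_above) (auto simp: dist_real_def less_imp_le)
      also have "\<dots> < (real (card ?A) + 1) * d'" using d' by (simp add: algebra_simps)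
      also have "\<dots> = d" by (simp add: d'_def field_simps)
      finally show "\<gamma> \<in> s" using d(2) g loc[OF g R] by (simp add: s)
    qed
  qed
qed

text \<open>Around each configuration of an open set fits a ball pattern inside that set: cover the points in a
  large ball by balls with centres in a countable dense set, so small that they are disjoint and that
  points sharing a ball are matched.\<close>

lemma open_config_in_sigma:
  fixes U :: "'a::euclidean_space set set"
  assumes "openin config_topology U"
  shows "U \<in> sigma_sets configs void_events"
proof -
  interpret sigma_algebra configs "sigma_sets configs void_events :: 'a set set set"
    by (rule sigma_algebra_sigma_sets[OF void_events_closed])
  obtain D :: "'a set" where D: "countable D" "\<And>X. open X \<Longrightarrow> X \<noteq> {} \<Longrightarrow> \<exists>d \<in> D. d \<in> X"
    using countable_dense_setE by blast
  define I where "I = {(R, Q, n::nat). finite Q \<and> Q \<subseteq> D \<and> ball_pattern R Q (1 / real (Suc n)) \<subseteq> U}"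
  have cI: "countable I"
    by (rule countable_subset[of _ "UNIV \<times> {Q. finite Q \<and> Q \<subseteq> D} \<times> UNIV"])
      (auto simp: I_def intro!: countable_SIGMA countable_Collect_finite_subset D)
  have UI: "\<exists>i\<in>I. \<gamma>0 \<in> (case i of (R, Q, n) \<Rightarrow> ball_pattern R Q (1 / real (Suc n)))" if g: "\<gamma>0 \<in> U" for \<gamma>0
  proof -
    have g0: "\<gamma>0 \<in> configs" using config_topology_subset[OF assms] g by auto
    obtain R0 where R0: "\<forall>R\<ge>R0. \<exists>e>0. \<forall>\<gamma>\<in>configs. matched R e \<gamma>0 \<gamma> \<longrightarrow> \<gamma> \<in> U"
      using open_config_matched[OF assms g] by blast
    obtain R :: nat where "real R \<ge> R0" using real_arch_simple by blast
    with R0 obtain e where e: "e > 0" "\<And>\<gamma>. \<gamma> \<in> configs \<Longrightarrow> matched (real R) e \<gamma>0 \<gamma> \<Longrightarrow> \<gamma> \<in> U" by blast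
    let ?B = "cball (0::'a) (real R)"
    let ?A = "\<gamma>0 \<inter> ?B"
    have fin: "finite ?A" by (rule config_finite_Int[OF g0]) simp
    obtain s where s: "s > 0" "\<And>x y. x \<in> ?A \<Longrightarrow> y \<in> ?A \<Longrightarrow> x \<noteq> y \<Longrightarrow> s \<le> dist x y"
    proof -
      define S where "S = insert 1 ((\<lambda>(x, y). dist x y) ` {(x, y) \<in> ?A \<times> ?A. x \<noteq> y})"
      have fS: "finite S" unfolding S_def using fin
        by (intro finite.insertI finite_imageI finite_subset[OF _ finite_cartesian_product[OF fin fin]]) auto
      have "Min S \<in> S" using fS by (intro Min_in) (auto simp: S_def)
      then have "Min S > 0" by (auto simp: S_def)
      moreover have "Min S \<le> dist x y" if "x \<in> ?A" "y \<in> ?A" "x \<noteq> y" for x y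
        using that fS by (intro Min_le) (auto simp: S_def)
      ultimately show ?thesis using that by blast
    qed
    obtain n :: nat where n: "1 / real (Suc n) < min (e / 2) (s / 4)"
      using nat_approx_posE[of "min (e / 2) (s / 4)"] e(1) s(1) by auto
    define r where "r = 1 / real (Suc n)"
    have r: "r > 0" "2 * r < e" "4 * r < s" using n by (auto simp: r_def)
    have "\<exists>q. q \<in> D \<and> dist x q < r" for x using D(2)[of "ball x r"] r by auto
    then obtain q where q: "\<And>x. q x \<in> D" "\<And>x. dist x (q x) < r" by metis
    have apart: "x = y" if "x \<in> ?A" "y \<in> ?A" "dist (q x) z < r" "dist (q y) z < r" for x y z
    proof (rule ccontr)
      assume "x \<noteq> y"
      then have "s \<le> dist x y" using s(2) that by blast
      moreover have "dist x y \<le> dist x (q x) + dist (q x) z + dist (q y) z + dist y (q y)"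
        using dist_triangle[of x y "q x"] dist_triangle[of "q x" y z] dist_triangle[of z y "q y"]
        by (simp add: dist_commute)
      ultimately show False using q(2)[of x] q(2)[of y] that r by linarith
    qed
    have sub: "ball_pattern R (q ` ?A) r \<subseteq> U"
    proof
      fix \<gamma> assume "\<gamma> \<in> ball_pattern R (q ` ?A) r"
      then have \<gamma>: "\<gamma> \<in> configs" "\<gamma> \<inter> (?B - (\<Union>x\<in>?A. ball (q x) r)) = {}"
        "\<And>x. x \<in> ?A \<Longrightarrow> card (\<gamma> \<inter> (?B \<inter> ball (q x) r)) = 1" by (auto simp: ball_pattern_def)
      have "\<forall>x\<in>?A. \<exists>y. \<gamma> \<inter> (?B \<inter> ball (q x) r) = {y}"
        using \<gamma>(3) by (auto simp: card_1_singleton_iff)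
      then obtain \<phi> where \<phi>: "\<And>x. x \<in> ?A \<Longrightarrow> \<gamma> \<inter> (?B \<inter> ball (q x) r) = {\<phi> x}" by metis
      have "\<phi> x \<in> \<gamma> \<inter> (?B \<inter> ball (q x) r)" if "x \<in> ?A" for x
        unfolding \<phi>[OF that] by simp
      then have \<phi>': "\<phi> x \<in> \<gamma>" "\<phi> x \<in> ?B" "dist (q x) (\<phi> x) < r" if "x \<in> ?A" for x
        using that by simp_all
      have "matched (real R) e \<gamma>0 \<gamma>" unfolding matched_def
      proof (intro exI[of _ \<phi>] conjI ballI)
        show "bij_betw \<phi> ?A (\<gamma> \<inter> ?B)"
        proof (rule bij_betw_imageI)
          show "inj_on \<phi> ?A" 
          proof (rule inj_onI)
            fix x y assume xy: "x \<in> ?A" "y \<in> ?A" "\<phi> x = \<phi> y"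
            show "x = y" using apart[OF xy(1,2) \<phi>'(3)[OF xy(1)]] \<phi>'(3)[OF xy(2)] xy(3) by simp
          qed
          show "\<phi> ` ?A = \<gamma> \<inter> ?B"
          proof (intro equalityI subsetI)
            fix y assume y: "y \<in> \<gamma> \<inter> ?B"
            then obtain x where "x \<in> ?A" "y \<in> ball (q x) r" using \<gamma>(2) by blast
            then have "y \<in> {\<phi> x}" using \<phi> y by blast
            then show "y \<in> \<phi> ` ?A" using \<open>x \<in> ?A\<close> by auto
          qed (use \<phi>' in auto)
        qed
        fix x assume "x \<in> ?A"
        have "dist (\<phi> x) x \<le> dist (q x) (\<phi> x) + dist x (q x)" 
          using dist_triangle[of "\<phi> x" x "q x"] by (simp add: dist_commute)
        then show "dist (\<phi> x) x < e" using \<phi>'(3)[OF \<open>x \<in> ?A\<close>] q(2)[of x] r by linarith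
      qed
      then show "\<gamma> \<in> U" using e(2) \<gamma>(1) by blast
    qed
    have "\<gamma>0 \<in> ball_pattern R (q ` ?A) r"
    proof -
      have "\<gamma>0 \<inter> (?B \<inter> ball (q x) r) = {x}" if "x \<in> ?A" for x
      proof (intro equalityI subsetI)
        fix y assume "y \<in> \<gamma>0 \<inter> (?B \<inter> ball (q x) r)"
        then have "y \<in> ?A" "dist (q x) y < r" by auto
        then have "x = y" using apart[OF that, of y y] q(2)[of y] by (simp add: dist_commute)
        then show "y \<in> {x}" by simp
      qed (use that q(2)[of x] in \<open>simp add: dist_commute\<close>)
      moreover have "\<gamma>0 \<inter> (?B - (\<Union>x\<in>?A. ball (q x) r)) = {}"
      proof -
        have "x \<in> ball (q x) r" for x using q(2)[of x] by (simp add: dist_commute)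
        then show ?thesis by blast
      qed
      ultimately show ?thesis unfolding ball_pattern_def using g0 by simp
    qed
    then show ?thesis using sub fin q(1)
      by (intro bexI[of _ "(R, q ` ?A, n)"]) (auto simp: I_def r_def)
  qed
  have "U = (\<Union>i\<in>I. case i of (R, Q, n) \<Rightarrow> ball_pattern R Q (1 / real (Suc n)))"
    using UI by (intro equalityI subsetI) (blast, auto simp: I_def)
  also have "\<dots> \<in> sigma_sets configs void_events"
    using cI by (intro countable_UN') (auto simp: I_def intro: ball_pattern_in_sigma)
  finally show ?thesis .
qed

lemma space_config_borel [simp]: "space config_borel = configs"
  by (simp add: config_borel_def space_measure_of_conv)

lemma sets_config_borel_subset: "sets config_borel \<subseteq> sigma_sets configs void_events"
proof -
  have "sets config_borel = sigma_sets configs {U. openin config_topology U}"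
    unfolding config_borel_def using config_topology_subset by (intro sets_measure_of) auto
  also have "\<dots> \<subseteq> sigma_sets configs void_events"
    using open_config_in_sigma by (intro sigma_sets_mono) auto
  finally show ?thesis .
qed

lemma space_config_prob: "config_prob \<mu> \<Longrightarrow> space \<mu> = configs"
  unfolding config_prob_def by (metis sets_eq_imp_space_eq space_config_borel)

section \<open>Test functions\<close>

text \<open>The pairing of a test function with a correlation function, and the bound that membership in
  \<open>K_space \<alpha>\<close> amounts to.\<close>

abbreviation pairing :: "('a::euclidean_space set \<Rightarrow> real) \<Rightarrow> ('a set \<Rightarrow> real) \<Rightarrow> real" ("\<langle>_, _\<rangle>") where
  "\<langle>G, k\<rangle> \<equiv> \<integral>\<eta>. G \<eta> * k \<eta> \<partial>lebesgue_poisson"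

abbreviation exp_bounded :: "real \<Rightarrow> real \<Rightarrow> ('a::euclidean_space set \<Rightarrow> real) \<Rightarrow> bool" where
  "exp_bounded C \<alpha> k \<equiv> AE \<eta> in lebesgue_poisson. \<bar>k \<eta>\<bar> \<le> C * exp (\<alpha> * real (card \<eta>))"

lemma BbsE:
  assumes "G \<in> Bbs"
  obtains C N \<Lambda> where "C \<ge> 0" "\<And>\<eta>. finite \<eta> \<Longrightarrow> \<bar>G \<eta>\<bar> \<le> C" "\<Lambda> \<in> sets borel" "bounded \<Lambda>"
    "\<And>\<eta>. finite \<eta> \<Longrightarrow> card \<eta> > N \<or> \<not> \<eta> \<subseteq> \<Lambda> \<Longrightarrow> G \<eta> = 0"
proof -
  obtain N :: nat and \<Lambda> where L: "compact \<Lambda>" "\<forall>\<eta>\<in>fin_configs. card \<eta> > N \<or> \<eta> \<inter> - \<Lambda> \<noteq> {} \<longrightarrow> G \<eta> = 0"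
    and "bounded (G ` fin_configs)"
    using assms unfolding Bbs_def by blast
  then obtain C where C: "\<And>\<eta>. finite \<eta> \<Longrightarrow> \<bar>G \<eta>\<bar> \<le> C" unfolding bounded_real by force
  have "C \<ge> 0" using C[of "{}"] by simp
  then show ?thesis using that[OF _ C _ compact_imp_bounded[OF L(1)], of N] L
    by (auto simp: borel_compact disjoint_eq_subset_Compl)
qed

lemma BbsI:
  assumes "G \<in> borel_measurable fin_config_space" "\<And>\<eta>. finite \<eta> \<Longrightarrow> \<bar>G \<eta>\<bar> \<le> C" "bounded \<Lambda>"
    "\<And>\<eta>. finite \<eta> \<Longrightarrow> card \<eta> > N \<or> \<not> \<eta> \<subseteq> \<Lambda> \<Longrightarrow> G \<eta> = 0"
  shows "G \<in> Bbs"
proof -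
  obtain R where R: "\<Lambda> \<subseteq> cball 0 R" using bounded_subset_cball0[OF assms(3)] .
  have "bounded (G ` fin_configs)" unfolding bounded_real using assms(2) by (intro exI[of _ C]) auto
  moreover have "\<forall>\<eta>\<in>fin_configs. card \<eta> > N \<or> \<eta> \<inter> - cball 0 R \<noteq> {} \<longrightarrow> G \<eta> = 0"
  proof (intro ballI impI)
    fix \<eta> :: "'a set" assume "\<eta> \<in> fin_configs" "card \<eta> > N \<or> \<eta> \<inter> - cball 0 R \<noteq> {}"
    then have "finite \<eta>" "card \<eta> > N \<or> \<not> \<eta> \<subseteq> \<Lambda>" using R by auto
    then show "G \<eta> = 0" by (rule assms(4))
  qed
  ultimately show ?thesis unfolding Bbs_def using assms(1) compact_cball by blast
qed

lemma Bbs_measurable [measurable_dest]: "G \<in> Bbs \<Longrightarrow> G \<in> borel_measurable fin_config_space"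
  by (simp add: Bbs_def)

lemma Bbs_mult:
  assumes G: "G \<in> Bbs" and f[measurable]: "f \<in> borel_measurable fin_config_space"
    and bd: "\<And>n. \<exists>M. \<forall>\<eta>. finite \<eta> \<longrightarrow> card \<eta> \<le> n \<longrightarrow> \<bar>f \<eta>\<bar> \<le> M"
  shows "(\<lambda>\<eta>. f \<eta> * G \<eta>) \<in> Bbs"
proof -
  obtain C N \<Lambda> where L: "C \<ge> 0" "\<And>\<eta>. finite \<eta> \<Longrightarrow> \<bar>G \<eta>\<bar> \<le> C" "bounded \<Lambda>"
    "\<And>\<eta>. finite \<eta> \<Longrightarrow> card \<eta> > N \<or> \<not> \<eta> \<subseteq> \<Lambda> \<Longrightarrow> G \<eta> = 0" using BbsE[OF G] by metis
  obtain M where M: "\<And>\<eta>. finite \<eta> \<Longrightarrow> card \<eta> \<le> N \<Longrightarrow> \<bar>f \<eta>\<bar> \<le> M" using bd[of N] by blast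
  have M0: "M \<ge> 0" using M[of "{}"] by simp
  show ?thesis
  proof (rule BbsI[of _ "M * C" \<Lambda> N])
    fix \<eta> :: "'a set" assume fin: "finite \<eta>"
    show "\<bar>f \<eta> * G \<eta>\<bar> \<le> M * C"
    proof (cases "card \<eta> \<le> N")
      case True
      then show ?thesis unfolding abs_mult using M[OF fin True] L(1,2) fin M0 by (intro mult_mono) auto
    qed (use L M0 fin in auto)
  qed (use L Bbs_measurable[OF G] in auto)
qed

lemma Bbs_diff:
  assumes G: "G \<in> Bbs" and H: "H \<in> Bbs"
  shows "(\<lambda>\<eta>. G \<eta> - H \<eta>) \<in> Bbs"
proof -
  obtain C N \<Lambda> where L: "\<And>\<eta>. finite \<eta> \<Longrightarrow> \<bar>G \<eta>\<bar> \<le> C" "bounded \<Lambda>"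
    "\<And>\<eta>. finite \<eta> \<Longrightarrow> card \<eta> > N \<or> \<not> \<eta> \<subseteq> \<Lambda> \<Longrightarrow> G \<eta> = 0" using BbsE[OF G] by metis
  obtain C' N' \<Lambda>' where L': "\<And>\<eta>. finite \<eta> \<Longrightarrow> \<bar>H \<eta>\<bar> \<le> C'" "bounded \<Lambda>'"
    "\<And>\<eta>. finite \<eta> \<Longrightarrow> card \<eta> > N' \<or> \<not> \<eta> \<subseteq> \<Lambda>' \<Longrightarrow> H \<eta> = 0" using BbsE[OF H] by metis
  show ?thesis
  proof (rule BbsI[of _ "C + C'" "\<Lambda> \<union> \<Lambda>'" "max N N'"])
    fix \<eta> :: "'a set" assume fin: "finite \<eta>"
    show "\<bar>G \<eta> - H \<eta>\<bar> \<le> C + C'" using L(1)[OF fin] L'(1)[OF fin] by linarith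
    assume "card \<eta> > max N N' \<or> \<not> \<eta> \<subseteq> \<Lambda> \<union> \<Lambda>'"
    then have "card \<eta> > N \<or> \<not> \<eta> \<subseteq> \<Lambda>" "card \<eta> > N' \<or> \<not> \<eta> \<subseteq> \<Lambda>'" by auto
    then show "G \<eta> - H \<eta> = 0" using L(3)[OF fin] L'(3)[OF fin] by simp
  qed (use L L' Bbs_measurable[OF G] Bbs_measurable[OF H] in auto)
qed

lemma Bbs_abs:
  assumes G: "G \<in> Bbs"
  shows "(\<lambda>\<eta>. \<bar>G \<eta>\<bar>) \<in> Bbs"
proof -
  obtain C N \<Lambda> where L: "\<And>\<eta>. finite \<eta> \<Longrightarrow> \<bar>G \<eta>\<bar> \<le> C" "bounded \<Lambda>"
    "\<And>\<eta>. finite \<eta> \<Longrightarrow> card \<eta> > N \<or> \<not> \<eta> \<subseteq> \<Lambda> \<Longrightarrow> G \<eta> = 0" using BbsE[OF G] by metis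
  show ?thesis by (rule BbsI[of _ C \<Lambda> N]) (use L Bbs_measurable[OF G] in auto)
qed

lemma Bbs_indicator:
  assumes [measurable]: "B \<in> sets borel" "Measurable.pred fin_config_space P" and "bounded B"
  shows "(\<lambda>\<eta>. if \<eta> \<subseteq> B \<and> card \<eta> \<le> n \<and> P \<eta> then 1 else 0) \<in> Bbs"
proof (rule BbsI[of _ 1 B n])
  have [measurable]: "Measurable.pred fin_config_space (\<lambda>\<eta>::'a set. card \<eta> \<le> n)"
    using measurable_compose[OF measurable_card_config, of "\<lambda>k. k \<le> n" "count_space UNIV"] by simp
  show "(\<lambda>\<eta>. if \<eta> \<subseteq> B \<and> card \<eta> \<le> n \<and> P \<eta> then 1 else 0 :: real) \<in> borel_measurable fin_config_space"
    by measurable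
qed (use assms in auto)

lemma borel_measurable_card_config [measurable]:
  "(\<lambda>\<eta>. f (card \<eta>)) \<in> measurable fin_config_space (borel :: 'b::topological_space measure)"
  using measurable_compose[OF measurable_card_config, of f borel] by simp

text \<open>A test function sees configurations of boundedly many particles in a bounded region only, so a bound on
  \<open>w\<close> by any function of the number of particles makes the product integrable.\<close>

lemma integrable_Bbs_mult:
  fixes w :: "'a::euclidean_space set \<Rightarrow> real"
  assumes G: "G \<in> Bbs" and w[measurable]: "w \<in> borel_measurable fin_config_space"
    and bd: "AE \<eta> in lebesgue_poisson. \<bar>w \<eta>\<bar> \<le> v (card \<eta>)"
  shows "integrable lebesgue_poisson (\<lambda>\<eta>. G \<eta> * w \<eta>)"
proof -
  obtain C N \<Lambda> where L: "C \<ge> 0" "\<And>\<eta>. finite \<eta> \<Longrightarrow> \<bar>G \<eta>\<bar> \<le> C" "\<Lambda> \<in> sets borel" "bounded \<Lambda>"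
    "\<And>\<eta>. finite \<eta> \<Longrightarrow> card \<eta> > N \<or> \<not> \<eta> \<subseteq> \<Lambda> \<Longrightarrow> G \<eta> = 0" by (rule BbsE[OF G]) (rule that, assumption+)
  define M where "M = (\<Sum>i\<le>N. \<bar>v i\<bar>)"
  have M: "\<bar>v i\<bar> \<le> M" if "i \<le> N" for i unfolding M_def using that by (intro member_le_sum) auto
  have M0: "M \<ge> 0" by (auto simp: M_def intro: sum_nonneg)
  note [measurable] = Bbs_measurable[OF G] L(3)
  have "integrable lebesgue_poisson (\<lambda>\<eta>. if \<eta> \<subseteq> \<Lambda> then C * M else 0 :: real)"
    by (rule integrable_local_bounded[of _ \<Lambda> "C * M" 1]) (use L M0 in auto)
  then show ?thesis
  proof (rule Bochner_Integration.integrable_bound)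
    show "AE \<eta> in lebesgue_poisson. norm (G \<eta> * w \<eta>) \<le> norm (if \<eta> \<subseteq> \<Lambda> then C * M else 0)"
      using bd AE_space
    proof eventually_elim
      case (elim \<eta>)
      show ?case
      proof (cases "card \<eta> > N \<or> \<not> \<eta> \<subseteq> \<Lambda>")
        case False
        then have "\<bar>w \<eta>\<bar> \<le> M" using elim M[of "card \<eta>"] by auto
        then have "\<bar>G \<eta>\<bar> * \<bar>w \<eta>\<bar> \<le> C * M" using elim L by (intro mult_mono) auto
        then show ?thesis using False L(1) M0 by (simp add: abs_mult)
      qed (use elim L in auto)
    qed
  qed simp
qed

text \<open>Test functions detect almost everywhere bounds: choose the sign of \<open>p\<close> on the part of a
  bounded region where the bound is violated.\<close>

lemma AE_bound_by_test_functions: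
  fixes p W :: "'a::euclidean_space set \<Rightarrow> real"
  assumes [measurable]: "p \<in> borel_measurable fin_config_space" "W \<in> borel_measurable fin_config_space"
    and ip: "\<And>G. G \<in> Bbs \<Longrightarrow> integrable lebesgue_poisson (\<lambda>\<eta>. G \<eta> * p \<eta>)"
    and iW: "\<And>G. G \<in> Bbs \<Longrightarrow> integrable lebesgue_poisson (\<lambda>\<eta>. G \<eta> * W \<eta>)"
    and le: "\<And>G. G \<in> Bbs \<Longrightarrow> \<langle>G, p\<rangle> \<le> (\<integral>\<eta>. \<bar>G \<eta>\<bar> * W \<eta> \<partial>lebesgue_poisson)"
  shows "AE \<eta> in lebesgue_poisson. \<bar>p \<eta>\<bar> \<le> W \<eta>"
proof -
  have "AE \<eta> in lebesgue_poisson. \<forall>n::nat. \<eta> \<subseteq> cball 0 (real n) \<and> card \<eta> \<le> n \<longrightarrow> \<bar>p \<eta>\<bar> \<le> W \<eta>"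
    unfolding AE_all_countable
  proof
    fix n :: nat
    define I where "I \<eta> = (if \<eta> \<subseteq> cball 0 (real n) \<and> card \<eta> \<le> n \<and> W \<eta> < \<bar>p \<eta>\<bar> then 1 else 0 :: real)" for \<eta>
    have I: "I \<in> Bbs" unfolding I_def by (rule Bbs_indicator) auto
    define G where "G \<eta> = (if 0 \<le> p \<eta> then 1 else - 1) * I \<eta>" for \<eta>
    have G: "G \<in> Bbs" unfolding G_def by (rule Bbs_mult[OF I]) (auto intro!: exI[of _ 1])
    have 1: "G \<eta> * p \<eta> = I \<eta> * \<bar>p \<eta>\<bar>" and 2: "\<bar>G \<eta>\<bar> * W \<eta> = I \<eta> * W \<eta>" for \<eta>
      by (auto simp: G_def I_def)
    have int: "integrable lebesgue_poisson (\<lambda>\<eta>. I \<eta> * \<bar>p \<eta>\<bar>)" "integrable lebesgue_poisson (\<lambda>\<eta>. I \<eta> * W \<eta>)"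
      using ip[OF G] iW[OF I] unfolding 1 .
    let ?h = "\<lambda>\<eta>. I \<eta> * \<bar>p \<eta>\<bar> - I \<eta> * W \<eta>"
    have pos: "0 \<le> ?h \<eta>" for \<eta> by (simp add: I_def)
    have "(\<integral>\<eta>. ?h \<eta> \<partial>lebesgue_poisson) \<le> 0"
      using le[OF G] int unfolding 1 2 by simp
    moreover have "(\<integral>\<eta>. ?h \<eta> \<partial>lebesgue_poisson) \<ge> 0" by (rule Bochner_Integration.integral_nonneg) (rule pos)
    ultimately have "(\<integral>\<eta>. ?h \<eta> \<partial>lebesgue_poisson) = 0" by simp
    then have "AE \<eta> in lebesgue_poisson. ?h \<eta> = 0"
      using int pos by (subst (asm) integral_nonneg_eq_0_iff_AE) auto
    then show "AE \<eta> in lebesgue_poisson. \<eta> \<subseteq> cball 0 (real n) \<and> card \<eta> \<le> n \<longrightarrow> \<bar>p \<eta>\<bar> \<le> W \<eta>"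
      by eventually_elim (auto simp: I_def split: if_splits)
  qed
  then show ?thesis using AE_space
  proof eventually_elim
    case (elim \<eta>)
    then have "bounded \<eta>" by (simp add: finite_imp_bounded)
    then obtain R where R: "\<eta> \<subseteq> cball 0 R" by (rule bounded_subset_cball0)
    obtain n :: nat where n: "max R (real (card \<eta>)) \<le> real n" using real_arch_simple by blast
    then have "\<eta> \<subseteq> cball 0 (real n)" "card \<eta> \<le> n" using R by (force, simp)
    then show ?case using elim by blast
  qed
qed

section \<open>The K-transform\<close>

lemma K_transform_local:
  fixes G :: "'a::euclidean_space set \<Rightarrow> real"
  assumes "\<gamma> \<in> configs" "bounded \<Lambda>" "\<And>\<eta>. finite \<eta> \<Longrightarrow> \<not> \<eta> \<subseteq> \<Lambda> \<Longrightarrow> G \<eta> = 0"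
  shows "K_transform G \<gamma> = (\<Sum>\<eta>\<in>Pow (\<gamma> \<inter> \<Lambda>). G \<eta>)"
proof -
  have fin: "finite (\<gamma> \<inter> \<Lambda>)" by (rule config_finite_Int) fact+
  have "K_transform G \<gamma> = (\<Sum>\<^sub>\<infinity>\<eta>\<in>Pow (\<gamma> \<inter> \<Lambda>). G \<eta>)"
    unfolding K_transform_def
    by (rule infsum_cong_neutral) (use assms(3) finite_subset[OF _ fin] in auto)
  then show ?thesis using fin by (simp del: Pow_Int_eq)
qed

lemma K_transform_diff:
  assumes \<gamma>: "\<gamma> \<in> configs" and G: "G \<in> Bbs" and H: "H \<in> Bbs"
  shows "K_transform (\<lambda>\<eta>. G \<eta> - H \<eta>) \<gamma> = K_transform G \<gamma> - K_transform H \<gamma>"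
proof -
  obtain C N \<Lambda> where L: "bounded \<Lambda>"
    "\<And>\<eta>. finite \<eta> \<Longrightarrow> card \<eta> > N \<or> \<not> \<eta> \<subseteq> \<Lambda> \<Longrightarrow> G \<eta> = 0" using BbsE[OF G] by metis
  obtain C' N' \<Lambda>' where L': "bounded \<Lambda>'"
    "\<And>\<eta>. finite \<eta> \<Longrightarrow> card \<eta> > N' \<or> \<not> \<eta> \<subseteq> \<Lambda>' \<Longrightarrow> H \<eta> = 0" using BbsE[OF H] by metis
  have b: "bounded (\<Lambda> \<union> \<Lambda>')" using L L' by simp
  have z: "G \<eta> = 0" "H \<eta> = 0" if "finite \<eta>" "\<not> \<eta> \<subseteq> \<Lambda> \<union> \<Lambda>'" for \<eta>
    using L(2)[OF that(1)] L'(2)[OF that(1)] that(2) by blast+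
  show ?thesis
    using K_transform_local[OF \<gamma> b, of G] K_transform_local[OF \<gamma> b, of H]
      K_transform_local[OF \<gamma> b, of "\<lambda>\<eta>. G \<eta> - H \<eta>"] z
    by (simp add: sum_subtractf)
qed

lemma abs_K_transform_le:
  assumes \<gamma>: "\<gamma> \<in> configs" and G: "G \<in> Bbs"
  shows "\<bar>K_transform G \<gamma>\<bar> \<le> K_transform (\<lambda>\<eta>. \<bar>G \<eta>\<bar>) \<gamma>"
proof -
  obtain C N \<Lambda> where L: "bounded \<Lambda>"
    "\<And>\<eta>. finite \<eta> \<Longrightarrow> card \<eta> > N \<or> \<not> \<eta> \<subseteq> \<Lambda> \<Longrightarrow> G \<eta> = 0" using BbsE[OF G] by metis
  show ?thesis
    using K_transform_local[OF \<gamma> L(1), of G] K_transform_local[OF \<gamma> L(1), of "\<lambda>\<eta>. \<bar>G \<eta>\<bar>"] L(2)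
    by (simp add: sum_abs)
qed

text \<open>Inversion of the K-transform by induction on \<open>\<eta>\<close>.  Hence the test function representing an
  observable in \<open>generator_image\<close> is determined on finite configurations.\<close>

lemma K_transform_inj:
  fixes G H :: "'a::euclidean_space set \<Rightarrow> real"
  assumes "K_transform G = K_transform H" "finite \<eta>"
  shows "G \<eta> = H \<eta>"
  using assms(2)
proof (induct \<eta> rule: finite_psubset_induct)
  case (psubset \<eta>)
  have K: "K_transform F \<eta> = F \<eta> + (\<Sum>\<xi>\<in>Pow \<eta> - {\<eta>}. F \<xi>)" for F :: "'a set \<Rightarrow> real"
  proof -
    have "{\<xi>. finite \<xi> \<and> \<xi> \<subseteq> \<eta>} = Pow \<eta>" using psubset(1) by (auto intro: finite_subset)
    then have "K_transform F \<eta> = (\<Sum>\<xi>\<in>Pow \<eta>. F \<xi>)"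
      unfolding K_transform_def using psubset(1) by simp
    also have "\<dots> = F \<eta> + (\<Sum>\<xi>\<in>Pow \<eta> - {\<eta>}. F \<xi>)"
      using psubset(1) by (intro sum.remove) auto
    finally show ?thesis .
  qed
  have "(\<Sum>\<xi>\<in>Pow \<eta> - {\<eta>}. G \<xi>) = (\<Sum>\<xi>\<in>Pow \<eta> - {\<eta>}. H \<xi>)"
    by (intro sum.cong refl psubset(2)) auto
  then show ?case using K[of G] K[of H] assms(1) by simp
qed

text \<open>The K-transform of the indicator of the \<open>j\<close>-point configurations in \<open>B\<close> counts the \<open>j\<close>-subsets of
  \<open>\<gamma> \<inter> B\<close>.  Its integral is a factorial moment of the number of points in \<open>B\<close>, up to the factor \<open>j!\<close>.\<close>

lemma K_transform_binomial:
  fixes B :: "'a::euclidean_space set"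
  assumes "\<gamma> \<in> configs" "bounded B"
  shows "K_transform (\<lambda>\<eta>. if \<eta> \<subseteq> B \<and> card \<eta> \<le> j \<and> card \<eta> = j then 1 else 0) \<gamma> = real (card (\<gamma> \<inter> B) choose j)"
proof -
  have fin: "finite (\<gamma> \<inter> B)" by (rule config_finite_Int) fact+
  have "K_transform (\<lambda>\<eta>. if \<eta> \<subseteq> B \<and> card \<eta> \<le> j \<and> card \<eta> = j then 1 else 0) \<gamma>
      = (\<Sum>\<eta>\<in>Pow (\<gamma> \<inter> B). if \<eta> \<subseteq> B \<and> card \<eta> \<le> j \<and> card \<eta> = j then 1 else 0)"
    by (rule K_transform_local) (use assms in auto)
  also have "\<dots> = (\<Sum>\<eta>\<in>Pow (\<gamma> \<inter> B). if \<eta> \<in> {\<eta>. \<eta> \<subseteq> \<gamma> \<inter> B \<and> card \<eta> = j} then 1 else 0)"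
    by (intro sum.cong refl) auto
  also have "\<dots> = real (card (Pow (\<gamma> \<inter> B) \<inter> {\<eta>. \<eta> \<subseteq> \<gamma> \<inter> B \<and> card \<eta> = j}))"
    by (subst sum.If_cases) (use fin in \<open>simp_all del: Pow_Int_eq\<close>)
  also have "Pow (\<gamma> \<inter> B) \<inter> {\<eta>. \<eta> \<subseteq> \<gamma> \<inter> B \<and> card \<eta> = j} = {\<eta>. \<eta> \<subseteq> \<gamma> \<inter> B \<and> card \<eta> = j}" by auto
  finally show ?thesis unfolding n_subsets[OF fin] .
qed

section \<open>Correlation functions\<close>

lemma correlation_functionD:
  assumes "correlation_function \<mu> k"
  shows "k \<in> borel_measurable fin_config_space" "finite \<eta> \<Longrightarrow> 0 \<le> k \<eta>"
    and "G \<in> Bbs \<Longrightarrow> integrable \<mu> (K_transform G)"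
    and "G \<in> Bbs \<Longrightarrow> integrable lebesgue_poisson (\<lambda>\<eta>. G \<eta> * k \<eta>)"
    and "G \<in> Bbs \<Longrightarrow> (\<integral>\<gamma>. K_transform G \<gamma> \<partial>\<mu>) = \<langle>G, k\<rangle>"
  using assms by (auto simp: correlation_function_def)

lemma correlation_function_unique:
  fixes k l :: "'a::euclidean_space set \<Rightarrow> real"
  assumes k: "correlation_function \<mu> k" and l: "correlation_function \<mu> l"
  shows "AE \<eta> in lebesgue_poisson. k \<eta> = l \<eta>"
proof -
  note D = correlation_functionD[OF k] correlation_functionD[OF l]
  note [measurable] = D(1) D(6)
  have "AE \<eta> in lebesgue_poisson. \<bar>k \<eta> - l \<eta>\<bar> \<le> 0"
  proof (rule AE_bound_by_test_functions)
    fix G :: "'a set \<Rightarrow> real" assume G: "G \<in> Bbs"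
    show "integrable lebesgue_poisson (\<lambda>\<eta>. G \<eta> * (k \<eta> - l \<eta>))"
      using D(4,9)[OF G] by (simp add: right_diff_distrib)
    show "(\<integral>\<eta>. G \<eta> * (k \<eta> - l \<eta>) \<partial>lebesgue_poisson) \<le> (\<integral>\<eta>. \<bar>G \<eta>\<bar> * 0 \<partial>lebesgue_poisson)"
      using D(4,5,9,10)[OF G] by (simp add: right_diff_distrib)
  qed auto
  then show ?thesis by eventually_elim simp
qed

lemma K_space_bound:
  assumes "k \<in> K_space \<alpha>"
  shows "\<exists>C\<ge>0. exp_bounded C \<alpha> k"
proof -
  have lt: "K_norm \<alpha> k < \<infinity>" using assms by (simp add: K_space_def)
  obtain C :: real where C: "K_norm \<alpha> k \<le> ereal C"
    using lt by (cases "K_norm \<alpha> k") auto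
  have "AE \<eta> in lebesgue_poisson. ereal (\<bar>k \<eta>\<bar> * exp (- \<alpha> * real (card \<eta>))) \<le> K_norm \<alpha> k"
    unfolding K_norm_def by (rule esssup_AE)
  then have "exp_bounded (max 0 C) \<alpha> k"
  proof eventually_elim
    case (elim \<eta>)
    then have "\<bar>k \<eta>\<bar> * exp (- \<alpha> * real (card \<eta>)) \<le> max 0 C" using C order_trans by fastforce
    then have "\<bar>k \<eta>\<bar> * exp (- \<alpha> * real (card \<eta>)) * exp (\<alpha> * real (card \<eta>)) \<le> max 0 C * exp (\<alpha> * real (card \<eta>))"
      by (rule mult_right_mono) simp
    then show ?case by (simp add: mult.assoc flip: exp_add)
  qed
  then show ?thesis by (intro exI[of _ "max 0 C"]) simp
qed

lemma exp_card_le: "exp (\<alpha> * real n) \<le> (max 1 (exp \<alpha>)) ^ n"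
  by (subst mult.commute, subst exp_of_nat_mult, rule power_mono) auto

text \<open>Inclusion--exclusion over the points in \<open>B\<close>; the series converges absolutely because an
  exponential bound on \<open>k\<close> makes \<open>2 ^ N\<close> integrable, where \<open>N\<close> counts the points in \<open>B\<close>.\<close>

lemma void_probability:
  fixes k :: "'a::euclidean_space set \<Rightarrow> real"
  assumes \<mu>: "config_prob \<mu>" and k: "correlation_function \<mu> k"
    and bd: "exp_bounded C \<alpha> k"
    and B: "B \<in> sets borel" "bounded B"
  shows "void_event B \<in> sets \<mu>"
    and "measure \<mu> (void_event B) =
      (\<Sum>j. (- 1) ^ j * (\<integral>\<eta>. (if \<eta> \<subseteq> B \<and> card \<eta> \<le> j \<and> card \<eta> = j then 1 else 0) * k \<eta> \<partial>lebesgue_poisson))"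
proof -
  note D = correlation_functionD[OF k]
  note [measurable] = D(1) B(1)
  interpret prob_space \<mu> using \<mu> by (simp add: config_prob_def)
  define I where "I j \<eta> = (if \<eta> \<subseteq> B \<and> card \<eta> \<le> j \<and> card \<eta> = j then 1 else 0 :: real)" for j and \<eta> :: "'a set"
  have I: "I j \<in> Bbs" for j
    unfolding I_def
    using measurable_compose[OF measurable_card_config, of "\<lambda>k. k = j" "count_space UNIV"] by (intro Bbs_indicator B) auto
  define b where "b j \<gamma> = real (card (\<gamma> \<inter> B) choose j)" for j and \<gamma> :: "'a set"
  have K: "K_transform (I j) \<gamma> = b j \<gamma>" if "\<gamma> \<in> space \<mu>" for j \<gamma>
    unfolding b_def I_def[abs_def] using that space_config_prob[OF \<mu>] by (intro K_transform_binomial B) simp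
  have ib: "integrable \<mu> (b j)" for j
    using D(3)[OF I, of j] K by (subst (asm) Bochner_Integration.integrable_cong) auto
  have eb: "(\<integral>\<gamma>. b j \<gamma> \<partial>\<mu>) = \<langle>I j, k\<rangle>" for j
    using D(5)[OF I, of j] K by (subst (asm) Bochner_Integration.integral_cong[of _ _ _ "b j"]) auto
  have "void_event B = {\<gamma> \<in> space \<mu>. b 1 \<gamma> = 0}"
    using config_finite_Int[OF _ B(2)] by (auto simp: void_event_def b_def space_config_prob[OF \<mu>])
  also have "\<dots> \<in> sets \<mu>"
    using borel_measurable_integrable[OF ib[of 1]] by measurable
  finally show V: "void_event B \<in> sets \<mu>" .
  have iB: "integrable lebesgue_poisson (\<lambda>\<eta>. (if \<eta> \<subseteq> B then 1 else 0) * k \<eta>)"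
  proof (rule Bochner_Integration.integrable_bound)
    show "integrable lebesgue_poisson (\<lambda>\<eta>. if \<eta> \<subseteq> B then \<bar>C\<bar> * max 1 (exp \<alpha>) ^ card \<eta> else 0 :: real)"
      by (rule integrable_local_bounded[of _ B "\<bar>C\<bar>" "max 1 (exp \<alpha>)"]) (use B in auto)
    show "AE \<eta> in lebesgue_poisson. norm ((if \<eta> \<subseteq> B then 1 else 0) * k \<eta>)
        \<le> norm (if \<eta> \<subseteq> B then \<bar>C\<bar> * max 1 (exp \<alpha>) ^ card \<eta> else 0)"
      using bd
    proof eventually_elim
      case (elim \<eta>)
      also have "C * exp (\<alpha> * real (card \<eta>)) \<le> \<bar>C\<bar> * max 1 (exp \<alpha>) ^ card \<eta>"
        by (intro mult_mono exp_card_le) auto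
      finally show ?case by (simp add: abs_mult)
    qed
  qed simp
  have nn: "0 \<le> (\<integral>\<gamma>. b j \<gamma> \<partial>\<mu>)" for j by (rule Bochner_Integration.integral_nonneg) (simp add: b_def)
  have sm: "summable (\<lambda>j. \<integral>\<gamma>. b j \<gamma> \<partial>\<mu>)"
  proof (rule bounded_imp_summable[OF nn, where B = "\<integral>\<eta>. (if \<eta> \<subseteq> B then 1 else 0) * k \<eta> \<partial>lebesgue_poisson"])
    fix n
    have "(\<Sum>j\<le>n. \<integral>\<gamma>. b j \<gamma> \<partial>\<mu>) = (\<integral>\<eta>. (\<Sum>j\<le>n. I j \<eta> * k \<eta>) \<partial>lebesgue_poisson)"
      unfolding eb using D(4)[OF I] by (simp add: Bochner_Integration.integral_sum)
    also have "\<dots> \<le> (\<integral>\<eta>. (if \<eta> \<subseteq> B then 1 else 0) * k \<eta> \<partial>lebesgue_poisson)"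
    proof (rule integral_mono_AE)
      show "AE \<eta> in lebesgue_poisson. (\<Sum>j\<le>n. I j \<eta> * k \<eta>) \<le> (if \<eta> \<subseteq> B then 1 else 0) * k \<eta>"
        using AE_space
      proof eventually_elim
        case (elim \<eta>)
        have "(\<Sum>j\<le>n. I j \<eta>) = (\<Sum>j\<le>n. if j = card \<eta> then (if \<eta> \<subseteq> B then 1 else 0) else 0)"
          by (intro sum.cong) (auto simp: I_def)
        also have "\<dots> \<le> (if \<eta> \<subseteq> B then 1 else 0)" by simp
        finally have "(\<Sum>j\<le>n. I j \<eta>) * k \<eta> \<le> (if \<eta> \<subseteq> B then 1 else 0) * k \<eta>"
          using D(2)[of \<eta>] elim by (intro mult_right_mono) auto
        then show ?case by (simp add: sum_distrib_right)
      qed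
    qed (use D(4)[OF I] iB in auto)
    finally show "(\<Sum>j\<le>n. \<integral>\<gamma>. b j \<gamma> \<partial>\<mu>) \<le> \<dots>" .
  qed
  have pw: "(\<lambda>j. (- 1) ^ j * b j \<gamma>) sums indicator (void_event B) \<gamma>"
    and pws: "summable (\<lambda>j. norm ((- 1) ^ j * b j \<gamma>))" if "\<gamma> \<in> space \<mu>" for \<gamma>
  proof -
    have g: "\<gamma> \<in> configs" using that space_config_prob[OF \<mu>] by simp
    define N where "N = card (\<gamma> \<inter> B)"
    have z: "b j \<gamma> = 0" if "j \<notin> {..N}" for j using that by (simp add: b_def N_def)
    have "(\<lambda>j. (- 1) ^ j * b j \<gamma>) sums (\<Sum>j\<le>N. (- 1) ^ j * b j \<gamma>)"
      by (rule sums_finite) (use z in auto)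
    moreover have "(\<Sum>j\<le>N. (- 1) ^ j * b j \<gamma>) = indicator (void_event B) \<gamma>"
    proof (cases "N = 0")
      case True
      then have "\<gamma> \<inter> B = {}" using config_finite_Int[OF g B(2)] by (simp add: N_def)
      then show ?thesis using True g by (simp add: b_def void_event_def)
    next
      case False
      then have "\<gamma> \<inter> B \<noteq> {}" by (auto simp: N_def)
      then show ?thesis using choose_alternating_sum[of N, where 'a = real] False
        by (simp add: b_def void_event_def N_def)
    qed
    ultimately show "(\<lambda>j. (- 1) ^ j * b j \<gamma>) sums indicator (void_event B) \<gamma>" by simp
    show "summable (\<lambda>j. norm ((- 1) ^ j * b j \<gamma>))"
      by (rule summable_finite[of "{..N}"]) (use z in auto)
  qed
  have "measure \<mu> (void_event B) = (\<integral>\<gamma>. indicator (void_event B) \<gamma> \<partial>\<mu>)"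
    using V by simp
  also have "\<dots> = (\<integral>\<gamma>. (\<Sum>j. (- 1) ^ j * b j \<gamma>) \<partial>\<mu>)"
    using pw by (intro Bochner_Integration.integral_cong) (auto simp: sums_iff)
  also have "\<dots> = (\<Sum>j. \<integral>\<gamma>. (- 1) ^ j * b j \<gamma> \<partial>\<mu>)"
  proof (rule integral_suminf)
    show "AE \<gamma> in \<mu>. summable (\<lambda>j. norm ((- 1) ^ j * b j \<gamma>))" using pws by (intro AE_I2)
    have "norm ((- 1) ^ j * b j \<gamma>) = b j \<gamma>" for j \<gamma> by (simp add: abs_mult b_def)
    then show "summable (\<lambda>j. \<integral>\<gamma>. norm ((- 1) ^ j * b j \<gamma>) \<partial>\<mu>)" using sm by simp
  qed (use ib in simp)
  also have "\<dots> = (\<Sum>j. (- 1) ^ j * \<langle>I j, k\<rangle>)"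
    by (simp add: eb)
  finally show "measure \<mu> (void_event B) =
      (\<Sum>j. (- 1) ^ j * (\<integral>\<eta>. (if \<eta> \<subseteq> B \<and> card \<eta> \<le> j \<and> card \<eta> = j then 1 else 0) * k \<eta> \<partial>lebesgue_poisson))"
    unfolding I_def .
qed

theorem config_measure_unique:
  fixes k l :: "'a::euclidean_space set \<Rightarrow> real"
  assumes \<mu>: "config_prob \<mu>" "correlation_function \<mu> k" and \<nu>: "config_prob \<nu>" "correlation_function \<nu> l"
    and kl: "AE \<eta> in lebesgue_poisson. k \<eta> = l \<eta>"
    and bd: "exp_bounded C \<alpha> k"
  shows "\<mu> = \<nu>"
proof (rule measure_eqI_generator_eq[OF Int_stable_void_events void_events_closed])
  interpret M: prob_space \<mu> using \<mu> by (simp add: config_prob_def)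
  interpret N: prob_space \<nu> using \<nu> by (simp add: config_prob_def)
  have bd': "exp_bounded C \<alpha> l"
    using bd kl by eventually_elim simp
  note V = void_probability[OF \<mu> bd] and V' = void_probability[OF \<nu> bd']
  note [measurable] = correlation_functionD(1)[OF \<mu>(2)] correlation_functionD(1)[OF \<nu>(2)]
  fix X :: "'a set set" assume "X \<in> void_events"
  then obtain B where X: "X = void_event B" and B: "B \<in> sets borel" "bounded B" by (auto simp: void_events_def)
  have [measurable]: "B \<in> sets borel" by fact
  have eq: "(\<integral>\<eta>. (if \<eta> \<subseteq> B \<and> card \<eta> \<le> j \<and> card \<eta> = j then 1 else 0) * k \<eta> \<partial>lebesgue_poisson)
      = (\<integral>\<eta>. (if \<eta> \<subseteq> B \<and> card \<eta> \<le> j \<and> card \<eta> = j then 1 else 0) * l \<eta> \<partial>lebesgue_poisson)" for j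
  proof (rule integral_cong_AE)
    have "(\<lambda>\<eta>. if \<eta> \<subseteq> B \<and> card \<eta> \<le> j \<and> card \<eta> = j then 1 else 0 :: real) \<in> Bbs"
      using measurable_compose[OF measurable_card_config, of "\<lambda>k. k = j" "count_space UNIV"] by (intro Bbs_indicator B) auto
    note [measurable] = Bbs_measurable[OF this]
    show "(\<lambda>\<eta>. (if \<eta> \<subseteq> B \<and> card \<eta> \<le> j \<and> card \<eta> = j then 1 else 0) * k \<eta>) \<in> borel_measurable lebesgue_poisson"
      "(\<lambda>\<eta>. (if \<eta> \<subseteq> B \<and> card \<eta> \<le> j \<and> card \<eta> = j then 1 else 0) * l \<eta>) \<in> borel_measurable lebesgue_poisson"
      unfolding measurable_lebesgue_poisson by (intro borel_measurable_times; measurable)+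
  qed (use kl in eventually_elim, simp)
  show "emeasure \<mu> X = emeasure \<nu> X"
    unfolding M.emeasure_eq_measure N.emeasure_eq_measure X V(2)[OF B] V'(2)[OF B] eq ..
next
  have s: "sets \<rho> = sigma_sets configs void_events"
    if "config_prob \<rho>" "correlation_function \<rho> r"
      "exp_bounded C \<alpha> r" for \<rho> r
  proof
    show "sets \<rho> \<subseteq> sigma_sets configs void_events"
      using that(1) sets_config_borel_subset by (auto simp: config_prob_def)
    have "void_events \<subseteq> sets \<rho>"
      using void_probability(1)[OF that] by (auto simp: void_events_def)
    then show "sigma_sets configs void_events \<subseteq> sets \<rho>"
      using sets.sigma_sets_subset[of void_events \<rho>] space_config_prob[OF that(1)] by simp
  qed
  show "sets \<mu> = sigma_sets configs void_events" by (rule s[OF \<mu> bd])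
  show "sets \<nu> = sigma_sets configs void_events"
    by (rule s[OF \<nu>]) (use bd kl in eventually_elim, simp)
  show "range (\<lambda>_::nat. void_event {}) \<subseteq> (void_events :: 'a set set set)" by (auto simp: void_events_def)
  show "(\<Union>i::nat. void_event {}) = (configs :: 'a set set)" by (simp add: void_event_def)
  interpret M: prob_space \<mu> using \<mu> by (simp add: config_prob_def)
  show "emeasure \<mu> (void_event {}) \<noteq> \<infinity>" by simp
qed

section \<open>The extension of the K-transform\<close>

lemma L1_norm_K_transform_le:
  assumes \<mu>: "config_prob \<mu>" and k: "correlation_function \<mu> k" and G: "G \<in> Bbs"
  shows "(\<integral>\<gamma>. \<bar>K_transform G \<gamma>\<bar> \<partial>\<mu>) \<le> (\<integral>\<eta>. \<bar>G \<eta>\<bar> * k \<eta> \<partial>lebesgue_poisson)"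
proof -
  note D = correlation_functionD[OF k]
  have "(\<integral>\<gamma>. \<bar>K_transform G \<gamma>\<bar> \<partial>\<mu>) \<le> (\<integral>\<gamma>. K_transform (\<lambda>\<eta>. \<bar>G \<eta>\<bar>) \<gamma> \<partial>\<mu>)"
    using D(3)[OF G] D(3)[OF Bbs_abs[OF G]] abs_K_transform_le[OF _ G] space_config_prob[OF \<mu>]
    by (intro integral_mono) auto
  then show ?thesis using D(5)[OF Bbs_abs[OF G]] by simp
qed

lemma density_integral:
  assumes k: "correlation_function \<mu> k" and [measurable]: "g \<in> borel_measurable fin_config_space"
  shows "integrable (density lebesgue_poisson (\<lambda>\<eta>. ennreal (k \<eta>))) g \<longleftrightarrow> integrable lebesgue_poisson (\<lambda>\<eta>. g \<eta> * k \<eta>)"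
    and "(\<integral>\<eta>. g \<eta> \<partial>density lebesgue_poisson (\<lambda>\<eta>. ennreal (k \<eta>))) = \<langle>g, k\<rangle>"
proof -
  note [measurable] = correlation_functionD(1)[OF k]
  have nn: "AE \<eta> in lebesgue_poisson. 0 \<le> k \<eta>" using correlation_functionD(2)[OF k] by (intro AE_I2) auto
  show "integrable (density lebesgue_poisson (\<lambda>\<eta>. ennreal (k \<eta>))) g \<longleftrightarrow> integrable lebesgue_poisson (\<lambda>\<eta>. g \<eta> * k \<eta>)"
    using nn by (subst integrable_density) (auto simp: mult.commute)
  show "(\<integral>\<eta>. g \<eta> \<partial>density lebesgue_poisson (\<lambda>\<eta>. ennreal (k \<eta>))) = \<langle>g, k\<rangle>"
    using nn by (subst integral_density) (auto simp: mult.commute)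
qed

lemma K_extension_integral:
  assumes k: "correlation_function \<mu> k" and g[measurable]: "g \<in> borel_measurable fin_config_space"
    and ext: "K_extension \<mu> k g H"
  shows "(\<integral>\<gamma>. H \<gamma> \<partial>\<mu>) = \<langle>g, k\<rangle>"
proof -
  let ?D = "density lebesgue_poisson (\<lambda>\<eta>. ennreal (k \<eta>))"
  obtain Gn where G: "\<And>n. Gn n \<in> Bbs" and ig: "integrable ?D g" and iH: "integrable \<mu> H"
    and l1: "(\<lambda>n. \<integral>\<eta>. \<bar>Gn n \<eta> - g \<eta>\<bar> \<partial>?D) \<longlonglongrightarrow> 0"
    and l2: "(\<lambda>n. \<integral>\<gamma>. \<bar>K_transform (Gn n) \<gamma> - H \<gamma>\<bar> \<partial>\<mu>) \<longlonglongrightarrow> 0"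
    using ext unfolding K_extension_def by blast
  have iG: "integrable ?D (Gn n)" for n
    using density_integral(1)[OF k Bbs_measurable[OF G]] correlation_functionD(4)[OF k G] by simp
  have iK: "integrable \<mu> (K_transform (Gn n))" for n by (rule correlation_functionD(3)[OF k G])
  have "(\<lambda>n. (\<integral>\<eta>. Gn n \<eta> \<partial>?D) - (\<integral>\<eta>. g \<eta> \<partial>?D)) \<longlonglongrightarrow> 0"
  proof (rule tendsto_0_le[OF l1, of _ 1], intro always_eventually allI)
    fix n
    have "norm ((\<integral>\<eta>. Gn n \<eta> \<partial>?D) - (\<integral>\<eta>. g \<eta> \<partial>?D)) = \<bar>\<integral>\<eta>. Gn n \<eta> - g \<eta> \<partial>?D\<bar>"
      using iG ig by simp
    also have "\<dots> \<le> (\<integral>\<eta>. \<bar>Gn n \<eta> - g \<eta>\<bar> \<partial>?D)" by (rule integral_abs_bound)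
    finally show "norm ((\<integral>\<eta>. Gn n \<eta> \<partial>?D) - (\<integral>\<eta>. g \<eta> \<partial>?D)) \<le> norm (\<integral>\<eta>. \<bar>Gn n \<eta> - g \<eta>\<bar> \<partial>?D) * 1" by simp
  qed
  then have t1: "(\<lambda>n. \<integral>\<eta>. Gn n \<eta> \<partial>?D) \<longlonglongrightarrow> (\<integral>\<eta>. g \<eta> \<partial>?D)" by (simp add: LIM_zero_iff)
  have "(\<lambda>n. (\<integral>\<gamma>. K_transform (Gn n) \<gamma> \<partial>\<mu>) - (\<integral>\<gamma>. H \<gamma> \<partial>\<mu>)) \<longlonglongrightarrow> 0"
  proof (rule tendsto_0_le[OF l2, of _ 1], intro always_eventually allI)
    fix n
    have "norm ((\<integral>\<gamma>. K_transform (Gn n) \<gamma> \<partial>\<mu>) - (\<integral>\<gamma>. H \<gamma> \<partial>\<mu>)) = \<bar>\<integral>\<gamma>. K_transform (Gn n) \<gamma> - H \<gamma> \<partial>\<mu>\<bar>"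
      using iK iH by simp
    also have "\<dots> \<le> (\<integral>\<gamma>. \<bar>K_transform (Gn n) \<gamma> - H \<gamma>\<bar> \<partial>\<mu>)" by (rule integral_abs_bound)
    finally show "norm ((\<integral>\<gamma>. K_transform (Gn n) \<gamma> \<partial>\<mu>) - (\<integral>\<gamma>. H \<gamma> \<partial>\<mu>))
      \<le> norm (\<integral>\<gamma>. \<bar>K_transform (Gn n) \<gamma> - H \<gamma>\<bar> \<partial>\<mu>) * 1" by simp
  qed
  then have t2: "(\<lambda>n. \<integral>\<gamma>. K_transform (Gn n) \<gamma> \<partial>\<mu>) \<longlonglongrightarrow> (\<integral>\<gamma>. H \<gamma> \<partial>\<mu>)" by (simp add: LIM_zero_iff)
  have "(\<integral>\<gamma>. K_transform (Gn n) \<gamma> \<partial>\<mu>) = (\<integral>\<eta>. Gn n \<eta> \<partial>?D)" for n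
    using correlation_functionD(5)[OF k G] density_integral(2)[OF k Bbs_measurable[OF G]] by simp
  with t2 have "(\<lambda>n. \<integral>\<eta>. Gn n \<eta> \<partial>?D) \<longlonglongrightarrow> (\<integral>\<gamma>. H \<gamma> \<partial>\<mu>)" by simp
  with t1 have "(\<integral>\<gamma>. H \<gamma> \<partial>\<mu>) = (\<integral>\<eta>. g \<eta> \<partial>?D)" by (rule LIMSEQ_unique[rotated])
  then show ?thesis using density_integral(2)[OF k g] by simp
qed

text \<open>Approximate \<open>g\<close> by its restrictions to large balls.  Their K-transforms form a Cauchy sequence
  in \<open>L\<^sup>1(\<mu>)\<close>, and Fatou's lemma identifies the limit of an almost everywhere convergent subsequence.\<close>

lemma K_extension_exists:
  fixes g k :: "'a::euclidean_space set \<Rightarrow> real"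
  assumes \<mu>: "config_prob \<mu>" and k: "correlation_function \<mu> k"
    and g[measurable]: "g \<in> borel_measurable fin_config_space"
    and bd: "\<And>\<eta>. finite \<eta> \<Longrightarrow> \<bar>g \<eta>\<bar> \<le> C" "\<And>\<eta>. finite \<eta> \<Longrightarrow> card \<eta> > N \<Longrightarrow> g \<eta> = 0"
    and ig: "integrable lebesgue_poisson (\<lambda>\<eta>. g \<eta> * k \<eta>)"
  shows "\<exists>H. K_extension \<mu> k g H"
proof -
  let ?D = "density lebesgue_poisson (\<lambda>\<eta>. ennreal (k \<eta>))"
  note D = correlation_functionD[OF k]
  note [measurable] = D(1)
  define G where "G n \<eta> = (if \<eta> \<subseteq> cball 0 (real n) then g \<eta> else 0)" for n :: nat and \<eta>
  have C0: "C \<ge> 0" using bd(1)[of "{}"] by simp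
  have Gm[measurable]: "G n \<in> borel_measurable fin_config_space" for n unfolding G_def by measurable
  have G: "G n \<in> Bbs" for n
    by (rule BbsI[of _ C "cball 0 (real n)" N, OF Gm]) (use bd C0 in \<open>auto simp: G_def\<close>)
  define e where "e n = (\<integral>\<eta>. \<bar>G n \<eta> - g \<eta>\<bar> * k \<eta> \<partial>lebesgue_poisson)" for n
  have ie: "integrable lebesgue_poisson (\<lambda>\<eta>. \<bar>G n \<eta> - g \<eta>\<bar> * k \<eta>)" for n
  proof (rule Bochner_Integration.integrable_bound[OF ig])
    show "AE \<eta> in lebesgue_poisson. norm (\<bar>G n \<eta> - g \<eta>\<bar> * k \<eta>) \<le> norm (g \<eta> * k \<eta>)"
      by (intro AE_I2) (simp add: G_def abs_mult)
  qed simp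
  have "e \<longlonglongrightarrow> (\<integral>\<eta>. (0::real) \<partial>(lebesgue_poisson :: 'a set measure))" unfolding e_def
  proof (rule integral_dominated_convergence[where w = "\<lambda>\<eta>. \<bar>g \<eta> * k \<eta>\<bar>"])
    show "AE \<eta> in lebesgue_poisson. (\<lambda>n. \<bar>G n \<eta> - g \<eta>\<bar> * k \<eta>) \<longlonglongrightarrow> 0"
    proof (rule AE_I2)
      fix \<eta> :: "'a set" assume "\<eta> \<in> space lebesgue_poisson"
      then have "bounded \<eta>" by (simp add: finite_imp_bounded)
      then obtain R where R: "\<eta> \<subseteq> cball 0 R" by (rule bounded_subset_cball0)
      have "eventually (\<lambda>n. \<bar>G n \<eta> - g \<eta>\<bar> * k \<eta> = 0) sequentially"
        using eventually_ge_at_top[of "nat \<lceil>R\<rceil>"]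
      proof eventually_elim
        case (elim n)
        then have "R \<le> real n" by linarith
        then have "\<eta> \<subseteq> cball 0 (real n)" using R by force
        then show ?case by (simp add: G_def)
      qed
      then show "(\<lambda>n. \<bar>G n \<eta> - g \<eta>\<bar> * k \<eta>) \<longlonglongrightarrow> 0" by (rule tendsto_eventually)
    qed
    show "AE \<eta> in lebesgue_poisson. norm (\<bar>G n \<eta> - g \<eta>\<bar> * k \<eta>) \<le> \<bar>g \<eta> * k \<eta>\<bar>" for n
      by (intro AE_I2) (simp add: G_def abs_mult)
  qed (use ig in auto)
  then have e0: "e \<longlonglongrightarrow> 0" by simp
  define s where "s n = K_transform (G n)" for n
  have ints: "integrable \<mu> (s n)" for n unfolding s_def by (rule D(3)[OF G])
  have dist_s: "(\<integral>\<gamma>. \<bar>s i \<gamma> - s j \<gamma>\<bar> \<partial>\<mu>) \<le> e i + e j" for i j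
  proof -
    have d: "(\<lambda>\<eta>. G i \<eta> - G j \<eta>) \<in> Bbs" by (rule Bbs_diff[OF G G])
    have "(\<integral>\<gamma>. \<bar>s i \<gamma> - s j \<gamma>\<bar> \<partial>\<mu>) = (\<integral>\<gamma>. \<bar>K_transform (\<lambda>\<eta>. G i \<eta> - G j \<eta>) \<gamma>\<bar> \<partial>\<mu>)"
      by (intro Bochner_Integration.integral_cong refl)
        (simp add: s_def K_transform_diff[OF _ G G] space_config_prob[OF \<mu>])
    also have "\<dots> \<le> (\<integral>\<eta>. \<bar>G i \<eta> - G j \<eta>\<bar> * k \<eta> \<partial>lebesgue_poisson)"
      by (rule L1_norm_K_transform_le[OF \<mu> k d])
    also have "\<dots> \<le> (\<integral>\<eta>. \<bar>G i \<eta> - g \<eta>\<bar> * k \<eta> + \<bar>G j \<eta> - g \<eta>\<bar> * k \<eta> \<partial>lebesgue_poisson)"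
    proof (rule integral_mono)
      show "integrable lebesgue_poisson (\<lambda>\<eta>. \<bar>G i \<eta> - G j \<eta>\<bar> * k \<eta>)" by (rule D(4)[OF Bbs_abs[OF d]])
      fix \<eta> :: "'a set" assume "\<eta> \<in> space lebesgue_poisson"
      then have "0 \<le> k \<eta>" using D(2) by simp
      then have "\<bar>G i \<eta> - G j \<eta>\<bar> * k \<eta> \<le> (\<bar>G i \<eta> - g \<eta>\<bar> + \<bar>G j \<eta> - g \<eta>\<bar>) * k \<eta>"
        by (intro mult_right_mono) auto
      then show "\<bar>G i \<eta> - G j \<eta>\<bar> * k \<eta> \<le> \<bar>G i \<eta> - g \<eta>\<bar> * k \<eta> + \<bar>G j \<eta> - g \<eta>\<bar> * k \<eta>"
        by (simp add: distrib_right)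
    qed (use ie in auto)
    finally show ?thesis using ie by (simp add: e_def)
  qed
  have "\<exists>N. \<forall>i\<ge>N. \<forall>j\<ge>N. (\<integral>\<gamma>. norm (s i \<gamma> - s j \<gamma>) \<partial>\<mu>) < d" if "d > 0" for d
  proof -
    have "d / 2 > 0" using that by simp
    from order_tendstoD(2)[OF e0 this] obtain N where N: "\<And>i. i \<ge> N \<Longrightarrow> e i < d / 2"
      unfolding eventually_sequentially by blast
    have "(\<integral>\<gamma>. norm (s i \<gamma> - s j \<gamma>) \<partial>\<mu>) < d" if "i \<ge> N" "j \<ge> N" for i j
      using dist_s[of i j] N[OF that(1)] N[OF that(2)] by simp
    then show ?thesis by blast
  qed
  from cauchy_L1_AE_cauchy_subseq[OF ints this]
  obtain r where r: "strict_mono r" "AE \<gamma> in \<mu>. Cauchy (\<lambda>i. s (r i) \<gamma>)" by blast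
  define H where "H \<gamma> = lim (\<lambda>i. s (r i) \<gamma>)" for \<gamma>
  note [measurable] = borel_measurable_integrable[OF ints]
  have [measurable]: "H \<in> borel_measurable \<mu>" unfolding H_def by measurable
  have le: "(\<integral>\<^sup>+\<gamma>. ennreal \<bar>s n \<gamma> - H \<gamma>\<bar> \<partial>\<mu>) \<le> ennreal (e n)" for n
  proof -
    have "(\<integral>\<^sup>+\<gamma>. ennreal \<bar>s n \<gamma> - H \<gamma>\<bar> \<partial>\<mu>) = (\<integral>\<^sup>+\<gamma>. liminf (\<lambda>i. ennreal \<bar>s n \<gamma> - s (r i) \<gamma>\<bar>) \<partial>\<mu>)"
    proof (rule nn_integral_cong_AE, use r(2) in eventually_elim)
      case (elim \<gamma>)
      then have "(\<lambda>i. s (r i) \<gamma>) \<longlonglongrightarrow> H \<gamma>"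
        unfolding H_def by (simp add: Cauchy_convergent convergent_LIMSEQ_iff[symmetric])
      then have "(\<lambda>i. ennreal \<bar>s n \<gamma> - s (r i) \<gamma>\<bar>) \<longlonglongrightarrow> ennreal \<bar>s n \<gamma> - H \<gamma>\<bar>"
        by (intro tendsto_ennrealI tendsto_intros)
      then show ?case by (rule lim_imp_Liminf[OF sequentially_bot, symmetric])
    qed
    also have "\<dots> \<le> liminf (\<lambda>i. \<integral>\<^sup>+\<gamma>. ennreal \<bar>s n \<gamma> - s (r i) \<gamma>\<bar> \<partial>\<mu>)"
      by (rule nn_integral_liminf) measurable
    also have "\<dots> \<le> liminf (\<lambda>i. ennreal (e n + e (r i)))"
    proof (intro Liminf_mono always_eventually allI)
      fix i
      have "(\<integral>\<^sup>+\<gamma>. ennreal \<bar>s n \<gamma> - s (r i) \<gamma>\<bar> \<partial>\<mu>) = ennreal (\<integral>\<gamma>. \<bar>s n \<gamma> - s (r i) \<gamma>\<bar> \<partial>\<mu>)"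
        by (rule nn_integral_eq_integral) (use ints in auto)
      then show "(\<integral>\<^sup>+\<gamma>. ennreal \<bar>s n \<gamma> - s (r i) \<gamma>\<bar> \<partial>\<mu>) \<le> ennreal (e n + e (r i))"
        using dist_s by (simp add: ennreal_leI)
    qed
    also have "\<dots> = ennreal (e n + 0)"
      using LIMSEQ_subseq_LIMSEQ[OF e0 r(1)]
      by (intro lim_imp_Liminf tendsto_ennrealI tendsto_intros) (auto simp: o_def)
    finally show ?thesis by simp
  qed
  have idiff: "integrable \<mu> (\<lambda>\<gamma>. s n \<gamma> - H \<gamma>)" for n
    by (rule integrableI_bounded) (use le[of n] in \<open>auto intro: order.strict_trans1\<close>)
  have iH: "integrable \<mu> H"
    using Bochner_Integration.integrable_diff[OF ints[of 0] idiff[of 0]] by simp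
  have e_nn: "e n \<ge> 0" for n
    unfolding e_def by (rule integral_nonneg_AE) (use D(2) in \<open>auto intro!: AE_I2\<close>)
  have "(\<lambda>n. \<integral>\<gamma>. \<bar>s n \<gamma> - H \<gamma>\<bar> \<partial>\<mu>) \<longlonglongrightarrow> 0"
  proof (rule tendsto_0_le[OF e0, of _ 1], intro always_eventually allI)
    fix n
    have "ennreal (\<integral>\<gamma>. \<bar>s n \<gamma> - H \<gamma>\<bar> \<partial>\<mu>) \<le> ennreal (e n)"
      using le[of n] idiff by (subst nn_integral_eq_integral[symmetric]) auto
    then show "norm (\<integral>\<gamma>. \<bar>s n \<gamma> - H \<gamma>\<bar> \<partial>\<mu>) \<le> norm (e n) * 1"
      using e_nn[of n] by (simp add: ennreal_le_iff)
  qed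
  moreover have "(\<lambda>n. \<integral>\<eta>. \<bar>G n \<eta> - g \<eta>\<bar> \<partial>?D) \<longlonglongrightarrow> 0"
    using e0 unfolding e_def by (subst density_integral(2)[OF k]) simp_all
  ultimately have "K_extension \<mu> k g H"
    unfolding K_extension_def using density_integral(1)[OF k g] ig iH G s_def by auto
  then show ?thesis by blast
qed

section \<open>The generator on test functions and its dual\<close>

definition pair_sum :: "('a::euclidean_space \<Rightarrow> real) \<Rightarrow> 'a set \<Rightarrow> real" where
  "pair_sum a \<eta> = (\<Sum>x\<in>\<eta>. \<Sum>y\<in>\<eta> - {x}. a (x - y))"

definition death_rate :: "real \<Rightarrow> ('a::euclidean_space \<Rightarrow> real) \<Rightarrow> 'a set \<Rightarrow> real" where
  "death_rate m am \<eta> = m * real (card \<eta>) + pair_sum am \<eta>"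

lemma abs_integral_le_nn_integral: "ennreal \<bar>\<integral>x. f x \<partial>M\<bar> \<le> (\<integral>\<^sup>+x. ennreal \<bar>f x\<bar> \<partial>M)" for f :: "_ \<Rightarrow> real"
  using integral_norm_bound_ennreal[of M f] by (cases "integrable M f") (auto simp: not_integrable_integral_eq)

text \<open>The terms of the generator except for the diagonal one: an offspring is born, a particle
  feels the competition of another one, and a particle is replaced by its offspring.\<close>

locale interaction_kernel =
  fixes a :: "'a::euclidean_space \<Rightarrow> real"
  assumes nonneg: "\<And>x. 0 \<le> a x" and symmetric: "\<And>x. a (- x) = a x"
    and bounded_range: "bounded (range a)" and integrable_kernel: "integrable lborel a"
begin

lemma kernel_measurable [measurable]: "a \<in> borel_measurable borel"
  using borel_measurable_integrable[OF integrable_kernel] by simp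

lemma kernel_commute: "a (x - y) = a (y - x)"
  using symmetric[of "x - y"] by simp

definition mass where "mass = (\<integral>x. a x \<partial>lborel)"

lemma mass_nonneg: "0 \<le> mass" unfolding mass_def by (rule Bochner_Integration.integral_nonneg) (rule nonneg)

lemma nn_integral_kernel: "(\<integral>\<^sup>+x. ennreal (a (x - y)) \<partial>lborel) = ennreal mass"
  "(\<integral>\<^sup>+x. ennreal (a (y - x)) \<partial>lborel) = ennreal mass"
proof -
  have "(\<integral>\<^sup>+x. ennreal (a (x - y)) \<partial>lborel) = (\<integral>\<^sup>+x. ennreal (a x) \<partial>lborel)"
  proof -
    have "(\<integral>\<^sup>+x. ennreal (a x) \<partial>lborel) = (\<integral>\<^sup>+x. ennreal (a x) \<partial>distr lborel borel ((+) (- y)))"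
      by (simp add: lborel_distr_plus)
    also have "\<dots> = (\<integral>\<^sup>+x. ennreal (a (- y + x)) \<partial>lborel)" by (rule nn_integral_distr) measurable
    finally show ?thesis by simp
  qed
  also have "\<dots> = ennreal mass" unfolding mass_def
    by (rule nn_integral_eq_integral[OF integrable_kernel]) (simp add: nonneg)
  finally show "(\<integral>\<^sup>+x. ennreal (a (x - y)) \<partial>lborel) = ennreal mass" .
  then show "(\<integral>\<^sup>+x. ennreal (a (y - x)) \<partial>lborel) = ennreal mass" by (simp only: kernel_commute[of y])
qed

lemma kernel_bound: "\<exists>M\<ge>0. \<forall>x. a x \<le> M"
proof -
  obtain M where M: "\<forall>x. \<bar>a x\<bar> \<le> M" using bounded_range unfolding bounded_real by auto
  then have "\<forall>x. a x \<le> M" by (auto intro: order_trans[OF abs_ge_self])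
  moreover from this have "0 \<le> M" using order_trans[OF nonneg[of 0]] by blast
  ultimately have "0 \<le> M" "\<forall>x. a x \<le> M" by simp_all
  then show ?thesis by blast
qed

lemma pair_sum_measurable [measurable]: "pair_sum a \<in> borel_measurable fin_config_space"
  unfolding pair_sum_def[abs_def] by measurable

lemma pair_sum_nonneg: "0 \<le> pair_sum a \<eta>"
  unfolding pair_sum_def by (intro sum_nonneg nonneg)

lemma pair_sum_commute: "(\<Sum>y\<in>\<eta>. \<Sum>x\<in>\<eta> - {y}. a (x - y)) = pair_sum a \<eta>"
  unfolding pair_sum_def by (intro sum.cong refl kernel_commute)

lemma pair_sum_bound: "\<exists>M\<ge>0. \<forall>\<eta>. pair_sum a \<eta> \<le> M * real (card \<eta>) ^ 2"
proof -
  obtain M where M: "M \<ge> 0" "\<And>x. a x \<le> M" using kernel_bound by blast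
  have "pair_sum a \<eta> \<le> M * real (card \<eta>) ^ 2" for \<eta>
  proof (cases "finite \<eta>")
    case True
    have "(\<Sum>y\<in>\<eta> - {x}. a (x - y)) \<le> real (card \<eta>) * M" for x
    proof -
      have "(\<Sum>y\<in>\<eta> - {x}. a (x - y)) \<le> (\<Sum>y\<in>\<eta>. a (x - y))"
        using True nonneg by (intro sum_mono2) auto
      also have "\<dots> \<le> real (card \<eta>) * M" using M by (intro sum_bounded_above) auto
      finally show ?thesis .
    qed
    then have "pair_sum a \<eta> \<le> real (card \<eta>) * (real (card \<eta>) * M)"
      unfolding pair_sum_def by (rule sum_bounded_above)
    then show ?thesis by (simp add: power2_eq_square ac_simps)
  qed (simp add: pair_sum_def)
  then show ?thesis using M by blast
qed

text \<open>Mecke's formula moves the three terms from a test function to a weight that depends on the number of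
  particles only.  All of them are positive operators, and equality holds for positive functions.\<close>

lemma birth_nn_integral:
  assumes [measurable]: "G \<in> borel_measurable fin_config_space" and G0: "\<And>\<eta>. 0 \<le> G \<eta>" and w: "\<And>n::nat. 0 \<le> w n"
  shows "(\<integral>\<^sup>+\<eta>. (\<Sum>x\<in>\<eta>. \<integral>\<^sup>+y. ennreal (a (x - y) * G (insert y \<eta>)) \<partial>lborel) * ennreal (w (card \<eta>)) \<partial>lebesgue_poisson)
       = (\<integral>\<^sup>+\<eta>. ennreal (G \<eta> * (pair_sum a \<eta> * w (card \<eta> - 1))) \<partial>lebesgue_poisson)"
proof -
  define h where "h y \<eta> = ennreal ((\<Sum>x\<in>\<eta>. a (x - y)) * G (insert y \<eta>) * w (card \<eta>))" for y \<eta>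
  have s0: "0 \<le> (\<Sum>x\<in>\<eta>. a (x - y))" for \<eta> y by (intro sum_nonneg nonneg)
  have hm: "(\<lambda>z. h (fst z) (snd z)) \<in> borel_measurable (borel \<Otimes>\<^sub>M fin_config_space)"
    unfolding h_def by measurable
  have "(\<Sum>x\<in>\<eta>. \<integral>\<^sup>+y. ennreal (a (x - y) * G (insert y \<eta>)) \<partial>lborel) * ennreal (w (card \<eta>)) = (\<integral>\<^sup>+y. h y \<eta> \<partial>lborel)"
    if "\<eta> \<in> space lebesgue_poisson" for \<eta>
  proof -
    have [measurable]: "\<eta> \<in> space fin_config_space" using that by simp
    have "(\<Sum>x\<in>\<eta>. \<integral>\<^sup>+y. ennreal (a (x - y) * G (insert y \<eta>)) \<partial>lborel) * ennreal (w (card \<eta>))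
        = (\<integral>\<^sup>+y. (\<Sum>x\<in>\<eta>. ennreal (a (x - y) * G (insert y \<eta>))) * ennreal (w (card \<eta>)) \<partial>lborel)"
      by (subst nn_integral_multc) (simp_all add: nn_integral_sum)
    also have "\<dots> = (\<integral>\<^sup>+y. h y \<eta> \<partial>lborel)"
      unfolding h_def using nonneg G0 w s0
      by (intro nn_integral_cong) (simp add: sum_ennreal ennreal_mult[symmetric] sum_nonneg sum_distrib_right)
    finally show ?thesis .
  qed
  then have "(\<integral>\<^sup>+\<eta>. (\<Sum>x\<in>\<eta>. \<integral>\<^sup>+y. ennreal (a (x - y) * G (insert y \<eta>)) \<partial>lborel) * ennreal (w (card \<eta>)) \<partial>lebesgue_poisson)
      = (\<integral>\<^sup>+\<eta>. \<integral>\<^sup>+y. h y \<eta> \<partial>lborel \<partial>lebesgue_poisson)"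
    by (rule nn_integral_cong)
  also have "\<dots> = (\<integral>\<^sup>+\<eta>. (\<Sum>y\<in>\<eta>. h y (\<eta> - {y})) \<partial>lebesgue_poisson)"
    by (rule mecke_nn_integral[OF hm, symmetric])
  also have "\<dots> = (\<integral>\<^sup>+\<eta>. ennreal (G \<eta> * (pair_sum a \<eta> * w (card \<eta> - 1))) \<partial>lebesgue_poisson)"
  proof (rule nn_integral_cong)
    fix \<eta> :: "'a set" assume "\<eta> \<in> space lebesgue_poisson"
    then have fin: "finite \<eta>" by simp
    have "(\<Sum>y\<in>\<eta>. h y (\<eta> - {y})) = (\<Sum>y\<in>\<eta>. ennreal ((\<Sum>x\<in>\<eta> - {y}. a (x - y)) * (G \<eta> * w (card \<eta> - 1))))"
      unfolding h_def using fin by (intro sum.cong refl) (simp add: insert_absorb mult.assoc)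
    also have "\<dots> = ennreal (\<Sum>y\<in>\<eta>. (\<Sum>x\<in>\<eta> - {y}. a (x - y)) * (G \<eta> * w (card \<eta> - 1)))"
      using s0 G0 w by (intro sum_ennreal mult_nonneg_nonneg)
    also have "\<dots> = ennreal (G \<eta> * (pair_sum a \<eta> * w (card \<eta> - 1)))"
      unfolding sum_distrib_right[symmetric] pair_sum_commute by (simp add: ac_simps)
    finally show "(\<Sum>y\<in>\<eta>. h y (\<eta> - {y})) = ennreal (G \<eta> * (pair_sum a \<eta> * w (card \<eta> - 1)))" .
  qed
  finally show ?thesis .
qed

lemma competition_nn_integral:
  assumes [measurable]: "G \<in> borel_measurable fin_config_space" and G0: "\<And>\<eta>. 0 \<le> G \<eta>" and w: "\<And>n::nat. 0 \<le> w n"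
  shows "(\<integral>\<^sup>+\<eta>. ennreal ((\<Sum>x\<in>\<eta>. \<Sum>y\<in>\<eta> - {x}. a (x - y) * G (\<eta> - {x})) * w (card \<eta>)) \<partial>lebesgue_poisson)
       = (\<integral>\<^sup>+\<eta>. ennreal (G \<eta> * (real (card \<eta>) * mass * w (card \<eta> + 1))) \<partial>lebesgue_poisson)"
proof -
  define h where "h x \<eta> = ennreal ((\<Sum>y\<in>\<eta>. a (x - y)) * (G \<eta> * w (card \<eta> + 1)))" for x \<eta>
  have s0: "0 \<le> (\<Sum>y\<in>\<eta>. a (x - y))" for \<eta> x by (intro sum_nonneg nonneg)
  have hm: "(\<lambda>z. h (fst z) (snd z)) \<in> borel_measurable (borel \<Otimes>\<^sub>M fin_config_space)"
    unfolding h_def by measurable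
  have "ennreal ((\<Sum>x\<in>\<eta>. \<Sum>y\<in>\<eta> - {x}. a (x - y) * G (\<eta> - {x})) * w (card \<eta>)) = (\<Sum>x\<in>\<eta>. h x (\<eta> - {x}))"
    if "\<eta> \<in> space lebesgue_poisson" for \<eta>
  proof -
    have fin: "finite \<eta>" using that by simp
    have "(\<Sum>x\<in>\<eta>. h x (\<eta> - {x})) = (\<Sum>x\<in>\<eta>. ennreal ((\<Sum>y\<in>\<eta> - {x}. a (x - y)) * (G (\<eta> - {x}) * w (card \<eta>))))"
      unfolding h_def using fin by (intro sum.cong refl) (simp add: card_gt_0_iff Suc_leI, metis card_gt_0_iff empty_iff Suc_pred)
    also have "\<dots> = ennreal (\<Sum>x\<in>\<eta>. (\<Sum>y\<in>\<eta> - {x}. a (x - y)) * (G (\<eta> - {x}) * w (card \<eta>)))"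
      using s0 G0 w by (intro sum_ennreal mult_nonneg_nonneg)
    finally show ?thesis by (simp add: sum_distrib_right mult.assoc)
  qed
  then have "(\<integral>\<^sup>+\<eta>. ennreal ((\<Sum>x\<in>\<eta>. \<Sum>y\<in>\<eta> - {x}. a (x - y) * G (\<eta> - {x})) * w (card \<eta>)) \<partial>lebesgue_poisson)
      = (\<integral>\<^sup>+\<eta>. (\<Sum>x\<in>\<eta>. h x (\<eta> - {x})) \<partial>lebesgue_poisson)"
    by (rule nn_integral_cong)
  also have "\<dots> = (\<integral>\<^sup>+\<eta>. \<integral>\<^sup>+x. h x \<eta> \<partial>lborel \<partial>lebesgue_poisson)"
    by (rule mecke_nn_integral[OF hm])
  also have "\<dots> = (\<integral>\<^sup>+\<eta>. ennreal (G \<eta> * (real (card \<eta>) * mass * w (card \<eta> + 1))) \<partial>lebesgue_poisson)"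
  proof (rule nn_integral_cong)
    fix \<eta> :: "'a set"
    have "(\<integral>\<^sup>+x. h x \<eta> \<partial>lborel) = (\<integral>\<^sup>+x. (\<Sum>y\<in>\<eta>. ennreal (a (x - y))) * ennreal (G \<eta> * w (card \<eta> + 1)) \<partial>lborel)"
      unfolding h_def using nonneg G0 w s0
      by (intro nn_integral_cong) (simp add: sum_ennreal ennreal_mult)
    also have "\<dots> = ennreal (real (card \<eta>) * mass) * ennreal (G \<eta> * w (card \<eta> + 1))"
      using mass_nonneg by (subst nn_integral_multc)
        (simp_all add: nn_integral_sum nn_integral_kernel ennreal_of_nat_eq_real_of_nat ennreal_mult)
    also have "\<dots> = ennreal (G \<eta> * (real (card \<eta>) * mass * w (card \<eta> + 1)))"
      using mass_nonneg G0 w by (simp add: ennreal_mult[symmetric] ac_simps)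
    finally show "(\<integral>\<^sup>+x. h x \<eta> \<partial>lborel) = ennreal (G \<eta> * (real (card \<eta>) * mass * w (card \<eta> + 1)))" .
  qed
  finally show ?thesis .
qed

lemma replacement_nn_integral:
  assumes [measurable]: "G \<in> borel_measurable fin_config_space" "k \<in> borel_measurable fin_config_space"
    and G0: "\<And>\<eta>. 0 \<le> G \<eta>" and k0: "\<And>\<eta>. 0 \<le> k \<eta>"
  shows "(\<integral>\<^sup>+\<eta>. (\<Sum>x\<in>\<eta>. \<integral>\<^sup>+y. ennreal (a (x - y) * G (insert y (\<eta> - {x}))) \<partial>lborel) * ennreal (k \<eta>) \<partial>lebesgue_poisson)
       = (\<integral>\<^sup>+\<xi>. \<integral>\<^sup>+x. \<integral>\<^sup>+y. ennreal (a (x - y) * G (insert y \<xi>) * k (insert x \<xi>)) \<partial>lborel \<partial>lborel \<partial>lebesgue_poisson)"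
proof -
  define h where "h x \<xi> = (\<integral>\<^sup>+y. ennreal (a (x - y) * G (insert y \<xi>) * k (insert x \<xi>)) \<partial>lborel)" for x \<xi>
  have hm: "(\<lambda>z. h (fst z) (snd z)) \<in> borel_measurable (borel \<Otimes>\<^sub>M fin_config_space)"
    unfolding h_def by measurable
  have "(\<Sum>x\<in>\<eta>. \<integral>\<^sup>+y. ennreal (a (x - y) * G (insert y (\<eta> - {x}))) \<partial>lborel) * ennreal (k \<eta>) = (\<Sum>x\<in>\<eta>. h x (\<eta> - {x}))"
    if "\<eta> \<in> space lebesgue_poisson" for \<eta>
    unfolding sum_distrib_right
  proof (rule sum.cong[OF refl])
    fix x assume x: "x \<in> \<eta>"
    have [measurable]: "\<eta> - {x} \<in> space fin_config_space" using that by simp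
    have "(\<integral>\<^sup>+y. ennreal (a (x - y) * G (insert y (\<eta> - {x}))) \<partial>lborel) * ennreal (k \<eta>)
      = (\<integral>\<^sup>+y. ennreal (a (x - y) * G (insert y (\<eta> - {x}))) * ennreal (k \<eta>) \<partial>lborel)"
      by (rule nn_integral_multc[symmetric]) measurable
    also have "\<dots> = h x (\<eta> - {x})"
      unfolding h_def using x nonneg G0 k0 by (intro nn_integral_cong) (simp add: insert_absorb ennreal_mult)
    finally show "(\<integral>\<^sup>+y. ennreal (a (x - y) * G (insert y (\<eta> - {x}))) \<partial>lborel) * ennreal (k \<eta>) = h x (\<eta> - {x})" .
  qed
  then have "(\<integral>\<^sup>+\<eta>. (\<Sum>x\<in>\<eta>. \<integral>\<^sup>+y. ennreal (a (x - y) * G (insert y (\<eta> - {x}))) \<partial>lborel) * ennreal (k \<eta>) \<partial>lebesgue_poisson)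
      = (\<integral>\<^sup>+\<eta>. (\<Sum>x\<in>\<eta>. h x (\<eta> - {x})) \<partial>lebesgue_poisson)"
    by (rule nn_integral_cong)
  also have "\<dots> = (\<integral>\<^sup>+\<xi>. \<integral>\<^sup>+x. h x \<xi> \<partial>lborel \<partial>lebesgue_poisson)"
    by (rule mecke_nn_integral[OF hm])
  finally show ?thesis unfolding h_def .
qed

lemma replacement_nn_integral_card:
  assumes [measurable]: "G \<in> borel_measurable fin_config_space" and G0: "\<And>\<eta>. 0 \<le> G \<eta>" and w: "\<And>n::nat. 0 \<le> w n"
  shows "(\<integral>\<^sup>+\<eta>. (\<Sum>x\<in>\<eta>. \<integral>\<^sup>+y. ennreal (a (x - y) * G (insert y (\<eta> - {x}))) \<partial>lborel) * ennreal (w (card \<eta>)) \<partial>lebesgue_poisson)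
       = (\<integral>\<^sup>+\<eta>. ennreal (G \<eta> * (real (card \<eta>) * mass * w (card \<eta>))) \<partial>lebesgue_poisson)"
proof -
  let ?h = "\<lambda>y \<xi>. ennreal (mass * G (insert y \<xi>) * w (card (insert y \<xi>)))"
  have [measurable]: "(\<lambda>\<omega>. w (card (g \<omega>))) \<in> borel_measurable M"
    if "g \<in> M \<rightarrow>\<^sub>M fin_config_space" for g :: "'b \<Rightarrow> 'a set" and M
    using measurable_compose[OF that borel_measurable_card_config[of w]] .
  have hm: "(\<lambda>z. ?h (fst z) (snd z)) \<in> borel_measurable (borel \<Otimes>\<^sub>M fin_config_space)" by measurable
  have "(\<integral>\<^sup>+\<eta>. (\<Sum>x\<in>\<eta>. \<integral>\<^sup>+y. ennreal (a (x - y) * G (insert y (\<eta> - {x}))) \<partial>lborel) * ennreal (w (card \<eta>)) \<partial>lebesgue_poisson)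
      = (\<integral>\<^sup>+\<xi>. \<integral>\<^sup>+x. \<integral>\<^sup>+y. ennreal (a (x - y) * G (insert y \<xi>) * w (card (insert x \<xi>))) \<partial>lborel \<partial>lborel \<partial>lebesgue_poisson)"
    by (rule replacement_nn_integral) (use G0 w in auto)
  also have "\<dots> = (\<integral>\<^sup>+\<xi>. \<integral>\<^sup>+y. ?h y \<xi> \<partial>lborel \<partial>lebesgue_poisson)"
  proof (rule nn_integral_cong)
    fix \<xi> :: "'a set" assume xi: "\<xi> \<in> space lebesgue_poisson"
    then have [measurable]: "\<xi> \<in> space fin_config_space" by simp
    have ae: "AE x in lborel. x \<notin> \<xi>"
      using xi by (intro AE_I'[of \<xi>]) (auto simp: finite_imp_null_set_lborel)
    have "(\<integral>\<^sup>+x. \<integral>\<^sup>+y. ennreal (a (x - y) * G (insert y \<xi>) * w (card (insert x \<xi>))) \<partial>lborel \<partial>lborel)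
        = (\<integral>\<^sup>+x. \<integral>\<^sup>+y. ennreal (a (x - y) * G (insert y \<xi>) * w (card \<xi> + 1)) \<partial>lborel \<partial>lborel)"
      by (rule nn_integral_cong_AE) (use ae xi in \<open>auto elim!: eventually_mono\<close>)
    also have "\<dots> = (\<integral>\<^sup>+y. \<integral>\<^sup>+x. ennreal (a (x - y) * G (insert y \<xi>) * w (card \<xi> + 1)) \<partial>lborel \<partial>lborel)"
      by (rule lborel_pair.Fubini'[symmetric]) measurable
    also have "\<dots> = (\<integral>\<^sup>+y. ennreal mass * ennreal (G (insert y \<xi>) * w (card \<xi> + 1)) \<partial>lborel)"
      using nonneg G0 w
      by (intro nn_integral_cong) (simp add: ennreal_mult mult.assoc nn_integral_multc nn_integral_kernel)
    also have "\<dots> = (\<integral>\<^sup>+y. ?h y \<xi> \<partial>lborel)"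
    proof (rule nn_integral_cong_AE, use ae in eventually_elim)
      fix y assume "y \<notin> \<xi>"
      then show "ennreal mass * ennreal (G (insert y \<xi>) * w (card \<xi> + 1)) = ?h y \<xi>"
        using xi mass_nonneg G0 w by (simp add: ennreal_mult mult.assoc)
    qed
    finally show "(\<integral>\<^sup>+x. \<integral>\<^sup>+y. ennreal (a (x - y) * G (insert y \<xi>) * w (card (insert x \<xi>))) \<partial>lborel \<partial>lborel)
        = (\<integral>\<^sup>+y. ?h y \<xi> \<partial>lborel)" .
  qed
  also have "\<dots> = (\<integral>\<^sup>+\<eta>. (\<Sum>y\<in>\<eta>. ?h y (\<eta> - {y})) \<partial>lebesgue_poisson)"
    by (rule mecke_nn_integral[OF hm, symmetric])
  also have "\<dots> = (\<integral>\<^sup>+\<eta>. ennreal (G \<eta> * (real (card \<eta>) * mass * w (card \<eta>))) \<partial>lebesgue_poisson)"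
  proof (rule nn_integral_cong)
    fix \<eta> :: "'a set"
    have "(\<Sum>y\<in>\<eta>. ?h y (\<eta> - {y})) = (\<Sum>y\<in>\<eta>. ennreal (mass * G \<eta> * w (card \<eta>)))"
      by (intro sum.cong refl) (simp add: insert_absorb)
    also have "\<dots> = ennreal (G \<eta> * (real (card \<eta>) * mass * w (card \<eta>)))"
      using mass_nonneg G0 w by (simp add: ennreal_of_nat_eq_real_of_nat ennreal_mult[symmetric] ac_simps)
    finally show "(\<Sum>y\<in>\<eta>. ?h y (\<eta> - {y})) = ennreal (G \<eta> * (real (card \<eta>) * mass * w (card \<eta>)))" .
  qed
  finally show ?thesis .
qed

text \<open>The same terms acting on signed functions; these are Bochner integrals, to which the estimates above
  carry over through the absolute values.\<close>

definition birth_term where "birth_term G \<eta> = (\<Sum>x\<in>\<eta>. \<integral>y. a (x - y) * G (\<eta> \<union> {y}) \<partial>lborel)"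
definition competition_term where "competition_term G \<eta> = (\<Sum>x\<in>\<eta>. \<Sum>y\<in>\<eta> - {x}. a (x - y) * G (\<eta> - {x}))"
definition replacement_term where "replacement_term G \<eta> = (\<Sum>x\<in>\<eta>. \<integral>y. a (x - y) * G ((\<eta> - {x}) \<union> {y}) \<partial>lborel)"

lemma term_measurable:
  assumes [measurable]: "G \<in> borel_measurable fin_config_space"
  shows "birth_term G \<in> borel_measurable fin_config_space" "competition_term G \<in> borel_measurable fin_config_space"
    "replacement_term G \<in> borel_measurable fin_config_space"
  unfolding birth_term_def[abs_def] competition_term_def[abs_def] replacement_term_def[abs_def]
    Un_insert_right Un_empty_right by measurable

lemma weighted_bound_aux:
  fixes T q :: "'a set \<Rightarrow> real"
  assumes [measurable]: "T \<in> borel_measurable fin_config_space" "q \<in> borel_measurable fin_config_space"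
    and V: "integrable lebesgue_poisson V" "\<And>\<eta>. 0 \<le> V \<eta>"
    and q: "AE \<eta> in lebesgue_poisson. \<bar>q \<eta>\<bar> \<le> w (card \<eta>)"
    and T: "\<And>\<eta>. finite \<eta> \<Longrightarrow> ennreal \<bar>T \<eta>\<bar> \<le> T' \<eta>"
    and eq: "(\<integral>\<^sup>+\<eta>. T' \<eta> * ennreal (w (card \<eta>)) \<partial>lebesgue_poisson) = (\<integral>\<^sup>+\<eta>. ennreal (V \<eta>) \<partial>lebesgue_poisson)"
  shows "integrable lebesgue_poisson (\<lambda>\<eta>. T \<eta> * q \<eta>)"
    and "\<bar>\<langle>T, q\<rangle>\<bar> \<le> (\<integral>\<eta>. V \<eta> \<partial>lebesgue_poisson)"
proof -
  have le: "(\<integral>\<^sup>+\<eta>. ennreal \<bar>T \<eta> * q \<eta>\<bar> \<partial>lebesgue_poisson) \<le> ennreal (\<integral>\<eta>. V \<eta> \<partial>lebesgue_poisson)"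
  proof -
    have "(\<integral>\<^sup>+\<eta>. ennreal \<bar>T \<eta> * q \<eta>\<bar> \<partial>lebesgue_poisson) \<le> (\<integral>\<^sup>+\<eta>. T' \<eta> * ennreal (w (card \<eta>)) \<partial>lebesgue_poisson)"
    proof (rule nn_integral_mono_AE, use q AE_space in eventually_elim)
      case (elim \<eta>)
      then show ?case using T[of \<eta>]
        by (simp add: abs_mult ennreal_mult) (intro mult_mono ennreal_leI; simp)
    qed
    also have "\<dots> = ennreal (\<integral>\<eta>. V \<eta> \<partial>lebesgue_poisson)"
      unfolding eq using V by (intro nn_integral_eq_integral) auto
    finally show ?thesis .
  qed
  show i: "integrable lebesgue_poisson (\<lambda>\<eta>. T \<eta> * q \<eta>)"
    by (rule integrableI_bounded) (use le in \<open>auto intro: order.strict_trans1\<close>)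
  have "ennreal \<bar>\<langle>T, q\<rangle>\<bar> \<le> ennreal (\<integral>\<eta>. V \<eta> \<partial>lebesgue_poisson)"
    using abs_integral_le_nn_integral le by (rule order_trans)
  then show "\<bar>\<langle>T, q\<rangle>\<bar> \<le> (\<integral>\<eta>. V \<eta> \<partial>lebesgue_poisson)"
    by (subst (asm) ennreal_le_iff) (auto intro!: Bochner_Integration.integral_nonneg V)
qed

lemma weight_integrable:
  assumes G: "G \<in> Bbs" and v: "\<And>\<eta>. finite \<eta> \<Longrightarrow> \<bar>W \<eta>\<bar> \<le> v (card \<eta>)" and W: "W \<in> borel_measurable fin_config_space"
  shows "integrable lebesgue_poisson (\<lambda>\<eta>. \<bar>G \<eta>\<bar> * W \<eta>)"
  by (rule integrable_Bbs_mult[OF Bbs_abs[OF G] W, of v]) (auto intro!: AE_I2 v)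

lemma weighted_bounds:
  fixes q :: "'a set \<Rightarrow> real"
  assumes G: "G \<in> Bbs" and q[measurable]: "q \<in> borel_measurable fin_config_space"
    and qw: "AE \<eta> in lebesgue_poisson. \<bar>q \<eta>\<bar> \<le> w (card \<eta>)" and w: "\<And>n::nat. 0 \<le> w n"
  shows "integrable lebesgue_poisson (\<lambda>\<eta>. birth_term G \<eta> * q \<eta>)"
    and "integrable lebesgue_poisson (\<lambda>\<eta>. \<bar>G \<eta>\<bar> * (pair_sum a \<eta> * w (card \<eta> - 1)))"
    and "\<bar>\<langle>birth_term G, q\<rangle>\<bar>
      \<le> (\<integral>\<eta>. \<bar>G \<eta>\<bar> * (pair_sum a \<eta> * w (card \<eta> - 1)) \<partial>lebesgue_poisson)"
    and "integrable lebesgue_poisson (\<lambda>\<eta>. competition_term G \<eta> * q \<eta>)"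
    and "integrable lebesgue_poisson (\<lambda>\<eta>. \<bar>G \<eta>\<bar> * (real (card \<eta>) * mass * w (card \<eta> + 1)))"
    and "\<bar>\<langle>competition_term G, q\<rangle>\<bar>
      \<le> (\<integral>\<eta>. \<bar>G \<eta>\<bar> * (real (card \<eta>) * mass * w (card \<eta> + 1)) \<partial>lebesgue_poisson)"
    and "integrable lebesgue_poisson (\<lambda>\<eta>. replacement_term G \<eta> * q \<eta>)"
    and "integrable lebesgue_poisson (\<lambda>\<eta>. \<bar>G \<eta>\<bar> * (real (card \<eta>) * mass * w (card \<eta>)))"
    and "\<bar>\<langle>replacement_term G, q\<rangle>\<bar>
      \<le> (\<integral>\<eta>. \<bar>G \<eta>\<bar> * (real (card \<eta>) * mass * w (card \<eta>)) \<partial>lebesgue_poisson)"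
proof -
  note Gm[measurable] = Bbs_measurable[OF G]
  have aG[measurable]: "(\<lambda>\<eta>. \<bar>G \<eta>\<bar>) \<in> borel_measurable fin_config_space" by measurable
  obtain M where M: "M \<ge> 0" "\<And>\<eta>. pair_sum a \<eta> \<le> M * real (card \<eta>) ^ 2" using pair_sum_bound by blast
  show i1: "integrable lebesgue_poisson (\<lambda>\<eta>. \<bar>G \<eta>\<bar> * (pair_sum a \<eta> * w (card \<eta> - 1)))"
    by (rule weight_integrable[OF G, of _ "\<lambda>n. M * real n ^ 2 * w (n - 1)"])
      (use M pair_sum_nonneg w in \<open>auto simp: abs_mult intro!: mult_right_mono\<close>)
  show i2: "integrable lebesgue_poisson (\<lambda>\<eta>. \<bar>G \<eta>\<bar> * (real (card \<eta>) * mass * w (card \<eta> + 1)))"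
    by (rule weight_integrable[OF G, of _ "\<lambda>n. real n * mass * w (n + 1)"]) (use w mass_nonneg in \<open>auto simp: abs_mult\<close>)
  show i3: "integrable lebesgue_poisson (\<lambda>\<eta>. \<bar>G \<eta>\<bar> * (real (card \<eta>) * mass * w (card \<eta>)))"
    by (rule weight_integrable[OF G, of _ "\<lambda>n. real n * mass * w n"]) (use w mass_nonneg in \<open>auto simp: abs_mult\<close>)
  have T1: "ennreal \<bar>birth_term G \<eta>\<bar> \<le> (\<Sum>x\<in>\<eta>. \<integral>\<^sup>+y. ennreal (a (x - y) * \<bar>G (insert y \<eta>)\<bar>) \<partial>lborel)" for \<eta>
  proof -
    have "ennreal \<bar>birth_term G \<eta>\<bar> \<le> ennreal (\<Sum>x\<in>\<eta>. \<bar>\<integral>y. a (x - y) * G (insert y \<eta>) \<partial>lborel\<bar>)"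
      unfolding birth_term_def by (intro ennreal_leI) simp
    also have "\<dots> = (\<Sum>x\<in>\<eta>. ennreal \<bar>\<integral>y. a (x - y) * G (insert y \<eta>) \<partial>lborel\<bar>)" by (simp add: sum_ennreal)
    also have "\<dots> \<le> (\<Sum>x\<in>\<eta>. \<integral>\<^sup>+y. ennreal (a (x - y) * \<bar>G (insert y \<eta>)\<bar>) \<partial>lborel)"
      using abs_integral_le_nn_integral[of lborel "\<lambda>y. a (x - y) * G (insert y \<eta>)" for x] nonneg
      by (intro sum_mono) (simp add: abs_mult)
    finally show ?thesis .
  qed
  show "integrable lebesgue_poisson (\<lambda>\<eta>. birth_term G \<eta> * q \<eta>)"
    "\<bar>\<langle>birth_term G, q\<rangle>\<bar>
      \<le> (\<integral>\<eta>. \<bar>G \<eta>\<bar> * (pair_sum a \<eta> * w (card \<eta> - 1)) \<partial>lebesgue_poisson)"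
    by (rule weighted_bound_aux[OF term_measurable(1)[OF Gm] q i1 _ qw T1 birth_nn_integral[OF aG _ w]];
        use pair_sum_nonneg w in simp)+
  have T2: "ennreal \<bar>competition_term G \<eta>\<bar> \<le> ennreal (\<Sum>x\<in>\<eta>. \<Sum>y\<in>\<eta> - {x}. a (x - y) * \<bar>G (\<eta> - {x})\<bar>)" for \<eta>
    unfolding competition_term_def using nonneg
    by (intro ennreal_leI order_trans[OF sum_abs] sum_mono) (simp add: abs_mult flip: sum_distrib_right)
  have w': "ennreal (\<Sum>x\<in>\<eta>. \<Sum>y\<in>\<eta> - {x}. a (x - y) * \<bar>G (\<eta> - {x})\<bar>) * ennreal (w n)
      = ennreal ((\<Sum>x\<in>\<eta>. \<Sum>y\<in>\<eta> - {x}. a (x - y) * \<bar>G (\<eta> - {x})\<bar>) * w n)" for \<eta> n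
    using nonneg w by (intro ennreal_mult[symmetric] sum_nonneg) auto
  have e2: "(\<integral>\<^sup>+\<eta>. ennreal (\<Sum>x\<in>\<eta>. \<Sum>y\<in>\<eta> - {x}. a (x - y) * \<bar>G (\<eta> - {x})\<bar>) * ennreal (w (card \<eta>)) \<partial>lebesgue_poisson)
      = (\<integral>\<^sup>+\<eta>. ennreal (\<bar>G \<eta>\<bar> * (real (card \<eta>) * mass * w (card \<eta> + 1))) \<partial>lebesgue_poisson)"
    unfolding w' by (rule competition_nn_integral[OF aG _ w]) simp
  have p2: "0 \<le> \<bar>G \<eta>\<bar> * (real (card \<eta>) * mass * w (card \<eta> + 1))" for \<eta>
    using mass_nonneg w by simp
  show "integrable lebesgue_poisson (\<lambda>\<eta>. competition_term G \<eta> * q \<eta>)"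
    by (rule weighted_bound_aux(1)[OF term_measurable(2)[OF Gm] q i2 p2 qw T2 e2])
  show "\<bar>\<langle>competition_term G, q\<rangle>\<bar>
      \<le> (\<integral>\<eta>. \<bar>G \<eta>\<bar> * (real (card \<eta>) * mass * w (card \<eta> + 1)) \<partial>lebesgue_poisson)"
    by (rule weighted_bound_aux(2)[OF term_measurable(2)[OF Gm] q i2 p2 qw T2 e2])
  have T3: "ennreal \<bar>replacement_term G \<eta>\<bar> \<le> (\<Sum>x\<in>\<eta>. \<integral>\<^sup>+y. ennreal (a (x - y) * \<bar>G (insert y (\<eta> - {x}))\<bar>) \<partial>lborel)" for \<eta>
  proof -
    have "ennreal \<bar>replacement_term G \<eta>\<bar> \<le> ennreal (\<Sum>x\<in>\<eta>. \<bar>\<integral>y. a (x - y) * G (insert y (\<eta> - {x})) \<partial>lborel\<bar>)"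
      unfolding replacement_term_def by (intro ennreal_leI) simp
    also have "\<dots> = (\<Sum>x\<in>\<eta>. ennreal \<bar>\<integral>y. a (x - y) * G (insert y (\<eta> - {x})) \<partial>lborel\<bar>)" by (simp add: sum_ennreal)
    also have "\<dots> \<le> (\<Sum>x\<in>\<eta>. \<integral>\<^sup>+y. ennreal (a (x - y) * \<bar>G (insert y (\<eta> - {x}))\<bar>) \<partial>lborel)"
      using abs_integral_le_nn_integral[of lborel "\<lambda>y. a (x - y) * G (insert y (\<eta> - {x}))" for x] nonneg
      by (intro sum_mono) (simp add: abs_mult)
    finally show ?thesis .
  qed
  show "integrable lebesgue_poisson (\<lambda>\<eta>. replacement_term G \<eta> * q \<eta>)"
    "\<bar>\<langle>replacement_term G, q\<rangle>\<bar>
      \<le> (\<integral>\<eta>. \<bar>G \<eta>\<bar> * (real (card \<eta>) * mass * w (card \<eta>)) \<partial>lebesgue_poisson)"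
    by (rule weighted_bound_aux[OF term_measurable(3)[OF Gm] q i3 _ qw T3 replacement_nn_integral_card[OF aG _ w]];
        use mass_nonneg w in simp)+
qed

end

context interaction_kernel
begin

text \<open>Birth and competition terms are adjoint to each other with respect to the Lebesgue--Poisson
  measure: both sides pair a configuration with the same configuration enlarged by one particle.\<close>

lemma birth_competition_adjoint:
  fixes f g :: "'a set \<Rightarrow> real"
  assumes [measurable]: "f \<in> borel_measurable fin_config_space" "g \<in> borel_measurable fin_config_space"
    and fin: "(\<integral>\<^sup>+\<eta>. ennreal ((\<Sum>x\<in>\<eta>. \<Sum>y\<in>\<eta> - {x}. a (x - y) * \<bar>g (\<eta> - {x})\<bar>) * \<bar>f \<eta>\<bar>) \<partial>lebesgue_poisson) < \<infinity>"
  shows "integrable lebesgue_poisson (\<lambda>\<eta>. f \<eta> * competition_term g \<eta>)"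
    and "integrable lebesgue_poisson (\<lambda>\<eta>. birth_term f \<eta> * g \<eta>)"
    and "\<langle>birth_term f, g\<rangle> = \<langle>f, competition_term g\<rangle>"
proof -
  define h where "h y \<xi> = (\<Sum>x\<in>\<xi>. a (x - y)) * f (insert y \<xi>) * g \<xi>" for y \<xi>
  have hm: "(\<lambda>z. h (fst z) (snd z)) \<in> borel_measurable (borel \<Otimes>\<^sub>M fin_config_space)"
    unfolding h_def by measurable
  have h1: "h y (\<eta> - {y}) = (\<Sum>x\<in>\<eta> - {y}. a (y - x) * g (\<eta> - {y})) * f \<eta>" if "y \<in> \<eta>" for y \<eta>
    using that by (simp add: h_def insert_absorb sum_distrib_right[symmetric] kernel_commute[of _ y])
  have S: "(\<Sum>y\<in>\<eta>. h y (\<eta> - {y})) = f \<eta> * competition_term g \<eta>" for \<eta>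
    unfolding competition_term_def sum_distrib_left[of "f \<eta>"]
    by (intro sum.cong refl) (simp add: h1 sum_distrib_left mult.commute)
  have Sabs: "(\<Sum>y\<in>\<eta>. ennreal \<bar>h y (\<eta> - {y})\<bar>)
      = ennreal ((\<Sum>x\<in>\<eta>. \<Sum>y\<in>\<eta> - {x}. a (x - y) * \<bar>g (\<eta> - {x})\<bar>) * \<bar>f \<eta>\<bar>)" for \<eta>
  proof -
    have "(\<Sum>y\<in>\<eta>. ennreal \<bar>h y (\<eta> - {y})\<bar>) = ennreal (\<Sum>y\<in>\<eta>. \<bar>h y (\<eta> - {y})\<bar>)"
      by (intro sum_ennreal) simp
    also have "(\<Sum>y\<in>\<eta>. \<bar>h y (\<eta> - {y})\<bar>) = (\<Sum>y\<in>\<eta>. (\<Sum>x\<in>\<eta> - {y}. a (y - x) * \<bar>g (\<eta> - {y})\<bar>) * \<bar>f \<eta>\<bar>)"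
      using nonneg by (intro sum.cong refl)
        (simp add: h1 abs_mult sum_distrib_right[symmetric] sum_nonneg)
    finally show ?thesis by (simp add: sum_distrib_right)
  qed
  note M = mecke_integral[OF hm fin[folded Sabs]]
  have "AE \<xi> in lebesgue_poisson. (\<integral>y. h y \<xi> \<partial>lborel) = birth_term f \<xi> * g \<xi>"
    using M(3) AE_space
  proof eventually_elim
    case (elim \<xi>)
    have fin: "finite \<xi>" using elim by simp
    have [measurable]: "\<xi> \<in> space fin_config_space" using fin by simp
    have i: "integrable lborel (\<lambda>y. a (x - y) * f (insert y \<xi>) * g \<xi>)" if x: "x \<in> \<xi>" for x
    proof (rule Bochner_Integration.integrable_bound[OF elim(1)])
      have "a (x - y) \<le> (\<Sum>x\<in>\<xi>. a (x - y))" for y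
        using x fin nonneg by (intro member_le_sum) auto
      then have "a (x - y) \<le> \<bar>\<Sum>x\<in>\<xi>. a (x - y)\<bar>" for y
        by (rule order_trans[OF _ abs_ge_self])
      then show "AE y in lborel. norm (a (x - y) * f (insert y \<xi>) * g \<xi>) \<le> norm (h y \<xi>)"
        using nonneg by (intro AE_I2) (auto simp: h_def abs_mult intro!: mult_right_mono)
    qed measurable
    have "(\<integral>y. h y \<xi> \<partial>lborel) = (\<integral>y. (\<Sum>x\<in>\<xi>. a (x - y) * f (insert y \<xi>) * g \<xi>) \<partial>lborel)"
      by (simp add: h_def sum_distrib_right)
    also have "\<dots> = (\<Sum>x\<in>\<xi>. \<integral>y. a (x - y) * f (insert y \<xi>) * g \<xi> \<partial>lborel)"
      using i by (rule Bochner_Integration.integral_sum)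
    also have "\<dots> = birth_term f \<xi> * g \<xi>"
      unfolding birth_term_def by (simp add: sum_distrib_right)
    finally show ?case .
  qed
  note AE = this
  show "integrable lebesgue_poisson (\<lambda>\<eta>. f \<eta> * competition_term g \<eta>)" using M(1) unfolding S .
  show "integrable lebesgue_poisson (\<lambda>\<eta>. birth_term f \<eta> * g \<eta>)"
    by (rule Bochner_Integration.integrable_cong_AE_imp[OF M(2)]) (use AE term_measurable(1)[of f] in auto)
  have "\<langle>birth_term f, g\<rangle> = (\<integral>\<xi>. (\<integral>y. h y \<xi> \<partial>lborel) \<partial>lebesgue_poisson)"
    by (rule integral_cong_AE) (use AE term_measurable(1)[of f] borel_measurable_integrable[OF M(2)] in auto)
  also have "\<dots> = \<langle>f, competition_term g\<rangle>"
    using M(4) unfolding S by simp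
  finally show "\<langle>birth_term f, g\<rangle> = \<langle>f, competition_term g\<rangle>" .
qed

text \<open>The replacement term is self-adjoint because the kernel is symmetric.\<close>

lemma replacement_self_adjoint:
  fixes f g :: "'a set \<Rightarrow> real"
  assumes [measurable]: "f \<in> borel_measurable fin_config_space" "g \<in> borel_measurable fin_config_space"
    and fin: "(\<integral>\<^sup>+\<eta>. (\<Sum>x\<in>\<eta>. \<integral>\<^sup>+y. ennreal (a (x - y) * \<bar>f (insert y (\<eta> - {x}))\<bar>) \<partial>lborel) * ennreal \<bar>g \<eta>\<bar> \<partial>lebesgue_poisson) < \<infinity>"
  shows "integrable lebesgue_poisson (\<lambda>\<eta>. f \<eta> * replacement_term g \<eta>)"
    and "integrable lebesgue_poisson (\<lambda>\<eta>. replacement_term f \<eta> * g \<eta>)"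
    and "\<langle>replacement_term f, g\<rangle> = \<langle>f, replacement_term g\<rangle>"
proof -
  define t where "t \<xi> x y = a (x - y) * f (insert y \<xi>) * g (insert x \<xi>)" for \<xi> x y
  have fin3: "(\<integral>\<^sup>+\<xi>. \<integral>\<^sup>+x. \<integral>\<^sup>+y. ennreal \<bar>t \<xi> x y\<bar> \<partial>lborel \<partial>lborel \<partial>lebesgue_poisson) < \<infinity>"
    using fin by (subst (asm) replacement_nn_integral) (auto simp: t_def abs_mult nonneg)
  have tm[measurable]: "(\<lambda>p. t (snd (fst p)) (fst (fst p)) (snd p)) \<in> borel_measurable ((borel \<Otimes>\<^sub>M fin_config_space) \<Otimes>\<^sub>M lborel)"
    "(\<lambda>p. t (snd (fst p)) (snd p) (fst (fst p))) \<in> borel_measurable ((borel \<Otimes>\<^sub>M fin_config_space) \<Otimes>\<^sub>M lborel)"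
    unfolding t_def by measurable
  have tm2: "(\<lambda>(x, y). t \<xi> x y) \<in> borel_measurable (lborel \<Otimes>\<^sub>M lborel)" if "finite \<xi>" for \<xi>
  proof -
    have [measurable]: "\<xi> \<in> space fin_config_space" using that by simp
    show ?thesis unfolding t_def case_prod_beta' by measurable
  qed
  define h where "h x \<xi> = (\<integral>y. a (x - y) * f (insert y \<xi>) \<partial>lborel) * g (insert x \<xi>)" for x \<xi>
  define h' where "h' x \<xi> = (\<integral>y. a (x - y) * g (insert y \<xi>) \<partial>lborel) * f (insert x \<xi>)" for x \<xi>
  have h: "h x \<xi> = (\<integral>y. t \<xi> x y \<partial>lborel)" for x \<xi> by (simp add: h_def t_def)
  have h': "h' x \<xi> = (\<integral>y. t \<xi> y x \<partial>lborel)" for x \<xi>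
    unfolding h'_def integral_mult_left_zero[symmetric]
    by (intro Bochner_Integration.integral_cong refl) (simp add: t_def kernel_commute[of x] ac_simps)
  have hm: "(\<lambda>z. h (fst z) (snd z)) \<in> borel_measurable (borel \<Otimes>\<^sub>M fin_config_space)"
    unfolding h using tm(1) by (intro lborel.borel_measurable_lebesgue_integral) (simp add: case_prod_beta')
  have hm': "(\<lambda>z. h' (fst z) (snd z)) \<in> borel_measurable (borel \<Otimes>\<^sub>M fin_config_space)"
    unfolding h' using tm(2) by (intro lborel.borel_measurable_lebesgue_integral) (simp add: case_prod_beta')
  have amh: "(\<lambda>z. ennreal \<bar>h (fst z) (snd z)\<bar>) \<in> borel_measurable (borel \<Otimes>\<^sub>M fin_config_space)"
    using hm by measurable
  have amh': "(\<lambda>z. ennreal \<bar>h' (fst z) (snd z)\<bar>) \<in> borel_measurable (borel \<Otimes>\<^sub>M fin_config_space)"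
    using hm' by measurable
  have "(\<integral>\<^sup>+\<eta>. (\<Sum>x\<in>\<eta>. ennreal \<bar>h x (\<eta> - {x})\<bar>) \<partial>lebesgue_poisson) = (\<integral>\<^sup>+\<xi>. \<integral>\<^sup>+x. ennreal \<bar>h x \<xi>\<bar> \<partial>lborel \<partial>lebesgue_poisson)"
    by (rule mecke_nn_integral[OF amh])
  also have "\<dots> \<le> (\<integral>\<^sup>+\<xi>. \<integral>\<^sup>+x. \<integral>\<^sup>+y. ennreal \<bar>t \<xi> x y\<bar> \<partial>lborel \<partial>lborel \<partial>lebesgue_poisson)"
    unfolding h by (intro nn_integral_mono abs_integral_le_nn_integral)
  finally have f1: "(\<integral>\<^sup>+\<eta>. (\<Sum>x\<in>\<eta>. ennreal \<bar>h x (\<eta> - {x})\<bar>) \<partial>lebesgue_poisson) < \<infinity>"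
    using fin3 by (rule order.strict_trans1)
  have "(\<integral>\<^sup>+\<eta>. (\<Sum>x\<in>\<eta>. ennreal \<bar>h' x (\<eta> - {x})\<bar>) \<partial>lebesgue_poisson) = (\<integral>\<^sup>+\<xi>. \<integral>\<^sup>+x. ennreal \<bar>h' x \<xi>\<bar> \<partial>lborel \<partial>lebesgue_poisson)"
    by (rule mecke_nn_integral[OF amh'])
  also have "\<dots> \<le> (\<integral>\<^sup>+\<xi>. \<integral>\<^sup>+x. \<integral>\<^sup>+y. ennreal \<bar>t \<xi> y x\<bar> \<partial>lborel \<partial>lborel \<partial>lebesgue_poisson)"
    unfolding h' by (intro nn_integral_mono abs_integral_le_nn_integral)
  also have "\<dots> = (\<integral>\<^sup>+\<xi>. \<integral>\<^sup>+y. \<integral>\<^sup>+x. ennreal \<bar>t \<xi> y x\<bar> \<partial>lborel \<partial>lborel \<partial>lebesgue_poisson)"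
  proof (rule nn_integral_cong)
    fix \<xi> :: "'a set" assume "\<xi> \<in> space lebesgue_poisson"
    then have "(\<lambda>(x, y). t \<xi> x y) \<in> borel_measurable (lborel \<Otimes>\<^sub>M lborel)" by (intro tm2) simp
    then have "(\<lambda>(x, y). ennreal \<bar>t \<xi> x y\<bar>) \<in> borel_measurable (lborel \<Otimes>\<^sub>M lborel)"
      unfolding case_prod_beta' by measurable
    from lborel_pair.Fubini'[OF this]
    show "(\<integral>\<^sup>+x. \<integral>\<^sup>+y. ennreal \<bar>t \<xi> y x\<bar> \<partial>lborel \<partial>lborel) = (\<integral>\<^sup>+y. \<integral>\<^sup>+x. ennreal \<bar>t \<xi> y x\<bar> \<partial>lborel \<partial>lborel)" .
  qed
  finally have f2: "(\<integral>\<^sup>+\<eta>. (\<Sum>x\<in>\<eta>. ennreal \<bar>h' x (\<eta> - {x})\<bar>) \<partial>lebesgue_poisson) < \<infinity>"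
    using fin3 by (rule order.strict_trans1)
  note M = mecke_integral[OF hm f1] and M' = mecke_integral[OF hm' f2]
  have S: "(\<Sum>x\<in>\<eta>. h x (\<eta> - {x})) = replacement_term f \<eta> * g \<eta>" for \<eta>
    unfolding h_def replacement_term_def sum_distrib_right
    by (intro sum.cong refl) (simp add: insert_absorb)
  have S': "(\<Sum>x\<in>\<eta>. h' x (\<eta> - {x})) = f \<eta> * replacement_term g \<eta>" for \<eta>
    unfolding h'_def replacement_term_def sum_distrib_left
    by (intro sum.cong refl) (simp add: insert_absorb)
  show "integrable lebesgue_poisson (\<lambda>\<eta>. f \<eta> * replacement_term g \<eta>)" using M'(1) unfolding S' .
  show "integrable lebesgue_poisson (\<lambda>\<eta>. replacement_term f \<eta> * g \<eta>)" using M(1) unfolding S .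
  have "AE \<xi> in lebesgue_poisson. (\<integral>x. h x \<xi> \<partial>lborel) = (\<integral>x. h' x \<xi> \<partial>lborel)"
  proof -
    have "(\<lambda>\<xi>. \<integral>\<^sup>+x. \<integral>\<^sup>+y. ennreal \<bar>t \<xi> x y\<bar> \<partial>lborel \<partial>lborel) \<in> borel_measurable lebesgue_poisson"
      unfolding measurable_lebesgue_poisson
    proof (rule borel_measurable_config_nn_integral)
      have "(\<lambda>p. ennreal \<bar>t (snd (fst p)) (fst (fst p)) (snd p)\<bar>) \<in> borel_measurable ((borel \<Otimes>\<^sub>M fin_config_space) \<Otimes>\<^sub>M lborel)"
        by measurable
      then show "(\<lambda>z. \<integral>\<^sup>+y. ennreal \<bar>t (snd z) (fst z) y\<bar> \<partial>lborel) \<in> borel_measurable (borel \<Otimes>\<^sub>M fin_config_space)"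
        by (intro lborel.borel_measurable_nn_integral) (simp add: case_prod_beta')
    qed
    from nn_integral_PInf_AE[OF this] fin3
    have "AE \<xi> in lebesgue_poisson. (\<integral>\<^sup>+x. \<integral>\<^sup>+y. ennreal \<bar>t \<xi> x y\<bar> \<partial>lborel \<partial>lborel) \<noteq> \<infinity>" by (simp add: less_top)
    then show ?thesis using AE_space
    proof eventually_elim
      case (elim \<xi>)
      then have m: "(\<lambda>(x, y). t \<xi> x y) \<in> borel_measurable (lborel \<Otimes>\<^sub>M lborel)" by (intro tm2) simp
      have "integrable (lborel \<Otimes>\<^sub>M lborel) (\<lambda>(x, y). t \<xi> x y)"
      proof (rule integrableI_bounded[OF m])
        have "(\<lambda>p. ennreal \<bar>t \<xi> (fst p) (snd p)\<bar>) \<in> borel_measurable (lborel \<Otimes>\<^sub>M lborel)"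
          using m unfolding case_prod_beta' by measurable
        from lborel.nn_integral_fst[OF this]
        have "(\<integral>\<^sup>+p. ennreal \<bar>t \<xi> (fst p) (snd p)\<bar> \<partial>(lborel \<Otimes>\<^sub>M lborel)) = (\<integral>\<^sup>+x. \<integral>\<^sup>+y. ennreal \<bar>t \<xi> x y\<bar> \<partial>lborel \<partial>lborel)"
          by simp
        then show "(\<integral>\<^sup>+p. ennreal (norm (case p of (x, y) \<Rightarrow> t \<xi> x y)) \<partial>(lborel \<Otimes>\<^sub>M lborel)) < \<infinity>"
          using elim(1) by (simp add: case_prod_beta' less_top)
      qed
      from lborel_pair.Fubini_integral[OF this] show ?case unfolding h h' by simp
    qed
  qed
  then have "(\<integral>\<xi>. (\<integral>x. h x \<xi> \<partial>lborel) \<partial>lebesgue_poisson) = (\<integral>\<xi>. (\<integral>x. h' x \<xi> \<partial>lborel) \<partial>lebesgue_poisson)"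
    by (intro integral_cong_AE borel_measurable_integrable M(2) M'(2))
  then show "\<langle>replacement_term f, g\<rangle> = \<langle>f, replacement_term g\<rangle>"
    using M(4) M'(4) unfolding S S' by simp
qed

lemma adjoint_on_test_functions:
  fixes k :: "'a set \<Rightarrow> real"
  assumes G: "G \<in> Bbs" and k[measurable]: "k \<in> borel_measurable fin_config_space"
    and kw: "AE \<eta> in lebesgue_poisson. \<bar>k \<eta>\<bar> \<le> w (card \<eta>)" and w: "\<And>n::nat. 0 \<le> w n"
  shows "integrable lebesgue_poisson (\<lambda>\<eta>. G \<eta> * competition_term k \<eta>)"
    and "\<langle>birth_term G, k\<rangle> = \<langle>G, competition_term k\<rangle>"
    and "integrable lebesgue_poisson (\<lambda>\<eta>. G \<eta> * birth_term k \<eta>)"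
    and "\<langle>competition_term G, k\<rangle> = \<langle>G, birth_term k\<rangle>"
    and "integrable lebesgue_poisson (\<lambda>\<eta>. G \<eta> * replacement_term k \<eta>)"
    and "\<langle>replacement_term G, k\<rangle> = \<langle>G, replacement_term k\<rangle>"
proof -
  note Gm[measurable] = Bbs_measurable[OF G]
  note W = weighted_bounds[OF G k kw w]
  have aG: "(\<lambda>\<eta>. \<bar>G \<eta>\<bar>) \<in> borel_measurable fin_config_space" by measurable
  have fin: "(\<integral>\<^sup>+\<eta>. ennreal (V \<eta>) \<partial>lebesgue_poisson) < \<infinity>" if "integrable lebesgue_poisson V" for V :: "'a set \<Rightarrow> real"
  proof -
    have "(\<integral>\<^sup>+\<eta>. ennreal (V \<eta>) \<partial>lebesgue_poisson) \<le> (\<integral>\<^sup>+\<eta>. ennreal (norm (V \<eta>)) \<partial>lebesgue_poisson)"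
      by (intro nn_integral_mono ennreal_leI) simp
    then show ?thesis using integrableD(2)[OF that] by (simp add: less_top[symmetric])
  qed
  have "(\<integral>\<^sup>+\<eta>. ennreal ((\<Sum>x\<in>\<eta>. \<Sum>y\<in>\<eta> - {x}. a (x - y) * \<bar>k (\<eta> - {x})\<bar>) * \<bar>G \<eta>\<bar>) \<partial>lebesgue_poisson) < \<infinity>"
  proof -
    define h where "h y \<xi> = ennreal ((\<Sum>x\<in>\<xi>. a (x - y)) * \<bar>G (insert y \<xi>)\<bar> * \<bar>k \<xi>\<bar>)" for y \<xi>
    have hm: "(\<lambda>z. h (fst z) (snd z)) \<in> borel_measurable (borel \<Otimes>\<^sub>M fin_config_space)"
      unfolding h_def by measurable
    have "(\<Sum>y\<in>\<eta>. h y (\<eta> - {y})) = ennreal ((\<Sum>x\<in>\<eta>. \<Sum>y\<in>\<eta> - {x}. a (x - y) * \<bar>k (\<eta> - {x})\<bar>) * \<bar>G \<eta>\<bar>)" for \<eta>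
    proof -
      have "(\<Sum>y\<in>\<eta>. h y (\<eta> - {y})) = (\<Sum>y\<in>\<eta>. ennreal ((\<Sum>x\<in>\<eta> - {y}. a (y - x) * \<bar>k (\<eta> - {y})\<bar>) * \<bar>G \<eta>\<bar>))"
        unfolding h_def by (intro sum.cong refl)
          (simp add: insert_absorb sum_distrib_right[symmetric] kernel_commute[of _ y for y] ac_simps)
      also have "\<dots> = ennreal (\<Sum>y\<in>\<eta>. (\<Sum>x\<in>\<eta> - {y}. a (y - x) * \<bar>k (\<eta> - {y})\<bar>) * \<bar>G \<eta>\<bar>)"
        using nonneg by (intro sum_ennreal mult_nonneg_nonneg sum_nonneg) auto
      finally show ?thesis by (simp add: sum_distrib_right)
    qed
    then have "(\<integral>\<^sup>+\<eta>. ennreal ((\<Sum>x\<in>\<eta>. \<Sum>y\<in>\<eta> - {x}. a (x - y) * \<bar>k (\<eta> - {x})\<bar>) * \<bar>G \<eta>\<bar>) \<partial>lebesgue_poisson)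
        = (\<integral>\<^sup>+\<eta>. (\<Sum>y\<in>\<eta>. h y (\<eta> - {y})) \<partial>lebesgue_poisson)" by simp
    also have "\<dots> = (\<integral>\<^sup>+\<eta>. \<integral>\<^sup>+y. h y \<eta> \<partial>lborel \<partial>lebesgue_poisson)"
      by (rule mecke_nn_integral[OF hm])
    also have "\<dots> \<le> (\<integral>\<^sup>+\<eta>. (\<Sum>x\<in>\<eta>. \<integral>\<^sup>+y. ennreal (a (x - y) * \<bar>G (insert y \<eta>)\<bar>) \<partial>lborel) * ennreal (w (card \<eta>)) \<partial>lebesgue_poisson)"
    proof (rule nn_integral_mono_AE, use kw AE_space in eventually_elim)
      case (elim \<eta>)
      have [measurable]: "\<eta> \<in> space fin_config_space" using elim by simp
      have "(\<integral>\<^sup>+y. h y \<eta> \<partial>lborel) \<le> (\<integral>\<^sup>+y. (\<Sum>x\<in>\<eta>. ennreal (a (x - y) * \<bar>G (insert y \<eta>)\<bar>)) * ennreal (w (card \<eta>)) \<partial>lborel)"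
      proof (rule nn_integral_mono)
        fix y
        have "h y \<eta> \<le> ennreal ((\<Sum>x\<in>\<eta>. a (x - y)) * \<bar>G (insert y \<eta>)\<bar> * w (card \<eta>))"
          unfolding h_def using elim nonneg by (intro ennreal_leI mult_left_mono) (auto intro!: sum_nonneg mult_nonneg_nonneg)
        also have "\<dots> = (\<Sum>x\<in>\<eta>. ennreal (a (x - y) * \<bar>G (insert y \<eta>)\<bar>)) * ennreal (w (card \<eta>))"
          using nonneg w by (simp add: sum_ennreal ennreal_mult[symmetric] sum_nonneg sum_distrib_right)
        finally show "h y \<eta> \<le> (\<Sum>x\<in>\<eta>. ennreal (a (x - y) * \<bar>G (insert y \<eta>)\<bar>)) * ennreal (w (card \<eta>))" .
      qed
      also have "\<dots> = (\<Sum>x\<in>\<eta>. \<integral>\<^sup>+y. ennreal (a (x - y) * \<bar>G (insert y \<eta>)\<bar>) \<partial>lborel) * ennreal (w (card \<eta>))"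
        by (subst nn_integral_multc) (simp_all add: nn_integral_sum)
      finally show ?case .
    qed
    also have "\<dots> < \<infinity>"
      by (subst birth_nn_integral[OF aG _ w]) (use fin[OF W(2)] in simp_all)
    finally show ?thesis .
  qed
  note A = birth_competition_adjoint[OF Gm k this]
  show "integrable lebesgue_poisson (\<lambda>\<eta>. G \<eta> * competition_term k \<eta>)"
    "\<langle>birth_term G, k\<rangle> = \<langle>G, competition_term k\<rangle>"
    by (rule A(1), rule A(3))
  have "(\<integral>\<^sup>+\<eta>. ennreal ((\<Sum>x\<in>\<eta>. \<Sum>y\<in>\<eta> - {x}. a (x - y) * \<bar>G (\<eta> - {x})\<bar>) * \<bar>k \<eta>\<bar>) \<partial>lebesgue_poisson)
      \<le> (\<integral>\<^sup>+\<eta>. ennreal ((\<Sum>x\<in>\<eta>. \<Sum>y\<in>\<eta> - {x}. a (x - y) * \<bar>G (\<eta> - {x})\<bar>) * w (card \<eta>)) \<partial>lebesgue_poisson)"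
    using kw nonneg
    by (intro nn_integral_mono_AE) (auto elim!: eventually_mono intro!: ennreal_leI mult_left_mono sum_nonneg)
  also have "\<dots> < \<infinity>"
    by (subst competition_nn_integral[OF aG _ w]) (use fin[OF W(5)] in simp_all)
  finally have "(\<integral>\<^sup>+\<eta>. ennreal ((\<Sum>x\<in>\<eta>. \<Sum>y\<in>\<eta> - {x}. a (x - y) * \<bar>G (\<eta> - {x})\<bar>) * \<bar>k \<eta>\<bar>) \<partial>lebesgue_poisson) < \<infinity>" .
  note B = birth_competition_adjoint[OF k Gm this]
  show "integrable lebesgue_poisson (\<lambda>\<eta>. G \<eta> * birth_term k \<eta>)"
    "\<langle>competition_term G, k\<rangle> = \<langle>G, birth_term k\<rangle>"
    using B(2,3) by (simp_all add: mult.commute)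
  have "(\<integral>\<^sup>+\<eta>. (\<Sum>x\<in>\<eta>. \<integral>\<^sup>+y. ennreal (a (x - y) * \<bar>G (insert y (\<eta> - {x}))\<bar>) \<partial>lborel) * ennreal \<bar>k \<eta>\<bar> \<partial>lebesgue_poisson)
      \<le> (\<integral>\<^sup>+\<eta>. (\<Sum>x\<in>\<eta>. \<integral>\<^sup>+y. ennreal (a (x - y) * \<bar>G (insert y (\<eta> - {x}))\<bar>) \<partial>lborel) * ennreal (w (card \<eta>)) \<partial>lebesgue_poisson)"
    using kw by (intro nn_integral_mono_AE) (auto elim!: eventually_mono intro!: ennreal_leI mult_left_mono)
  also have "\<dots> < \<infinity>"
    by (subst replacement_nn_integral_card[OF aG _ w]) (use fin[OF W(8)] in simp_all)
  finally have "(\<integral>\<^sup>+\<eta>. (\<Sum>x\<in>\<eta>. \<integral>\<^sup>+y. ennreal (a (x - y) * \<bar>G (insert y (\<eta> - {x}))\<bar>) \<partial>lborel) * ennreal \<bar>k \<eta>\<bar> \<partial>lebesgue_poisson) < \<infinity>" .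
  note C = replacement_self_adjoint[OF Gm k this]
  show "integrable lebesgue_poisson (\<lambda>\<eta>. G \<eta> * replacement_term k \<eta>)"
    "\<langle>replacement_term G, k\<rangle> = \<langle>G, replacement_term k\<rangle>"
    by (rule C(1), rule C(3))
qed

text \<open>A bounded function of at most \<open>N\<close> particles is mapped to a bounded function of at most \<open>N + 1\<close>
  particles; locality is lost if the kernel has infinite range.\<close>

lemma term_bounds:
  assumes G: "\<And>\<eta>. finite \<eta> \<Longrightarrow> \<bar>G \<eta>\<bar> \<le> C" "\<And>\<eta>. finite \<eta> \<Longrightarrow> card \<eta> > N \<Longrightarrow> G \<eta> = 0" and fin: "finite \<eta>"
    and M: "\<And>x. a x \<le> M"
  shows "\<bar>birth_term G \<eta>\<bar> \<le> real (card \<eta>) * (mass * C)" "card \<eta> > N \<Longrightarrow> birth_term G \<eta> = 0"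
    "\<bar>competition_term G \<eta>\<bar> \<le> real (card \<eta>) * (real (card \<eta>) * (M * C))" "card \<eta> > Suc N \<Longrightarrow> competition_term G \<eta> = 0"
    "\<bar>replacement_term G \<eta>\<bar> \<le> real (card \<eta>) * (mass * C)" "card \<eta> > Suc N \<Longrightarrow> replacement_term G \<eta> = 0"
proof -
  have C0: "C \<ge> 0" using G(1)[of "{}"] by simp
  have M0: "M \<ge> 0" using order_trans[OF nonneg M] .
  have b: "\<bar>\<integral>y. a (x - y) * G (insert y \<xi>) \<partial>lborel\<bar> \<le> mass * C" if "finite \<xi>" for x \<xi>
  proof -
    have "ennreal \<bar>\<integral>y. a (x - y) * G (insert y \<xi>) \<partial>lborel\<bar> \<le> (\<integral>\<^sup>+y. ennreal \<bar>a (x - y) * G (insert y \<xi>)\<bar> \<partial>lborel)"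
      by (rule abs_integral_le_nn_integral)
    also have "\<dots> \<le> (\<integral>\<^sup>+y. ennreal (a (x - y)) * ennreal C \<partial>lborel)"
      using nonneg G(1) that C0
      by (intro nn_integral_mono) (auto simp: abs_mult ennreal_mult[symmetric] intro!: ennreal_leI mult_left_mono)
    also have "\<dots> = ennreal (mass * C)"
      using mass_nonneg C0 by (simp add: nn_integral_multc nn_integral_kernel ennreal_mult)
    finally show ?thesis using mass_nonneg C0 by (subst (asm) ennreal_le_iff) auto
  qed
  show "\<bar>birth_term G \<eta>\<bar> \<le> real (card \<eta>) * (mass * C)" unfolding birth_term_def
    using b[OF fin] by (intro order_trans[OF sum_abs] sum_bounded_above) simp
  show "\<bar>replacement_term G \<eta>\<bar> \<le> real (card \<eta>) * (mass * C)" unfolding replacement_term_def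
    using b[of "\<eta> - {x}" for x] fin by (intro order_trans[OF sum_abs] sum_bounded_above) simp
  show "\<bar>competition_term G \<eta>\<bar> \<le> real (card \<eta>) * (real (card \<eta>) * (M * C))" unfolding competition_term_def
  proof (rule order_trans[OF sum_abs], rule sum_bounded_above)
    fix x
    have "\<bar>\<Sum>y\<in>\<eta> - {x}. a (x - y) * G (\<eta> - {x})\<bar> \<le> real (card (\<eta> - {x})) * (M * C)"
      using nonneg M G(1) fin M0
      by (intro order_trans[OF sum_abs] sum_bounded_above) (auto simp: abs_mult intro!: mult_mono)
    also have "\<dots> \<le> real (card \<eta>) * (M * C)"
      using fin M0 C0 by (intro mult_right_mono) (auto intro: card_mono)
    finally show "\<bar>\<Sum>y\<in>\<eta> - {x}. a (x - y) * G (\<eta> - {x})\<bar> \<le> real (card \<eta>) * (M * C)" .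
  qed
  show "birth_term G \<eta> = 0" if "card \<eta> > N"
  proof -
    have "G (insert y \<eta>) = 0" for y using fin that by (intro G(2)) (auto simp: card_insert_if)
    then show ?thesis by (simp add: birth_term_def)
  qed
  have z: "card (\<eta> - {x}) > N" if "card \<eta> > Suc N" for x
    using that fin by (auto simp: card_Diff_singleton_if)
  show "competition_term G \<eta> = 0" if "card \<eta> > Suc N"
    unfolding competition_term_def using G(2)[OF _ z[OF that]] fin by simp
  show "replacement_term G \<eta> = 0" if "card \<eta> > Suc N"
  proof -
    have "G (insert y (\<eta> - {x})) = 0" for x y
      using fin z[OF that, of x] by (intro G(2)) (auto simp: card_insert_if)
    then show ?thesis by (simp add: replacement_term_def)
  qed
qed

end

locale spatial_logistic =
  fixes m :: real and am ap :: "'a::euclidean_space \<Rightarrow> real"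
  assumes mortality: "m \<ge> 0" and condition: "condition_G am ap"
begin

sublocale birth: interaction_kernel ap
  using condition by unfold_locales (auto simp: condition_G_def)

sublocale comp: interaction_kernel am
  using condition by unfold_locales (auto simp: condition_G_def)

text \<open>The generator is split as \<open>off_diagonal - death_rate\<close>.  The adjoint of the off-diagonal part maps the weight
  \<open>\<lambda>\<eta>. w |\<eta>|\<close> to \<open>off_weight w\<close>, if all signs are taken positive.  For the empty configuration the truncated
  difference \<open>card \<eta> - 1\<close> is harmless since \<open>pair_sum ap {} = 0\<close>.\<close>

definition off_diagonal where
  "off_diagonal G \<eta> = birth.birth_term G \<eta> - comp.competition_term G \<eta> + birth.replacement_term G \<eta>"

definition off_weight where
  "off_weight w \<eta> = pair_sum ap \<eta> * w (card \<eta> - 1) + real (card \<eta>) * comp.mass * w (card \<eta> + 1)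
     + real (card \<eta>) * birth.mass * w (card \<eta>)"

lemma L_hat_decomp: "L_hat m am ap G \<eta> = off_diagonal G \<eta> - death_rate m am \<eta> * G \<eta>"
  unfolding L_hat_def off_diagonal_def death_rate_def pair_sum_def birth.birth_term_def
    comp.competition_term_def birth.replacement_term_def by (simp add: left_diff_distrib distrib_right)

lemma L_Delta_decomp: "L_Delta m am ap k \<eta> =
    - death_rate m am \<eta> * k \<eta> + birth.competition_term k \<eta> - comp.birth_term k \<eta> + birth.replacement_term k \<eta>"
  unfolding L_Delta_def death_rate_def pair_sum_def birth.competition_term_def
    comp.birth_term_def birth.replacement_term_def by simp

lemma death_rate_measurable [measurable]: "death_rate m am \<in> borel_measurable fin_config_space"
  unfolding death_rate_def[abs_def] by measurable

lemma death_rate_nonneg: "0 \<le> death_rate m am \<eta>"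
  unfolding death_rate_def using mortality comp.pair_sum_nonneg by simp

lemma death_rate_bound: "\<exists>c\<ge>0. \<forall>\<eta>. death_rate m am \<eta> \<le> c * real (card \<eta>) ^ 2"
proof -
  obtain M where M: "M \<ge> 0" "\<And>\<eta>. pair_sum am \<eta> \<le> M * real (card \<eta>) ^ 2" using comp.pair_sum_bound by blast
  have "death_rate m am \<eta> \<le> (m + M) * real (card \<eta>) ^ 2" for \<eta>
  proof -
    have "real (card \<eta>) \<le> real (card \<eta>) ^ 2"
      by (cases "card \<eta> = 0") (auto simp: power2_eq_square)
    then have "m * real (card \<eta>) \<le> m * real (card \<eta>) ^ 2" using mortality by (rule mult_left_mono)
    then show ?thesis using M(2)[of \<eta>] by (simp add: death_rate_def distrib_right)
  qed
  then show ?thesis using M mortality by (intro exI[of _ "m + M"]) auto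
qed

lemma death_rate_locally_bounded:
  "\<exists>M\<ge>0. \<forall>\<eta>. card \<eta> \<le> n \<longrightarrow> death_rate m am \<eta> \<le> M"
proof -
  obtain c where c: "c \<ge> 0" "\<And>\<eta>. death_rate m am \<eta> \<le> c * real (card \<eta>) ^ 2" using death_rate_bound by blast
  have "death_rate m am \<eta> \<le> c * real n ^ 2" if "card \<eta> \<le> n" for \<eta>
  proof -
    have "c * real (card \<eta>) ^ 2 \<le> c * real n ^ 2"
      using c(1) that by (intro mult_left_mono power_mono) auto
    then show ?thesis using c(2)[of \<eta>] by linarith
  qed
  then show ?thesis using c(1) by (intro exI[of _ "c * real n ^ 2"]) auto
qed

lemma L_hat_measurable:
  assumes "G \<in> borel_measurable fin_config_space"
  shows "off_diagonal G \<in> borel_measurable fin_config_space" "L_hat m am ap G \<in> borel_measurable fin_config_space"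
proof -
  note [measurable] = assms birth.term_measurable[OF assms] comp.term_measurable[OF assms]
  show "off_diagonal G \<in> borel_measurable fin_config_space" unfolding off_diagonal_def[abs_def] by measurable
  note [measurable] = this
  show "L_hat m am ap G \<in> borel_measurable fin_config_space" unfolding L_hat_decomp[abs_def] by measurable
qed

lemma off_diagonal_bound:
  fixes q :: "'a set \<Rightarrow> real"
  assumes G: "G \<in> Bbs" and q: "q \<in> borel_measurable fin_config_space"
    and qw: "AE \<eta> in lebesgue_poisson. \<bar>q \<eta>\<bar> \<le> w (card \<eta>)" and w: "\<And>n::nat. 0 \<le> w n"
  shows "integrable lebesgue_poisson (\<lambda>\<eta>. off_diagonal G \<eta> * q \<eta>)"
    and "integrable lebesgue_poisson (\<lambda>\<eta>. \<bar>G \<eta>\<bar> * off_weight w \<eta>)"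
    and "\<bar>\<langle>off_diagonal G, q\<rangle>\<bar> \<le> (\<integral>\<eta>. \<bar>G \<eta>\<bar> * off_weight w \<eta> \<partial>lebesgue_poisson)"
proof -
  note B = birth.weighted_bounds[OF G q qw w] and C = comp.weighted_bounds[OF G q qw w]
  have e: "off_diagonal G \<eta> * q \<eta> = birth.birth_term G \<eta> * q \<eta> - comp.competition_term G \<eta> * q \<eta> + birth.replacement_term G \<eta> * q \<eta>" for \<eta>
    by (simp add: off_diagonal_def algebra_simps)
  have e': "\<bar>G \<eta>\<bar> * off_weight w \<eta> = \<bar>G \<eta>\<bar> * (pair_sum ap \<eta> * w (card \<eta> - 1))
      + \<bar>G \<eta>\<bar> * (real (card \<eta>) * comp.mass * w (card \<eta> + 1)) + \<bar>G \<eta>\<bar> * (real (card \<eta>) * birth.mass * w (card \<eta>))" for \<eta>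
    unfolding off_weight_def distrib_left ..
  show "integrable lebesgue_poisson (\<lambda>\<eta>. off_diagonal G \<eta> * q \<eta>)" unfolding e
    by (intro Bochner_Integration.integrable_add Bochner_Integration.integrable_diff B C)
  show "integrable lebesgue_poisson (\<lambda>\<eta>. \<bar>G \<eta>\<bar> * off_weight w \<eta>)" unfolding e'
    by (intro Bochner_Integration.integrable_add B C)
  have i: "\<langle>off_diagonal G, q\<rangle> = \<langle>birth.birth_term G, q\<rangle>
      - \<langle>comp.competition_term G, q\<rangle> + \<langle>birth.replacement_term G, q\<rangle>"
    unfolding e using B(1,7) C(4) by simp
  have i': "(\<integral>\<eta>. \<bar>G \<eta>\<bar> * off_weight w \<eta> \<partial>lebesgue_poisson) = (\<integral>\<eta>. \<bar>G \<eta>\<bar> * (pair_sum ap \<eta> * w (card \<eta> - 1)) \<partial>lebesgue_poisson)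
      + (\<integral>\<eta>. \<bar>G \<eta>\<bar> * (real (card \<eta>) * comp.mass * w (card \<eta> + 1)) \<partial>lebesgue_poisson)
      + (\<integral>\<eta>. \<bar>G \<eta>\<bar> * (real (card \<eta>) * birth.mass * w (card \<eta>)) \<partial>lebesgue_poisson)"
    unfolding e' by (subst Bochner_Integration.integral_add Bochner_Integration.integral_add[OF B(2) C(5)],
      (intro Bochner_Integration.integrable_add B C)+)+ simp
  show "\<bar>\<langle>off_diagonal G, q\<rangle>\<bar> \<le> (\<integral>\<eta>. \<bar>G \<eta>\<bar> * off_weight w \<eta> \<partial>lebesgue_poisson)"
    unfolding i i' using B(3,9) C(6) by linarith
qed

lemma Bbs_death_rate: "G \<in> Bbs \<Longrightarrow> (\<lambda>\<eta>. death_rate m am \<eta> * G \<eta>) \<in> Bbs"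
  using death_rate_locally_bounded death_rate_nonneg
  by (intro Bbs_mult) (auto, meson)

lemma L_hat_integrable:
  fixes q :: "'a set \<Rightarrow> real"
  assumes G: "G \<in> Bbs" and q: "q \<in> borel_measurable fin_config_space"
    and qw: "AE \<eta> in lebesgue_poisson. \<bar>q \<eta>\<bar> \<le> w (card \<eta>)" and w: "\<And>n::nat. 0 \<le> w n"
  shows "integrable lebesgue_poisson (\<lambda>\<eta>. L_hat m am ap G \<eta> * q \<eta>)"
    and "integrable lebesgue_poisson (\<lambda>\<eta>. death_rate m am \<eta> * G \<eta> * q \<eta>)"
    and "\<langle>L_hat m am ap G, q\<rangle> =
      \<langle>off_diagonal G, q\<rangle> - (\<integral>\<eta>. death_rate m am \<eta> * G \<eta> * q \<eta> \<partial>lebesgue_poisson)"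
proof -
  show i: "integrable lebesgue_poisson (\<lambda>\<eta>. death_rate m am \<eta> * G \<eta> * q \<eta>)"
    by (rule integrable_Bbs_mult[OF Bbs_death_rate[OF G] q qw])
  note o = off_diagonal_bound(1)[OF G q qw w]
  show "integrable lebesgue_poisson (\<lambda>\<eta>. L_hat m am ap G \<eta> * q \<eta>)"
    unfolding L_hat_decomp left_diff_distrib using i o by simp
  show "\<langle>L_hat m am ap G, q\<rangle> =
      \<langle>off_diagonal G, q\<rangle> - (\<integral>\<eta>. death_rate m am \<eta> * G \<eta> * q \<eta> \<partial>lebesgue_poisson)"
    unfolding L_hat_decomp left_diff_distrib using i o by simp
qed

theorem L_hat_L_Delta_duality:
  fixes k :: "'a set \<Rightarrow> real"
  assumes G: "G \<in> Bbs" and k: "k \<in> borel_measurable fin_config_space"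
    and kw: "AE \<eta> in lebesgue_poisson. \<bar>k \<eta>\<bar> \<le> w (card \<eta>)" and w: "\<And>n::nat. 0 \<le> w n"
  shows "\<langle>L_hat m am ap G, k\<rangle> = \<langle>G, L_Delta m am ap k\<rangle>"
proof -
  note B = birth.weighted_bounds[OF G k kw w] and C = comp.weighted_bounds[OF G k kw w]
  note B' = birth.adjoint_on_test_functions[OF G k kw w] and C' = comp.adjoint_on_test_functions[OF G k kw w]
  have d: "integrable lebesgue_poisson (\<lambda>\<eta>. death_rate m am \<eta> * G \<eta> * k \<eta>)"
    by (rule L_hat_integrable(2)[OF G k kw w])
  have e: "off_diagonal G \<eta> * k \<eta> = birth.birth_term G \<eta> * k \<eta> - comp.competition_term G \<eta> * k \<eta> + birth.replacement_term G \<eta> * k \<eta>" for \<eta>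
    by (simp add: off_diagonal_def algebra_simps)
  have e': "G \<eta> * L_Delta m am ap k \<eta> = G \<eta> * birth.competition_term k \<eta> - G \<eta> * comp.birth_term k \<eta>
      + G \<eta> * birth.replacement_term k \<eta> - death_rate m am \<eta> * G \<eta> * k \<eta>" for \<eta>
    by (simp add: L_Delta_decomp algebra_simps)
  show ?thesis
    unfolding L_hat_integrable(3)[OF G k kw w] e e' using B(1,7) C(4) B'(1,3,5) C'(1,3,5) d
    by (simp add: B'(2,6) C'(4))
qed

lemma L_hat_bounded:
  assumes G: "G \<in> Bbs"
  shows "\<exists>C N. \<forall>\<eta>. finite \<eta> \<longrightarrow> \<bar>L_hat m am ap G \<eta>\<bar> \<le> C \<and> (card \<eta> > N \<longrightarrow> L_hat m am ap G \<eta> = 0)"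
proof -
  obtain C N \<Lambda> where L: "C \<ge> 0" "\<And>\<eta>. finite \<eta> \<Longrightarrow> \<bar>G \<eta>\<bar> \<le> C"
    "\<And>\<eta>. finite \<eta> \<Longrightarrow> card \<eta> > N \<or> \<not> \<eta> \<subseteq> \<Lambda> \<Longrightarrow> G \<eta> = 0" using BbsE[OF G] by metis
  have z: "\<And>\<eta>. finite \<eta> \<Longrightarrow> card \<eta> > N \<Longrightarrow> G \<eta> = 0" using L(3) by simp
  obtain Mm where Mm: "\<And>x. am x \<le> Mm" "Mm \<ge> 0" using comp.kernel_bound by blast
  obtain Mp where Mp: "\<And>x. ap x \<le> Mp" "Mp \<ge> 0" using birth.kernel_bound by blast
  obtain D where D: "D \<ge> 0" "\<And>\<eta>. card \<eta> \<le> Suc N \<Longrightarrow> death_rate m am \<eta> \<le> D"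
    using death_rate_locally_bounded[of "Suc N"] by blast
  define n where "n = real (Suc N)"
  have "\<bar>L_hat m am ap G \<eta>\<bar> \<le> n * (birth.mass * C) + n * (n * (Mm * C)) + n * (birth.mass * C) + D * C \<and>
      (card \<eta> > Suc N \<longrightarrow> L_hat m am ap G \<eta> = 0)" if fin: "finite \<eta>" for \<eta>
  proof -
    note B = birth.term_bounds[where G = G and C = C and N = N, OF L(2) z fin Mp(1)] and K = comp.term_bounds[where G = G and C = C and N = N, OF L(2) z fin Mm(1)]
    have zero: "L_hat m am ap G \<eta> = 0" if "card \<eta> > Suc N"
      using B(2,6) K(4) z[OF fin] that by (simp add: L_hat_decomp off_diagonal_def)
    show ?thesis
    proof (cases "card \<eta> > Suc N")
      case True
      then show ?thesis using zero L(1) Mm D birth.mass_nonneg by (simp add: n_def)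
    next
      case False
      then have c: "real (card \<eta>) \<le> n" by (simp add: n_def)
      have "\<bar>death_rate m am \<eta> * G \<eta>\<bar> \<le> D * C"
        unfolding abs_mult using D(2)[of \<eta>] False death_rate_nonneg[of \<eta>] L(2)[OF fin] D(1)
        by (intro mult_mono) auto
      moreover have "\<bar>birth.birth_term G \<eta>\<bar> \<le> n * (birth.mass * C)" "\<bar>birth.replacement_term G \<eta>\<bar> \<le> n * (birth.mass * C)"
      proof -
        have "real (card \<eta>) * (birth.mass * C) \<le> n * (birth.mass * C)"
          using c birth.mass_nonneg L(1) by (intro mult_right_mono) auto
        then show "\<bar>birth.birth_term G \<eta>\<bar> \<le> n * (birth.mass * C)" "\<bar>birth.replacement_term G \<eta>\<bar> \<le> n * (birth.mass * C)"
          using B(1,5) by linarith+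
      qed
      moreover have "\<bar>comp.competition_term G \<eta>\<bar> \<le> n * (n * (Mm * C))"
      proof -
        have "real (card \<eta>) * (real (card \<eta>) * (Mm * C)) \<le> n * (n * (Mm * C))"
          using c Mm L(1) by (intro mult_mono) auto
        then show ?thesis using K(3) by linarith
      qed
      ultimately show ?thesis using False unfolding L_hat_decomp off_diagonal_def by linarith
    qed
  qed
  then show ?thesis by blast
qed

end

section \<open>Correlation functions of weak solutions\<close>

lemma K_norm_less_imp_AE:
  assumes "K_norm \<alpha> f < ereal e"
  shows "exp_bounded e \<alpha> f"
proof -
  have "AE \<eta> in lebesgue_poisson. ereal (\<bar>f \<eta>\<bar> * exp (- \<alpha> * real (card \<eta>))) \<le> K_norm \<alpha> f"
    unfolding K_norm_def by (rule esssup_AE)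
  then show ?thesis
  proof eventually_elim
    case (elim \<eta>)
    then have "ereal (\<bar>f \<eta>\<bar> * exp (- \<alpha> * real (card \<eta>))) < ereal e" using assms by (rule order.strict_trans1)
    then have "\<bar>f \<eta>\<bar> * exp (- \<alpha> * real (card \<eta>)) \<le> e" by simp
    then have "\<bar>f \<eta>\<bar> * exp (- \<alpha> * real (card \<eta>)) * exp (\<alpha> * real (card \<eta>)) \<le> e * exp (\<alpha> * real (card \<eta>))"
      by (rule mult_right_mono) simp
    then show ?case by (simp add: mult.assoc flip: exp_add)
  qed
qed

lemma exp_weight_integrable:
  assumes "G \<in> Bbs"
  shows "integrable lebesgue_poisson (\<lambda>\<eta>. \<bar>G \<eta>\<bar> * (c * exp (\<alpha> * real (card \<eta>))))"
  by (rule integrable_Bbs_mult[OF Bbs_abs[OF assms], of _ "\<lambda>n. \<bar>c\<bar> * exp (\<alpha> * real n)"])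
    (auto intro!: AE_I2 simp: abs_mult borel_measurable_card_config[of "\<lambda>n. c * exp (\<alpha> * real n)"])

lemma integral_test_bound:
  assumes G: "G \<in> Bbs" and p: "p \<in> borel_measurable fin_config_space"
    and bd: "exp_bounded c \<alpha> p"
  shows "integrable lebesgue_poisson (\<lambda>\<eta>. G \<eta> * p \<eta>)"
    and "\<bar>\<langle>G, p\<rangle>\<bar> \<le> c * (\<integral>\<eta>. \<bar>G \<eta>\<bar> * exp (\<alpha> * real (card \<eta>)) \<partial>lebesgue_poisson)"
proof -
  show i: "integrable lebesgue_poisson (\<lambda>\<eta>. G \<eta> * p \<eta>)"
    by (rule integrable_Bbs_mult[OF G p, of "\<lambda>n. c * exp (\<alpha> * real n)"]) (rule bd)
  have "\<bar>\<langle>G, p\<rangle>\<bar> \<le> (\<integral>\<eta>. \<bar>G \<eta> * p \<eta>\<bar> \<partial>lebesgue_poisson)"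
    by (rule integral_abs_bound)
  also have "\<dots> \<le> (\<integral>\<eta>. \<bar>G \<eta>\<bar> * (c * exp (\<alpha> * real (card \<eta>))) \<partial>lebesgue_poisson)"
    by (rule integral_mono_AE[OF integrable_abs[OF i] exp_weight_integrable[OF G]],
        use bd in eventually_elim) (auto simp: abs_mult intro!: mult_left_mono)
  also have "\<dots> = c * (\<integral>\<eta>. \<bar>G \<eta>\<bar> * exp (\<alpha> * real (card \<eta>)) \<partial>lebesgue_poisson)"
    unfolding mult.left_commute[of _ c] by simp
  finally show "\<bar>\<langle>G, p\<rangle>\<bar> \<le> c * (\<integral>\<eta>. \<bar>G \<eta>\<bar> * exp (\<alpha> * real (card \<eta>)) \<partial>lebesgue_poisson)" .
qed

lemma tendsto_integral_test:
  assumes G: "G \<in> Bbs" and p: "eventually (\<lambda>s. p s \<in> borel_measurable fin_config_space) F"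
    and lim: "((\<lambda>s. K_norm \<alpha> (p s)) \<longlongrightarrow> 0) F"
  shows "((\<lambda>s. \<langle>G, p s\<rangle>) \<longlongrightarrow> 0) F"
proof (rule tendstoI)
  fix e :: real assume e: "e > 0"
  define c where "c = (\<integral>\<eta>. \<bar>G \<eta>\<bar> * exp (\<alpha> * real (card \<eta>)) \<partial>lebesgue_poisson)"
  have c: "c \<ge> 0" unfolding c_def by (rule Bochner_Integration.integral_nonneg) simp
  define d where "d = e / (c + 1)"
  have d: "d > 0" "d * c < e" using e c by (auto simp: d_def field_simps)
  have "eventually (\<lambda>s. K_norm \<alpha> (p s) < ereal d) F"
    using order_tendstoD(2)[OF lim, of "ereal d"] d by simp
  then show "eventually (\<lambda>s. dist \<langle>G, p s\<rangle> 0 < e) F" using p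
  proof eventually_elim
    case (elim s)
    have "\<bar>\<langle>G, p s\<rangle>\<bar> \<le> d * c"
      unfolding c_def by (rule integral_test_bound(2)[OF G elim(2) K_norm_less_imp_AE[OF elim(1)]])
    then show ?case using d by simp
  qed
qed

text \<open>Pairing with a test function is continuous on \<open>K_space \<alpha>\<close>, so it commutes with the time derivative.\<close>

lemma classical_solution_derivative:
  assumes cl: "classical_solution m am ap \<alpha> T k0 k" and G: "G \<in> Bbs"
  shows "t \<in> {0..T} \<Longrightarrow> ((\<lambda>s. \<langle>G, k s\<rangle>) has_real_derivative
      \<langle>G, L_Delta m am ap (k t)\<rangle>) (at t within {0..T})"
    and "continuous_on {0..T} (\<lambda>t. \<langle>G, L_Delta m am ap (k t)\<rangle>)"
proof -
  have K: "k t \<in> K_space \<alpha>" "L_Delta m am ap (k t) \<in> K_space \<alpha>" if "t \<in> {0..T}" for t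
    using cl that by (auto simp: classical_solution_def)
  have m: "k t \<in> borel_measurable fin_config_space" "L_Delta m am ap (k t) \<in> borel_measurable fin_config_space"
    if "t \<in> {0..T}" for t using K[OF that] by (auto simp: K_space_def)
  have i: "integrable lebesgue_poisson (\<lambda>\<eta>. G \<eta> * k t \<eta>)"
    "integrable lebesgue_poisson (\<lambda>\<eta>. G \<eta> * L_Delta m am ap (k t) \<eta>)" if "t \<in> {0..T}" for t
    using K_space_bound[OF K(1)[OF that]] K_space_bound[OF K(2)[OF that]] integral_test_bound(1)[OF G] m[OF that] by blast+
  have inS: "eventually (\<lambda>s. s \<in> {0..T}) (at t within {0..T})" for t by (simp add: eventually_at_filter)
  show "((\<lambda>s. \<langle>G, k s\<rangle>) has_real_derivative
      \<langle>G, L_Delta m am ap (k t)\<rangle>) (at t within {0..T})" if t: "t \<in> {0..T}"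
  proof -
    let ?p = "\<lambda>s \<eta>. (k s \<eta> - k t \<eta>) / (s - t) - L_Delta m am ap (k t) \<eta>"
    have "((\<lambda>s. \<integral>\<eta>. G \<eta> * ?p s \<eta> \<partial>lebesgue_poisson) \<longlongrightarrow> 0) (at t within {0..T})"
    proof (rule tendsto_integral_test[OF G])
      show "eventually (\<lambda>s. ?p s \<in> borel_measurable fin_config_space) (at t within {0..T})"
        using inS by eventually_elim (intro borel_measurable_diff borel_measurable_divide m t borel_measurable_const)
      show "((\<lambda>s. K_norm \<alpha> (?p s)) \<longlongrightarrow> 0) (at t within {0..T})"
        using cl t unfolding classical_solution_def by blast
    qed
    moreover have "eventually (\<lambda>s. (\<integral>\<eta>. G \<eta> * ?p s \<eta> \<partial>lebesgue_poisson) =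
        (\<langle>G, k s\<rangle> - \<langle>G, k t\<rangle>) / (s - t)
        - \<langle>G, L_Delta m am ap (k t)\<rangle>) (at t within {0..T})"
      using inS
    proof eventually_elim
      case (elim s)
      have "G \<eta> * ?p s \<eta> = (G \<eta> * k s \<eta> - G \<eta> * k t \<eta>) / (s - t) - G \<eta> * L_Delta m am ap (k t) \<eta>" for \<eta>
        by (simp add: right_diff_distrib)
      then show ?case using i[OF elim] i[OF t] by simp
    qed
    ultimately have "((\<lambda>s. (\<langle>G, k s\<rangle> - \<langle>G, k t\<rangle>) / (s - t)
        - \<langle>G, L_Delta m am ap (k t)\<rangle>) \<longlongrightarrow> 0) (at t within {0..T})"
      by (rule Lim_transform_eventually)
    then show ?thesis unfolding has_field_derivative_iff by (simp add: LIM_zero_iff)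
  qed
  show "continuous_on {0..T} (\<lambda>t. \<langle>G, L_Delta m am ap (k t)\<rangle>)"
    unfolding continuous_on_def
  proof
    fix t assume t: "t \<in> {0..T}"
    let ?p = "\<lambda>s \<eta>. L_Delta m am ap (k s) \<eta> - L_Delta m am ap (k t) \<eta>"
    have "((\<lambda>s. \<integral>\<eta>. G \<eta> * ?p s \<eta> \<partial>lebesgue_poisson) \<longlongrightarrow> 0) (at t within {0..T})"
    proof (rule tendsto_integral_test[OF G])
      show "eventually (\<lambda>s. ?p s \<in> borel_measurable fin_config_space) (at t within {0..T})"
        using inS by eventually_elim (intro borel_measurable_diff m t)
      show "((\<lambda>s. K_norm \<alpha> (?p s)) \<longlongrightarrow> 0) (at t within {0..T})"
        using cl t unfolding classical_solution_def by blast
    qed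
    moreover have "eventually (\<lambda>s. (\<integral>\<eta>. G \<eta> * ?p s \<eta> \<partial>lebesgue_poisson) =
        \<langle>G, L_Delta m am ap (k s)\<rangle>
        - \<langle>G, L_Delta m am ap (k t)\<rangle>) (at t within {0..T})"
      using inS
    proof eventually_elim
      case (elim s)
      show ?case unfolding right_diff_distrib using i[OF elim] i[OF t] by simp
    qed
    ultimately have "((\<lambda>s. \<langle>G, L_Delta m am ap (k s)\<rangle>
        - \<langle>G, L_Delta m am ap (k t)\<rangle>) \<longlongrightarrow> 0) (at t within {0..T})"
      by (rule Lim_transform_eventually)
    then show "((\<lambda>s. \<langle>G, L_Delta m am ap (k s)\<rangle>) \<longlongrightarrow>
        \<langle>G, L_Delta m am ap (k t)\<rangle>) (at t within {0..T})"
      by (simp add: LIM_zero_iff)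
  qed
qed

lemma set_integrable_lebesgue_continuous:
  fixes f :: "real \<Rightarrow> real"
  assumes "continuous_on {a..b} f"
  shows "set_integrable lebesgue {a..b} f"
proof -
  have "integrable lborel (\<lambda>x. indicat_real {a..b} x *\<^sub>R f x)"
    using borel_integrable_atLeastAtMost'[OF assms] by (simp add: set_integrable_def)
  then show ?thesis
    unfolding set_integrable_def by (subst integrable_completion) (auto intro: borel_measurable_integrable)
qed

context spatial_logistic
begin

text \<open>\<open>L F\<close> is represented by the extension of the K-transform at \<open>L_hat G\<close>; by duality its expectation is
  \<open>\<langle>G, L_Delta k\<^sub>t\<rangle>\<close>, the derivative of \<open>\<langle>G, k\<^sub>t\<rangle>\<close>.\<close>

theorem hierarchical_weak_solution:
  fixes \<mu> :: "real \<Rightarrow> 'a set measure"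
  assumes \<mu>0: "config_prob \<mu>0" "correlation_function \<mu>0 k0" "k0 \<in> K_space \<alpha>0"
    and k: "hierarchical_solution m am ap \<alpha>0 k0 k"
    and \<mu>: "\<And>t. t \<ge> 0 \<Longrightarrow> config_prob (\<mu> t)" "\<And>t. t \<ge> 0 \<Longrightarrow> correlation_function (\<mu> t) (k t)"
  shows "weak_solution m am ap \<mu>0 \<mu>"
proof -
  have cl: "\<exists>\<alpha>. classical_solution m am ap \<alpha> T k0 k" if "T > 0" for T
    using k that unfolding hierarchical_solution_def by blast
  have bd: "\<exists>\<alpha> C. C \<ge> 0 \<and> exp_bounded C \<alpha> (k t)" if t: "t \<ge> 0" for t
  proof -
    obtain \<alpha> where "classical_solution m am ap \<alpha> (t + 1) k0 k" using cl[of "t + 1"] t by auto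
    then have "k t \<in> K_space \<alpha>" using t by (auto simp: classical_solution_def)
    then show ?thesis using K_space_bound by blast
  qed
  have "AE \<eta> in lebesgue_poisson. k 0 \<eta> = k0 \<eta>"
    using cl[of 1] by (auto simp: classical_solution_def)
  moreover obtain C where "exp_bounded C \<alpha>0 (k 0)"
  proof -
    obtain C where "exp_bounded C \<alpha>0 k0"
      using K_space_bound[OF \<mu>0(3)] by blast
    with \<open>AE \<eta> in lebesgue_poisson. k 0 \<eta> = k0 \<eta>\<close>
    have "exp_bounded C \<alpha>0 (k 0)" by eventually_elim simp
    then show ?thesis by (rule that)
  qed
  ultimately have init: "\<mu> 0 = \<mu>0"
    using config_measure_unique[OF \<mu>(1)[of 0] \<mu>(2)[of 0] \<mu>0(1,2)] by simp
  have main: "\<exists>LF.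
        (\<forall>t\<ge>0. generator_image m am ap (\<mu> t) (K_transform G) (LF t) \<and>
           integrable (\<mu> t) (K_transform G) \<and> integrable (\<mu> t) (LF t)) \<and>
        (\<forall>T>0. set_integrable lebesgue {0..T} (\<lambda>t. \<integral>\<gamma>. LF t \<gamma> \<partial>\<mu> t)) \<and>
        (\<forall>t\<ge>0. (\<integral>\<gamma>. K_transform G \<gamma> \<partial>\<mu> t) =
           (\<integral>\<gamma>. K_transform G \<gamma> \<partial>\<mu>0) + (LINT s:{0..t}|lebesgue. \<integral>\<gamma>. LF s \<gamma> \<partial>\<mu> s))"
    if G: "G \<in> Bbs" for G
  proof -
    note LG = L_hat_measurable(2)[OF Bbs_measurable[OF G]]
    have "\<exists>H. K_extension (\<mu> t) (k t) (L_hat m am ap G) H" if t: "t \<ge> 0" for t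
    proof -
      obtain \<alpha> C where C: "C \<ge> 0" "exp_bounded C \<alpha> (k t)"
        using bd[OF t] by blast
      have i: "integrable lebesgue_poisson (\<lambda>\<eta>. L_hat m am ap G \<eta> * k t \<eta>)"
        by (rule L_hat_integrable(1)[OF G correlation_functionD(1)[OF \<mu>(2)[OF t]], of "\<lambda>n. C * exp (\<alpha> * real n)"])
          (use C in auto)
      obtain B N where "\<And>\<eta>. finite \<eta> \<Longrightarrow> \<bar>L_hat m am ap G \<eta>\<bar> \<le> B"
        "\<And>\<eta>. finite \<eta> \<Longrightarrow> card \<eta> > N \<Longrightarrow> L_hat m am ap G \<eta> = 0" using L_hat_bounded[OF G] by blast
      then show ?thesis by (rule K_extension_exists[OF \<mu>(1)[OF t] \<mu>(2)[OF t] LG _ _ i])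
    qed
    then obtain H where H: "\<And>t. t \<ge> 0 \<Longrightarrow> K_extension (\<mu> t) (k t) (L_hat m am ap G) (H t)" by metis
    have IH: "(\<integral>\<gamma>. H t \<gamma> \<partial>\<mu> t) = \<langle>G, L_Delta m am ap (k t)\<rangle>" if t: "t \<ge> 0" for t
    proof -
      obtain \<alpha> C where C: "C \<ge> 0" "exp_bounded C \<alpha> (k t)"
        using bd[OF t] by blast
      have "(\<integral>\<gamma>. H t \<gamma> \<partial>\<mu> t) = \<langle>L_hat m am ap G, k t\<rangle>"
        by (rule K_extension_integral[OF \<mu>(2)[OF t] LG H[OF t]])
      also have "\<dots> = \<langle>G, L_Delta m am ap (k t)\<rangle>"
        by (rule L_hat_L_Delta_duality[OF G correlation_functionD(1)[OF \<mu>(2)[OF t]], of "\<lambda>n. C * exp (\<alpha> * real n)"])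
          (use C in auto)
      finally show ?thesis .
    qed
    have cont: "continuous_on {0..T} (\<lambda>t. \<integral>\<gamma>. H t \<gamma> \<partial>\<mu> t)" if "T > 0" for T
    proof -
      obtain \<alpha> where "classical_solution m am ap \<alpha> T k0 k" using cl[OF \<open>T > 0\<close>] by blast
      from classical_solution_derivative(2)[OF this G]
      show ?thesis by (rule continuous_on_eq) (simp add: IH)
    qed
    show ?thesis
    proof (intro exI[of _ H] conjI allI impI)
      fix t :: real assume t: "t \<ge> 0"
      show "generator_image m am ap (\<mu> t) (K_transform G) (H t)"
        unfolding generator_image_def using \<mu>(2)[OF t] G H[OF t] by blast
      show "integrable (\<mu> t) (K_transform G)" by (rule correlation_functionD(3)[OF \<mu>(2)[OF t] G])
      show "integrable (\<mu> t) (H t)" using H[OF t] by (simp add: K_extension_def)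
      obtain \<alpha> where c: "classical_solution m am ap \<alpha> (t + 1) k0 k" using cl[of "t + 1"] t by auto
      have "((\<lambda>s. \<integral>\<gamma>. H s \<gamma> \<partial>\<mu> s) has_integral
          (\<langle>G, k t\<rangle> - \<langle>G, k 0\<rangle>)) {0..t}"
      proof (rule fundamental_theorem_of_calculus[OF t])
        fix s assume s: "s \<in> {0..t}"
        have "((\<lambda>s. \<langle>G, k s\<rangle>) has_vector_derivative (\<integral>\<gamma>. H s \<gamma> \<partial>\<mu> s)) (at s within {0..t + 1})"
          using classical_solution_derivative(1)[OF c G, of s] s IH[of s]
          by (simp add: has_real_derivative_iff_has_vector_derivative)
        then show "((\<lambda>s. \<langle>G, k s\<rangle>) has_vector_derivative (\<integral>\<gamma>. H s \<gamma> \<partial>\<mu> s)) (at s within {0..t})"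
          by (rule has_vector_derivative_within_subset) auto
      qed
      moreover have "continuous_on {0..t} (\<lambda>t. \<integral>\<gamma>. H t \<gamma> \<partial>\<mu> t)"
        by (rule continuous_on_subset[OF cont[of "t + 1"]]) (use t in auto)
      then have "(LINT s:{0..t}|lebesgue. \<integral>\<gamma>. H s \<gamma> \<partial>\<mu> s) = integral {0..t} (\<lambda>s. \<integral>\<gamma>. H s \<gamma> \<partial>\<mu> s)"
        by (intro set_lebesgue_integral_eq_integral(2) set_integrable_lebesgue_continuous)
      ultimately show "(\<integral>\<gamma>. K_transform G \<gamma> \<partial>\<mu> t) =
           (\<integral>\<gamma>. K_transform G \<gamma> \<partial>\<mu>0) + (LINT s:{0..t}|lebesgue. \<integral>\<gamma>. H s \<gamma> \<partial>\<mu> s)"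
        using correlation_functionD(5)[OF \<mu>(2)[OF t] G] correlation_functionD(5)[OF \<mu>(2)[of 0] G]
        by (simp add: integral_unique flip: init)
    next
      fix T :: real assume "T > 0"
      then show "set_integrable lebesgue {0..T} (\<lambda>t. \<integral>\<gamma>. H t \<gamma> \<partial>\<mu> t)"
        by (intro set_integrable_lebesgue_continuous cont)
    qed
  qed
  show ?thesis unfolding weak_solution_def
  proof (intro conjI allI impI ballI)
    fix F :: "'a set \<Rightarrow> real" assume "F \<in> FP"
    then obtain G where "G \<in> Bbs" "F = K_transform G" by (auto simp: FP_def)
    then show "\<exists>LF.
        (\<forall>t\<ge>0. generator_image m am ap (\<mu> t) F (LF t) \<and>
           integrable (\<mu> t) F \<and> integrable (\<mu> t) (LF t)) \<and>
        (\<forall>T>0. set_integrable lebesgue {0..T} (\<lambda>t. \<integral>\<gamma>. LF t \<gamma> \<partial>\<mu> t)) \<and>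
        (\<forall>t\<ge>0. (\<integral>\<gamma>. F \<gamma> \<partial>\<mu> t) =
           (\<integral>\<gamma>. F \<gamma> \<partial>\<mu>0) + (LINT s:{0..t}|lebesgue. \<integral>\<gamma>. LF s \<gamma> \<partial>\<mu> s))"
      using main by simp
  qed (use \<mu> init in auto)
qed

lemma L_hat_cong:
  assumes "\<And>\<eta>. finite \<eta> \<Longrightarrow> G \<eta> = H \<eta>" "finite \<eta>"
  shows "L_hat m am ap G \<eta> = L_hat m am ap H \<eta>"
  unfolding L_hat_def using assms by simp

text \<open>The Fokker--Planck equation, rewritten for the correlation functions.\<close>

lemma weak_solution_correlation:
  fixes \<nu> :: "real \<Rightarrow> 'a set measure"
  assumes \<nu>: "weak_solution m am ap \<mu>0 \<nu>" and \<kappa>: "\<And>t. t \<ge> 0 \<Longrightarrow> correlation_function (\<nu> t) (\<kappa> t)" and G: "G \<in> Bbs"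
  shows "T > 0 \<Longrightarrow> set_integrable lebesgue {0..T} (\<lambda>t. \<langle>L_hat m am ap G, \<kappa> t\<rangle>)"
    and "t \<ge> 0 \<Longrightarrow> \<langle>G, \<kappa> t\<rangle> =
      (\<integral>\<gamma>. K_transform G \<gamma> \<partial>\<mu>0) + (LINT s:{0..t}|lebesgue. \<langle>L_hat m am ap G, \<kappa> s\<rangle>)"
proof -
  have KG: "K_transform G \<in> FP" using G by (auto simp: FP_def)
  have "\<exists>LF. (\<forall>t\<ge>0. generator_image m am ap (\<nu> t) (K_transform G) (LF t) \<and>
           integrable (\<nu> t) (K_transform G) \<and> integrable (\<nu> t) (LF t)) \<and>
        (\<forall>T>0. set_integrable lebesgue {0..T} (\<lambda>t. \<integral>\<gamma>. LF t \<gamma> \<partial>\<nu> t)) \<and>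
        (\<forall>t\<ge>0. (\<integral>\<gamma>. K_transform G \<gamma> \<partial>\<nu> t) =
           (\<integral>\<gamma>. K_transform G \<gamma> \<partial>\<mu>0) + (LINT s:{0..t}|lebesgue. \<integral>\<gamma>. LF s \<gamma> \<partial>\<nu> s))"
    by (rule bspec[OF conjunct2[OF conjunct2[OF \<nu>[unfolded weak_solution_def]]] KG])
  then obtain LF where "(\<forall>t\<ge>0. generator_image m am ap (\<nu> t) (K_transform G) (LF t) \<and>
           integrable (\<nu> t) (K_transform G) \<and> integrable (\<nu> t) (LF t)) \<and>
        (\<forall>T>0. set_integrable lebesgue {0..T} (\<lambda>t. \<integral>\<gamma>. LF t \<gamma> \<partial>\<nu> t)) \<and>
        (\<forall>t\<ge>0. (\<integral>\<gamma>. K_transform G \<gamma> \<partial>\<nu> t) =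
           (\<integral>\<gamma>. K_transform G \<gamma> \<partial>\<mu>0) + (LINT s:{0..t}|lebesgue. \<integral>\<gamma>. LF s \<gamma> \<partial>\<nu> s))" by (rule exE)
  then have gen: "\<And>t. t \<ge> 0 \<Longrightarrow> generator_image m am ap (\<nu> t) (K_transform G) (LF t)"
    and int: "\<And>T. T > 0 \<Longrightarrow> set_integrable lebesgue {0..T} (\<lambda>t. \<integral>\<gamma>. LF t \<gamma> \<partial>\<nu> t)"
    and eq: "\<And>t. t \<ge> 0 \<Longrightarrow> (\<integral>\<gamma>. K_transform G \<gamma> \<partial>\<nu> t) =
           (\<integral>\<gamma>. K_transform G \<gamma> \<partial>\<mu>0) + (LINT s:{0..t}|lebesgue. \<integral>\<gamma>. LF s \<gamma> \<partial>\<nu> s)"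
    by simp_all
  have LF: "(\<integral>\<gamma>. LF t \<gamma> \<partial>\<nu> t) = \<langle>L_hat m am ap G, \<kappa> t\<rangle>" if t: "t \<ge> 0" for t
  proof -
    obtain k' G' where k': "correlation_function (\<nu> t) k'" and G': "G' \<in> Bbs" and KG: "K_transform G = K_transform G'"
      and ext: "K_extension (\<nu> t) k' (L_hat m am ap G') (LF t)"
      using gen[OF t] unfolding generator_image_def by blast
    note [measurable] = L_hat_measurable(2)[OF Bbs_measurable[OF G]] L_hat_measurable(2)[OF Bbs_measurable[OF G']]
      correlation_functionD(1)[OF k'] correlation_functionD(1)[OF \<kappa>[OF t]]
    have "(\<integral>\<gamma>. LF t \<gamma> \<partial>\<nu> t) = \<langle>L_hat m am ap G', k'\<rangle>"
      by (rule K_extension_integral[OF k' _ ext]) measurable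
    also have "\<dots> = \<langle>L_hat m am ap G, \<kappa> t\<rangle>"
    proof (rule integral_cong_AE)
      show "AE \<eta> in lebesgue_poisson. L_hat m am ap G' \<eta> * k' \<eta> = L_hat m am ap G \<eta> * \<kappa> t \<eta>"
        using correlation_function_unique[OF k' \<kappa>[OF t]] AE_space
      proof eventually_elim
        case (elim \<eta>)
        have "L_hat m am ap G' \<eta> = L_hat m am ap G \<eta>"
          by (rule L_hat_cong) (use K_transform_inj[OF KG] elim in auto)
        then show ?case using elim by simp
      qed
    qed simp_all
    finally show ?thesis .
  qed
  show "set_integrable lebesgue {0..T} (\<lambda>t. \<langle>L_hat m am ap G, \<kappa> t\<rangle>)" if "T > 0"
    using int[OF that] LF by (subst (asm) set_integrable_cong) auto
  have "(LINT s:{0..t}|lebesgue. \<integral>\<gamma>. LF s \<gamma> \<partial>\<nu> s)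
      = (LINT s:{0..t}|lebesgue. \<langle>L_hat m am ap G, \<kappa> s\<rangle>)" if "t \<ge> 0"
    using LF by (intro set_lebesgue_integral_cong) auto
  then show "\<langle>G, \<kappa> t\<rangle> =
      (\<integral>\<gamma>. K_transform G \<gamma> \<partial>\<mu>0) + (LINT s:{0..t}|lebesgue. \<langle>L_hat m am ap G, \<kappa> s\<rangle>)" if "t \<ge> 0"
    using eq[OF that] correlation_functionD(5)[OF \<kappa>[OF that] G] that by simp
qed

end

section \<open>Differences of weak solutions\<close>

text \<open>The mean value estimate for a primitive, without continuity of the integrand.\<close>

lemma increment_bound:
  fixes g \<phi> :: "real \<Rightarrow> real"
  assumes int: "set_integrable lebesgue {0..T} g"
    and \<phi>: "\<And>t. t \<in> {0..T} \<Longrightarrow> \<phi> t = c + (LINT s:{0..t}|lebesgue. g s)"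
    and st: "0 \<le> s" "s \<le> t" "t \<le> T" and B: "\<And>r. r \<in> {s..t} \<Longrightarrow> \<bar>g r - y\<bar> \<le> B"
  shows "\<bar>\<phi> t - \<phi> s - (t - s) * y\<bar> \<le> (t - s) * B"
proof -
  have i: "g integrable_on {0..T}" using set_lebesgue_integral_eq_integral(1)[OF int] .
  have I: "(LINT s:{0..t}|lebesgue. g s) = integral {0..t} g" if "t \<in> {0..T}" for t
    by (rule set_lebesgue_integral_eq_integral(2), rule set_integrable_subset[OF int]) (use that in auto)
  have it: "g integrable_on {0..t}" "g integrable_on {s..t}"
    using i st by (auto intro: integrable_on_subinterval)
  have "integral {0..s} g + integral {s..t} g = integral {0..t} g"
    by (rule Henstock_Kurzweil_Integration.integral_combine) (use st it in auto)
  then have "\<phi> t - \<phi> s = integral {s..t} g" using \<phi> I st by simp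
  moreover have "((\<lambda>r. g r - y) has_integral (integral {s..t} g - (t - s) * y)) {s..t}"
    using has_integral_diff[OF integrable_integral[OF it(2)] has_integral_const_real[of y s t]] st by simp
  then have "norm (integral {s..t} g - (t - s) * y) \<le> B * measure lborel (cbox s t)"
    using order_trans[OF abs_ge_zero B[of s]] st B
    by (intro has_integral_bound[where f = "\<lambda>r. g r - y"]) auto
  ultimately show ?thesis using st by (simp add: mult.commute)
qed

lemma nat_le_exp: "real n \<le> exp (real n)" "real n ^ 2 \<le> 2 * exp (real n)"
proof -
  show "real n \<le> exp (real n)" using exp_ge_add_one_self[of "real n"] by linarith
  have "1 + real n + real n ^ 2 / 2 \<le> exp (real n)" by (rule exp_lower_Taylor_quadratic) simp
  then show "real n ^ 2 \<le> 2 * exp (real n)" by (simp add: field_simps)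
qed

context spatial_logistic
begin

text \<open>The dual generator maps functions bounded by \<open>exp (\<beta> |\<eta>|)\<close> to functions bounded by
  \<open>exp ((\<beta> + 1) |\<eta>|)\<close>.  For a gap \<open>\<epsilon>\<close> between the exponents instead of \<open>1\<close> the constant would be of order
  \<open>1 / \<epsilon>\<^sup>2\<close>, because the death rate and the birth term are quadratic in the number of particles; this
  is too singular to be iterated, and the bound only serves for continuity in time.\<close>

lemma L_hat_exp_bound:
  "\<exists>K\<ge>0. \<forall>G\<in>Bbs. \<forall>p C. p \<in> borel_measurable fin_config_space \<longrightarrow> 0 \<le> C \<longrightarrow>
     exp_bounded C \<beta> p \<longrightarrow>
     \<bar>\<langle>L_hat m am ap G, p\<rangle>\<bar>
       \<le> C * K * (\<integral>\<eta>. \<bar>G \<eta>\<bar> * exp ((\<beta> + 1) * real (card \<eta>)) \<partial>lebesgue_poisson)"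
proof -
  obtain c where c: "c \<ge> 0" "\<And>\<eta>. death_rate m am \<eta> \<le> c * real (card \<eta>) ^ 2" using death_rate_bound by blast
  obtain M where M: "M \<ge> 0" "\<And>\<eta>. pair_sum ap \<eta> \<le> M * real (card \<eta>) ^ 2" using birth.pair_sum_bound by blast
  define K where "K = 2 * M * exp \<bar>\<beta>\<bar> + comp.mass * exp \<beta> + birth.mass + 2 * c"
  have K0: "K \<ge> 0" using M c comp.mass_nonneg birth.mass_nonneg by (simp add: K_def)
  have pw: "off_weight (\<lambda>n. C * exp (\<beta> * real n)) \<eta> + death_rate m am \<eta> * (C * exp (\<beta> * real (card \<eta>)))
      \<le> C * K * exp ((\<beta> + 1) * real (card \<eta>))" if C: "0 \<le> C" for \<eta> :: "'a set" and C
  proof -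
    define n where "n = real (card \<eta>)"
    define e where "e = exp (\<beta> * n)"
    have e0: "e \<ge> 0" by (simp add: e_def)
    have ee: "exp ((\<beta> + 1) * n) = e * exp n" by (simp add: e_def distrib_right exp_add)
    have n: "n \<le> exp n" "n ^ 2 \<le> 2 * exp n" "n \<ge> 0" unfolding n_def using nat_le_exp[of "card \<eta>"] by auto
    have w1: "exp (\<beta> * real (card \<eta> - 1)) \<le> exp \<bar>\<beta>\<bar> * e"
      unfolding e_def exp_add[symmetric] n_def by (cases "card \<eta>") (auto simp: algebra_simps)
    have w2: "exp (\<beta> * real (card \<eta> + 1)) = exp \<beta> * e"
      unfolding e_def exp_add[symmetric] n_def by (simp add: algebra_simps)
    have t1: "pair_sum ap \<eta> * (C * exp (\<beta> * real (card \<eta> - 1))) \<le> C * (2 * M * exp \<bar>\<beta>\<bar>) * (e * exp n)"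
    proof -
      have "pair_sum ap \<eta> \<le> M * (2 * exp n)"
        using M(2)[of \<eta>] mult_left_mono[OF n(2) M(1)] by (simp add: n_def)
      then have "pair_sum ap \<eta> * (C * exp (\<beta> * real (card \<eta> - 1))) \<le> (M * (2 * exp n)) * (C * (exp \<bar>\<beta>\<bar> * e))"
        using w1 C M(1) birth.pair_sum_nonneg by (intro mult_mono mult_left_mono) auto
      then show ?thesis by (simp add: ac_simps)
    qed
    have t2: "n * comp.mass * (C * exp (\<beta> * real (card \<eta> + 1))) \<le> C * (comp.mass * exp \<beta>) * (e * exp n)"
      unfolding w2 using mult_right_mono[OF n(1), of "comp.mass * (C * (exp \<beta> * e))"] C comp.mass_nonneg e0
      by (simp add: ac_simps)
    have t3: "n * birth.mass * (C * e) \<le> C * birth.mass * (e * exp n)"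
      using mult_right_mono[OF n(1), of "birth.mass * (C * e)"] C birth.mass_nonneg e0 by (simp add: ac_simps)
    have t4: "death_rate m am \<eta> * (C * e) \<le> C * (2 * c) * (e * exp n)"
    proof -
      have "death_rate m am \<eta> \<le> c * (2 * exp n)"
        using c(2)[of \<eta>] mult_left_mono[OF n(2) c(1)] by (simp add: n_def)
      from mult_right_mono[OF this, of "C * e"] show ?thesis using C e0 by (simp add: ac_simps)
    qed
    have "off_weight (\<lambda>n. C * exp (\<beta> * real n)) \<eta> + death_rate m am \<eta> * (C * exp (\<beta> * real (card \<eta>)))
        \<le> C * (2 * M * exp \<bar>\<beta>\<bar>) * (e * exp n) + C * (comp.mass * exp \<beta>) * (e * exp n)
          + C * birth.mass * (e * exp n) + C * (2 * c) * (e * exp n)"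
      using t1 t2 t3 t4 unfolding off_weight_def n_def[symmetric] e_def[symmetric] by linarith
    also have "\<dots> = C * K * (e * exp n)" by (simp add: K_def algebra_simps)
    finally show ?thesis unfolding n_def[symmetric] ee .
  qed
  show ?thesis
  proof (intro exI[of _ K] conjI ballI allI impI K0)
    fix G :: "'a set \<Rightarrow> real" and p :: "'a set \<Rightarrow> real" and C :: real
    assume G: "G \<in> Bbs" and p: "p \<in> borel_measurable fin_config_space" and C: "0 \<le> C"
      and bd: "exp_bounded C \<beta> p"
    let ?w = "\<lambda>n::nat. C * exp (\<beta> * real n)"
    have w: "\<And>n. 0 \<le> ?w n" using C by simp
    note o = off_diagonal_bound[OF G p bd w] and L = L_hat_integrable[OF G p bd w]
    note d = integral_test_bound[OF Bbs_death_rate[OF G] p bd]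
    have id: "integrable lebesgue_poisson (\<lambda>\<eta>. \<bar>G \<eta>\<bar> * (death_rate m am \<eta> * ?w (card \<eta>)))"
      using exp_weight_integrable[OF Bbs_death_rate[OF G], of C \<beta>] death_rate_nonneg
      by (simp add: abs_mult ac_simps)
    have "C * (\<integral>\<eta>. \<bar>death_rate m am \<eta> * G \<eta>\<bar> * exp (\<beta> * real (card \<eta>)) \<partial>lebesgue_poisson)
        = (\<integral>\<eta>. C * (\<bar>death_rate m am \<eta> * G \<eta>\<bar> * exp (\<beta> * real (card \<eta>))) \<partial>lebesgue_poisson)" by simp
    also have "\<dots> = (\<integral>\<eta>. \<bar>G \<eta>\<bar> * (death_rate m am \<eta> * ?w (card \<eta>)) \<partial>lebesgue_poisson)"
      using death_rate_nonneg by (intro Bochner_Integration.integral_cong refl) (simp add: abs_mult ac_simps)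
    finally have "\<bar>\<langle>L_hat m am ap G, p\<rangle>\<bar>
        \<le> (\<integral>\<eta>. \<bar>G \<eta>\<bar> * off_weight ?w \<eta> \<partial>lebesgue_poisson) + (\<integral>\<eta>. \<bar>G \<eta>\<bar> * (death_rate m am \<eta> * ?w (card \<eta>)) \<partial>lebesgue_poisson)"
      using o(3) d(2) unfolding L(3) by linarith
    also have "\<dots> = (\<integral>\<eta>. \<bar>G \<eta>\<bar> * (off_weight ?w \<eta> + death_rate m am \<eta> * ?w (card \<eta>)) \<partial>lebesgue_poisson)"
      unfolding distrib_left by (rule Bochner_Integration.integral_add[symmetric, OF o(2) id])
    also have "\<dots> \<le> (\<integral>\<eta>. \<bar>G \<eta>\<bar> * (C * K * exp ((\<beta> + 1) * real (card \<eta>))) \<partial>lebesgue_poisson)"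
    proof (rule integral_mono[OF _ exp_weight_integrable[OF G]])
      show "integrable lebesgue_poisson (\<lambda>\<eta>. \<bar>G \<eta>\<bar> * (off_weight ?w \<eta> + death_rate m am \<eta> * ?w (card \<eta>)))"
        unfolding distrib_left by (rule Bochner_Integration.integrable_add[OF o(2) id])
    qed (intro mult_left_mono pw C, simp)
    also have "\<dots> = C * K * (\<integral>\<eta>. \<bar>G \<eta>\<bar> * exp ((\<beta> + 1) * real (card \<eta>)) \<partial>lebesgue_poisson)"
      unfolding mult.left_commute[of _ "C * K"] by simp
    finally show "\<bar>\<langle>L_hat m am ap G, p\<rangle>\<bar>
       \<le> C * K * (\<integral>\<eta>. \<bar>G \<eta>\<bar> * exp ((\<beta> + 1) * real (card \<eta>)) \<partial>lebesgue_poisson)" .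
  qed
qed

text \<open>\<open>weak_evolution\<close> collects what is used of a family solving \<open>q' = L_Delta q\<close> weakly; all
  of it is invariant under a shift of time.  The quadratic error has to be uniform over all test functions below a
  given one, because the test functions will depend on time.\<close>

definition weak_evolution :: "real \<Rightarrow> real \<Rightarrow> real \<Rightarrow> real \<Rightarrow> (real \<Rightarrow> 'a set \<Rightarrow> real) \<Rightarrow> bool" where
  "weak_evolution \<beta> C L T q \<longleftrightarrow>
     (\<forall>t\<in>{0..T}. q t \<in> borel_measurable fin_config_space \<and>
        exp_bounded C \<beta> (q t)) \<and>
     (\<forall>s\<in>{0..T}. \<forall>t\<in>{0..T}. AE \<eta> in lebesgue_poisson. \<bar>q t \<eta> - q s \<eta>\<bar> \<le> (L * \<bar>t - s\<bar>) * exp ((\<beta> + 1) * real (card \<eta>))) \<and>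
     (\<forall>G\<in>Bbs. \<exists>D. \<forall>G'\<in>Bbs. (\<forall>\<eta>. finite \<eta> \<longrightarrow> \<bar>G' \<eta>\<bar> \<le> \<bar>G \<eta>\<bar>) \<longrightarrow>
        (\<forall>s h. 0 \<le> s \<longrightarrow> 0 \<le> h \<longrightarrow> s + h \<le> T \<longrightarrow>
           \<bar>\<langle>G', q (s + h)\<rangle> - \<langle>G', q s\<rangle>
             - h * \<langle>L_hat m am ap G', q s\<rangle>\<bar> \<le> D * h ^ 2))"

lemma weak_evolution_shift:
  assumes "weak_evolution \<beta> C L T q" "0 \<le> \<tau>" "\<tau> \<le> T"
  shows "weak_evolution \<beta> C L (T - \<tau>) (\<lambda>s. q (\<tau> + s))"
  unfolding weak_evolution_def
proof (intro conjI ballI)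
  note W = assms(1)[unfolded weak_evolution_def]
  fix t assume t: "t \<in> {0..T - \<tau>}"
  then have t': "\<tau> + t \<in> {0..T}" using assms by auto
  show "q (\<tau> + t) \<in> borel_measurable fin_config_space"
    "exp_bounded C \<beta> (q (\<tau> + t))" using W t' by auto
  fix s assume "s \<in> {0..T - \<tau>}"
  then have "\<tau> + s \<in> {0..T}" using assms by auto
  with W t' have "AE \<eta> in lebesgue_poisson. \<bar>q (\<tau> + s) \<eta> - q (\<tau> + t) \<eta>\<bar> \<le> (L * \<bar>(\<tau> + s) - (\<tau> + t)\<bar>) * exp ((\<beta> + 1) * real (card \<eta>))"
    by blast
  then show "AE \<eta> in lebesgue_poisson. \<bar>q (\<tau> + s) \<eta> - q (\<tau> + t) \<eta>\<bar> \<le> (L * \<bar>s - t\<bar>) * exp ((\<beta> + 1) * real (card \<eta>))"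
    by simp
next
  note W = assms(1)[unfolded weak_evolution_def]
  fix G :: "'a set \<Rightarrow> real" assume "G \<in> Bbs"
  then obtain D where D: "\<forall>G'\<in>Bbs. (\<forall>\<eta>. finite \<eta> \<longrightarrow> \<bar>G' \<eta>\<bar> \<le> \<bar>G \<eta>\<bar>) \<longrightarrow>
        (\<forall>s h. 0 \<le> s \<longrightarrow> 0 \<le> h \<longrightarrow> s + h \<le> T \<longrightarrow>
           \<bar>\<langle>G', q (s + h)\<rangle> - \<langle>G', q s\<rangle>
             - h * \<langle>L_hat m am ap G', q s\<rangle>\<bar> \<le> D * h ^ 2)"
    using W by blast
  show "\<exists>D. \<forall>G'\<in>Bbs. (\<forall>\<eta>. finite \<eta> \<longrightarrow> \<bar>G' \<eta>\<bar> \<le> \<bar>G \<eta>\<bar>) \<longrightarrow>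
        (\<forall>s h. 0 \<le> s \<longrightarrow> 0 \<le> h \<longrightarrow> s + h \<le> T - \<tau> \<longrightarrow>
           \<bar>\<langle>G', q (\<tau> + (s + h))\<rangle> - \<langle>G', q (\<tau> + s)\<rangle>
             - h * \<langle>L_hat m am ap G', q (\<tau> + s)\<rangle>\<bar> \<le> D * h ^ 2)"
  proof (intro exI[of _ D] ballI impI allI)
    fix G' and s h :: real
    assume "G' \<in> Bbs" "\<forall>\<eta>. finite \<eta> \<longrightarrow> \<bar>G' \<eta>\<bar> \<le> \<bar>G \<eta>\<bar>" and s: "0 \<le> s" "0 \<le> h" "s + h \<le> T - \<tau>"
    moreover from s have "0 \<le> \<tau> + s" "(\<tau> + s) + h \<le> T" using assms by auto
    ultimately show "\<bar>\<langle>G', q (\<tau> + (s + h))\<rangle> - \<langle>G', q (\<tau> + s)\<rangle>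
             - h * \<langle>L_hat m am ap G', q (\<tau> + s)\<rangle>\<bar> \<le> D * h ^ 2"
      using D unfolding add.assoc[symmetric] by blast
  qed
qed

text \<open>The bound on the generator yields Lipschitz continuity with one unit lost in the exponent, and a second
  application to \<open>q r - q s\<close> bounds the error of the first order expansion by the square of the time step.\<close>

lemma weak_evolutionI:
  fixes q :: "real \<Rightarrow> 'a set \<Rightarrow> real"
  assumes qm: "\<And>t. t \<in> {0..T} \<Longrightarrow> q t \<in> borel_measurable fin_config_space" and C: "0 \<le> C"
    and bd: "\<And>t. t \<in> {0..T} \<Longrightarrow> exp_bounded C \<beta> (q t)"
    and int: "\<And>G. G \<in> Bbs \<Longrightarrow> set_integrable lebesgue {0..T} (\<lambda>t. \<langle>L_hat m am ap G, q t\<rangle>)"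
    and eq: "\<And>G t. G \<in> Bbs \<Longrightarrow> t \<in> {0..T} \<Longrightarrow> \<langle>G, q t\<rangle> =
      c G + (LINT s:{0..t}|lebesgue. \<langle>L_hat m am ap G, q s\<rangle>)"
  shows "\<exists>L\<ge>0. weak_evolution \<beta> C L T q"
proof -
  obtain K where K: "K \<ge> 0" and Kb: "\<forall>G\<in>Bbs. \<forall>p C. p \<in> borel_measurable fin_config_space \<longrightarrow> 0 \<le> C \<longrightarrow>
     exp_bounded C \<beta> p \<longrightarrow>
     \<bar>\<langle>L_hat m am ap G, p\<rangle>\<bar>
       \<le> C * K * (\<integral>\<eta>. \<bar>G \<eta>\<bar> * exp ((\<beta> + 1) * real (card \<eta>)) \<partial>lebesgue_poisson)"
    using L_hat_exp_bound[of \<beta>] by blast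
  obtain K' where K': "K' \<ge> 0" and Kb': "\<forall>G\<in>Bbs. \<forall>p C. p \<in> borel_measurable fin_config_space \<longrightarrow> 0 \<le> C \<longrightarrow>
     exp_bounded C (\<beta> + 1) p \<longrightarrow>
     \<bar>\<langle>L_hat m am ap G, p\<rangle>\<bar>
       \<le> C * K' * (\<integral>\<eta>. \<bar>G \<eta>\<bar> * exp ((\<beta> + 1 + 1) * real (card \<eta>)) \<partial>lebesgue_poisson)"
    using L_hat_exp_bound[of "\<beta> + 1"] by blast
  define L where "L = C * K"
  have L0: "L \<ge> 0" using C K by (simp add: L_def)
  have lip_le: "AE \<eta> in lebesgue_poisson. \<bar>q t \<eta> - q s \<eta>\<bar> \<le> (L * (t - s)) * exp ((\<beta> + 1) * real (card \<eta>))"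
    if st: "0 \<le> s" "s \<le> t" "t \<le> T" for s t
  proof (rule AE_bound_by_test_functions)
    have s: "s \<in> {0..T}" and t: "t \<in> {0..T}" using st by auto
    show "(\<lambda>\<eta>. q t \<eta> - q s \<eta>) \<in> borel_measurable fin_config_space" using qm s t by simp
    show "(\<lambda>\<eta>. (L * (t - s)) * exp ((\<beta> + 1) * real (card \<eta>))) \<in> borel_measurable (fin_config_space :: 'a set measure)"
      by (rule borel_measurable_card_config)
    fix G :: "'a set \<Rightarrow> real" assume G: "G \<in> Bbs"
    note int_s = integral_test_bound(1)[OF G qm[OF s] bd[OF s]] and int_t = integral_test_bound(1)[OF G qm[OF t] bd[OF t]]
    show "integrable lebesgue_poisson (\<lambda>\<eta>. G \<eta> * (q t \<eta> - q s \<eta>))"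
      unfolding right_diff_distrib using int_s int_t by simp
    show "integrable lebesgue_poisson (\<lambda>\<eta>. G \<eta> * ((L * (t - s)) * exp ((\<beta> + 1) * real (card \<eta>))))"
      by (rule integrable_Bbs_mult[OF G borel_measurable_card_config, of _ "\<lambda>n. \<bar>(L * (t - s)) * exp ((\<beta> + 1) * real n)\<bar>"]) simp
    let ?J = "\<integral>\<eta>. \<bar>G \<eta>\<bar> * exp ((\<beta> + 1) * real (card \<eta>)) \<partial>lebesgue_poisson"
    have "\<bar>\<langle>G, q t\<rangle> - \<langle>G, q s\<rangle> - (t - s) * 0\<bar> \<le> (t - s) * (L * ?J)"
    proof (rule increment_bound[OF int[OF G] eq[OF G] st])
      fix r assume "r \<in> {s..t}"
      then have r: "r \<in> {0..T}" using st by auto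
      show "\<bar>\<langle>L_hat m am ap G, q r\<rangle> - 0\<bar> \<le> L * ?J"
        unfolding L_def using Kb G qm[OF r] C bd[OF r] by simp
    qed
    then have "(\<integral>\<eta>. G \<eta> * (q t \<eta> - q s \<eta>) \<partial>lebesgue_poisson) \<le> (t - s) * (L * ?J)"
      unfolding right_diff_distrib using int_s int_t by simp
    also have "\<dots> = (\<integral>\<eta>. (L * (t - s)) * (\<bar>G \<eta>\<bar> * exp ((\<beta> + 1) * real (card \<eta>))) \<partial>lebesgue_poisson)" by simp
    finally show "(\<integral>\<eta>. G \<eta> * (q t \<eta> - q s \<eta>) \<partial>lebesgue_poisson)
        \<le> (\<integral>\<eta>. \<bar>G \<eta>\<bar> * ((L * (t - s)) * exp ((\<beta> + 1) * real (card \<eta>))) \<partial>lebesgue_poisson)"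
      by (simp add: ac_simps)
  qed
  have lip: "AE \<eta> in lebesgue_poisson. \<bar>q t \<eta> - q s \<eta>\<bar> \<le> (L * \<bar>t - s\<bar>) * exp ((\<beta> + 1) * real (card \<eta>))"
    if "s \<in> {0..T}" "t \<in> {0..T}" for s t
    using lip_le[of s t] lip_le[of t s] that by (cases "s \<le> t") (auto simp: abs_minus_commute)
  have incr: "\<exists>D. \<forall>G'\<in>Bbs. (\<forall>\<eta>. finite \<eta> \<longrightarrow> \<bar>G' \<eta>\<bar> \<le> \<bar>G \<eta>\<bar>) \<longrightarrow>
        (\<forall>s h. 0 \<le> s \<longrightarrow> 0 \<le> h \<longrightarrow> s + h \<le> T \<longrightarrow>
           \<bar>\<langle>G', q (s + h)\<rangle> - \<langle>G', q s\<rangle>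
             - h * \<langle>L_hat m am ap G', q s\<rangle>\<bar> \<le> D * h ^ 2)"
    if G: "G \<in> Bbs" for G
  proof -
    let ?J = "\<lambda>G. \<integral>\<eta>. \<bar>G \<eta>\<bar> * exp ((\<beta> + 1 + 1) * real (card \<eta>)) \<partial>lebesgue_poisson"
    show ?thesis
    proof (intro exI[of _ "L * K' * ?J G"] ballI impI allI)
      fix G' and s h :: real
      assume G': "G' \<in> Bbs" and le: "\<forall>\<eta>. finite \<eta> \<longrightarrow> \<bar>G' \<eta>\<bar> \<le> \<bar>G \<eta>\<bar>" and h: "0 \<le> s" "0 \<le> h" "s + h \<le> T"
      have J: "?J G' \<le> ?J G"
        using exp_weight_integrable[OF G', of 1] exp_weight_integrable[OF G, of 1] le
        by (intro integral_mono) (auto intro!: mult_right_mono)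
      have s: "s \<in> {0..T}" using h by auto
      let ?w = "\<lambda>n::nat. C * exp (\<beta> * real n)"
      have w: "\<And>n. 0 \<le> ?w n" using C by simp
      have "\<bar>\<langle>G', q (s + h)\<rangle> - \<langle>G', q s\<rangle>
             - (s + h - s) * \<langle>L_hat m am ap G', q s\<rangle>\<bar> \<le> (s + h - s) * (L * h * K' * ?J G)"
      proof (rule increment_bound[OF int[OF G'] eq[OF G']])
        fix r assume r': "r \<in> {s..s + h}"
        then have r: "r \<in> {0..T}" using h by auto
        have i: "integrable lebesgue_poisson (\<lambda>\<eta>. L_hat m am ap G' \<eta> * q r \<eta>)"
          "integrable lebesgue_poisson (\<lambda>\<eta>. L_hat m am ap G' \<eta> * q s \<eta>)"
          using L_hat_integrable(1)[OF G' qm[OF r], of ?w] L_hat_integrable(1)[OF G' qm[OF s], of ?w] bd[OF r] bd[OF s] w by auto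
        have "\<langle>L_hat m am ap G', q r\<rangle> - \<langle>L_hat m am ap G', q s\<rangle>
            = (\<integral>\<eta>. L_hat m am ap G' \<eta> * (q r \<eta> - q s \<eta>) \<partial>lebesgue_poisson)"
          unfolding right_diff_distrib using i by simp
        moreover have "\<bar>\<integral>\<eta>. L_hat m am ap G' \<eta> * (q r \<eta> - q s \<eta>) \<partial>lebesgue_poisson\<bar> \<le> (L * \<bar>r - s\<bar>) * K' * ?J G'"
          using Kb'[rule_format, OF G', of "\<lambda>\<eta>. q r \<eta> - q s \<eta>" "L * \<bar>r - s\<bar>"] qm[OF r] qm[OF s] L0 lip[OF s r] by simp
        moreover have "(L * \<bar>r - s\<bar>) * K' * ?J G' \<le> (L * h) * K' * ?J G"
          using J r' L0 K' by (intro mult_mono mult_nonneg_nonneg Bochner_Integration.integral_nonneg) auto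
        ultimately show "\<bar>\<langle>L_hat m am ap G', q r\<rangle> - \<langle>L_hat m am ap G', q s\<rangle>\<bar>
            \<le> L * h * K' * ?J G" by linarith
      qed (use h in auto)
      then show "\<bar>\<langle>G', q (s + h)\<rangle> - \<langle>G', q s\<rangle>
             - h * \<langle>L_hat m am ap G', q s\<rangle>\<bar> \<le> L * K' * ?J G * h ^ 2"
        by (simp add: power2_eq_square ac_simps)
    qed
  qed
  have "weak_evolution \<beta> C L T q"
    unfolding weak_evolution_def using qm bd lip incr by blast
  with L0 show ?thesis by blast
qed

end

section \<open>Uniqueness for the weak evolution\<close>

text \<open>A differential inequality without derivatives: quadratic errors over \<open>N\<close> steps of length \<open>t / N\<close> add up to
  \<open>O (1 / N)\<close>.\<close>

lemma quadratic_error_telescope: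
  fixes f H :: "real \<Rightarrow> real"
  assumes t: "0 \<le> t"
    and step: "\<And>s h. 0 \<le> s \<Longrightarrow> 0 \<le> h \<Longrightarrow> s + h \<le> t \<Longrightarrow> \<bar>f (s + h) - f s\<bar> \<le> H (s + h) - H s + D * h ^ 2"
  shows "\<bar>f t - f 0\<bar> \<le> H t - H 0"
proof -
  have N: "\<bar>f t - f 0\<bar> \<le> H t - H 0 + D * t ^ 2 * inverse (real (Suc N))" for N
  proof -
    define h where "h = t / real (Suc N)"
    have h: "0 \<le> h" "real (Suc N) * h = t" using t by (simp_all add: h_def)
    have "\<bar>f (real i * h) - f 0\<bar> \<le> H (real i * h) - H 0 + real i * (D * h ^ 2)" if "i \<le> Suc N" for i
      using that
    proof (induct i)
      case (Suc i)
      have "real i * h + h = real (Suc i) * h" by (simp add: distrib_right)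
      moreover have "real (Suc i) * h \<le> t"
        unfolding h(2)[symmetric] using Suc(2) h(1) by (intro mult_right_mono) auto
      ultimately have "\<bar>f (real (Suc i) * h) - f (real i * h)\<bar> \<le> H (real (Suc i) * h) - H (real i * h) + D * h ^ 2"
        using step[of "real i * h" h] h(1) by simp
      moreover have "\<bar>f (real i * h) - f 0\<bar> \<le> H (real i * h) - H 0 + real i * (D * h ^ 2)"
        using Suc by simp
      moreover have "real (Suc i) * (D * h ^ 2) = real i * (D * h ^ 2) + D * h ^ 2" by (simp add: distrib_right)
      ultimately show ?case by linarith
    qed simp
    from this[of "Suc N"] have "\<bar>f t - f 0\<bar> \<le> H t - H 0 + real (Suc N) * (D * h ^ 2)" unfolding h(2) by simp
    also have "real (Suc N) * (D * h ^ 2) = D * t ^ 2 * inverse (real (Suc N))"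
      by (simp add: h_def power2_eq_square divide_simps)
    finally show ?thesis .
  qed
  have "(\<lambda>N. H t - H 0 + D * t ^ 2 * inverse (real (Suc N))) \<longlonglongrightarrow> H t - H 0 + D * t ^ 2 * 0"
    by (intro tendsto_intros LIMSEQ_inverse_real_of_nat)
  then show ?thesis using N by (intro LIMSEQ_le_const[of _ "H t - H 0"]) auto
qed

lemma lim_ge_const: "X \<longlonglongrightarrow> x \<Longrightarrow> (\<And>n. a \<le> X n) \<Longrightarrow> a \<le> (x::real)"
  by (rule LIMSEQ_le_const) auto

lemma power_Suc_increment:
  fixes s h :: real
  assumes "0 \<le> s" "0 \<le> h"
  shows "h * s ^ j \<le> ((s + h) ^ Suc j - s ^ Suc j) / real (Suc j)"
proof -
  have "s ^ Suc j + real (Suc j) * (h * s ^ j) \<le> (s + h) ^ Suc j"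
  proof (induct j)
    case (Suc j)
    have "s ^ Suc (Suc j) + real (Suc (Suc j)) * (h * s ^ Suc j)
        = (s ^ Suc j + real (Suc j) * (h * s ^ j)) * s + h * s ^ Suc j"
      by (simp add: algebra_simps)
    also have "\<dots> \<le> (s + h) ^ Suc j * s + h * (s + h) ^ Suc j"
      using Suc assms by (intro add_mono mult_right_mono mult_left_mono power_mono) auto
    also have "\<dots> = (s + h) ^ Suc (Suc j)" by (simp add: algebra_simps)
    finally show ?case .
  qed simp
  then show ?thesis by (simp add: field_simps)
qed

lemma power_self_le_fact_exp: "real k ^ k / fact k \<le> exp 1 ^ k"
proof -
  have "(\<Sum>i\<in>{k}. real k ^ i /\<^sub>R fact i) \<le> (\<Sum>i. real k ^ i /\<^sub>R fact i)"
    by (rule sum_le_suminf) (use summable_exp_generic[of "real k"] in auto)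
  also have "\<dots> = exp (real k)" by (simp add: exp_def)
  also have "\<dots> = exp 1 ^ k" using exp_of_nat_mult[of k "1::real"] by simp
  finally show ?thesis by (simp add: divide_inverse mult.commute)
qed

definition exp_norm :: "real \<Rightarrow> ('a::euclidean_space set \<Rightarrow> real) \<Rightarrow> real" where
  "exp_norm \<gamma> G = (\<integral>\<eta>. \<bar>G \<eta>\<bar> * exp (\<gamma> * real (card \<eta>)) \<partial>lebesgue_poisson)"

lemma exp_norm_nonneg: "0 \<le> exp_norm \<gamma> G"
  unfolding exp_norm_def by (rule Bochner_Integration.integral_nonneg) simp

lemma exp_norm_mono:
  assumes "G \<in> Bbs" "H \<in> Bbs" "\<And>\<eta>. finite \<eta> \<Longrightarrow> \<bar>G \<eta>\<bar> \<le> \<bar>H \<eta>\<bar>"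
  shows "exp_norm \<gamma> G \<le> exp_norm \<gamma> H"
  unfolding exp_norm_def
  using exp_weight_integrable[OF assms(1), of 1] exp_weight_integrable[OF assms(2), of 1] assms(3)
  by (intro integral_mono) (auto intro!: mult_right_mono)

lemma exp_norm_cmult: "exp_norm \<gamma> (\<lambda>\<eta>. c * G \<eta>) = \<bar>c\<bar> * exp_norm \<gamma> G"
  unfolding exp_norm_def by (simp add: abs_mult mult.assoc)

context spatial_logistic
begin

lemma pair_sum_condition:
  "\<exists>\<theta> b. \<theta> > 0 \<and> b \<ge> 0 \<and> (\<forall>\<eta>. finite \<eta> \<longrightarrow> pair_sum ap \<eta> \<le> (death_rate m am \<eta> + b * real (card \<eta>)) / \<theta>)"
proof -
  obtain \<theta> b where t: "\<theta> > 0" "b \<ge> 0"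
    and c: "\<And>\<eta>. finite \<eta> \<Longrightarrow> (\<Sum>x\<in>\<eta>. \<Sum>y\<in>\<eta> - {x}. am (x - y) - \<theta> * ap (x - y)) \<ge> - b * real (card \<eta>)"
    using condition unfolding condition_G_def by auto
  have "pair_sum ap \<eta> \<le> (death_rate m am \<eta> + b * real (card \<eta>)) / \<theta>" if "finite \<eta>" for \<eta>
  proof -
    have "(\<Sum>x\<in>\<eta>. \<Sum>y\<in>\<eta> - {x}. am (x - y) - \<theta> * ap (x - y)) = pair_sum am \<eta> - \<theta> * pair_sum ap \<eta>"
      unfolding pair_sum_def by (simp add: sum_subtractf sum_distrib_left)
    then have "\<theta> * pair_sum ap \<eta> \<le> death_rate m am \<eta> + b * real (card \<eta>)"
      using c[OF that] mult_nonneg_nonneg[OF mortality, of "real (card \<eta>)"] by (simp add: death_rate_def)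
    then show ?thesis using t by (simp add: pos_le_divide_eq mult.commute)
  qed
  with t show ?thesis by blast
qed

text \<open>The part of the birth term which is not controlled by the number of particles is dominated
  by the death rate, with a small factor if the weight exponent \<open>\<alpha>\<close> is large.  The
  remaining contributions are linear in the number of particles and cost a change of exponent.\<close>

lemma off_weight_le:
  fixes \<phi> \<psi> :: real
  assumes cond: "\<And>\<eta>. finite \<eta> \<Longrightarrow> pair_sum ap \<eta> \<le> (death_rate m am \<eta> + b * real (card \<eta>)) / \<theta>"
    and \<theta>: "\<theta> > 0" "b \<ge> 0" and \<alpha>: "\<alpha>' < \<alpha>" "exp (- \<alpha>) \<le> \<theta> / 2" and w: "0 \<le> \<phi>" "0 \<le> \<psi>"
    and c: "b / \<theta> * exp (- \<alpha>') + comp.mass * exp \<alpha>' + birth.mass \<le> c" and fin: "finite \<eta>"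
  shows "off_weight (\<lambda>n. min (\<phi> * exp (\<alpha> * real n)) (\<psi> * exp (\<alpha>' * real n))) \<eta>
    \<le> \<phi> / 2 * (death_rate m am \<eta> * exp (\<alpha> * real (card \<eta>))) + \<psi> * (c / (\<alpha> - \<alpha>')) * exp (\<alpha> * real (card \<eta>))"
proof (cases "\<eta> = {}")
  case True
  have "0 \<le> b / \<theta> * exp (- \<alpha>') + comp.mass * exp \<alpha>' + birth.mass"
    using \<theta> comp.mass_nonneg birth.mass_nonneg by simp
  then have "0 \<le> c" using c by linarith
  then show ?thesis using True w \<alpha> by (simp add: off_weight_def pair_sum_def death_rate_def)
next
  case False
  define w where "w n = min (\<phi> * exp (\<alpha> * real n)) (\<psi> * exp (\<alpha>' * real n))" for n
  define n where "n = real (card \<eta>)"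
  have n1: "real (card \<eta> - 1) = n - 1" using False fin by (simp add: n_def of_nat_diff card_gt_0_iff Suc_leI)
  have n0: "0 \<le> n" by (simp add: n_def)
  have w0: "0 \<le> w i" for i using \<open>0 \<le> \<phi>\<close> \<open>0 \<le> \<psi>\<close> by (simp add: w_def)
  define E where "E = death_rate m am \<eta>"
  have E0: "0 \<le> E" unfolding E_def by (rule death_rate_nonneg)
  have "w (card \<eta> - 1) \<le> \<phi> * exp (\<alpha> * real (card \<eta> - 1))" by (simp add: w_def)
  also have "\<dots> = \<phi> * exp (- \<alpha>) * exp (\<alpha> * n)" unfolding n1 by (simp add: right_diff_distrib mult_exp_exp)
  also have "\<dots> \<le> \<phi> * (\<theta> / 2) * exp (\<alpha> * n)" using \<alpha>(2) \<open>0 \<le> \<phi>\<close> by (intro mult_right_mono mult_left_mono) auto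
  finally have wa: "w (card \<eta> - 1) \<le> \<phi> * (\<theta> / 2) * exp (\<alpha> * n)" .
  have "w (card \<eta> - 1) \<le> \<psi> * exp (\<alpha>' * real (card \<eta> - 1))" by (simp add: w_def)
  also have "\<dots> = \<psi> * exp (- \<alpha>') * exp (\<alpha>' * n)" unfolding n1 by (simp add: right_diff_distrib mult_exp_exp)
  finally have wb: "w (card \<eta> - 1) \<le> \<psi> * exp (- \<alpha>') * exp (\<alpha>' * n)" .
  have "w (card \<eta> + 1) \<le> \<psi> * exp (\<alpha>' * real (card \<eta> + 1))" by (simp add: w_def)
  also have "\<dots> = \<psi> * exp \<alpha>' * exp (\<alpha>' * n)" by (simp add: n_def distrib_left mult_exp_exp ac_simps)
  finally have wc: "w (card \<eta> + 1) \<le> \<psi> * exp \<alpha>' * exp (\<alpha>' * n)" .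
  have wd: "w (card \<eta>) \<le> \<psi> * exp (\<alpha>' * n)" by (simp add: w_def n_def)
  have "pair_sum ap \<eta> * w (card \<eta> - 1) \<le> (E + b * n) / \<theta> * w (card \<eta> - 1)"
    unfolding E_def n_def by (rule mult_right_mono[OF cond[OF fin] w0])
  also have "\<dots> = E / \<theta> * w (card \<eta> - 1) + b / \<theta> * n * w (card \<eta> - 1)" by (simp add: add_divide_distrib distrib_right)
  also have "\<dots> \<le> E / \<theta> * (\<phi> * (\<theta> / 2) * exp (\<alpha> * n)) + b / \<theta> * n * (\<psi> * exp (- \<alpha>') * exp (\<alpha>' * n))"
    using E0 \<theta> n0 by (intro add_mono mult_left_mono wa wb) auto
  also have "E / \<theta> * (\<phi> * (\<theta> / 2) * exp (\<alpha> * n)) = \<phi> / 2 * (E * exp (\<alpha> * n))" using \<theta> by simp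
  finally have 1: "pair_sum ap \<eta> * w (card \<eta> - 1) \<le> \<phi> / 2 * (E * exp (\<alpha> * n)) + b / \<theta> * n * (\<psi> * exp (- \<alpha>') * exp (\<alpha>' * n))" .
  have 2: "n * comp.mass * w (card \<eta> + 1) \<le> n * comp.mass * (\<psi> * exp \<alpha>' * exp (\<alpha>' * n))"
    using n0 comp.mass_nonneg by (intro mult_left_mono wc) auto
  have 3: "n * birth.mass * w (card \<eta>) \<le> n * birth.mass * (\<psi> * exp (\<alpha>' * n))"
    using n0 birth.mass_nonneg by (intro mult_left_mono wd) auto
  have "off_weight w \<eta> \<le> \<phi> / 2 * (E * exp (\<alpha> * n))
      + (b / \<theta> * exp (- \<alpha>') + comp.mass * exp \<alpha>' + birth.mass) * (\<psi> * (n * exp (\<alpha>' * n)))"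
    using 1 2 3 unfolding off_weight_def n_def[symmetric] by (simp add: algebra_simps)
  also have "\<dots> \<le> \<phi> / 2 * (E * exp (\<alpha> * n)) + c * (\<psi> * (exp (\<alpha> * n) / (\<alpha> - \<alpha>')))"
  proof (rule add_left_mono, rule mult_mono[OF c])
    have "n * (\<alpha> - \<alpha>') \<le> exp (n * (\<alpha> - \<alpha>'))" using exp_ge_add_one_self[of "n * (\<alpha> - \<alpha>')"] by linarith
    then have "n * (\<alpha> - \<alpha>') * exp (\<alpha>' * n) \<le> exp (n * (\<alpha> - \<alpha>')) * exp (\<alpha>' * n)" by (rule mult_right_mono) simp
    also have "\<dots> = exp (\<alpha> * n)" by (simp add: mult_exp_exp algebra_simps)
    finally have "n * exp (\<alpha>' * n) \<le> exp (\<alpha> * n) / (\<alpha> - \<alpha>')" using \<alpha>(1) by (simp add: field_simps)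
    then show "\<psi> * (n * exp (\<alpha>' * n)) \<le> \<psi> * (exp (\<alpha> * n) / (\<alpha> - \<alpha>'))" using \<open>0 \<le> \<psi>\<close> by (rule mult_left_mono)
    have "0 \<le> b / \<theta> * exp (- \<alpha>') + comp.mass * exp \<alpha>' + birth.mass"
      using \<theta> comp.mass_nonneg birth.mass_nonneg by simp
    then show "0 \<le> c" using c by linarith
    show "0 \<le> \<psi> * (n * exp (\<alpha>' * n))" using \<open>0 \<le> \<psi>\<close> n0 by simp
  qed
  finally show ?thesis unfolding w_def[abs_def] E_def n_def by (simp add: ac_simps)
qed

text \<open>Duhamel's formula for the death rate, in integrated form and against a test function
  that is damped backwards in time.  The damping turns the birth term, which has an unbounded rate, into a
  contraction: \<open>\<integral> E exp (- r E) dr \<le> 1\<close>.  Only increments of the pairing are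
  estimated, so that \<open>q\<close> need not be measurable in time.\<close>

lemma duhamel_estimate:
  fixes \<phi> M :: real
  assumes cond: "\<And>\<eta>. finite \<eta> \<Longrightarrow> pair_sum ap \<eta> \<le> (death_rate m am \<eta> + b * real (card \<eta>)) / \<theta>"
    and \<theta>: "\<theta> > 0" "b \<ge> 0" and \<alpha>: "\<alpha>' < \<alpha>" "exp (- \<alpha>) \<le> \<theta> / 2"
    and c: "b / \<theta> * exp (- \<alpha>') + comp.mass * exp \<alpha>' + birth.mass \<le> c"
    and ev: "weak_evolution \<beta> C L T q" and CL: "0 \<le> C" "0 \<le> L"
    and q0: "AE \<eta> in lebesgue_poisson. q 0 \<eta> = 0" and t: "t \<in> {0..T}"
    and \<phi>: "0 \<le> \<phi>" "\<And>s. s \<in> {0..t} \<Longrightarrow> exp_bounded \<phi> \<alpha> (q s)"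
    and M: "0 \<le> M" "\<And>s. s \<in> {0..t} \<Longrightarrow> exp_bounded (M * s ^ j) \<alpha>' (q s)"
  shows "exp_bounded (\<phi> / 2 + c / (\<alpha> - \<alpha>') * (M * t ^ Suc j / real (Suc j))) \<alpha> (q t)"
proof -
  let ?E = "death_rate m am"
  define \<kappa> where "\<kappa> = c / (\<alpha> - \<alpha>')"
  define Z where "Z = \<phi> / 2 + \<kappa> * (M * t ^ Suc j / real (Suc j))"
  have "0 \<le> b / \<theta> * exp (- \<alpha>') + comp.mass * exp \<alpha>' + birth.mass"
    using \<theta> comp.mass_nonneg birth.mass_nonneg by simp
  then have \<kappa>0: "0 \<le> \<kappa>" using c \<alpha> by (simp add: \<kappa>_def)
  have t0: "0 \<le> t" using t by simp
  have qm: "q s \<in> borel_measurable fin_config_space" and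
    qb: "exp_bounded C \<beta> (q s)" if "s \<in> {0..T}" for s
    using ev that unfolding weak_evolution_def by blast+
  have lip: "AE \<eta> in lebesgue_poisson. \<bar>q s' \<eta> - q s \<eta>\<bar> \<le> (L * \<bar>s' - s\<bar>) * exp ((\<beta> + 1) * real (card \<eta>))"
    if "s \<in> {0..T}" "s' \<in> {0..T}" for s s' using ev that unfolding weak_evolution_def by blast
  have le: "\<langle>G, q t\<rangle> \<le> Z * exp_norm \<alpha> G" if G: "G \<in> Bbs" for G
  proof -
    define damp where "damp r \<eta> = exp (- r * ?E \<eta>) * G \<eta>" for r \<eta>
    have dle: "\<bar>damp r \<eta>\<bar> \<le> \<bar>G \<eta>\<bar>" if "0 \<le> r" for r \<eta>
      using that death_rate_nonneg[of \<eta>] by (simp add: damp_def abs_mult mult_left_le_one_le)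
    have dB: "damp r \<in> Bbs" if r: "0 \<le> r" for r
      unfolding damp_def
    proof (rule Bbs_mult[OF G])
      show "\<exists>M. \<forall>\<eta>. finite \<eta> \<longrightarrow> card \<eta> \<le> n \<longrightarrow> \<bar>exp (- r * ?E \<eta>)\<bar> \<le> M" for n
        using r death_rate_nonneg by (intro exI[of _ 1]) auto
    qed measurable
    obtain D1 where D1: "\<forall>G'\<in>Bbs. (\<forall>\<eta>. finite \<eta> \<longrightarrow> \<bar>G' \<eta>\<bar> \<le> \<bar>G \<eta>\<bar>) \<longrightarrow>
        (\<forall>s h. 0 \<le> s \<longrightarrow> 0 \<le> h \<longrightarrow> s + h \<le> T \<longrightarrow>
           \<bar>\<langle>G', q (s + h)\<rangle> - \<langle>G', q s\<rangle>
             - h * \<langle>L_hat m am ap G', q s\<rangle>\<bar> \<le> D1 * h ^ 2)"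
      using ev G unfolding weak_evolution_def by blast
    define EG where "EG \<eta> = ?E \<eta> * G \<eta>" for \<eta>
    have EG: "EG \<in> Bbs" unfolding EG_def by (rule Bbs_death_rate[OF G])
    define EEG where "EEG \<eta> = ?E \<eta> * EG \<eta>" for \<eta>
    have EEG: "EEG \<in> Bbs" unfolding EEG_def by (rule Bbs_death_rate[OF EG])
    \<comment> \<open>The quadratic errors of the evolution, of the damping, and of their product.\<close>
    define D where "D = D1 + C * exp_norm \<beta> EEG + L * exp_norm (\<beta> + 1) EG"
    define J where "J = exp_norm \<alpha> G"
    have J0: "0 \<le> J" unfolding J_def by (rule exp_norm_nonneg)
    define f where "f s = \<langle>damp (t - s), q s\<rangle>" for s
    \<comment> \<open>The increments of \<open>H\<close> dominate those of \<open>f\<close>: differentiating the damping produces the death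
      rate which pays for the birth term, and the second summand is the time integral of the linear terms.\<close>
    define H where "H s = \<phi> / 2 * exp_norm \<alpha> (damp (t - s)) + \<kappa> * (M * s ^ Suc j / real (Suc j)) * J" for s
    have "\<bar>f t - f 0\<bar> \<le> H t - H 0"
    proof (rule quadratic_error_telescope[OF t0, where D = D])
      fix s h :: real assume s: "0 \<le> s" and h: "0 \<le> h" and sh: "s + h \<le> t"
      have sT: "s \<in> {0..T}" "s + h \<in> {0..T}" and st: "s \<in> {0..t}" using s h sh t by auto
      define Gs where "Gs = damp (t - s)"
      define Gh where "Gh = damp (t - (s + h))"
      have Gs: "Gs \<in> Bbs" and Gh: "Gh \<in> Bbs" unfolding Gs_def Gh_def using h sh by (intro dB; simp)+
      have Gsle: "\<bar>Gs \<eta>\<bar> \<le> \<bar>G \<eta>\<bar>" and Ghle: "\<bar>Gh \<eta>\<bar> \<le> \<bar>G \<eta>\<bar>" for \<eta>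
        unfolding Gs_def Gh_def using h sh by (intro dle; simp)+
      have Gsh: "Gs \<eta> = exp (- (h * ?E \<eta>)) * Gh \<eta>" for \<eta>
        unfolding Gs_def Gh_def damp_def mult.assoc[symmetric] exp_add[symmetric] by (simp add: algebra_simps)
      define EGs where "EGs \<eta> = ?E \<eta> * Gs \<eta>" for \<eta>
      have EGs: "EGs \<in> Bbs" unfolding EGs_def by (rule Bbs_death_rate[OF Gs])
      define F where "F \<eta> = (Gh \<eta> - Gs \<eta>) - h * EGs \<eta>" for \<eta>
      have hEGs: "(\<lambda>\<eta>. h * EGs \<eta>) \<in> Bbs" by (rule Bbs_mult[OF EGs]) (auto intro: exI[of _ "\<bar>h\<bar>"])
      have F: "F \<in> Bbs" unfolding F_def by (intro Bbs_diff Gh Gs hEGs)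
      note int = integral_test_bound(1)[OF _ qm qb]
      have i: "integrable lebesgue_poisson (\<lambda>\<eta>. Gs \<eta> * q r \<eta>)" "integrable lebesgue_poisson (\<lambda>\<eta>. Gh \<eta> * q r \<eta>)"
        "integrable lebesgue_poisson (\<lambda>\<eta>. EGs \<eta> * q r \<eta>)" "integrable lebesgue_poisson (\<lambda>\<eta>. F \<eta> * q r \<eta>)"
        if "r \<in> {0..T}" for r using that by (intro int Gs Gh EGs F; simp)+
      \<comment> \<open>The exponent \<open>\<alpha>\<close> serves for the birth term and \<open>\<alpha>'\<close> for everything else.\<close>
      let ?w = "\<lambda>n::nat. min (\<phi> * exp (\<alpha> * real n)) (M * s ^ j * exp (\<alpha>' * real n))"
      have Ms: "0 \<le> M * s ^ j" using M(1) s by simp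
      have w0: "0 \<le> ?w n" for n using \<phi>(1) Ms by simp
      have qw: "AE \<eta> in lebesgue_poisson. \<bar>q s \<eta>\<bar> \<le> ?w (card \<eta>)"
        using \<phi>(2)[OF st] M(2)[OF st] by eventually_elim simp
      have L: "\<langle>L_hat m am ap Gs, q s\<rangle> =
          \<langle>off_diagonal Gs, q s\<rangle> - \<langle>EGs, q s\<rangle>"
        unfolding EGs_def by (rule L_hat_integrable(3)[OF Gs qm[OF sT(1)] qw w0])
      \<comment> \<open>First order expansion in time of \<open>q\<close>.\<close>
      have A1: "\<bar>\<langle>Gs, q (s + h)\<rangle> - \<langle>Gs, q s\<rangle>
             - h * \<langle>L_hat m am ap Gs, q s\<rangle>\<bar> \<le> D1 * h ^ 2"
        using D1 Gs Gsle s h sT(2) by auto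
      \<comment> \<open>Only this term is of first order, since the diagonal part is cancelled by the damping.\<close>
      have A3: "\<bar>\<langle>off_diagonal Gs, q s\<rangle>\<bar> \<le> \<phi> / 2 * exp_norm \<alpha> EGs + \<kappa> * (M * s ^ j) * J"
      proof -
        note o = off_diagonal_bound[OF Gs qm[OF sT(1)] qw w0]
        have e1: "integrable lebesgue_poisson (\<lambda>\<eta>. \<phi> / 2 * (\<bar>EGs \<eta>\<bar> * exp (\<alpha> * real (card \<eta>))))"
          and e2: "integrable lebesgue_poisson (\<lambda>\<eta>. \<kappa> * (M * s ^ j) * (\<bar>G \<eta>\<bar> * exp (\<alpha> * real (card \<eta>))))"
          using exp_weight_integrable[OF EGs, of 1 \<alpha>] exp_weight_integrable[OF G, of 1 \<alpha>] by simp_all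
        note o(3)
        also have "(\<integral>\<eta>. \<bar>Gs \<eta>\<bar> * off_weight ?w \<eta> \<partial>lebesgue_poisson)
            \<le> (\<integral>\<eta>. \<phi> / 2 * (\<bar>EGs \<eta>\<bar> * exp (\<alpha> * real (card \<eta>))) + \<kappa> * (M * s ^ j) * (\<bar>G \<eta>\<bar> * exp (\<alpha> * real (card \<eta>))) \<partial>lebesgue_poisson)"
        proof (rule integral_mono[OF o(2) Bochner_Integration.integrable_add[OF e1 e2]])
          fix \<eta> :: "'a set" assume "\<eta> \<in> space lebesgue_poisson"
          then have fin: "finite \<eta>" by simp
          let ?e = "exp (\<alpha> * real (card \<eta>))"
          have "\<bar>Gs \<eta>\<bar> * off_weight ?w \<eta> \<le> \<bar>Gs \<eta>\<bar> * (\<phi> / 2 * (?E \<eta> * ?e) + M * s ^ j * \<kappa> * ?e)"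
            unfolding \<kappa>_def by (rule mult_left_mono[OF off_weight_le[OF cond \<theta> \<alpha> \<phi>(1) Ms c fin] abs_ge_zero])
          also have "\<dots> = \<phi> / 2 * (\<bar>EGs \<eta>\<bar> * ?e) + \<bar>Gs \<eta>\<bar> * (M * s ^ j * \<kappa> * ?e)"
            using death_rate_nonneg[of \<eta>] by (simp add: EGs_def abs_mult algebra_simps)
          also have "\<bar>Gs \<eta>\<bar> * (M * s ^ j * \<kappa> * ?e) \<le> \<bar>G \<eta>\<bar> * (M * s ^ j * \<kappa> * ?e)"
            using Ms \<kappa>0 Gsle by (intro mult_right_mono) auto
          finally show "\<bar>Gs \<eta>\<bar> * off_weight ?w \<eta> \<le> \<phi> / 2 * (\<bar>EGs \<eta>\<bar> * ?e) + \<kappa> * (M * s ^ j) * (\<bar>G \<eta>\<bar> * ?e)"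
            by (simp add: ac_simps)
        qed
        also have "\<dots> = \<phi> / 2 * exp_norm \<alpha> EGs + \<kappa> * (M * s ^ j) * J"
          using e1 e2 unfolding exp_norm_def J_def by (subst Bochner_Integration.integral_add) simp_all
        finally show ?thesis .
      qed
      \<comment> \<open>Second order error of the damping, from \<open>\<bar>1 - exp (- x) - x exp (- x)\<bar> \<le> x\<^sup>2\<close>.\<close>
      have A4: "\<bar>\<langle>F, q (s + h)\<rangle>\<bar> \<le> C * exp_norm \<beta> EEG * h ^ 2"
      proof -
        have Fle: "\<bar>F \<eta>\<bar> \<le> \<bar>h ^ 2 * EEG \<eta>\<bar>" for \<eta>
        proof -
          define x where "x = h * ?E \<eta>"
          have x: "0 \<le> x" using h death_rate_nonneg by (simp add: x_def)
          have "1 - x \<le> exp (- x)" "exp (- x) \<le> 1" using exp_ge_add_one_self[of "- x"] x by auto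
          moreover have "x * exp (- x) \<ge> x * (1 - x)" using calculation(1) x by (rule mult_left_mono)
          moreover have "(1 + x) * exp (- x) \<le> exp x * exp (- x)" using exp_ge_add_one_self[of x] by (intro mult_right_mono) auto
          ultimately have "\<bar>1 - exp (- x) - x * exp (- x)\<bar> \<le> x ^ 2"
            by (simp add: abs_le_iff power2_eq_square algebra_simps flip: exp_add)
          then have "\<bar>1 - exp (- x) - x * exp (- x)\<bar> * \<bar>Gh \<eta>\<bar> \<le> x ^ 2 * \<bar>G \<eta>\<bar>" using Ghle by (intro mult_mono) auto
          moreover have "F \<eta> = (1 - exp (- x) - x * exp (- x)) * Gh \<eta>"
            unfolding F_def EGs_def Gsh x_def by (simp add: algebra_simps)
          moreover have "x ^ 2 * \<bar>G \<eta>\<bar> = \<bar>h ^ 2 * EEG \<eta>\<bar>"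
            using death_rate_nonneg[of \<eta>] by (simp add: x_def EEG_def EG_def abs_mult power2_eq_square ac_simps)
          ultimately show ?thesis by (simp add: abs_mult)
        qed
        have hE: "(\<lambda>\<eta>. h ^ 2 * EEG \<eta>) \<in> Bbs" by (rule Bbs_mult[OF EEG]) (auto intro: exI[of _ "\<bar>h ^ 2\<bar>"])
        have "\<bar>\<langle>F, q (s + h)\<rangle>\<bar> \<le> C * exp_norm \<beta> F"
          unfolding exp_norm_def by (rule integral_test_bound(2)[OF F qm[OF sT(2)] qb[OF sT(2)]])
        also have "\<dots> \<le> C * exp_norm \<beta> (\<lambda>\<eta>. h ^ 2 * EEG \<eta>)"
          using CL by (intro mult_left_mono exp_norm_mono F hE Fle)
        finally show ?thesis unfolding exp_norm_cmult by (simp add: ac_simps)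
      qed
      have A5: "\<bar>\<langle>EGs, q (s + h)\<rangle> - \<langle>EGs, q s\<rangle>\<bar>
          \<le> L * h * exp_norm (\<beta> + 1) EG"
      proof -
        have "\<langle>EGs, q (s + h)\<rangle> - \<langle>EGs, q s\<rangle>
            = (\<integral>\<eta>. EGs \<eta> * (q (s + h) \<eta> - q s \<eta>) \<partial>lebesgue_poisson)"
          unfolding right_diff_distrib using i(3)[OF sT(1)] i(3)[OF sT(2)] by simp
        moreover have "\<bar>\<integral>\<eta>. EGs \<eta> * (q (s + h) \<eta> - q s \<eta>) \<partial>lebesgue_poisson\<bar> \<le> (L * h) * exp_norm (\<beta> + 1) EGs"
          unfolding exp_norm_def
          by (rule integral_test_bound(2)[OF EGs]) (use qm[OF sT(1)] qm[OF sT(2)] lip[OF sT] h in auto)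
        moreover have "(L * h) * exp_norm (\<beta> + 1) EGs \<le> (L * h) * exp_norm (\<beta> + 1) EG"
          using CL h Gsle by (intro mult_left_mono exp_norm_mono EGs EG) (auto simp: EGs_def EG_def abs_mult intro!: mult_left_mono)
        ultimately show ?thesis by linarith
      qed
      \<comment> \<open>Convexity of the exponential function.\<close>
      have A6: "h * exp_norm \<alpha> EGs \<le> exp_norm \<alpha> Gh - exp_norm \<alpha> Gs"
      proof -
        have e: "integrable lebesgue_poisson (\<lambda>\<eta>. \<bar>Gh \<eta>\<bar> * exp (\<alpha> * real (card \<eta>)))"
          "integrable lebesgue_poisson (\<lambda>\<eta>. \<bar>Gs \<eta>\<bar> * exp (\<alpha> * real (card \<eta>)))"
          "integrable lebesgue_poisson (\<lambda>\<eta>. \<bar>EGs \<eta>\<bar> * exp (\<alpha> * real (card \<eta>)))"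
          using exp_weight_integrable[OF Gh, of 1 \<alpha>] exp_weight_integrable[OF Gs, of 1 \<alpha>] exp_weight_integrable[OF EGs, of 1 \<alpha>] by simp_all
        have "h * exp_norm \<alpha> EGs = (\<integral>\<eta>. h * (\<bar>EGs \<eta>\<bar> * exp (\<alpha> * real (card \<eta>))) \<partial>lebesgue_poisson)"
          by (simp add: exp_norm_def)
        also have "\<dots> \<le> (\<integral>\<eta>. \<bar>Gh \<eta>\<bar> * exp (\<alpha> * real (card \<eta>)) - \<bar>Gs \<eta>\<bar> * exp (\<alpha> * real (card \<eta>)) \<partial>lebesgue_poisson)"
        proof (rule integral_mono)
          fix \<eta> :: "'a set"
          define x where "x = h * ?E \<eta>"
          have "(1 + x) * exp (- x) \<le> exp x * exp (- x)" using exp_ge_add_one_self[of x] by (intro mult_right_mono) auto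
          then have "x * exp (- x) \<le> 1 - exp (- x)" by (simp add: distrib_right flip: exp_add)
          then have "x * exp (- x) * \<bar>Gh \<eta>\<bar> \<le> (1 - exp (- x)) * \<bar>Gh \<eta>\<bar>" by (rule mult_right_mono) simp
          moreover have "\<bar>Gs \<eta>\<bar> = exp (- x) * \<bar>Gh \<eta>\<bar>" by (simp add: Gsh x_def abs_mult)
          moreover have "h * \<bar>EGs \<eta>\<bar> = x * \<bar>Gs \<eta>\<bar>" using death_rate_nonneg[of \<eta>] by (simp add: EGs_def x_def abs_mult)
          ultimately have "h * \<bar>EGs \<eta>\<bar> \<le> \<bar>Gh \<eta>\<bar> - \<bar>Gs \<eta>\<bar>" by (simp add: left_diff_distrib)
          then have "h * \<bar>EGs \<eta>\<bar> * exp (\<alpha> * real (card \<eta>)) \<le> (\<bar>Gh \<eta>\<bar> - \<bar>Gs \<eta>\<bar>) * exp (\<alpha> * real (card \<eta>))"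
            by (rule mult_right_mono) simp
          then show "h * (\<bar>EGs \<eta>\<bar> * exp (\<alpha> * real (card \<eta>))) \<le> \<bar>Gh \<eta>\<bar> * exp (\<alpha> * real (card \<eta>)) - \<bar>Gs \<eta>\<bar> * exp (\<alpha> * real (card \<eta>))"
            by (simp add: left_diff_distrib mult.assoc)
        qed (use e in auto)
        finally show ?thesis using e by (simp add: exp_norm_def)
      qed
      have split: "f (s + h) - f s =
          (\<langle>Gs, q (s + h)\<rangle> - \<langle>Gs, q s\<rangle>
             - h * \<langle>L_hat m am ap Gs, q s\<rangle>)
          + h * \<langle>off_diagonal Gs, q s\<rangle> + \<langle>F, q (s + h)\<rangle>
          + h * (\<langle>EGs, q (s + h)\<rangle> - \<langle>EGs, q s\<rangle>)"
      proof -
        have "\<langle>F, q (s + h)\<rangle> =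
            (\<integral>\<eta>. (Gh \<eta> * q (s + h) \<eta> - Gs \<eta> * q (s + h) \<eta>) - h * (EGs \<eta> * q (s + h) \<eta>) \<partial>lebesgue_poisson)"
          by (intro Bochner_Integration.integral_cong refl) (simp add: F_def algebra_simps)
        also have "\<dots> = \<langle>Gh, q (s + h)\<rangle> - \<langle>Gs, q (s + h)\<rangle>
            - h * \<langle>EGs, q (s + h)\<rangle>" using i[OF sT(2)] by simp
        finally show ?thesis unfolding f_def Gs_def[symmetric] Gh_def[symmetric] L by (simp add: algebra_simps)
      qed
      have hA3: "\<bar>h * \<langle>off_diagonal Gs, q s\<rangle>\<bar> \<le> \<phi> / 2 * (h * exp_norm \<alpha> EGs) + \<kappa> * M * J * (h * s ^ j)"
        using mult_left_mono[OF A3 h] h by (simp add: abs_mult algebra_simps)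
      have hA5: "\<bar>h * (\<langle>EGs, q (s + h)\<rangle> - \<langle>EGs, q s\<rangle>)\<bar>
          \<le> L * exp_norm (\<beta> + 1) EG * h ^ 2"
        using mult_left_mono[OF A5 h] h by (simp add: abs_mult power2_eq_square ac_simps)
      have B1: "\<phi> / 2 * (h * exp_norm \<alpha> EGs) \<le> \<phi> / 2 * (exp_norm \<alpha> Gh - exp_norm \<alpha> Gs)"
        using A6 \<phi>(1) by (intro mult_left_mono) auto
      have B2: "\<kappa> * M * J * (h * s ^ j) \<le> \<kappa> * M * J * (((s + h) ^ Suc j - s ^ Suc j) / real (Suc j))"
        using \<kappa>0 M(1) J0 power_Suc_increment[OF s h] by (intro mult_left_mono) auto
      have HH: "H (s + h) - H s = \<phi> / 2 * (exp_norm \<alpha> Gh - exp_norm \<alpha> Gs) + \<kappa> * M * J * (((s + h) ^ Suc j - s ^ Suc j) / real (Suc j))"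
        unfolding H_def Gs_def[symmetric] Gh_def[symmetric] by (simp add: right_diff_distrib diff_divide_distrib ac_simps)
      have DD: "D * h ^ 2 = D1 * h ^ 2 + C * exp_norm \<beta> EEG * h ^ 2 + L * exp_norm (\<beta> + 1) EG * h ^ 2"
        by (simp add: D_def distrib_right)
      show "\<bar>f (s + h) - f s\<bar> \<le> H (s + h) - H s + D * h ^ 2"
        unfolding HH DD split using A1 hA3 A4 hA5 B1 B2 by linarith
    qed
    moreover have "f t = \<langle>G, q t\<rangle>" by (simp add: f_def damp_def)
    moreover have "f 0 = (\<integral>\<eta>. (0::real) \<partial>(lebesgue_poisson :: 'a set measure))"
      unfolding f_def
    proof (rule integral_cong_AE)
      show "(\<lambda>\<eta>. damp (t - 0) \<eta> * q 0 \<eta>) \<in> borel_measurable lebesgue_poisson"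
        using Bbs_measurable[OF dB[of "t - 0"]] qm[of 0] t by simp
    qed (use q0 in \<open>auto elim!: eventually_mono\<close>)
    moreover have "H t = Z * J" by (simp add: H_def Z_def J_def damp_def[abs_def] distrib_right)
    moreover have "0 \<le> H 0" using \<phi>(1) by (simp add: H_def exp_norm_nonneg)
    ultimately show ?thesis unfolding J_def by simp
  qed
  show ?thesis unfolding \<kappa>_def[symmetric] Z_def[symmetric]
  proof (rule AE_bound_by_test_functions[OF qm[OF t] borel_measurable_card_config])
    fix G :: "'a set \<Rightarrow> real" assume G: "G \<in> Bbs"
    show "integrable lebesgue_poisson (\<lambda>\<eta>. G \<eta> * q t \<eta>)" by (rule integral_test_bound(1)[OF G qm[OF t] qb[OF t]])
    show "integrable lebesgue_poisson (\<lambda>\<eta>. G \<eta> * (Z * exp (\<alpha> * real (card \<eta>))))"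
      by (rule integrable_Bbs_mult[OF G borel_measurable_card_config, of _ "\<lambda>n. \<bar>Z * exp (\<alpha> * real n)\<bar>"]) simp
    show "\<langle>G, q t\<rangle> \<le> (\<integral>\<eta>. \<bar>G \<eta>\<bar> * (Z * exp (\<alpha> * real (card \<eta>))) \<partial>lebesgue_poisson)"
      using le[OF G] unfolding exp_norm_def mult.left_commute[of _ Z] by simp
  qed
qed

text \<open>The a priori bound \<open>\<phi>\<close> is halved by each application of the estimate and disappears.\<close>

lemma duhamel_absorbed:
  fixes M :: real
  assumes cond: "\<And>\<eta>. finite \<eta> \<Longrightarrow> pair_sum ap \<eta> \<le> (death_rate m am \<eta> + b * real (card \<eta>)) / \<theta>"
    and \<theta>: "\<theta> > 0" "b \<ge> 0" and \<alpha>: "\<alpha>' < \<alpha>" "exp (- \<alpha>) \<le> \<theta> / 2" "\<beta> \<le> \<alpha>"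
    and c: "b / \<theta> * exp (- \<alpha>') + comp.mass * exp \<alpha>' + birth.mass \<le> c"
    and ev: "weak_evolution \<beta> C L T q" and CL: "0 \<le> C" "0 \<le> L"
    and q0: "AE \<eta> in lebesgue_poisson. q 0 \<eta> = 0" and t: "t \<in> {0..T}"
    and M: "0 \<le> M" "\<And>s. s \<in> {0..T} \<Longrightarrow> exp_bounded (M * s ^ j) \<alpha>' (q s)"
  shows "exp_bounded (2 * (c / (\<alpha> - \<alpha>') * (M * t ^ Suc j / real (Suc j)))) \<alpha> (q t)"
proof -
  define X where "X s = c / (\<alpha> - \<alpha>') * (M * s ^ Suc j / real (Suc j))" for s
  have "0 \<le> b / \<theta> * exp (- \<alpha>') + comp.mass * exp \<alpha>' + birth.mass"
    using \<theta> comp.mass_nonneg birth.mass_nonneg by simp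
  then have \<kappa>0: "0 \<le> c / (\<alpha> - \<alpha>')" using c \<alpha> by simp
  have X0: "0 \<le> X s" if "0 \<le> s" for s
    unfolding X_def by (rule mult_nonneg_nonneg[OF \<kappa>0]) (use M(1) that in simp)
  have Xm: "X s \<le> X t" if "s \<in> {0..t}" for s
    unfolding X_def using \<kappa>0 M(1) that by (intro mult_left_mono divide_right_mono power_mono) auto
  have bd: "exp_bounded (C / 2 ^ i + 2 * X t) \<alpha> (q s)" if "s \<in> {0..t}" for s i
    using that
  proof (induct i arbitrary: s)
    case 0
    have "s \<in> {0..T}" using 0 t by auto
    then have "exp_bounded C \<beta> (q s)"
      using ev unfolding weak_evolution_def by blast
    then show ?case
    proof eventually_elim
      case (elim \<eta>)
      also have "C * exp (\<beta> * real (card \<eta>)) \<le> (C / 2 ^ 0 + 2 * X t) * exp (\<alpha> * real (card \<eta>))"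
        using CL(1) X0[of t] t \<alpha>(3) by (intro mult_mono) (auto intro!: mult_right_mono)
      finally show ?case .
    qed
  next
    case (Suc i)
    have s: "s \<in> {0..T}" using Suc(2) t by auto
    have "exp_bounded ((C / 2 ^ i + 2 * X t) / 2 + X s) \<alpha> (q s)"
      unfolding X_def[of s]
    proof (rule duhamel_estimate[OF cond \<theta> \<alpha>(1,2) c ev CL q0 s _ _ M(1)])
      show "0 \<le> C / 2 ^ i + 2 * X t" using CL(1) X0[of t] t by simp
      fix r assume r: "r \<in> {0..s}"
      then show "exp_bounded (C / 2 ^ i + 2 * X t) \<alpha> (q r)"
        using Suc(2) by (intro Suc(1)) auto
      show "exp_bounded (M * r ^ j) \<alpha>' (q r)"
        using r s by (intro M(2)) auto
    qed
    then show ?case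
    proof eventually_elim
      case (elim \<eta>)
      also have "((C / 2 ^ i + 2 * X t) / 2 + X s) * exp (\<alpha> * real (card \<eta>)) \<le> (C / 2 ^ Suc i + 2 * X t) * exp (\<alpha> * real (card \<eta>))"
        using Xm[OF Suc(2)] by (intro mult_right_mono) (auto simp: field_simps)
      finally show ?case .
    qed
  qed
  have "AE \<eta> in lebesgue_poisson. \<forall>i. \<bar>q t \<eta>\<bar> \<le> (C / 2 ^ i + 2 * X t) * exp (\<alpha> * real (card \<eta>))"
    unfolding AE_all_countable using bd[of t] t by auto
  then show ?thesis unfolding X_def[symmetric]
  proof eventually_elim
    case (elim \<eta>)
    have "(\<lambda>i. (C * (1 / 2) ^ i + 2 * X t) * exp (\<alpha> * real (card \<eta>))) \<longlonglongrightarrow> (C * 0 + 2 * X t) * exp (\<alpha> * real (card \<eta>))"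
      by (intro tendsto_intros LIMSEQ_power_zero) simp
    moreover have "\<bar>q t \<eta>\<bar> \<le> (C * (1 / 2) ^ i + 2 * X t) * exp (\<alpha> * real (card \<eta>))" for i
      using spec[OF elim, of i] by (simp only: power_one_over) (simp only: times_divide_eq_right mult_1_right)
    ultimately have "\<bar>q t \<eta>\<bar> \<le> (C * 0 + 2 * X t) * exp (\<alpha> * real (card \<eta>))"
      by (rule lim_ge_const)
    then show ?case by simp
  qed
qed

text \<open>Ovsyannikov's iteration: passing from the exponent \<open>\<beta>\<close> to \<open>\<beta> + 1\<close> in \<open>k\<close> equal steps costs \<open>k ^ k\<close>,
  which the \<open>k\<close>-fold time integral compensates by \<open>1 / k!\<close>, up to a geometric factor that is
  small for short times.\<close>

lemma weak_evolution_short_time: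
  assumes cond: "\<And>\<eta>. finite \<eta> \<Longrightarrow> pair_sum ap \<eta> \<le> (death_rate m am \<eta> + b * real (card \<eta>)) / \<theta>"
    and \<theta>: "\<theta> > 0" "b \<ge> 0" and \<beta>: "exp (- \<beta>) \<le> \<theta> / 2"
    and c: "c = b / \<theta> * exp (- \<beta>) + comp.mass * exp (\<beta> + 1) + birth.mass + 1"
    and ev: "weak_evolution \<beta> C L T q" and CL: "0 \<le> C" "0 \<le> L"
    and q0: "AE \<eta> in lebesgue_poisson. q 0 \<eta> = 0" and t: "t \<in> {0..T}" "t \<le> 1 / (4 * c * exp 1)"
  shows "AE \<eta> in lebesgue_poisson. q t \<eta> = 0"
proof -
  have "0 \<le> b / \<theta> * exp (- \<beta>) + comp.mass * exp (\<beta> + 1) + birth.mass"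
    using \<theta> comp.mass_nonneg birth.mass_nonneg by simp
  then have c0: "0 < c" unfolding c by linarith
  have ca: "b / \<theta> * exp (- \<alpha>) + comp.mass * exp \<alpha> + birth.mass \<le> c" if "\<beta> \<le> \<alpha>" "\<alpha> \<le> \<beta> + 1" for \<alpha>
  proof -
    have "b / \<theta> * exp (- \<alpha>) \<le> b / \<theta> * exp (- \<beta>)" "comp.mass * exp \<alpha> \<le> comp.mass * exp (\<beta> + 1)"
      using \<theta> comp.mass_nonneg that by (auto intro!: mult_left_mono divide_right_mono)
    then show ?thesis unfolding c by linarith
  qed
  have level: "AE \<eta> in lebesgue_poisson. \<bar>q s \<eta>\<bar> \<le>
      C * (2 * c * real k) ^ i / fact i * s ^ i * exp ((\<beta> + real i / real k) * real (card \<eta>))"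
    if k: "0 < k" and "i \<le> k" "s \<in> {0..T}" for k i :: nat and s
    using that(2,3)
  proof (induct i arbitrary: s)
    case 0
    then show ?case using ev unfolding weak_evolution_def by simp
  next
    case (Suc i)
    let ?a' = "\<beta> + real i / real k" and ?a = "\<beta> + real (Suc i) / real k"
    define M where "M = C * (2 * c * real k) ^ i / fact i"
    have gap: "?a - ?a' = 1 / real k" by (simp add: add_divide_distrib)
    have "real i / real k \<le> 1" using Suc(2) k by simp
    then have a': "\<beta> \<le> ?a'" "?a' \<le> \<beta> + 1" "?a' < ?a" "\<beta> \<le> ?a" using k by (auto simp: divide_strict_right_mono)
    have ea: "exp (- ?a) \<le> \<theta> / 2" using a'(4) \<beta> by (smt (verit) exp_le_cancel_iff)
    have M0: "0 \<le> M" using CL c0 by (simp add: M_def)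
    have A: "exp_bounded (2 * (c / (?a - ?a') * (M * s ^ Suc i / real (Suc i)))) (?a) (q s)"
    proof (rule duhamel_absorbed[OF cond \<theta> a'(3) ea a'(4) ca[OF a'(1,2)] ev CL q0 Suc(3) M0])
      fix r assume "r \<in> {0..T}"
      from Suc(1)[OF _ this] Suc(2)
      show "exp_bounded (M * r ^ i) (?a') (q r)" by (simp add: M_def)
    qed
    have E: "2 * (c / (?a - ?a') * (M * s ^ Suc i / real (Suc i))) = C * (2 * c * real k) ^ Suc i / fact (Suc i) * s ^ Suc i"
      unfolding gap M_def by (simp add: divide_simps)
    show ?case using A unfolding E .
  qed
  have "AE \<eta> in lebesgue_poisson. \<forall>k. \<bar>q t \<eta>\<bar> \<le> C * (1 / 2) ^ Suc k * exp ((\<beta> + 1) * real (card \<eta>))"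
    unfolding AE_all_countable
  proof
    fix j
    define k where "k = Suc j"
    have k: "0 < k" by (simp add: k_def)
    have t0: "0 \<le> t" using t by simp
    have "C * (2 * c * real k) ^ k / fact k * t ^ k = C * (2 * c * t) ^ k * (real k ^ k / fact k)"
      by (simp add: power_mult_distrib)
    also have "\<dots> \<le> C * (2 * c * t) ^ k * exp 1 ^ k"
      using CL c0 t0 by (intro mult_left_mono power_self_le_fact_exp) auto
    also have "\<dots> = C * (2 * c * t * exp 1) ^ k" by (simp add: power_mult_distrib)
    also have "\<dots> \<le> C * (1 / 2) ^ k"
    proof -
      have "t * (4 * c * exp 1) \<le> 1" using t(2) c0 by (simp add: pos_le_divide_eq)
      then have "2 * c * t * exp 1 \<le> 1 / 2" by (simp add: ac_simps)
      then show ?thesis using CL c0 t0 by (intro mult_left_mono power_mono) auto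
    qed
    finally have le: "C * (2 * c * real k) ^ k / fact k * t ^ k \<le> C * (1 / 2) ^ k" .
    show "exp_bounded (C * (1 / 2) ^ Suc j) (\<beta> + 1) (q t)"
      using level[OF k order_refl t(1)] unfolding k_def[symmetric]
    proof eventually_elim
      case (elim \<eta>)
      also have "C * (2 * c * real k) ^ k / fact k * t ^ k * exp ((\<beta> + real k / real k) * real (card \<eta>))
          \<le> C * (1 / 2) ^ k * exp ((\<beta> + 1) * real (card \<eta>))"
      proof -
        have kk: "real k / real k = 1" using k by simp
        show ?thesis unfolding kk by (rule mult_right_mono[OF le]) simp
      qed
      finally show ?case .
    qed
  qed
  then show ?thesis
  proof eventually_elim
    case (elim \<eta>)
    have "(\<lambda>k. C * (1 / 2) ^ Suc k * exp ((\<beta> + 1) * real (card \<eta>))) \<longlonglongrightarrow> C * 0 * exp ((\<beta> + 1) * real (card \<eta>))"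
      by (intro tendsto_intros LIMSEQ_Suc LIMSEQ_power_zero) simp
    then have "\<bar>q t \<eta>\<bar> \<le> C * 0 * exp ((\<beta> + 1) * real (card \<eta>))"
      by (rule lim_ge_const) (rule spec[OF elim])
    then show ?case by simp
  qed
qed

text \<open>The length of the time step depends on \<open>\<beta>\<close> and the kernels, but not on \<open>q\<close>, so it can be repeated.\<close>

lemma weak_evolution_zero:
  assumes cond: "\<And>\<eta>. finite \<eta> \<Longrightarrow> pair_sum ap \<eta> \<le> (death_rate m am \<eta> + b * real (card \<eta>)) / \<theta>"
    and \<theta>: "\<theta> > 0" "b \<ge> 0" and \<beta>: "exp (- \<beta>) \<le> \<theta> / 2"
    and ev: "weak_evolution \<beta> C L T q" and CL: "0 \<le> C" "0 \<le> L"
    and q0: "AE \<eta> in lebesgue_poisson. q 0 \<eta> = 0" and t: "t \<in> {0..T}"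
  shows "AE \<eta> in lebesgue_poisson. q t \<eta> = 0"
proof -
  define c where "c = b / \<theta> * exp (- \<beta>) + comp.mass * exp (\<beta> + 1) + birth.mass + 1"
  have "0 \<le> b / \<theta> * exp (- \<beta>) + comp.mass * exp (\<beta> + 1) + birth.mass"
    using \<theta> comp.mass_nonneg birth.mass_nonneg by simp
  then have c0: "0 < c" unfolding c_def by linarith
  define \<tau> where "\<tau> = 1 / (4 * c * exp 1)"
  have \<tau>: "0 < \<tau>" using c0 by (simp add: \<tau>_def)
  have step: "\<forall>t\<in>{0..T}. t \<le> real i * \<tau> \<longrightarrow> (AE \<eta> in lebesgue_poisson. q t \<eta> = 0)" for i
  proof (induct i)
    case 0
    have "t = 0" if "t \<in> {0..T}" "t \<le> real 0 * \<tau>" for t using that by simp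
    then show ?case using q0 by blast
  next
    case (Suc i)
    show ?case
    proof (intro ballI impI)
      fix t assume t: "t \<in> {0..T}" "t \<le> real (Suc i) * \<tau>"
      show "AE \<eta> in lebesgue_poisson. q t \<eta> = 0"
      proof (cases "t \<le> real i * \<tau>")
        case True
        then show ?thesis using Suc t by blast
      next
        case False
        define s where "s = real i * \<tau>"
        have s: "0 \<le> s" "s \<le> T" "s \<le> t" "t \<le> s + \<tau>" using False t \<tau> by (auto simp: s_def distrib_right)
        have "AE \<eta> in lebesgue_poisson. q s \<eta> = 0" using Suc s by (auto simp: s_def)
        then have z: "AE \<eta> in lebesgue_poisson. q (s + 0) \<eta> = 0" by simp
        have "AE \<eta> in lebesgue_poisson. q (s + (t - s)) \<eta> = 0"
          by (rule weak_evolution_short_time[OF cond \<theta> \<beta> c_def weak_evolution_shift[OF ev s(1,2)] CL z])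
            (use s t in \<open>auto simp: \<tau>_def\<close>)
        then show ?thesis by simp
      qed
    qed
  qed
  obtain i :: nat where "t / \<tau> \<le> real i" using real_arch_simple by blast
  then have "t \<le> real i * \<tau>" using \<tau> by (simp add: pos_divide_le_eq)
  then show ?thesis using step t by blast
qed

text \<open>The exponent \<open>\<beta>\<close> is chosen above those of both families and so large that \<open>exp (- \<beta>) \<le> \<theta> / 2\<close>.\<close>

theorem weak_solution_correlation_unique:
  fixes \<mu> \<nu> :: "real \<Rightarrow> 'a set measure"
  assumes \<mu>: "weak_solution m am ap \<mu>0 \<mu>" "\<And>t. t \<ge> 0 \<Longrightarrow> correlation_function (\<mu> t) (k t)"
    and \<nu>: "weak_solution m am ap \<mu>0 \<nu>" "\<And>t. t \<ge> 0 \<Longrightarrow> correlation_function (\<nu> t) (l t)"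
    and T: "T > 0"
    and k: "\<And>t. t \<in> {0..T} \<Longrightarrow> exp_bounded C1 \<alpha>1 (k t)"
    and l: "\<And>t. t \<in> {0..T} \<Longrightarrow> exp_bounded C2 \<alpha>2 (l t)"
    and t: "t \<in> {0..T}"
  shows "AE \<eta> in lebesgue_poisson. k t \<eta> = l t \<eta>"
proof -
  obtain \<theta> b where \<theta>: "\<theta> > 0" "b \<ge> 0"
    and cond: "\<And>\<eta>. finite \<eta> \<Longrightarrow> pair_sum ap \<eta> \<le> (death_rate m am \<eta> + b * real (card \<eta>)) / \<theta>"
    using pair_sum_condition by blast
  define \<beta> where "\<beta> = max (max \<alpha>1 \<alpha>2) (- ln (\<theta> / 2))"
  have "exp (- \<beta>) \<le> exp (ln (\<theta> / 2))" unfolding exp_le_cancel_iff by (simp add: \<beta>_def)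
  then have \<beta>: "exp (- \<beta>) \<le> \<theta> / 2" using \<theta> by simp
  define C where "C = \<bar>C1\<bar> + \<bar>C2\<bar>"
  define q where "q s \<eta> = k s \<eta> - l s \<eta>" for s \<eta>
  have km: "k s \<in> borel_measurable fin_config_space" and lm: "l s \<in> borel_measurable fin_config_space"
    if "s \<in> {0..T}" for s using correlation_functionD(1)[OF \<mu>(2)] correlation_functionD(1)[OF \<nu>(2)] that by auto
  have up: "C' * exp (\<alpha> * real n) \<le> \<bar>C'\<bar> * exp (\<beta> * real n)" if "\<alpha> \<le> \<beta>" for C' \<alpha> n
    using that by (intro mult_mono) (auto intro!: mult_right_mono)
  have kb: "exp_bounded \<bar>C1\<bar> \<beta> (k s)"
    and lb: "exp_bounded \<bar>C2\<bar> \<beta> (l s)" if "s \<in> {0..T}" for s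
  proof -
    have a: "\<alpha>1 \<le> \<beta>" "\<alpha>2 \<le> \<beta>" by (simp_all add: \<beta>_def)
    show "exp_bounded \<bar>C1\<bar> \<beta> (k s)"
      using k[OF that] by eventually_elim (rule order_trans[OF _ up[OF a(1)]])
    show "exp_bounded \<bar>C2\<bar> \<beta> (l s)"
      using l[OF that] by eventually_elim (rule order_trans[OF _ up[OF a(2)]])
  qed
  have qb: "exp_bounded C \<beta> (q s)" if "s \<in> {0..T}" for s
    using kb[OF that] lb[OF that] by eventually_elim (simp add: q_def C_def distrib_right)
  have Lq: "\<langle>L_hat m am ap G, q s\<rangle> =
      \<langle>L_hat m am ap G, k s\<rangle> - \<langle>L_hat m am ap G, l s\<rangle>"
    if "G \<in> Bbs" "s \<in> {0..T}" for G s
    unfolding q_def right_diff_distrib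
    using L_hat_integrable(1)[OF that(1) km[OF that(2)] kb[OF that(2)]]
      L_hat_integrable(1)[OF that(1) lm[OF that(2)] lb[OF that(2)]] by simp
  have int: "set_integrable lebesgue {0..T} (\<lambda>s. \<langle>L_hat m am ap G, q s\<rangle>)" if G: "G \<in> Bbs" for G
  proof -
    have "set_integrable lebesgue {0..T} (\<lambda>s. \<langle>L_hat m am ap G, k s\<rangle>
        - \<langle>L_hat m am ap G, l s\<rangle>)"
      using weak_solution_correlation(1)[OF \<mu> G T] weak_solution_correlation(1)[OF \<nu> G T] by (rule set_integral_diff)
    then show ?thesis using Lq[OF G] by (subst set_integrable_cong[OF refl refl]) auto
  qed
  have eq: "\<langle>G, q s\<rangle> =
      0 + (LINT r:{0..s}|lebesgue. \<langle>L_hat m am ap G, q r\<rangle>)" if G: "G \<in> Bbs" and s: "s \<in> {0..T}" for G s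
  proof -
    have s0: "0 \<le> s" using s by simp
    have sub: "{0..s} \<subseteq> {0..T}" using s by auto
    have "(LINT r:{0..s}|lebesgue. \<langle>L_hat m am ap G, q r\<rangle>)
        = (LINT r:{0..s}|lebesgue. \<langle>L_hat m am ap G, k r\<rangle> - \<langle>L_hat m am ap G, l r\<rangle>)"
      using Lq[OF G] sub by (intro set_lebesgue_integral_cong) auto
    also have "\<dots> = (LINT r:{0..s}|lebesgue. \<langle>L_hat m am ap G, k r\<rangle>)
        - (LINT r:{0..s}|lebesgue. \<langle>L_hat m am ap G, l r\<rangle>)"
      using set_integrable_subset[OF weak_solution_correlation(1)[OF \<mu> G T] _ sub]
        set_integrable_subset[OF weak_solution_correlation(1)[OF \<nu> G T] _ sub] by (intro set_integral_diff(2)) auto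
    finally show ?thesis
      using weak_solution_correlation(2)[OF \<mu> G s0] weak_solution_correlation(2)[OF \<nu> G s0]
        correlation_functionD(4)[OF \<mu>(2)[OF s0] G] correlation_functionD(4)[OF \<nu>(2)[OF s0] G]
      by (simp add: q_def right_diff_distrib)
  qed
  have qm: "q s \<in> borel_measurable fin_config_space" if "s \<in> {0..T}" for s
    unfolding q_def[abs_def] using km[OF that] lm[OF that] by simp
  have C0: "0 \<le> C" by (simp add: C_def)
  obtain L where L: "L \<ge> 0" "weak_evolution \<beta> C L T q"
    using weak_evolutionI[OF qm C0 qb int eq] by blast
  have "AE \<eta> in lebesgue_poisson. \<bar>q 0 \<eta>\<bar> \<le> 0"
  proof (rule AE_bound_by_test_functions)
    fix G :: "'a set \<Rightarrow> real" assume G: "G \<in> Bbs"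
    have z: "0 \<in> {0..T}" using T by simp
    show "integrable lebesgue_poisson (\<lambda>\<eta>. G \<eta> * q 0 \<eta>)" by (rule integral_test_bound(1)[OF G qm[OF z] qb[OF z]])
    have "(LINT r:{0..0}|lebesgue. \<langle>L_hat m am ap G, q r\<rangle>) = integral {0..0} (\<lambda>r. \<langle>L_hat m am ap G, q r\<rangle>)"
      by (rule set_lebesgue_integral_eq_integral(2), rule set_integrable_subset[OF int[OF G]]) (use T in auto)
    then show "\<langle>G, q 0\<rangle> \<le> (\<integral>\<eta>. \<bar>G \<eta>\<bar> * 0 \<partial>lebesgue_poisson)"
      unfolding eq[OF G z] by simp
  qed (use qm[of 0] T in auto)
  then have q0: "AE \<eta> in lebesgue_poisson. q 0 \<eta> = 0" by eventually_elim simp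
  have "AE \<eta> in lebesgue_poisson. q t \<eta> = 0"
    by (rule weak_evolution_zero[OF cond \<theta> \<beta> L(2) C0 L(1) q0 t])
  then show ?thesis by eventually_elim (simp add: q_def)
qed

end

text \<open>A classical solution is norm continuous, hence bounded on compact time intervals.\<close>

lemma classical_solution_bounded:
  fixes k :: "real \<Rightarrow> 'a::euclidean_space set \<Rightarrow> real"
  assumes cl: "classical_solution m am ap \<alpha> T k0 k" and T: "0 \<le> T"
  shows "\<exists>C. \<forall>t\<in>{0..T}. exp_bounded C \<alpha> (k t)"
proof -
  let ?P = "\<lambda>a b. \<exists>C. \<forall>t\<in>{a..b}. t \<in> {0..T} \<longrightarrow> exp_bounded C \<alpha> (k t)"
  have "?P 0 T"
  proof (rule Bolzano[of 0 T ?P, OF T])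
    fix a b c assume "?P a b" "?P b c"
    then obtain C1 C2 where C1: "\<forall>t\<in>{a..b}. t \<in> {0..T} \<longrightarrow> exp_bounded C1 \<alpha> (k t)"
      and C2: "\<forall>t\<in>{b..c}. t \<in> {0..T} \<longrightarrow> exp_bounded C2 \<alpha> (k t)" by blast
    show "?P a c"
    proof (intro exI[of _ "max C1 C2"] ballI impI)
      fix t assume t: "t \<in> {a..c}" "t \<in> {0..T}"
      have m: "C1 * exp x \<le> max C1 C2 * exp x" "C2 * exp x \<le> max C1 C2 * exp x" for x :: real
        by (intro mult_right_mono; simp)+
      have "(exp_bounded C1 \<alpha> (k t)) \<or>
          exp_bounded C2 \<alpha> (k t)"
        using C1 C2 t by (cases "t \<le> b") auto
      then show "exp_bounded (max C1 C2) \<alpha> (k t)"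
      proof
        assume "exp_bounded C1 \<alpha> (k t)"
        then show ?thesis by eventually_elim (rule order_trans[OF _ m(1)])
      next
        assume "exp_bounded C2 \<alpha> (k t)"
        then show ?thesis by eventually_elim (rule order_trans[OF _ m(2)])
      qed
    qed
  next
    fix x assume "0 \<le> x" "x \<le> T"
    then have x: "x \<in> {0..T}" by simp
    obtain C1 where C1: "exp_bounded C1 \<alpha> (k x)"
      using cl x K_space_bound unfolding classical_solution_def by blast
    obtain C2 where C2: "C2 \<ge> 0" "exp_bounded C2 \<alpha> (L_Delta m am ap (k x))"
      using cl x K_space_bound unfolding classical_solution_def by blast
    have "((\<lambda>s. K_norm \<alpha> (\<lambda>\<eta>. (k s \<eta> - k x \<eta>) / (s - x) - L_Delta m am ap (k x) \<eta>)) \<longlongrightarrow> 0) (at x within {0..T})"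
      using cl x unfolding classical_solution_def by blast
    from order_tendstoD(2)[OF this, of "ereal 1"]
    obtain d where d: "d > 0" "\<And>s. s \<in> {0..T} \<Longrightarrow> s \<noteq> x \<Longrightarrow> dist s x < d \<Longrightarrow>
        K_norm \<alpha> (\<lambda>\<eta>. (k s \<eta> - k x \<eta>) / (s - x) - L_Delta m am ap (k x) \<eta>) < ereal 1"
      unfolding eventually_at by auto
    define C where "C = \<bar>C1\<bar> + d * (1 + C2)"
    have near: "exp_bounded C \<alpha> (k s)" if s: "s \<in> {0..T}" "dist s x < d" for s
    proof (cases "s = x")
      case True
      have "C1 * exp y \<le> C * exp y" for y :: real
        using d(1) C2(1) by (intro mult_right_mono) (auto simp: C_def intro: add_increasing2)
      then have m: "C1 * exp y \<le> C * exp y" for y :: real .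
      show ?thesis using C1 unfolding True by eventually_elim (rule order_trans[OF _ m])
    next
      case False
      show ?thesis
        using K_norm_less_imp_AE[OF d(2)[OF s(1) False s(2)]] C1 C2(2)
      proof eventually_elim
        case (elim \<eta>)
        define e where "e = exp (\<alpha> * real (card \<eta>))"
        define r where "r = (k s \<eta> - k x \<eta>) / (s - x)"
        have "\<bar>r\<bar> \<le> (1 + C2) * e" using elim unfolding e_def[symmetric] r_def[symmetric] by (simp add: distrib_right)
        then have "\<bar>s - x\<bar> * \<bar>r\<bar> \<le> d * ((1 + C2) * e)"
          using s(2) d(1) by (intro mult_mono) (auto simp: dist_real_def)
        moreover have "k s \<eta> = k x \<eta> + (s - x) * r" using False by (simp add: r_def)
        moreover have "\<bar>k x \<eta>\<bar> \<le> \<bar>C1\<bar> * e"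
        proof -
          have "C1 * e \<le> \<bar>C1\<bar> * e" by (rule mult_right_mono) (simp_all add: e_def)
          then show ?thesis using elim(2) unfolding e_def[symmetric] by linarith
        qed
        ultimately have "\<bar>k s \<eta>\<bar> \<le> \<bar>C1\<bar> * e + d * ((1 + C2) * e)"
          by (auto simp: abs_mult intro: order_trans[OF abs_triangle_ineq])
        then show ?case by (simp add: C_def e_def algebra_simps)
      qed
    qed
    show "\<exists>d>0. \<forall>a b. a \<le> x \<and> x \<le> b \<and> b - a < d \<longrightarrow> ?P a b"
    proof (rule exI[of _ d], rule conjI[OF d(1)], intro allI impI)
      fix a b assume ab: "a \<le> x \<and> x \<le> b \<and> b - a < d"
      have "dist s x < d" if "s \<in> {a..b}" for s using that ab by (auto simp: dist_real_def)
      then show "?P a b" using near by blast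
    qed
  qed
  then show ?thesis by blast
qed

section \<open>Existence and uniqueness for the Fokker--Planck equation\<close>

theorem theorem5p5:
  fixes m \<alpha>0 :: real
    and am ap :: "'a::euclidean_space \<Rightarrow> real"
    and \<mu>0 :: "'a set measure" and k0 :: "'a set \<Rightarrow> real"
    and \<mu> :: "real \<Rightarrow> 'a set measure" and k :: "real \<Rightarrow> 'a set \<Rightarrow> real"
  assumes "m \<ge> 0"
    and "condition_G am ap"
    and "config_prob \<mu>0"
    and "correlation_function \<mu>0 k0"
    and "k0 \<in> K_space \<alpha>0"
    and "hierarchical_solution m am ap \<alpha>0 k0 k"
    and "\<forall>t\<ge>0. config_prob (\<mu> t) \<and> correlation_function (\<mu> t) (k t)"
  shows "weak_solution m am ap \<mu>0 \<mu> \<and>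
    (\<forall>(\<nu> :: real \<Rightarrow> 'a set measure) (k\<nu> :: real \<Rightarrow> 'a set \<Rightarrow> real).
       weak_solution m am ap \<mu>0 \<nu> \<longrightarrow>
       (\<forall>t\<ge>0. correlation_function (\<nu> t) (k\<nu> t)) \<longrightarrow>
       (\<forall>T>0. \<exists>\<beta>\<ge>\<alpha>0. (SUP t\<in>{0..T}. K_norm \<beta> (k\<nu> t)) < \<infinity>) \<longrightarrow>
       (\<forall>t\<ge>0. \<mu> t = \<nu> t))"
proof -
  interpret spatial_logistic m am ap using assms(1,2) by unfold_locales
  have \<mu>c: "\<And>t. t \<ge> 0 \<Longrightarrow> config_prob (\<mu> t)" and \<mu>k: "\<And>t. t \<ge> 0 \<Longrightarrow> correlation_function (\<mu> t) (k t)"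
    using assms(7) by auto
  have weak: "weak_solution m am ap \<mu>0 \<mu>"
    by (rule hierarchical_weak_solution[OF assms(3-6) \<mu>c \<mu>k])
  moreover have "\<mu> t = \<nu> t"
    if \<nu>: "weak_solution m am ap \<mu>0 \<nu>" and \<nu>k: "\<forall>t\<ge>0. correlation_function (\<nu> t) (k\<nu> t)"
      and bd: "\<forall>T>0. \<exists>\<beta>\<ge>\<alpha>0. (SUP t\<in>{0..T}. K_norm \<beta> (k\<nu> t)) < \<infinity>" and t: "t \<ge> 0"
    for \<nu> :: "real \<Rightarrow> 'a set measure" and k\<nu> :: "real \<Rightarrow> 'a set \<Rightarrow> real" and t
  proof -
    define T where "T = t + 1"
    have T: "T > 0" "0 \<le> T" "t \<in> {0..T}" using t by (auto simp: T_def)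
    obtain \<alpha> where "classical_solution m am ap \<alpha> T k0 k"
      using assms(6) T(1) unfolding hierarchical_solution_def by blast
    from classical_solution_bounded[OF this T(2)]
    obtain C1 where C1: "\<And>s. s \<in> {0..T} \<Longrightarrow> exp_bounded C1 \<alpha> (k s)"
      by blast
    obtain \<beta> where "(SUP s\<in>{0..T}. K_norm \<beta> (k\<nu> s)) < \<infinity>" using bd T(1) by blast
    then obtain n :: nat where n: "(SUP s\<in>{0..T}. K_norm \<beta> (k\<nu> s)) < ereal (real n)"
      using less_PInf_Ex_of_nat by auto
    have C2: "exp_bounded (real n) \<beta> (k\<nu> s)" if "s \<in> {0..T}" for s
    proof (rule K_norm_less_imp_AE)
      show "K_norm \<beta> (k\<nu> s) < ereal (real n)" using SUP_upper[OF that] n by (rule order.strict_trans1)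
    qed
    have \<nu>k': "\<And>t. t \<ge> 0 \<Longrightarrow> correlation_function (\<nu> t) (k\<nu> t)" using \<nu>k by simp
    have eq: "AE \<eta> in lebesgue_poisson. k t \<eta> = k\<nu> t \<eta>"
      by (rule weak_solution_correlation_unique[OF weak \<mu>k \<nu> \<nu>k' T(1) C1 C2 T(3)])
    have "config_prob (\<nu> t)" using \<nu> t by (simp add: weak_solution_def)
    from config_measure_unique[OF \<mu>c[OF t] \<mu>k[OF t] this \<nu>k'[OF t] eq C1[OF T(3)]]
    show ?thesis .
  qed
  ultimately show ?thesis by (intro conjI allI impI)
qed
end
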